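(* Let $l,n\ge 1$ be integers, let $R$ be a field, let $q,Q_0,\ldots,Q_{l-1}\in R$ be nonzero, put ${\bf q}=(Q_0,\ldots,Q_{l-1};q)$, and assume that the Ariki-Koike algebra $\mathcal{H}_n^{\bf q}$ over $R$ is split semisimple. Let $\boldsymbol{\lambda}=(\lambda^0,\lambda^1,\ldots,\lambda^{l-1})$ be an $l$-partition of $n$. Then the Schur element $s_{\boldsymbol{\lambda}}({\bf q})$ is given by $$s_{\boldsymbol{\lambda}}({\bf q})=(-1)^{n(l-1)}q^{-n(\bar{\boldsymbol{\lambda}})}(q-1)^{-n}\prod_{0\le s\le l-1}\ \prod_{(i,j)\in[\lambda^s]}\ \prod_{0\le t\le l-1}\left(q^{h_{i,j}^{\lambda^s,\lambda^t}}Q_sQ_t^{-1}-1\right),$$ or, in equivalent form, $$s_{\boldsymbol{\lambda}}({\bf q})=(-1)^{n(l-1)}q^{-n(\bar{\boldsymbol{\lambda}})}\prod_{0\le s\le l-1}\ \prod_{(i,j)\in[\lambda^s]}\left([h_{i,j}^{\lambda^s,\lambda^s}]_q\prod_{0\le t\le l-1,\ t\ne s}\left(q^{h_{i,j}^{\lambda^s,\lambda^t}}Q_sQ_t^{-1}-1\right)\right).$$ (If $q=1$, the first formula is to be read as the second one.)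
   Context: Partitions. A partition $\lambda=(\lambda_1,\lambda_2,\ldots)$ is a weakly decreasing sequence of non-negative integers with finite sum $|\lambda|$; its nodes are $[\lambda]=\{(i,j): i\ge1,\ 1\le j\le\lambda_i\}$; its conjugate is $\lambda'_k=\#\{i\ge 1:\lambda_i\ge k\}$; $n(\lambda)=\sum_{i\ge1}(i-1)\lambda_i$. For partitions $\lambda,\mu$ and $(i,j)\in[\lambda]$, the generalised hook length is $h_{i,j}^{\lambda,\mu}=\lambda_i-i+\mu'_j-j+1$. An $l$-partition of $n$ is an $l$-tuple $\boldsymbol{\lambda}=(\lambda^0,\ldots,\lambda^{l-1})$ of partitions with $\sum_s|\lambda^s|=n$; $\Pi^l_n$ is the set of these. $\bar{\boldsymbol{\lambda}}$ is the partition of $n$ obtained by arranging all the parts $\lambda^s_i$ ($0\le s\le l-1$, $i\ge1$) in decreasing order. For $m\in\mathbb{N}$, $[m]_q=1+q+\cdots+q^{m-1}$. Ariki-Koike algebra. $\mathcal{H}_n^{\bf q}$ is the unital associative $R$-algebra with generators $T_0,\ldots,T_{n-1}$ and relations $(T_0-Q_0)\cdots(T_0-Q_{l-1})=0$; $(T_i-q)(T_i+1)=0$ for $1\le i\le n-1$; $T_0T_1T_0T_1=T_1T_0T_1T_0$; $T_iT_{i+1}T_i=T_{i+1}T_iT_{i+1}$ for $1\le i\le n-2$; $T_iT_j=T_jT_i$ for $0\le i<j\le n-1$, $j-i>1$. Simple modules. In the split semisimple case the simple modules are, up to isomorphism, the $V^{\boldsymbol{\lambda}}$ ($\boldsymbol{\lambda}\in\Pi^l_n$)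 of Ariki and Koike: $V^{\boldsymbol{\lambda}}$ has a basis $(v_T)$ indexed by the standard $\boldsymbol{\lambda}$-tableaux $T$ (fillings of the nodes of $\lambda^0,\ldots,\lambda^{l-1}$ by $1,\ldots,n$, increasing along rows and columns in each component). If $k$ occupies the node $(i,j)$ of component $s$ of $T$, put $c_k=q^{j-i}Q_s$. Then $T_0v_T=Q_sv_T$, where $s$ is the component containing $1$; for $1\le k\le n-1$, $T_kv_T=qv_T$ (resp. $-v_T$) if $k,k+1$ lie in the same row (resp. column) of the same component, and otherwise $T_kv_T=a\,v_T+(1+a)v_{s_kT}$, where $s_kT$ is $T$ with $k,k+1$ exchanged and $a=(q-1)c_{k+1}/(c_{k+1}-c_k)$ (when $k,k+1$ lie in the same component, with contents $j-i$ differing by $d$, content of $k+1$ minus content of $k$, this is read as $a=q^d(q-1)/(q^d-1)$, with limiting value $1/d$ if $q=1$). The character of $V^{\boldsymbol{\lambda}}$ is denoted $\chi^{\boldsymbol{\lambda}}$. Schur elements. Let $L_k=q^{1-k}T_{k-1}\cdots T_1T_0T_1\cdots T_{k-1}$ for $1\le k\le n$, and for $w\in\mathfrak{S}_n$ let $T_w$ be the product of the $T_i$ ($1\le i\le n-1$) along a reduced expression of $w$. The elements $L_1^{c_1}\cdots L_n^{c_n}T_w$ ($0\le c_k<l$, $w\in\mathfrak{S}_n$) form an $R$-basis of $\mathcal{H}_n^{\bf q}$, and $\tau:\mathcal{H}_n^{\bf q}\to R$ is the $R$-linear form which is $1$ on the basis element $1$ and $0$ on all other basis elements (the symmetrizing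 form of Bremke-Malle and Malle-Mathas). The Schur elements are the elements $s_{\boldsymbol{\lambda}}({\bf q})\in R$ such that $\tau=\sum_{\boldsymbol{\lambda}\in\Pi^l_n}\frac{1}{s_{\boldsymbol{\lambda}}({\bf q})}\chi^{\boldsymbol{\lambda}}$. *)

theory Defs
  imports
    Complex_Main
    "HOL-Library.Poly_Mapping"
    "HOL-Library.FuncSet"
    "HOL-Library.Multiset"
    "HOL-Combinatorics.Permutations"
    "HOL-Algebra.QuotRing"
    "HOL-Algebra.Module"
begin

section \<open>Partitions and multipartitions\<close>

text \<open>
  Partitions are indexed from 1, as in the usual notation. The value at the unused
  index 0 is fixed to be 0, so that each partition is represented exactly once.
\<close>

definition is_partition :: "(nat \<Rightarrow> nat) \<Rightarrow> bool" where
  "is_partition p \<longleftrightarrow> p 0 = 0 \<and> (\<forall>i\<ge>1. p (Suc i) \<le> p i) \<and> finite {i. p i \<noteq> 0}"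

definition psize :: "(nat \<Rightarrow> nat) \<Rightarrow> nat" where
  "psize p = (\<Sum>i | p i \<noteq> 0. p i)"

definition young :: "(nat \<Rightarrow> nat) \<Rightarrow> (nat \<times> nat) set" where
  "young p = {(i, j). 1 \<le> i \<and> 1 \<le> j \<and> j \<le> p i}"

definition conj_part :: "(nat \<Rightarrow> nat) \<Rightarrow> nat \<Rightarrow> nat" where
  "conj_part p k = card {i. 1 \<le> i \<and> k \<le> p i}"

definition n_stat :: "(nat \<Rightarrow> nat) \<Rightarrow> nat" where
  "n_stat p = (\<Sum>i | p i \<noteq> 0. (i - 1) * p i)"

definition hook :: "(nat \<Rightarrow> nat) \<Rightarrow> (nat \<Rightarrow> nat) \<Rightarrow> nat \<Rightarrow> nat \<Rightarrow> int" where
  "hook p m i j = int (p i) - int i + int (conj_part m j) - int j + 1"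

type_synonym multipartition = "(nat \<Rightarrow> nat) list"

definition mp_size :: "multipartition \<Rightarrow> nat" where
  "mp_size \<Lambda> = (\<Sum>p\<leftarrow>\<Lambda>. psize p)"

definition multipartitions :: "nat \<Rightarrow> nat \<Rightarrow> multipartition set" where
  "multipartitions l n =
     {\<Lambda>. length \<Lambda> = l \<and> (\<forall>p\<in>set \<Lambda>. is_partition p) \<and> mp_size \<Lambda> = n}"

definition mp_parts :: "multipartition \<Rightarrow> nat multiset" where
  "mp_parts \<Lambda> = (\<Sum>p\<leftarrow>\<Lambda>. image_mset p (mset_set {i. p i \<noteq> 0}))"

definition mp_bar :: "multipartition \<Rightarrow> nat \<Rightarrow> nat" where
  "mp_bar \<Lambda> i =
     (if 1 \<le> i \<and> i \<le> size (mp_parts \<Lambda>)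
      then rev (sorted_list_of_multiset (mp_parts \<Lambda>)) ! (i - 1) else 0)"

definition q_int :: "'a::field \<Rightarrow> nat \<Rightarrow> 'a" where
  "q_int q m = (\<Sum>k<m. q ^ k)"


section \<open>Split semisimple algebras\<close>

text \<open>
  An algebra over a field, the latter given as a type, is a ring \<open>A\<close> together with a
  structure map \<open>\<eta>\<close> from the field to the centre of \<open>A\<close>. The library locale
  \<^locale>\<open>module\<close> requires a commutative base ring, whereas \<^locale>\<open>submodule\<close> does not.
\<close>

locale left_module = A?: ring A + M?: abelian_group M
  for A (structure) and M (structure) +
  assumes smult_closed: "a \<in> carrier A \<Longrightarrow> x \<in> carrier M \<Longrightarrow> a \<odot>\<^bsub>M\<^esub> x \<in> carrier M"
    and smult_l_distr: "a \<in> carrier A \<Longrightarrow> b \<in> carrier A \<Longrightarrow> x \<in> carrier M \<Longrightarrow>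
      (a \<oplus>\<^bsub>A\<^esub> b) \<odot>\<^bsub>M\<^esub> x = a \<odot>\<^bsub>M\<^esub> x \<oplus>\<^bsub>M\<^esub> b \<odot>\<^bsub>M\<^esub> x"
    and smult_r_distr: "a \<in> carrier A \<Longrightarrow> x \<in> carrier M \<Longrightarrow> y \<in> carrier M \<Longrightarrow>
      a \<odot>\<^bsub>M\<^esub> (x \<oplus>\<^bsub>M\<^esub> y) = a \<odot>\<^bsub>M\<^esub> x \<oplus>\<^bsub>M\<^esub> a \<odot>\<^bsub>M\<^esub> y"
    and smult_assoc: "a \<in> carrier A \<Longrightarrow> b \<in> carrier A \<Longrightarrow> x \<in> carrier M \<Longrightarrow>
      (a \<otimes>\<^bsub>A\<^esub> b) \<odot>\<^bsub>M\<^esub> x = a \<odot>\<^bsub>M\<^esub> (b \<odot>\<^bsub>M\<^esub> x)"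
    and smult_one: "x \<in> carrier M \<Longrightarrow> \<one>\<^bsub>A\<^esub> \<odot>\<^bsub>M\<^esub> x = x"

definition regular_module :: "('r, 'm) ring_scheme \<Rightarrow> ('r, 'r) module" where
  "regular_module A =
     \<lparr>carrier = carrier A, mult = mult A, one = one A, zero = zero A, add = add A,
      smult = mult A\<rparr>"

lemma (in ring) left_module_regular: "left_module R (regular_module R)"
proof -
  have "abelian_group (regular_module R)"
    by (rule abelian_groupI)
       (auto simp: regular_module_def a_ac intro: bexI[of _ "\<ominus> _"] l_neg)
  then show ?thesis
    by (intro left_module.intro left_module_axioms.intro ring_axioms)
       (auto simp: regular_module_def l_distr r_distr m_assoc)
qed

definition simple_module :: "('r, 'm) ring_scheme \<Rightarrow> ('r, 'v, 'k) module_scheme \<Rightarrow> bool" where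
  "simple_module A M \<longleftrightarrow>
     left_module A M \<and> carrier M \<noteq> {\<zero>\<^bsub>M\<^esub>} \<and>
     (\<forall>N. submodule N A M \<longrightarrow> N = {\<zero>\<^bsub>M\<^esub>} \<or> N = carrier M)"

definition semisimple_module :: "('r, 'm) ring_scheme \<Rightarrow> ('r, 'v, 'k) module_scheme \<Rightarrow> bool" where
  "semisimple_module A M \<longleftrightarrow>
     left_module A M \<and>
     (\<forall>N. submodule N A M \<longrightarrow>
        (\<exists>N'. submodule N' A M \<and> N \<inter> N' = {\<zero>\<^bsub>M\<^esub>} \<and> N <+>\<^bsub>M\<^esub> N' = carrier M))"

definition module_End ::
  "('r, 'm) ring_scheme \<Rightarrow> ('r, 'v, 'k) module_scheme \<Rightarrow> ('v \<Rightarrow> 'v) set" where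
  "module_End A M =
     {f \<in> carrier M \<rightarrow> carrier M.
        (\<forall>x\<in>carrier M. \<forall>y\<in>carrier M. f (x \<oplus>\<^bsub>M\<^esub> y) = f x \<oplus>\<^bsub>M\<^esub> f y) \<and>
        (\<forall>a\<in>carrier A. \<forall>x\<in>carrier M. f (a \<odot>\<^bsub>M\<^esub> x) = a \<odot>\<^bsub>M\<^esub> f x)}"

text \<open>
  Semisimple: the regular module is semisimple. Split: every simple module has only the
  scalars as endomorphisms. Simple modules are taken with carriers in the type \<open>'r set\<close>,
  which loses nothing: each is isomorphic to the quotient of the regular module by a
  maximal left ideal, whose elements are cosets.
\<close>

definition split_semisimple :: "('r, 'm) ring_scheme \<Rightarrow> ('a::field \<Rightarrow> 'r) \<Rightarrow> bool" where
  "split_semisimple A \<eta> \<longleftrightarrow>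
     semisimple_module A (regular_module A) \<and>
     (\<forall>S :: ('r, 'r set) module. simple_module A S \<longrightarrow>
        (\<forall>f \<in> module_End A S. \<exists>c. \<forall>x\<in>carrier S. f x = \<eta> c \<odot>\<^bsub>S\<^esub> x))"


section \<open>The Ariki-Koike algebra\<close>

text \<open>
  The free algebra on letters of type \<open>'g\<close> is the monoid algebra of the free monoid,
  which is written additively because \<^typ>\<open>'b \<Rightarrow>\<^sub>0 'a\<close> takes its exponents in an
  additive monoid.
\<close>

datatype 'g free_monoid = FM (letters: "'g list")

instantiation free_monoid :: (type) monoid_add
begin

definition zero_free_monoid :: "'a free_monoid" where
  "0 = FM []"

definition plus_free_monoid :: "'a free_monoid \<Rightarrow> 'a free_monoid \<Rightarrow> 'a free_monoid" where
  "u + v = FM (letters u @ letters v)"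

instance
  by standard (simp_all add: zero_free_monoid_def plus_free_monoid_def)

end

type_synonym 'a free_alg = "nat free_monoid \<Rightarrow>\<^sub>0 'a"

definition free_gen :: "nat \<Rightarrow> 'a::field free_alg" where
  "free_gen i = Poly_Mapping.single (FM [i]) 1"

definition free_const :: "'a::field \<Rightarrow> 'a free_alg" where
  "free_const c = Poly_Mapping.single 0 c"

definition free_algebra :: "nat \<Rightarrow> 'a::field free_alg ring" where
  "free_algebra n =
     \<lparr>carrier = {x. \<forall>w\<in>Poly_Mapping.keys x. set (letters w) \<subseteq> {..<n}},
      mult = (*), one = 1, zero = 0, add = (+)\<rparr>"

definition ak_relations :: "nat \<Rightarrow> nat \<Rightarrow> 'a::field \<Rightarrow> (nat \<Rightarrow> 'a) \<Rightarrow> 'a free_alg set" where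
  "ak_relations l n q Q =
     {\<Prod>s\<leftarrow>[0..<l]. free_gen 0 - free_const (Q s)} \<union>
     {(free_gen i - free_const q) * (free_gen i + 1) | i. 1 \<le> i \<and> i < n} \<union>
     (if 2 \<le> n
      then {free_gen 0 * free_gen 1 * free_gen 0 * free_gen 1
              - free_gen 1 * free_gen 0 * free_gen 1 * free_gen 0}
      else {}) \<union>
     {free_gen i * free_gen (i + 1) * free_gen i
        - free_gen (i + 1) * free_gen i * free_gen (i + 1) | i. 1 \<le> i \<and> i + 1 < n} \<union>
     {free_gen i * free_gen j - free_gen j * free_gen i | i j. i + 1 < j \<and> j < n}"

definition ak_ideal :: "nat \<Rightarrow> nat \<Rightarrow> 'a::field \<Rightarrow> (nat \<Rightarrow> 'a) \<Rightarrow> 'a free_alg set" where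
  "ak_ideal l n q Q = Idl\<^bsub>free_algebra n\<^esub> (ak_relations l n q Q)"

definition ak_algebra ::
  "nat \<Rightarrow> nat \<Rightarrow> 'a::field \<Rightarrow> (nat \<Rightarrow> 'a) \<Rightarrow> 'a free_alg set ring" where
  "ak_algebra l n q Q = free_algebra n Quot ak_ideal l n q Q"

definition ak_scalar ::
  "nat \<Rightarrow> nat \<Rightarrow> 'a::field \<Rightarrow> (nat \<Rightarrow> 'a) \<Rightarrow> 'a \<Rightarrow> 'a free_alg set" where
  "ak_scalar l n q Q c = ak_ideal l n q Q +>\<^bsub>free_algebra n\<^esub> free_const c"

definition ak_gen ::
  "nat \<Rightarrow> nat \<Rightarrow> 'a::field \<Rightarrow> (nat \<Rightarrow> 'a) \<Rightarrow> nat \<Rightarrow> 'a free_alg set" where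
  "ak_gen l n q Q i = ak_ideal l n q Q +>\<^bsub>free_algebra n\<^esub> free_gen i"

lemma free_algebra_simps:
  "mult (free_algebra n) = (*)" "one (free_algebra n) = 1"
  "zero (free_algebra n) = 0" "add (free_algebra n) = (+)"
  by (simp_all add: free_algebra_def)

lemma free_algebra_carrier_iff:
  "x \<in> carrier (free_algebra n) \<longleftrightarrow> (\<forall>w\<in>Poly_Mapping.keys x. set (letters w) \<subseteq> {..<n})"
  by (simp add: free_algebra_def)

lemma free_algebra_closed:
  fixes x y :: "'a::field free_alg"
  shows "x \<in> carrier (free_algebra n) \<Longrightarrow> y \<in> carrier (free_algebra n) \<Longrightarrow>
           x + y \<in> carrier (free_algebra n)"
    and "x \<in> carrier (free_algebra n) \<Longrightarrow> y \<in> carrier (free_algebra n) \<Longrightarrow>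
           x - y \<in> carrier (free_algebra n)"
    and "x \<in> carrier (free_algebra n) \<Longrightarrow> y \<in> carrier (free_algebra n) \<Longrightarrow>
           x * y \<in> carrier (free_algebra n)"
    and "x \<in> carrier (free_algebra n) \<Longrightarrow> - x \<in> carrier (free_algebra n)"
    and "(0 :: 'a free_alg) \<in> carrier (free_algebra n)"
    and "(1 :: 'a free_alg) \<in> carrier (free_algebra n)"
    and "free_const c \<in> carrier (free_algebra n)"
    and "i < n \<Longrightarrow> (free_gen i :: 'a free_alg) \<in> carrier (free_algebra n)"
proof -
  assume x: "x \<in> carrier (free_algebra n)" and y: "y \<in> carrier (free_algebra n)"
  show "x + y \<in> carrier (free_algebra n)"
    using x y Poly_Mapping.keys_add[of x y] unfolding free_algebra_carrier_iff by blast
  show "x - y \<in> carrier (free_algebra n)"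
    using x y keys_diff[of x y] unfolding free_algebra_carrier_iff by blast
  show "x * y \<in> carrier (free_algebra n)"
    unfolding free_algebra_carrier_iff
  proof
    fix w assume "w \<in> Poly_Mapping.keys (x * y)"
    then obtain u v where "w = u + v" "u \<in> Poly_Mapping.keys x" "v \<in> Poly_Mapping.keys y"
      using keys_mult[of x y] by blast
    then show "set (letters w) \<subseteq> {..<n}"
      using x y by (auto simp: free_algebra_carrier_iff plus_free_monoid_def)
  qed
next
  assume "x \<in> carrier (free_algebra n)"
  then show "- x \<in> carrier (free_algebra n)" by (simp add: free_algebra_carrier_iff)
next
  show "(0 :: 'a free_alg) \<in> carrier (free_algebra n)"
    by (simp add: free_algebra_carrier_iff)
  show "(1 :: 'a free_alg) \<in> carrier (free_algebra n)"
    by (simp add: free_algebra_carrier_iff zero_free_monoid_def)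
  show "free_const c \<in> carrier (free_algebra n)"
    by (simp add: free_algebra_carrier_iff free_const_def zero_free_monoid_def)
next
  assume "i < n"
  then show "(free_gen i :: 'a free_alg) \<in> carrier (free_algebra n)"
    by (simp add: free_algebra_carrier_iff free_gen_def)
qed

lemma ring_free_algebra: "ring (free_algebra n :: 'a::field free_alg ring)"
proof (rule ringI)
  show "abelian_group (free_algebra n :: 'a free_alg ring)"
  proof (rule abelian_groupI)
    fix x :: "'a free_alg" assume "x \<in> carrier (free_algebra n)"
    then show "\<exists>y\<in>carrier (free_algebra n). y \<oplus>\<^bsub>free_algebra n\<^esub> x = \<zero>\<^bsub>free_algebra n\<^esub>"
      by (intro bexI[of _ "- x"]) (auto simp: free_algebra_simps free_algebra_closed)
  qed (auto simp: free_algebra_simps free_algebra_closed add_ac)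
  show "monoid (free_algebra n :: 'a free_alg ring)"
    by (rule monoidI) (auto simp: free_algebra_simps free_algebra_closed mult.assoc)
qed (auto simp: free_algebra_simps distrib_left distrib_right)

lemma ak_relations_carrier:
  assumes "1 \<le> n"
  shows "ak_relations l n q Q \<subseteq> carrier (free_algebra n)"
proof -
  have "prod_list xs \<in> carrier (free_algebra n)"
    if "set xs \<subseteq> carrier (free_algebra n)" for xs :: "'a free_alg list"
    using that by (induction xs) (auto intro: free_algebra_closed)
  moreover have "set (map (\<lambda>s. free_gen 0 - free_const (Q s)) [0..<l]) \<subseteq> carrier (free_algebra n)"
    using assms by (auto intro!: free_algebra_closed)
  ultimately have "(\<Prod>s\<leftarrow>[0..<l]. free_gen 0 - free_const (Q s)) \<in> carrier (free_algebra n)"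
    by blast
  then show ?thesis
    unfolding ak_relations_def by (auto intro!: free_algebra_closed)
qed

lemma ideal_ak_ideal: "1 \<le> n \<Longrightarrow> ideal (ak_ideal l n q Q) (free_algebra n)"
  unfolding ak_ideal_def
  by (intro ring.genideal_ideal ring_free_algebra ak_relations_carrier)

lemma ring_ak_algebra: "1 \<le> n \<Longrightarrow> ring (ak_algebra l n q Q)"
  unfolding ak_algebra_def by (intro ideal.quotient_is_ring ideal_ak_ideal)


section \<open>The modules indexed by multipartitions\<close>

text \<open>
  The vector space with basis the standard tableaux is rendered as functions from
  tableaux to the field. A tableau assigns to the node \<open>(i, j)\<close> of component \<open>s\<close>, that is
  to the triple \<open>(s, i, j)\<close>, its entry, and takes the dummy value 0 off the diagram.
\<close>

type_synonym tableau = "nat \<times> nat \<times> nat \<Rightarrow> nat"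

definition mp_nodes :: "multipartition \<Rightarrow> (nat \<times> nat \<times> nat) set" where
  "mp_nodes \<Lambda> = {(s, i, j). s < length \<Lambda> \<and> (i, j) \<in> young (\<Lambda> ! s)}"

definition std_tableaux :: "multipartition \<Rightarrow> tableau set" where
  "std_tableaux \<Lambda> =
     {T. bij_betw T (mp_nodes \<Lambda>) {1..mp_size \<Lambda>} \<and> (\<forall>x. x \<notin> mp_nodes \<Lambda> \<longrightarrow> T x = 0) \<and>
         (\<forall>s i j j'. (s, i, j) \<in> mp_nodes \<Lambda> \<and> (s, i, j') \<in> mp_nodes \<Lambda> \<and> j < j' \<longrightarrow>
            T (s, i, j) < T (s, i, j')) \<and>
         (\<forall>s i i' j. (s, i, j) \<in> mp_nodes \<Lambda> \<and> (s, i', j) \<in> mp_nodes \<Lambda> \<and> i < i' \<longrightarrow>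
            T (s, i, j) < T (s, i', j))}"

definition node_of :: "multipartition \<Rightarrow> tableau \<Rightarrow> nat \<Rightarrow> nat \<times> nat \<times> nat" where
  "node_of \<Lambda> T k = inv_into (mp_nodes \<Lambda>) T k"

definition basis_vec :: "tableau \<Rightarrow> tableau \<Rightarrow> 'a::field" where
  "basis_vec T = (\<lambda>U. if U = T then 1 else 0)"

definition seminormal_coeff ::
  "'a::field \<Rightarrow> (nat \<Rightarrow> 'a) \<Rightarrow> nat \<times> nat \<times> nat \<Rightarrow> nat \<times> nat \<times> nat \<Rightarrow> 'a" where
  "seminormal_coeff q Q = (\<lambda>(s, i, j) (s', i', j').
     if s = s' then
       let d = (int j' - int i') - (int j - int i)
       in if q = 1 then 1 / of_int d else q powi d * (q - 1) / (q powi d - 1)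
     else
       let c = q powi (int j - int i) * Q s; c' = q powi (int j' - int i') * Q s'
       in (q - 1) * c' / (c' - c))"

text \<open>The image of the basis vector of \<open>T\<close> under the generator of index \<open>k\<close>:\<close>

definition gen_basis ::
  "'a::field \<Rightarrow> (nat \<Rightarrow> 'a) \<Rightarrow> multipartition \<Rightarrow> nat \<Rightarrow> tableau \<Rightarrow> tableau \<Rightarrow> 'a" where
  "gen_basis q Q \<Lambda> k T =
     (if k = 0 then (\<lambda>U. Q (fst (node_of \<Lambda> T 1)) * basis_vec T U)
      else
        let (s, i, j) = node_of \<Lambda> T k; (s', i', j') = node_of \<Lambda> T (k + 1)
        in if s = s' \<and> i = i' then (\<lambda>U. q * basis_vec T U)
           else if s = s' \<and> j = j' then (\<lambda>U. - basis_vec T U)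
           else
             let a = seminormal_coeff q Q (s, i, j) (s', i', j')
             in (\<lambda>U. a * basis_vec T U + (1 + a) * basis_vec (transpose k (k + 1) \<circ> T) U))"

definition gen_op ::
  "'a::field \<Rightarrow> (nat \<Rightarrow> 'a) \<Rightarrow> multipartition \<Rightarrow> nat \<Rightarrow> (tableau \<Rightarrow> 'a) \<Rightarrow> tableau \<Rightarrow> 'a" where
  "gen_op q Q \<Lambda> k v = (\<lambda>U. \<Sum>T\<in>std_tableaux \<Lambda>. v T * gen_basis q Q \<Lambda> k T U)"

definition free_op ::
  "'a::field \<Rightarrow> (nat \<Rightarrow> 'a) \<Rightarrow> multipartition \<Rightarrow> 'a free_alg \<Rightarrow> (tableau \<Rightarrow> 'a) \<Rightarrow> tableau \<Rightarrow> 'a"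
  where
  "free_op q Q \<Lambda> x v =
     (\<lambda>U. \<Sum>w\<in>Poly_Mapping.keys x. Poly_Mapping.lookup x w * foldr (gen_op q Q \<Lambda>) (letters w) v U)"

text \<open>
  An element of the algebra is a coset; it acts by the common action of its
  representatives.
\<close>

definition ak_op ::
  "'a::field \<Rightarrow> (nat \<Rightarrow> 'a) \<Rightarrow> multipartition \<Rightarrow> 'a free_alg set \<Rightarrow> (tableau \<Rightarrow> 'a) \<Rightarrow> tableau \<Rightarrow> 'a"
  where
  "ak_op q Q \<Lambda> X v = the_elem ((\<lambda>x. free_op q Q \<Lambda> x v) ` X)"

definition ak_character ::
  "'a::field \<Rightarrow> (nat \<Rightarrow> 'a) \<Rightarrow> multipartition \<Rightarrow> 'a free_alg set \<Rightarrow> 'a" where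
  "ak_character q Q \<Lambda> X = (\<Sum>T\<in>std_tableaux \<Lambda>. ak_op q Q \<Lambda> X (basis_vec T) T)"


section \<open>The symmetrizing form and the Schur elements\<close>

definition ak_word ::
  "nat \<Rightarrow> nat \<Rightarrow> 'a::field \<Rightarrow> (nat \<Rightarrow> 'a) \<Rightarrow> nat list \<Rightarrow> 'a free_alg set" where
  "ak_word l n q Q is =
     foldr (\<lambda>i X. ak_gen l n q Q i \<otimes>\<^bsub>ak_algebra l n q Q\<^esub> X) is \<one>\<^bsub>ak_algebra l n q Q\<^esub>"

definition ak_L ::
  "nat \<Rightarrow> nat \<Rightarrow> 'a::field \<Rightarrow> (nat \<Rightarrow> 'a) \<Rightarrow> nat \<Rightarrow> 'a free_alg set" where
  "ak_L l n q Q k =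
     ak_scalar l n q Q (q powi (1 - int k))
       \<otimes>\<^bsub>ak_algebra l n q Q\<^esub> ak_word l n q Q (rev [1..<k] @ [0] @ [1..<k])"

definition word_perm :: "nat list \<Rightarrow> nat \<Rightarrow> nat" where
  "word_perm is = foldr (\<lambda>i f. transpose i (i + 1) \<circ> f) is id"

definition reduced_expr :: "nat \<Rightarrow> (nat \<Rightarrow> nat) \<Rightarrow> nat list \<Rightarrow> bool" where
  "reduced_expr n w is \<longleftrightarrow>
     set is \<subseteq> {1..<n} \<and> word_perm is = w \<and>
     (\<forall>js. set js \<subseteq> {1..<n} \<and> word_perm js = w \<longrightarrow> length is \<le> length js)"

definition ak_T ::
  "nat \<Rightarrow> nat \<Rightarrow> 'a::field \<Rightarrow> (nat \<Rightarrow> 'a) \<Rightarrow> (nat \<Rightarrow> nat) \<Rightarrow> 'a free_alg set" where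
  "ak_T l n q Q w = ak_word l n q Q (SOME is. reduced_expr n w is)"

definition ak_basis ::
  "nat \<Rightarrow> nat \<Rightarrow> 'a::field \<Rightarrow> (nat \<Rightarrow> 'a) \<Rightarrow> (nat \<Rightarrow> nat) \<Rightarrow> (nat \<Rightarrow> nat) \<Rightarrow> 'a free_alg set" where
  "ak_basis l n q Q c w =
     foldr (\<lambda>k X. ak_L l n q Q k [^]\<^bsub>ak_algebra l n q Q\<^esub> c k \<otimes>\<^bsub>ak_algebra l n q Q\<^esub> X)
       [1..<n + 1] (ak_T l n q Q w)"

definition ak_linear_form ::
  "nat \<Rightarrow> nat \<Rightarrow> 'a::field \<Rightarrow> (nat \<Rightarrow> 'a) \<Rightarrow> ('a free_alg set \<Rightarrow> 'a) \<Rightarrow> bool" where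
  "ak_linear_form l n q Q f \<longleftrightarrow>
     (\<forall>X\<in>carrier (ak_algebra l n q Q). \<forall>Y\<in>carrier (ak_algebra l n q Q).
        f (X \<oplus>\<^bsub>ak_algebra l n q Q\<^esub> Y) = f X + f Y) \<and>
     (\<forall>c. \<forall>X\<in>carrier (ak_algebra l n q Q).
        f (ak_scalar l n q Q c \<otimes>\<^bsub>ak_algebra l n q Q\<^esub> X) = c * f X)"

definition ak_tau :: "nat \<Rightarrow> nat \<Rightarrow> 'a::field \<Rightarrow> (nat \<Rightarrow> 'a) \<Rightarrow> 'a free_alg set \<Rightarrow> 'a" where
  "ak_tau l n q Q = (THE f. f \<in> extensional (carrier (ak_algebra l n q Q)) \<and>
     ak_linear_form l n q Q f \<and>
     (\<forall>c \<in> {1..n} \<rightarrow> {..<l}. \<forall>w. w permutes {1..n} \<longrightarrow>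
        f (ak_basis l n q Q c w) = (if (\<forall>k\<in>{1..n}. c k = 0) \<and> w = id then 1 else 0)))"

definition schur_element ::
  "nat \<Rightarrow> nat \<Rightarrow> 'a::field \<Rightarrow> (nat \<Rightarrow> 'a) \<Rightarrow> multipartition \<Rightarrow> 'a" where
  "schur_element l n q Q = (THE s. s \<in> multipartitions l n \<rightarrow>\<^sub>E (UNIV - {0}) \<and>
     (\<forall>X\<in>carrier (ak_algebra l n q Q).
        ak_tau l n q Q X =
          (\<Sum>\<Lambda>\<in>multipartitions l n. 1 / s \<Lambda> * ak_character q Q \<Lambda> X)))"

end

theory Submission
  imports Defs "HOL-Computational_Algebra.Formal_Laurent_Series"
begin

text \<open>
  The algebra acts on functions on paths, that is on sequences of nodes in which every initial segment is a
  multidiagram, through the seminormal operators; paths are the standard tableaux, and the elements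
  \<open>L\<^sub>k\<close> are diagonal with the residue of the k-th node as eigenvalue. Call the parameters separated if
  \<open>[m]\<^sub>q\<close> is nonzero for \<open>1 \<le> m \<le> n\<close> and \<open>q\<^sup>d Q\<^sub>s \<noteq> Q\<^sub>t\<close> for \<open>|d| < n\<close> and distinct \<open>s, t\<close>.

  For separated parameters let \<open>S(\<mu>)\<close> be the product of hook lengths in question and let \<open>\<phi>\<close> be the sum over
  all paths of the diagonal matrix entry divided by \<open>S\<close> of the shape. The ratio \<open>S(\<mu>) / S(\<mu> + x)\<close> is, as a function
  of the addable node \<open>x\<close> of \<open>\<mu>\<close>, the weight of Lagrange interpolation at 0, so that
  \<open>\<Sum>\<^sub>x res(x)\<^sup>k S(\<mu>) / S(\<mu> + x)\<close> is 1 for \<open>k = 0\<close> and 0 for \<open>0 < k < l\<close>. Hence, by induction on \<open>n\<close>, \<open>\<phi>\<close> agrees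
  with \<open>\<tau>\<close> on the elements \<open>L\<^sub>1\<^sup>c\<^sup>1 \<cdots> L\<^sub>n\<^sup>c\<^sup>n T\<^sub>w\<close>, and these span the algebra. The characters are
  independent because polynomials in diagonal elements separate the paths.

  Semisimplicity implies separation. The element \<open>y\<close>, the product of all \<open>L\<^sub>k - Q\<^sub>t\<close> with \<open>t \<noteq> s\<close> times the sum
  of all \<open>T\<^sub>w\<close>, satisfies \<open>y h = \<chi>(h) y\<close> for a linear character \<open>\<chi>\<close>, and \<open>\<chi>(y)\<close> is the product of the quantities
  that have to be nonzero. If it vanished, then \<open>y\<^sup>2 = 0\<close>, which together with \<open>y h = \<chi>(h) y\<close> forces \<open>y = 0\<close> in a
  semisimple algebra. But \<open>\<tau>(y) \<noteq> 0\<close>; for arbitrary parameters, \<open>\<tau>\<close> is obtained by specialising it from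
  the separated parameters \<open>q + X\<close> and \<open>Q\<^sub>s + X\<^sup>n\<^sup>(\<^sup>s\<^sup>+\<^sup>1\<^sup>)\<close> over Laurent series.
\<close>

section \<open>Congruences modulo ideals\<close>

text \<open>Three difficulties shape the development. The algebra depends on parameters and is not a
  type, so computations take place in a genuine ring and are carried back as congruences. Both
  \<open>ak_tau\<close> and \<open>schur_element\<close> are definite descriptions, so each of them
  needs existence and uniqueness; for \<open>ak_tau\<close> the former comes from the trace and the
  latter from the spanning monomials. Finally, the form has to be evaluated at y before the
  parameters are known to be separated. Specialisation is possible because the monomials span words
  with coefficients in any subring containing \<open>q\<close> and the \<open>Q s\<close>: the
  generic trace of a word is then a power series and can be evaluated at X = 0. Operators act on
  coefficient functions instead of basis vectors, so they are given by the rows of the seminormal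
  matrices, and each relation becomes an identity at a single path. For \<open>q = 1\<close> the
  residue of a node only shows its component, and the contents take over inside a component; hence
  the many case distinctions.\<close>

definition two_sided_ideal :: "'r::ring_1 set \<Rightarrow> bool" where
  "two_sided_ideal J \<longleftrightarrow> 0 \<in> J \<and> (\<forall>x\<in>J. \<forall>y\<in>J. x - y \<in> J) \<and> (\<forall>x\<in>J. \<forall>r. r * x \<in> J \<and> x * r \<in> J)"

lemma two_sided_idealD:
  assumes "two_sided_ideal J"
  shows "0 \<in> J" "x \<in> J \<Longrightarrow> y \<in> J \<Longrightarrow> x - y \<in> J" "x \<in> J \<Longrightarrow> - x \<in> J" "x \<in> J \<Longrightarrow> y \<in> J \<Longrightarrow> x + y \<in> J"
    "x \<in> J \<Longrightarrow> r * x \<in> J" "x \<in> J \<Longrightarrow> x * r \<in> J"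
proof -
  show z: "0 \<in> J" and d: "\<And>x y. x \<in> J \<Longrightarrow> y \<in> J \<Longrightarrow> x - y \<in> J"
    and "x \<in> J \<Longrightarrow> r * x \<in> J" "x \<in> J \<Longrightarrow> x * r \<in> J"
    using assms by (auto simp: two_sided_ideal_def)
  show m: "- x \<in> J" if "x \<in> J" for x using d[OF z that] by simp
  show "x + y \<in> J" if "x \<in> J" "y \<in> J" using d[OF that(1) m[OF that(2)]] by simp
qed

text \<open>
  The ideal defining the algebra depends on parameters, so the quotient by it is not a type. Ring identities
  are therefore derived in the product of all quotients of the free algebra, whose components recover the
  congruence modulo any particular ideal.
\<close>

quotient_type (overloaded) 'r all_quotients =
  "'r::ring_1 set \<Rightarrow> 'r" / "\<lambda>f g. \<forall>J. two_sided_ideal J \<longrightarrow> f J - g J \<in> J"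
proof (rule equivpI)
  show "reflp (\<lambda>f g. \<forall>J. two_sided_ideal J \<longrightarrow> f J - g J \<in> (J :: 'r set))"
    by (auto simp: reflp_def two_sided_ideal_def)
  show "symp (\<lambda>f g. \<forall>J. two_sided_ideal J \<longrightarrow> f J - g J \<in> (J :: 'r set))"
    unfolding symp_def by (metis minus_diff_eq two_sided_idealD(3))
  show "transp (\<lambda>f g. \<forall>J. two_sided_ideal J \<longrightarrow> f J - g J \<in> (J :: 'r set))"
    unfolding transp_def by (metis diff_add_cancel add_diff_eq two_sided_idealD(4))
qed

instantiation all_quotients :: (ring_1) ring_1
begin

lift_definition zero_all_quotients :: "'a all_quotients" is "\<lambda>J. 0" .
lift_definition one_all_quotients :: "'a all_quotients" is "\<lambda>J. 1" .
lift_definition plus_all_quotients :: "'a all_quotients \<Rightarrow> 'a all_quotients \<Rightarrow> 'a all_quotients"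
  is "\<lambda>f g J. f J + g J"
proof -
  fix f f' g g' :: "'a set \<Rightarrow> 'a" and J :: "'a set"
  assume "\<And>J. two_sided_ideal J \<Longrightarrow> f J - f' J \<in> J" "\<And>J. two_sided_ideal J \<Longrightarrow> g J - g' J \<in> J"
    and J: "two_sided_ideal J"
  then have "(f J - f' J) + (g J - g' J) \<in> J" using two_sided_idealD(4)[OF J] J by blast
  then show "f J + g J - (f' J + g' J) \<in> J" by (simp add: algebra_simps)
qed
lift_definition minus_all_quotients :: "'a all_quotients \<Rightarrow> 'a all_quotients \<Rightarrow> 'a all_quotients"
  is "\<lambda>f g J. f J - g J"
proof -
  fix f f' g g' :: "'a set \<Rightarrow> 'a" and J :: "'a set"
  assume "\<And>J. two_sided_ideal J \<Longrightarrow> f J - f' J \<in> J" "\<And>J. two_sided_ideal J \<Longrightarrow> g J - g' J \<in> J"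
    and J: "two_sided_ideal J"
  then have "(f J - f' J) - (g J - g' J) \<in> J" using two_sided_idealD(2)[OF J] J by blast
  then show "f J - g J - (f' J - g' J) \<in> J" by (simp add: algebra_simps)
qed
lift_definition uminus_all_quotients :: "'a all_quotients \<Rightarrow> 'a all_quotients"
  is "\<lambda>f J. - f J"
  by (metis minus_diff_minus two_sided_idealD(3))
lift_definition times_all_quotients :: "'a all_quotients \<Rightarrow> 'a all_quotients \<Rightarrow> 'a all_quotients"
  is "\<lambda>f g J. f J * g J"
proof -
  fix f f' g g' :: "'a set \<Rightarrow> 'a" and J :: "'a set"
  assume "\<And>J. two_sided_ideal J \<Longrightarrow> f J - f' J \<in> J" "\<And>J. two_sided_ideal J \<Longrightarrow> g J - g' J \<in> J"
    and J: "two_sided_ideal J"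
  then have "(f J - f' J) * g J + f' J * (g J - g' J) \<in> J"
    by (intro two_sided_idealD(4)[OF J] two_sided_idealD(5)[OF J] two_sided_idealD(6)[OF J]) auto
  then show "f J * g J - f' J * g' J \<in> J" by (simp add: algebra_simps)
qed

instance
proof
  \<comment> \<open>The zero ideal is one of the components, and in it 1 differs from 0.\<close>
  have "two_sided_ideal ({0} :: 'a set)" by (auto simp: two_sided_ideal_def)
  then show "(0 :: 'a all_quotients) \<noteq> 1"
    by transfer (metis diff_0 neg_equal_0_iff_equal singletonD zero_neq_one)
qed (transfer; simp add: algebra_simps two_sided_ideal_def)+

end

lemma abs_all_quotients_eqD:
  assumes "abs_all_quotients f = abs_all_quotients g" "two_sided_ideal J"
  shows "f J - g J \<in> J"
  using assms by (simp add: all_quotients.abs_eq_iff)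

section \<open>Words in the symmetric group\<close>

text \<open>Only commutation and braid moves, without cancellation of squares. Equivalent words
  therefore have equal length and equal letters, and the equivalence remains valid for Hecke
  generators, whose squares obey a different relation.\<close>

inductive braid_eq :: "nat list \<Rightarrow> nat list \<Rightarrow> bool" where
  be_refl: "braid_eq u u"
| be_sym: "braid_eq u v \<Longrightarrow> braid_eq v u"
| be_trans: "braid_eq u v \<Longrightarrow> braid_eq v w \<Longrightarrow> braid_eq u w"
| be_comm: "Suc i < j \<Longrightarrow> braid_eq (u @ [i, j] @ v) (u @ [j, i] @ v)"
| be_braid: "braid_eq (u @ [i, Suc i, i] @ v) (u @ [Suc i, i, Suc i] @ v)"

declare braid_eq.be_trans [trans]

lemma braid_eq_ctx:
  assumes "braid_eq u v"
  shows "braid_eq (x @ u @ y) (x @ v @ y)"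
  using assms
proof induction
  case (be_comm i j u v)
  then show ?case using braid_eq.be_comm[of i j "x @ u" "v @ y"] by simp
next
  case (be_braid u i v)
  then show ?case using braid_eq.be_braid[of "x @ u" i "v @ y"] by simp
qed (auto intro: braid_eq.intros)

lemma braid_eq_ctxL: "braid_eq u v \<Longrightarrow> braid_eq (x @ u) (x @ v)"
  and braid_eq_ctxR: "braid_eq u v \<Longrightarrow> braid_eq (u @ y) (v @ y)"
  using braid_eq_ctx[of u v x "[]"] braid_eq_ctx[of u v "[]" y] by simp_all

lemma braid_eq_length_set: "braid_eq u v \<Longrightarrow> length u = length v \<and> set u = set v"
  by (induction rule: braid_eq.induct) auto

lemma braid_eq_commute_letter:
  assumes "\<forall>k\<in>set w. Suc k < i \<or> Suc i < k"
  shows "braid_eq (w @ [i]) (i # w)"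
  using assms
proof (induction w)
  case (Cons k w)
  have "braid_eq (k # w @ [i]) (k # i # w)"
    using braid_eq_ctxL[of "w @ [i]" "i # w" "[k]"] Cons by simp
  also have "braid_eq (k # i # w) (i # k # w)"
    using Cons.prems braid_eq.be_comm[of k i "[]" w] braid_eq.be_sym[OF braid_eq.be_comm[of i k "[]" w]] by auto
  finally show ?case by simp
qed (auto intro: braid_eq.be_refl)

section \<open>Permutations represented by words\<close>

lemma word_perm_append: "word_perm (u @ v) = word_perm u \<circ> word_perm v"
  by (induction u) (auto simp: word_perm_def o_assoc)

lemma word_perm_Nil [simp]: "word_perm [] = id"
  and word_perm_Cons: "word_perm (i # u) = transpose i (Suc i) \<circ> word_perm u"
  by (auto simp: word_perm_def)

lemma word_perm_braid_eq: "braid_eq u v \<Longrightarrow> word_perm u = word_perm v"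
proof (induction rule: braid_eq.induct)
  case (be_comm i j u v)
  have "word_perm [i, j] = word_perm [j, i]"
    using be_comm by (auto simp: word_perm_def fun_eq_iff transpose_def)
  then show ?case by (simp only: word_perm_append)
next
  case (be_braid u i v)
  have "word_perm [i, Suc i, i] = word_perm [Suc i, i, Suc i]"
    by (auto simp: word_perm_def fun_eq_iff transpose_def)
  then show ?case by (simp only: word_perm_append)
qed auto

lemma word_perm_permutes: "set u \<subseteq> {1..<n} \<Longrightarrow> word_perm u permutes {1..n}"
proof (induction u)
  case (Cons i u)
  then have "transpose i (Suc i) permutes {1..n}" by (intro permutes_swap_id) auto
  moreover have "word_perm u permutes {1..n}" using Cons by simp
  ultimately show ?case unfolding word_perm_Cons by (rule permutes_compose[rotated])
qed (simp add: permutes_id[unfolded id_def] id_def)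

section \<open>Canonical words and the exchange argument\<close>

text \<open>
  The words \<open>cword j m\<close> represent each element of the symmetric group on \<open>{1..m}\<close> once,
  through the coset representatives \<open>s\<^sub>k\<cdots>s\<^sub>j\<close> of one symmetric group in the next.
\<close>

primrec cword :: "(nat \<Rightarrow> nat) \<Rightarrow> nat \<Rightarrow> nat list" where
  "cword j 0 = []"
| "cword j (Suc k) = cword j k @ rev [j (Suc k)..<Suc k]"

definition is_code :: "nat \<Rightarrow> (nat \<Rightarrow> nat) \<Rightarrow> bool" where
  "is_code m j \<longleftrightarrow> (\<forall>k\<in>{1..m}. 1 \<le> j k \<and> j k \<le> k)"

lemma is_code_Suc: "is_code (Suc m) j \<longleftrightarrow> is_code m j \<and> 1 \<le> j (Suc m) \<and> j (Suc m) \<le> Suc m"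
  by (simp add: is_code_def atLeastAtMostSuc_conv) blast

lemma cword_cong: "(\<And>k. k \<in> {1..m} \<Longrightarrow> j k = j' k) \<Longrightarrow> cword j m = cword j' m"
  by (induction m) auto

lemma set_cword: "is_code m j \<Longrightarrow> set (cword j m) \<subseteq> {1..<m}"
  by (induction m) (auto simp: is_code_Suc)

lemma rev_upt_split: "i \<le> j \<Longrightarrow> j \<le> k \<Longrightarrow> rev [i..<k] = rev [j..<k] @ rev [i..<j]"
  by (metis rev_append le_add_diff_inverse upt_add_eq_append)

text \<open>Conjugation by the cycle \<open>s_{m-1} ... s_J\<close> shifts an index down by one. The
  final letter travels left past all letters below \<open>i - 1\<close>, one braid move turns
  \<open>i, i-1, i\<close> into \<open>i-1, i, i-1\<close>, and the new first letter travels on to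
  the front.\<close>

lemma braid_eq_descending:
  assumes "J < i" "i < m"
  shows "braid_eq (rev [J..<m] @ [i]) ((i - 1) # rev [J..<m])"
proof -
  have split: "rev [J..<m] = rev [Suc i..<m] @ [i, i - 1] @ rev [J..<i - 1]"
  proof -
    have "rev [J..<m] = rev [Suc i..<m] @ rev [J..<Suc i]"
      using assms by (intro rev_upt_split) auto
    also have "rev [J..<Suc i] = rev [i - 1..<Suc i] @ rev [J..<i - 1]"
      using assms by (intro rev_upt_split) auto
    also have "rev [i - 1..<Suc i] = [i, i - 1]" using assms by (cases i) auto
    finally show ?thesis by simp
  qed
  have "braid_eq (rev [J..<i - 1] @ [i]) (i # rev [J..<i - 1])"
    by (rule braid_eq_commute_letter) auto
  then have "braid_eq (rev [J..<m] @ [i]) (rev [Suc i..<m] @ [i, i - 1, i] @ rev [J..<i - 1])"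
    unfolding split
    using braid_eq_ctxL[of "rev [J..<i - 1] @ [i]" "i # rev [J..<i - 1]" "rev [Suc i..<m] @ [i, i - 1]"]
    by simp
  also have "braid_eq \<dots> (rev [Suc i..<m] @ [i - 1, i, i - 1] @ rev [J..<i - 1])"
    using braid_eq.be_sym[OF braid_eq.be_braid[of "rev [Suc i..<m]" "i - 1" "rev [J..<i - 1]"]] assms by simp
  also have "braid_eq \<dots> ((i - 1) # rev [J..<m])"
  proof -
    have "braid_eq (rev [Suc i..<m] @ [i - 1]) ((i - 1) # rev [Suc i..<m])"
      using assms by (intro braid_eq_commute_letter) auto
    then show ?thesis unfolding split

      using braid_eq_ctxR[of "rev [Suc i..<m] @ [i - 1]" "(i - 1) # rev [Suc i..<m]"
        "[i, i - 1] @ rev [J..<i - 1]"] by simp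
  qed
  finally show ?thesis .
qed

text \<open>Right multiplication of a canonical word by a generator. The letter either passes
  through the last descending run and acts on the shorter canonical word, or it lengthens or
  shortens this run by one. Shortening is recorded with the letter on the other side, since squares
  are not cancelled.\<close>

lemma cword_mult_letter:
  assumes "is_code m j" "1 \<le> i" "i < m"
  shows "\<exists>j'. is_code m j' \<and>
    (braid_eq (cword j m @ [i]) (cword j' m) \<or> braid_eq (cword j m) (cword j' m @ [i]))"
  using assms
proof (induction m arbitrary: i)
  case (Suc k)
  let ?J = "j (Suc k)" and ?m = "Suc k"
  have code: "is_code k j" "1 \<le> ?J" "?J \<le> ?m" using Suc.prems by (auto simp: is_code_Suc)
  \<comment> \<open>The situation in which \<open>i\<close> emerges to the left of the run as a
    letter \<open>i'\<close> of the smaller symmetric group, where the induction hypothesis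
    applies.\<close>
  have pass: ?case if i': "1 \<le> i'" "i' < k" "braid_eq (rev [?J..<?m] @ [i]) (i' # rev [?J..<?m])" for i'
  proof -
    obtain j' where j': "is_code k j'"
      "braid_eq (cword j k @ [i']) (cword j' k) \<or> braid_eq (cword j k) (cword j' k @ [i'])"
      using Suc.IH[OF code(1) i'(1,2)] by blast
    define j'' where "j'' = j'(?m := ?J)"
    have c: "cword j'' ?m = cword j' k @ rev [?J..<?m]" "is_code ?m j''"
      using j'(1) code by (auto simp: j''_def is_code_def intro: cword_cong)
    have 1: "braid_eq (cword j ?m @ [i]) (cword j k @ [i'] @ rev [?J..<?m])"
      using braid_eq_ctxL[OF i'(3), of "cword j k"] by simp
    have 2: "braid_eq (cword j'' ?m @ [i]) (cword j' k @ [i'] @ rev [?J..<?m])"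
      unfolding c(1) using braid_eq_ctxL[OF i'(3), of "cword j' k"] by simp
    from j'(2) show ?thesis
    proof
      assume "braid_eq (cword j k @ [i']) (cword j' k)"
      from braid_eq_ctxR[OF this, of "rev [?J..<?m]"]
      have "braid_eq (cword j k @ [i'] @ rev [?J..<?m]) (cword j'' ?m)" using c by simp
      with 1 c(2) show ?thesis by (blast intro: braid_eq.be_trans)
    next
      assume "braid_eq (cword j k) (cword j' k @ [i'])"
      from braid_eq_ctxR[OF this, of "rev [?J..<?m]"]
      have "braid_eq (cword j ?m) (cword j' k @ [i'] @ rev [?J..<?m])" by simp
      with 2 c(2) show ?thesis by (blast intro: braid_eq.be_trans braid_eq.be_sym)
    qed
  qed
  \<comment> \<open>A letter below \<open>?J - 1\<close> commutes with the run,
    \<open>?J - 1\<close> prolongs it, \<open>?J\<close> is its last letter, and a larger letter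
    passes through it as \<open>i - 1\<close>.\<close>
  consider "i + 1 < ?J" | "i + 1 = ?J" | "i = ?J" | "?J < i" by linarith
  then show ?case
  proof cases
    case 1
    then show ?thesis using Suc.prems code
      by (intro pass[of i] braid_eq_commute_letter) auto
  next
    case 2
    define j' where "j' = j(?m := i)"
    have "cword j' ?m = cword j k @ rev [i..<?m]" by (auto simp: j'_def intro: cword_cong)
    moreover have "rev [i..<?m] = rev [?J..<?m] @ [i]"
      using code rev_upt_split[of i ?J ?m] by (simp add: 2[symmetric] del: upt_Suc) (simp add: upt_rec)
    ultimately have "cword j ?m @ [i] = cword j' ?m" by simp
    moreover have "is_code ?m j'" using code Suc.prems by (auto simp: is_code_def j'_def)
    ultimately show ?thesis by (metis braid_eq.be_refl)
  next
    case 3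
    define j' where "j' = j(?m := Suc i)"
    have "cword j' ?m = cword j k @ rev [Suc i..<?m]" by (auto simp: j'_def intro: cword_cong)
    moreover have "rev [?J..<?m] = rev [Suc i..<?m] @ [i]"
      using 3 Suc.prems rev_upt_split[of i "Suc i" ?m] by simp
    ultimately have "cword j ?m = cword j' ?m @ [i]" by simp
    moreover have "is_code ?m j'" using code Suc.prems by (auto simp: is_code_def j'_def)
    ultimately show ?thesis by (metis braid_eq.be_refl)
  next
    case 4
    then show ?thesis using Suc.prems code
      by (intro pass[of "i - 1"] braid_eq_descending) auto
  qed
qed simp

lemma cword_self: "cword (\<lambda>k. k) m = []" "is_code m (\<lambda>k. k)"
  by (induction m) (auto simp: is_code_def)

text \<open>The word is read from left to right while a canonical word for the prefix is kept. A
  loss of length arises only in the second alternative of \<open>cword_mult_letter\<close> and is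
  never made up for, so if no length is lost, all steps were braid moves.\<close>

lemma cword_of_word:
  assumes "set u \<subseteq> {1..<m}"
  shows "\<exists>j. is_code m j \<and> word_perm (cword j m) = word_perm u \<and> length (cword j m) \<le> length u \<and>
    (length (cword j m) = length u \<longrightarrow> braid_eq u (cword j m))"
  using assms
proof (induction u rule: rev_induct)
  case Nil
  then show ?case using cword_self[of m] by (intro exI[of _ "\<lambda>k. k"]) (auto intro: braid_eq.be_refl)
next
  case (snoc i u)
  then obtain j where j: "is_code m j" "word_perm (cword j m) = word_perm u"
    "length (cword j m) \<le> length u" "length (cword j m) = length u \<longrightarrow> braid_eq u (cword j m)"
    by auto
  obtain j' where j': "is_code m j'"
    "braid_eq (cword j m @ [i]) (cword j' m) \<or> braid_eq (cword j m) (cword j' m @ [i])"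
    using cword_mult_letter[OF j(1), of i] snoc.prems by auto
  from j'(2) show ?case
  proof
    assume b: "braid_eq (cword j m @ [i]) (cword j' m)"
    have "word_perm (cword j' m) = word_perm (u @ [i])"
      using word_perm_braid_eq[OF b] j(2) by (simp add: word_perm_append)
    moreover have len: "length (cword j' m) = Suc (length (cword j m))"
      using braid_eq_length_set[OF b] by simp
    moreover have "braid_eq (u @ [i]) (cword j' m)" if "length (cword j' m) = length (u @ [i])"
    proof -
      have "braid_eq u (cword j m)" using j(4) that len by simp
      from braid_eq_ctxR[OF this, of "[i]"] b show ?thesis by (rule braid_eq.be_trans)
    qed
    ultimately show ?thesis using j'(1) j(3) by auto
  next
    assume b: "braid_eq (cword j m) (cword j' m @ [i])"
    have "word_perm u = word_perm (cword j' m) \<circ> transpose i (Suc i)"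
      using word_perm_braid_eq[OF b] j(2) by (simp add: word_perm_append word_perm_Cons)
    then have "word_perm (cword j' m) = word_perm (u @ [i])"
      by (simp add: word_perm_append word_perm_Cons o_assoc[symmetric])
    moreover have "length (cword j' m) < length (u @ [i])"
      using braid_eq_length_set[OF b] j(3) by simp
    ultimately show ?thesis using j'(1) by auto
  qed
qed

lemma word_perm_descending: "J \<le> m \<Longrightarrow> word_perm (rev [J..<m]) J = m"
  by (induction m) (auto simp: word_perm_Cons le_Suc_eq)

text \<open>The canonical word of level \<open>k\<close> fixes \<open>Suc k\<close>, and the last
  run moves \<open>j (Suc k)\<close> there. The code can therefore be read off from the permutation,
  level by level.\<close>

lemma word_perm_cword_last:
  assumes "is_code (Suc k) j"
  shows "word_perm (cword j (Suc k)) (j (Suc k)) = Suc k"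
proof -
  have "word_perm (cword j k) permutes {1..k}"
    using assms by (intro word_perm_permutes set_cword) (simp add: is_code_Suc)
  then have "word_perm (cword j k) (Suc k) = Suc k" by (rule permutes_not_in) simp
  then show ?thesis
    using word_perm_descending[of "j (Suc k)" "Suc k"] assms
    by (simp add: word_perm_append is_code_Suc del: upt_Suc)
qed

lemma word_perm_bij: "bij (word_perm u)"
proof (induction u)
  case (Cons i u)
  then show ?case unfolding word_perm_Cons by (rule bij_comp) (rule bij_transpose)
qed (simp only: word_perm_Nil bij_id)

lemma cword_inj:
  assumes "is_code m j" "is_code m j'" "word_perm (cword j m) = word_perm (cword j' m)"
  shows "cword j m = cword j' m"
  using assms
proof (induction m)
  case (Suc k)
  have "word_perm (cword j (Suc k)) (j (Suc k)) = word_perm (cword j (Suc k)) (j' (Suc k))"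
    using word_perm_cword_last[OF Suc.prems(1)] word_perm_cword_last[OF Suc.prems(2)]
      Suc.prems(3) by simp
  then have eq: "j (Suc k) = j' (Suc k)" using word_perm_bij by (metis bij_pointE)
  let ?d = "word_perm (rev [j (Suc k)..<Suc k])"
  have "word_perm (cword j k) \<circ> ?d = word_perm (cword j' k) \<circ> ?d"
    using Suc.prems(3) unfolding cword.simps word_perm_append eq .
  then have "word_perm (cword j k) = word_perm (cword j' k)"
    using word_perm_bij by (metis bij_is_surj surj_fun_eq)
  then show ?case using Suc eq by (simp add: is_code_Suc)
qed simp

lemma cword_surj:
  assumes "w permutes {1..m}"
  shows "\<exists>j. is_code m j \<and> word_perm (cword j m) = w"
  using assms
proof (induction m arbitrary: w)
  case 0
  then show ?case by (auto simp: is_code_def)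
next
  case (Suc k)
  obtain J where J: "J \<in> {1..Suc k}" "w J = Suc k"
    using permutes_image[OF Suc.prems] by (metis atLeastAtMost_iff imageE le_add1 order_refl plus_1_eq_Suc)
  let ?d = "word_perm (rev [J..<Suc k])"
  have d: "?d permutes {1..Suc k}" using J by (intro word_perm_permutes) auto
  \<comment> \<open>Splitting off the run that moves \<open>J\<close> to \<open>Suc k\<close> leaves
    a permutation that fixes \<open>Suc k\<close>.\<close>
  let ?w = "w \<circ> inv_into UNIV ?d"
  have "?w permutes {1..Suc k}"
    using permutes_compose[OF permutes_inv[OF d] Suc.prems] .
  moreover have "?w (Suc k) = Suc k"
    using word_perm_descending[of J "Suc k"] J d
    by (metis atLeastAtMost_iff comp_apply permutes_inverses(2))
  ultimately have "?w permutes {1..k}"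
    by (auto simp: permutes_def atLeastAtMostSuc_conv) (metis le_SucE)+
  then obtain j where j: "is_code k j" "word_perm (cword j k) = ?w" using Suc.IH by blast
  define j' where "j' = j(Suc k := J)"
  have "cword j' (Suc k) = cword j k @ rev [J..<Suc k]"
    by (auto simp: j'_def intro: cword_cong)
  then have "word_perm (cword j' (Suc k)) = ?w \<circ> ?d" by (simp only: word_perm_append j)
  also have "\<dots> = w" using permutes_inv_o(2)[OF d] by (simp add: o_assoc[symmetric])
  finally have "word_perm (cword j' (Suc k)) = w" .
  moreover have "is_code (Suc k) j'" using j(1) J by (auto simp: is_code_def j'_def)
  ultimately show ?case by blast
qed

lemma reduced_expr_exists:
  assumes "w permutes {1..n}"
  shows "\<exists>u. reduced_expr n w u"
proof -
  obtain j where j: "is_code n j" "word_perm (cword j n) = w" using cword_surj[OF assms] by blast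
  let ?P = "\<lambda>u. set u \<subseteq> {1..<n} \<and> word_perm u = w"
  have "?P (cword j n)" using j set_cword by blast
  then obtain u where "?P u" "\<forall>v. ?P v \<longrightarrow> length u \<le> length v"
    using ex_has_least_nat[of ?P "cword j n" length] by blast
  then show ?thesis by (auto simp: reduced_expr_def)
qed

text \<open>A reduced word is not longer than the canonical word of its permutation, so the case of
  equal lengths in \<open>cword_of_word\<close> applies. This makes the choice of a reduced
  expression in \<open>ak_T\<close> immaterial.\<close>

lemma reduced_expr_braid_eq_cword:
  assumes "reduced_expr n w u"
  shows "\<exists>j. is_code n j \<and> word_perm (cword j n) = w \<and> braid_eq u (cword j n)"
proof -
  obtain j where j: "is_code n j" "word_perm (cword j n) = word_perm u"
     "length (cword j n) \<le> length u" "length (cword j n) = length u \<longrightarrow> braid_eq u (cword j n)"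
    using cword_of_word[of u n] assms by (auto simp: reduced_expr_def)
  moreover have "length u \<le> length (cword j n)"
    using assms j set_cword by (auto simp: reduced_expr_def)
  ultimately show ?thesis using assms by (auto simp: reduced_expr_def)
qed

section \<open>The spanning set of monomials\<close>

text \<open>The relations in a ring given as a type, with the scalars entering through a central
  homomorphism. The product of all quotients of the free algebra is the instance used below.\<close>

locale ak_ring =
  fixes l n :: nat and q :: "'k::field" and Q :: "nat \<Rightarrow> 'k"
    and \<eta> :: "'k \<Rightarrow> 'r::ring_1" and T :: "nat \<Rightarrow> 'r"
  assumes l: "1 \<le> l" and q0: "q \<noteq> 0"
    and eta_add: "\<eta> (a + b) = \<eta> a + \<eta> b"
    and eta_mult: "\<eta> (a * b) = \<eta> a * \<eta> b"
    and eta_one: "\<eta> 1 = 1"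
    and eta_central: "\<eta> a * x = x * \<eta> a"
    and cyclotomic: "(\<Prod>s\<leftarrow>[0..<l]. T 0 - \<eta> (Q s)) = 0"
    and quadratic: "1 \<le> i \<Longrightarrow> i < n \<Longrightarrow> T i * T i = \<eta> (q - 1) * T i + \<eta> q"
    and braid0: "2 \<le> n \<Longrightarrow> T 0 * T 1 * T 0 * T 1 = T 1 * T 0 * T 1 * T 0"
    and braid: "1 \<le> i \<Longrightarrow> i + 1 < n \<Longrightarrow> T i * T (i + 1) * T i = T (i + 1) * T i * T (i + 1)"
    and far_commute: "i + 1 < j \<Longrightarrow> j < n \<Longrightarrow> T i * T j = T j * T i"
begin

lemma eta_zero: "\<eta> 0 = 0" using eta_add[of 0 0] by simp
lemma eta_minus: "\<eta> (- a) = - \<eta> a" using eta_add[of a "- a"] eta_zero by (simp add: add_eq_0_iff)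
lemma eta_diff: "\<eta> (a - b) = \<eta> a - \<eta> b" using eta_add[of a "- b"] eta_minus by simp
lemma eta_left_commute: "x * (\<eta> a * y) = \<eta> a * (x * y)"
  by (metis eta_central mult.assoc)

section \<open>The elements \<open>L k\<close> and their commutation with the generators\<close>

definition wordT :: "nat list \<Rightarrow> 'r" where "wordT u = (\<Prod>i\<leftarrow>u. T i)"

lemma wordT_simps [simp]:
  "wordT [] = 1" "wordT (i # u) = T i * wordT u" "wordT (u @ v) = wordT u * wordT v"
  by (auto simp: wordT_def)

definition L :: "nat \<Rightarrow> 'r" where
  "L k = \<eta> (q powi (1 - int k)) * wordT (rev [1..<k] @ [0] @ [1..<k])"

lemmas T_eta = eta_left_commute[of "T i" for i] and L_eta = eta_left_commute[of "L k" for k]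
  and wordT_eta = eta_left_commute[of "wordT u" for u]
  and Lpow_eta = eta_left_commute[of "L k ^ m" for k m]

lemma L_1: "L (Suc 0) = T 0" by (simp add: L_def eta_one)

lemma L_Suc:
  assumes "1 \<le> k"
  shows "L (Suc k) = \<eta> (inverse q) * (T k * L k * T k)"
proof -
  have "q powi (1 - int (Suc k)) = inverse q * q powi (1 - int k)"
  proof -
    have "1 - int (Suc k) = -1 + (1 - int k)" by simp
    then have "q powi (1 - int (Suc k)) = q powi (-1) * q powi (1 - int k)"
      using q0 power_int_add[of q "-1" "1 - int k"] by metis
    then show ?thesis by simp
  qed
  then show ?thesis using assms by (simp add: L_def eta_mult mult.assoc T_eta L_eta wordT_eta Lpow_eta)
qed

lemma qL: "1 \<le> k \<Longrightarrow> \<eta> q * L (Suc k) = T k * L k * T k"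
  using q0 by (simp add: L_Suc mult.assoc[symmetric] eta_mult[symmetric] eta_one)

lemma far_commute': "i + 1 < j \<or> j + 1 < i \<Longrightarrow> i < n \<Longrightarrow> j < n \<Longrightarrow> T i * T j = T j * T i"
  using far_commute[of i j] far_commute[of j i] by auto

text \<open>Induction through \<open>L_{m+1} = q^{-1} T_m L_m T_m\<close>. The critical case is
  \<open>m = j + 1\<close>, where \<open>L_m = q^{-1} T_j L_j T_j\<close>: a braid move on the left,
  commutation of \<open>T_m\<close> with \<open>L_j\<close>, and a braid move on the right carry
  \<open>T_j\<close> across.\<close>

lemma T_L_commute:
  assumes "1 \<le> k" "k \<le> n" "1 \<le> j" "j < n" "j \<noteq> k" "Suc j \<noteq> k"
  shows "T j * L k = L k * T j"
  using assms
proof (induction k arbitrary: j rule: less_induct)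
  case (less k)
  show ?case
  proof (cases "k = 1")
    case True
    then show ?thesis using less.prems far_commute[of 0 j] by (simp add: L_1)
  next
    case False
    then obtain m where m: "k = Suc m" "1 \<le> m" using less.prems by (cases k) auto
    show ?thesis
    proof (cases "Suc j = m")
      case False
      have c: "T j * T m = T m * T j" using less.prems m False by (intro far_commute') auto
      have cL: "T j * L m = L m * T j" using less.prems m False by (intro less.IH) auto
      have "T j * (T m * L m * T m) = T m * (T j * L m) * T m"
        using c by (simp add: mult.assoc[symmetric])
      also have "\<dots> = T m * L m * (T j * T m)" using cL by (simp add: mult.assoc)
      finally have "T j * (T m * L m * T m) = (T m * L m * T m) * T j"
        using c by (simp add: mult.assoc)
      then show ?thesis using m by (simp add: L_Suc T_eta L_eta wordT_eta Lpow_eta mult.assoc)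
    next
      case True
      have br: "T j * T m * T j = T m * T j * T m"
        using braid[of j] True less.prems m by simp
      have cL: "T m * L j = L j * T m" using less.prems m True by (intro less.IH) auto
      have Lm: "L m = \<eta> (inverse q) * (T j * L j * T j)"
        using L_Suc[of j] True less.prems by simp
      have "T j * (T m * (T j * L j * T j) * T m) = (T j * T m * T j) * L j * (T j * T m)"
        by (simp add: mult.assoc)
      also have "\<dots> = T m * T j * (T m * L j) * (T j * T m)" unfolding br by (simp add: mult.assoc)
      also have "\<dots> = T m * T j * L j * (T m * T j * T m)" unfolding cL by (simp add: mult.assoc)
      also have "\<dots> = (T m * (T j * L j * T j) * T m) * T j" unfolding br[symmetric] by (simp add: mult.assoc)
      finally have "T j * (T m * (T j * L j * T j) * T m) = (T m * (T j * L j * T j) * T m) * T j" .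
      then have "T j * (T m * L m * T m) = (T m * L m * T m) * T j"
        unfolding Lm by (simp add: mult.assoc T_eta L_eta wordT_eta Lpow_eta)
      then show ?thesis using m by (simp add: L_Suc T_eta L_eta wordT_eta Lpow_eta mult.assoc)
    qed
  qed
qed

lemma T0_L_commute:
  assumes "1 \<le> k" "k \<le> n"
  shows "T 0 * L k = L k * T 0"
proof -
  from assms(1) show ?thesis using assms(2)
  proof (induction k rule: nat_induct_at_least)
    case base
    then show ?case by (simp add: L_1)
  next
    case (Suc m)
    have "T 0 * (T m * L m * T m) = (T m * L m * T m) * T 0"
    proof (cases "m = 1")
      case True
      \<comment> \<open>Here \<open>L_2\<close> is a multiple of \<open>T_1 T_0 T_1\<close>, and the
        claim is the relation of length four.\<close>
      then show ?thesis using braid0 Suc.prems by (simp add: L_1 mult.assoc)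
    next
      case False
      then have c: "T 0 * T m = T m * T 0" using Suc by (intro far_commute) auto
      have cL: "T 0 * L m = L m * T 0" using Suc by auto
      have "T 0 * (T m * L m * T m) = T m * (T 0 * L m) * T m"
        using c by (simp add: mult.assoc[symmetric])
      also have "\<dots> = T m * L m * (T 0 * T m)" using cL by (simp add: mult.assoc)
      finally show ?thesis using c by (simp add: mult.assoc)
    qed
    then show ?case using Suc by (simp add: L_Suc T_eta L_eta wordT_eta Lpow_eta mult.assoc)
  qed
qed

lemma wordT_commute: "(\<And>i. i \<in> set u \<Longrightarrow> T i * x = x * T i) \<Longrightarrow> wordT u * x = x * wordT u"
proof (induction u)
  case (Cons i u)
  then have "wordT u * x = x * wordT u" "T i * x = x * T i" by auto
  then show ?case by (metis mult.assoc wordT_simps(2))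
qed simp

text \<open>For \<open>j < k\<close> every letter of the word defining \<open>L j\<close> commutes
  with \<open>L k\<close>.\<close>

lemma L_commute:
  assumes "1 \<le> j" "1 \<le> k" "j \<le> n" "k \<le> n"
  shows "L j * L k = L k * L j"
proof -
  have *: "L j * L k = L k * L j" if "1 \<le> j" "j < k" "k \<le> n" for j k
  proof -
    have "T i * L k = L k * T i" if "i \<in> set (rev [1..<j] @ [0] @ [1..<j])" for i
      using that T0_L_commute[of k] T_L_commute[of k i] \<open>1 \<le> j\<close> \<open>j < k\<close> \<open>k \<le> n\<close> by (cases "i = 0") auto
    then have "wordT (rev [1..<j] @ [0] @ [1..<j]) * L k = L k * wordT (rev [1..<j] @ [0] @ [1..<j])"
      by (rule wordT_commute)
    then show ?thesis
      unfolding L_def[of j] mult.assoc eta_left_commute[of "L k"] by simp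
  qed
  from *[of j k] *[of k j] assms show ?thesis by (cases j k rule: linorder_cases) auto
qed

text \<open>\<open>T_i L_i T_i T_i\<close> is evaluated once as \<open>q L_{i+1} T_i\<close> and
  once by the quadratic relation; \<open>T_L2\<close> does the same with the square on the
  left.\<close>

lemma T_L1:
  assumes "1 \<le> i" "i < n"
  shows "T i * L i = L (Suc i) * T i - \<eta> (q - 1) * L (Suc i)"
proof -
  have "\<eta> q * (L (Suc i) * T i) = T i * L i * (T i * T i)"
    using qL[of i] assms by (simp add: mult.assoc[symmetric])
  also have "\<dots> = \<eta> (q - 1) * (T i * L i * T i) + \<eta> q * (T i * L i)"
    using assms by (simp add: quadratic distrib_left mult.assoc T_eta L_eta wordT_eta Lpow_eta eta_central[of q])
  also have "\<dots> = \<eta> q * (\<eta> (q - 1) * L (Suc i) + T i * L i)"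
    using qL[of i] assms by (metis distrib_left eta_left_commute)
  finally have "\<eta> (inverse q) * (\<eta> q * (L (Suc i) * T i)) =
    \<eta> (inverse q) * (\<eta> q * (\<eta> (q - 1) * L (Suc i) + T i * L i))" by simp
  then show ?thesis
    using q0 by (simp add: mult.assoc[symmetric] eta_mult[symmetric] eta_one)
qed

lemma T_L2:
  assumes "1 \<le> i" "i < n"
  shows "T i * L (Suc i) = L i * T i + \<eta> (q - 1) * L (Suc i)"
proof -
  have "\<eta> q * (T i * L (Suc i)) = (T i * T i) * L i * T i"
    using qL[of i] assms by (metis mult.assoc eta_left_commute)
  also have "\<dots> = \<eta> (q - 1) * (T i * L i * T i) + \<eta> q * (L i * T i)"
    using assms by (simp add: quadratic distrib_right mult.assoc)
  also have "\<dots> = \<eta> q * (L i * T i + \<eta> (q - 1) * L (Suc i))"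
    using qL[of i] assms by (metis distrib_left eta_left_commute add.commute)
  finally have "\<eta> (inverse q) * (\<eta> q * (T i * L (Suc i))) =
    \<eta> (inverse q) * (\<eta> q * (L i * T i + \<eta> (q - 1) * L (Suc i)))" by simp
  then show ?thesis
    using q0 by (simp add: mult.assoc[symmetric] eta_mult[symmetric] eta_one)
qed

lemma wordT_braid_eq: "braid_eq u v \<Longrightarrow> set u \<subseteq> {1..<n} \<Longrightarrow> wordT u = wordT v"
proof (induction rule: braid_eq.induct)
  case (be_sym u v)
  then show ?case using braid_eq_length_set by metis
next
  case (be_trans u v w)
  then show ?case using braid_eq_length_set by metis
next
  case (be_comm i j u v)
  then have "T i * T j = T j * T i" by (intro far_commute) auto
  then have "T i * (T j * x) = T j * (T i * x)" for x by (metis mult.assoc)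
  then show ?case by simp
next
  case (be_braid u i v)
  then have "T i * T (Suc i) * T i = T (Suc i) * T i * T (Suc i)"
    using ak_ring.braid[OF ak_ring_axioms, of i] by simp
  then have "T i * (T (Suc i) * (T i * x)) = T (Suc i) * (T i * (T (Suc i) * x))" for x
    by (metis mult.assoc)
  then show ?case by simp
qed simp

text \<open>Combinations with coefficients from a subset \<open>A\<close> of the field. With
  \<open>A\<close> the whole field this expresses spanning; with \<open>A\<close> the power series
  among the Laurent series it yields the integrality of the generic trace on words.\<close>

inductive_set aspan :: "'k set \<Rightarrow> 'r set \<Rightarrow> 'r set" for A :: "'k set" and B :: "'r set" where
  zero: "0 \<in> aspan A B"
| step: "a \<in> A \<Longrightarrow> b \<in> B \<Longrightarrow> x \<in> aspan A B \<Longrightarrow> \<eta> a * b + x \<in> aspan A B"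

lemma aspan_add: "x \<in> aspan A B \<Longrightarrow> y \<in> aspan A B \<Longrightarrow> x + y \<in> aspan A B"
  by (induction rule: aspan.induct) (auto simp: add.assoc intro: aspan.step)

lemma aspan_scale:
  "x \<in> aspan A B \<Longrightarrow> (\<And>b. b \<in> A \<Longrightarrow> a * b \<in> A) \<Longrightarrow> \<eta> a * x \<in> aspan A B"
proof (induction rule: aspan.induct)
  case (step b y x)
  have "\<eta> a * (\<eta> b * y + x) = \<eta> (a * b) * y + \<eta> a * x"
    by (simp add: distrib_left eta_mult mult.assoc)
  then show ?case using step by (auto intro!: aspan.step)
qed (auto intro: aspan.zero)

lemma aspan_base: "b \<in> B \<Longrightarrow> 1 \<in> A \<Longrightarrow> b \<in> aspan A B"
  using aspan.step[of 1 A b B 0] aspan.zero by (simp add: eta_one)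

lemma aspan_base_scale: "b \<in> B \<Longrightarrow> a \<in> A \<Longrightarrow> \<eta> a * b \<in> aspan A B"
  using aspan.step[of a A b B 0] aspan.zero by simp

lemma aspan_sandwich:
  assumes "x \<in> aspan A B" "\<And>b. b \<in> B \<Longrightarrow> u * b * v \<in> aspan A C" "\<And>a b. a \<in> A \<Longrightarrow> b \<in> A \<Longrightarrow> a * b \<in> A"
  shows "u * x * v \<in> aspan A C"
  using assms(1)
proof (induction rule: aspan.induct)
  case (step a b x)
  have "u * (\<eta> a * b + x) * v = \<eta> a * (u * b * v) + u * x * v"
    by (simp add: distrib_left distrib_right mult.assoc eta_left_commute[of u])
  then show ?case using step assms by (auto intro!: aspan_add aspan_scale)
qed (auto intro: aspan.zero)

lemma aspan_sandwich_left:
  assumes "x \<in> aspan A B" "\<And>b. b \<in> B \<Longrightarrow> u * b \<in> aspan A C" "\<And>a b. a \<in> A \<Longrightarrow> b \<in> A \<Longrightarrow> a * b \<in> A"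
  shows "u * x \<in> aspan A C"
  using aspan_sandwich[of x A B u 1 C] assms by simp

lemma aspan_sandwich_right:
  assumes "x \<in> aspan A B" "\<And>b. b \<in> B \<Longrightarrow> b * u \<in> aspan A C" "\<And>a b. a \<in> A \<Longrightarrow> b \<in> A \<Longrightarrow> a * b \<in> A"
  shows "x * u \<in> aspan A C"
  using aspan_sandwich[of x A B 1 u C] assms by simp

section \<open>Monomials in the \<open>L k\<close> and the passage of generators through
  them\<close>

definition Lmon :: "(nat \<Rightarrow> nat) \<Rightarrow> 'r" where
  "Lmon c = (\<Prod>k\<leftarrow>[1..<n + 1]. L k ^ c k)"

definition basis_elts :: "'r set" where
  "basis_elts = {Lmon c * wordT (cword j n) | c j. (\<forall>k\<in>{1..n}. c k < l) \<and> is_code n j}"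

text \<open>A letter that shortens the canonical word produces a square, and the quadratic relation
  brings in the coefficients \<open>q - 1\<close> and \<open>q\<close>.\<close>

lemma wordT_in_aspan:
  assumes A: "1 \<in> A" "q \<in> A" "\<And>a b. a \<in> A \<Longrightarrow> b \<in> A \<Longrightarrow> a - b \<in> A" "\<And>a b. a \<in> A \<Longrightarrow> b \<in> A \<Longrightarrow> a * b \<in> A"
    and u: "set u \<subseteq> {1..<n}"
  shows "wordT u \<in> aspan A {wordT (cword j n) | j. is_code n j}" (is "_ \<in> aspan A ?B")
  using u
proof (induction u rule: rev_induct)
  case Nil
  have "wordT (cword (\<lambda>k. k) n) \<in> ?B" using cword_self by blast
  then show ?case using A cword_self by (simp add: aspan_base)
next
  case (snoc i u)
  have "wordT (cword j n) * T i \<in> aspan A ?B" if j: "is_code n j" for j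
  proof -
    obtain j' where j': "is_code n j'"
      "braid_eq (cword j n @ [i]) (cword j' n) \<or> braid_eq (cword j n) (cword j' n @ [i])"
      using cword_mult_letter[OF j, of i] snoc.prems by auto
    have B: "wordT (cword j' n) \<in> ?B" "wordT (cword j n) \<in> ?B" using j' j by auto
    from j'(2) show ?thesis
    proof
      assume "braid_eq (cword j n @ [i]) (cword j' n)"
      then have "wordT (cword j n @ [i]) = wordT (cword j' n)"
        using set_cword[OF j] snoc.prems by (intro wordT_braid_eq) auto
      then show ?thesis using aspan_base[OF B(1) A(1)] by simp
    next
      assume "braid_eq (cword j n) (cword j' n @ [i])"
      then have e: "wordT (cword j n) = wordT (cword j' n @ [i])"
        using set_cword[OF j] by (intro wordT_braid_eq) auto
      have "wordT (cword j n) * T i = wordT (cword j' n) * (T i * T i)"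
        by (simp add: e mult.assoc)
      also have "\<dots> = \<eta> (q - 1) * wordT (cword j n) + \<eta> q * wordT (cword j' n)"
        using snoc.prems by (simp add: quadratic e distrib_left T_eta L_eta wordT_eta Lpow_eta eta_central[of q])
      finally show ?thesis using A B by (auto intro!: aspan_add aspan_base_scale)
    qed
  qed
  then have "wordT u * T i \<in> aspan A ?B"
    using snoc.prems by (intro aspan_sandwich_right[OF snoc.IH _ A(4)]) auto
  then show ?case by simp
qed

lemma commute_pow: "x * y = y * x \<Longrightarrow> x * y ^ k = y ^ k * x" for x y :: 'r
  by (metis power_commuting_commutes)

lemma L_pow_commute:
  "1 \<le> j \<Longrightarrow> 1 \<le> k \<Longrightarrow> j \<le> n \<Longrightarrow> k \<le> n \<Longrightarrow> L j ^ a * L k ^ b = L k ^ b * L j ^ a"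
  using L_commute by (metis commute_pow)

text \<open>Both exponents obey the same bound, and this bound survives the passage of
  \<open>T i\<close>; it is what keeps exponents below \<open>l\<close>.\<close>

definition box :: "nat \<Rightarrow> nat \<Rightarrow> 'r set" where
  "box i m = {L i ^ a * L (Suc i) ^ b | a b. a \<le> m \<and> b \<le> m}"

lemma box_mult:
  assumes i: "1 \<le> i" "i < n" and A: "\<And>a b. a \<in> A \<Longrightarrow> b \<in> A \<Longrightarrow> a * b \<in> A" "1 \<in> A"
    and x: "x \<in> aspan A (box i m)"
  shows "x * L i \<in> aspan A (box i (Suc m))" "x * L (Suc i) \<in> aspan A (box i (Suc m))"
proof -
  have c: "L (Suc i) ^ b * L i = L i * L (Suc i) ^ b" for b
    using L_pow_commute[of "Suc i" i b 1] i by simp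
  show "x * L i \<in> aspan A (box i (Suc m))"
  proof (rule aspan_sandwich_right[OF x _ A(1)])
    fix y assume "y \<in> box i m"
    then obtain a b where y: "y = L i ^ a * L (Suc i) ^ b" "a \<le> m" "b \<le> m" by (auto simp: box_def)
    have "y * L i = L i ^ Suc a * L (Suc i) ^ b" by (simp add: y mult.assoc c power_commutes)
        (simp add: mult.assoc[symmetric] power_commutes)
    then have "y * L i \<in> box i (Suc m)" using y(2,3) unfolding box_def
      by (intro CollectI exI[of _ "Suc a"] exI[of _ b]) simp
    then show "y * L i \<in> aspan A (box i (Suc m))" using A by (simp add: aspan_base)
  qed
  show "x * L (Suc i) \<in> aspan A (box i (Suc m))"
  proof (rule aspan_sandwich_right[OF x _ A(1)])
    fix y assume "y \<in> box i m"
    then obtain a b where y: "y = L i ^ a * L (Suc i) ^ b" "a \<le> m" "b \<le> m" by (auto simp: box_def)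
    have "y * L (Suc i) = L i ^ a * L (Suc i) ^ Suc b"
      by (simp only: y mult.assoc power_Suc2)
    then have "y * L (Suc i) \<in> box i (Suc m)" using y(2,3) unfolding box_def
      by (intro CollectI exI[of _ a] exI[of _ "Suc b"]) simp
    then show "y * L (Suc i) \<in> aspan A (box i (Suc m))" using A by (simp add: aspan_base)
  qed
qed

lemma aspan_mono: "x \<in> aspan A B \<Longrightarrow> B \<subseteq> C \<Longrightarrow> x \<in> aspan A C"
  by (induction rule: aspan.induct) (auto intro: aspan.intros)

text \<open>Up to terms in the box, \<open>T_i\<close> exchanges the two exponents. Since
  \<open>L_i L_{i+1}\<close> commutes with \<open>T_i\<close>, common powers can be split off until
  a power of only one of the two is left, and there \<open>T_L1\<close> or \<open>T_L2\<close> is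
  applied repeatedly.\<close>

lemma T_L_pow:
  assumes i: "1 \<le> i" "i < n" and ab: "a \<le> m" "b \<le> m"
    and A: "1 \<in> A" "q \<in> A" "\<And>a b. a \<in> A \<Longrightarrow> b \<in> A \<Longrightarrow> a - b \<in> A" "\<And>a b. a \<in> A \<Longrightarrow> b \<in> A \<Longrightarrow> a * b \<in> A"
  shows "\<exists>r\<in>aspan A (box i m). T i * (L i ^ a * L (Suc i) ^ b) = L i ^ b * L (Suc i) ^ a * T i + r"
proof -
  have A': "q - 1 \<in> A" "- (q - 1) \<in> A" using A(3)[of q 1] A(3)[of 1 q] A by auto
  have c: "L (Suc i) ^ b * L i = L i * L (Suc i) ^ b" "L i ^ b * L (Suc i) = L (Suc i) * L i ^ b" for b
    using L_pow_commute[of "Suc i" i b 1] L_pow_commute[of i "Suc i" b 1] i by simp_all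
  have mono: "x \<in> aspan A (box i m)" if "x \<in> aspan A (box i m')" "m' \<le> m" for x m m'
    using that(2) by (intro aspan_mono[OF that(1)]) (force simp: box_def)
  have left: "\<exists>r\<in>aspan A (box i a). T i * L i ^ a = L (Suc i) ^ a * T i + r" for a
  proof (induction a)
    case (Suc a)
    then obtain r where r: "r \<in> aspan A (box i a)" "T i * L i ^ a = L (Suc i) ^ a * T i + r" by blast
    have "T i * L i ^ Suc a = T i * L i ^ a * L i" by (simp only: power_Suc2 mult.assoc)
    also have "\<dots> = L (Suc i) ^ a * (T i * L i) + r * L i" by (simp add: r distrib_right mult.assoc)
    also have "\<dots> = L (Suc i) ^ Suc a * T i + (\<eta> (- (q - 1)) * L (Suc i) ^ Suc a + r * L i)"
      by (simp only: T_L1[OF i] power_Suc2 eta_minus)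
         (simp add: right_diff_distrib mult.assoc T_eta L_eta wordT_eta Lpow_eta)
    finally have "T i * L i ^ Suc a = \<dots>" .
    moreover have "L (Suc i) ^ Suc a \<in> box i (Suc a)" unfolding box_def
      by (rule CollectI, rule exI[of _ 0], rule exI[of _ "Suc a"]) simp
    ultimately show ?case using box_mult(1)[OF i A(4,1) r(1)] A'
      by (intro bexI[of _ "\<eta> (- (q - 1)) * L (Suc i) ^ Suc a + r * L i"])
         (auto intro!: aspan_add aspan_base_scale)
  qed (auto intro: bexI[of _ 0] aspan.zero)
  have right: "\<exists>r\<in>aspan A (box i a). T i * L (Suc i) ^ a = L i ^ a * T i + r" for a
  proof (induction a)
    case (Suc a)
    then obtain r where r: "r \<in> aspan A (box i a)" "T i * L (Suc i) ^ a = L i ^ a * T i + r" by blast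
    have "T i * L (Suc i) ^ Suc a = T i * L (Suc i) ^ a * L (Suc i)"
      by (simp only: power_Suc2 mult.assoc)
    also have "\<dots> = L i ^ a * (T i * L (Suc i)) + r * L (Suc i)"
      by (simp add: r distrib_right mult.assoc)
    also have "\<dots> = L i ^ Suc a * T i + (\<eta> (q - 1) * (L i ^ a * L (Suc i)) + r * L (Suc i))"
      by (simp only: T_L2[OF i] power_Suc2)
         (simp add: distrib_left mult.assoc T_eta L_eta wordT_eta Lpow_eta)
    finally have "T i * L (Suc i) ^ Suc a = \<dots>" .
    moreover have "L i ^ a * L (Suc i) \<in> box i (Suc a)" unfolding box_def
      by (rule CollectI, rule exI[of _ a], rule exI[of _ 1]) simp
    ultimately show ?case using box_mult(2)[OF i A(4,1) r(1)] A'
      by (intro bexI[of _ "\<eta> (q - 1) * (L i ^ a * L (Suc i)) + r * L (Suc i)"])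
         (auto intro!: aspan_add aspan_base_scale)
  qed (auto intro: bexI[of _ 0] aspan.zero)
  have "\<exists>r\<in>aspan A (box i (max a b)). T i * (L i ^ a * L (Suc i) ^ b) = L i ^ b * L (Suc i) ^ a * T i + r"
  proof (induction a arbitrary: b)
    case 0
    then show ?case using right[of b] by simp
  next
    case (Suc a)
    show ?case
    proof (cases b)
      case 0
      then show ?thesis using left[of "Suc a"] by simp
    next
      case b: (Suc b')
      obtain r where r: "r \<in> aspan A (box i (max a b'))"
        "T i * (L i ^ a * L (Suc i) ^ b') = L i ^ b' * L (Suc i) ^ a * T i + r" using Suc by blast
      let ?Z = "L i * L (Suc i)"
      have TZ: "T i * ?Z = ?Z * T i"
      proof -
        have "T i * ?Z = L (Suc i) * (T i * L (Suc i)) - \<eta> (q - 1) * (L (Suc i) * L (Suc i))"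
          by (simp add: mult.assoc[symmetric] T_L1[OF i] left_diff_distrib)
        also have "\<dots> = L (Suc i) * L i * T i"
          by (simp add: T_L2[OF i] distrib_left T_eta L_eta wordT_eta Lpow_eta mult.assoc)
        finally show ?thesis using c(1)[of 1] by simp
      qed
      have Zp: "L i ^ Suc a * L (Suc i) ^ Suc b = ?Z * (L i ^ a * L (Suc i) ^ b)" for a b
      proof -
        have "L i ^ Suc a * L (Suc i) ^ Suc b = L i * (L i ^ a * L (Suc i)) * L (Suc i) ^ b"
          by (simp add: mult.assoc)
        then show ?thesis by (simp only: c mult.assoc)
      qed
      have "T i * (L i ^ Suc a * L (Suc i) ^ b) = ?Z * (T i * (L i ^ a * L (Suc i) ^ b'))"
        unfolding b Zp by (metis TZ mult.assoc)
      also have "\<dots> = ?Z * (L i ^ b' * L (Suc i) ^ a) * T i + ?Z * r"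
        unfolding r by (simp add: distrib_left mult.assoc)
      also have "\<dots> = L i ^ b * L (Suc i) ^ Suc a * T i + ?Z * r" unfolding b Zp ..
      finally have eq: "T i * (L i ^ Suc a * L (Suc i) ^ b) = \<dots>" .
      have "?Z * r \<in> aspan A (box i (max (Suc a) b))"
      proof (rule aspan_sandwich_left[OF r(1) _ A(4)])
        fix y assume "y \<in> box i (max a b')"
        then obtain a1 b1 where y: "y = L i ^ a1 * L (Suc i) ^ b1" "a1 \<le> max a b'" "b1 \<le> max a b'"
          by (auto simp: box_def)
        have "?Z * y = L i ^ Suc a1 * L (Suc i) ^ Suc b1" unfolding y Zp ..
        then have "?Z * y \<in> box i (max (Suc a) b)"
          using y(2,3) b unfolding box_def
          by (intro CollectI exI[of _ "Suc a1"] exI[of _ "Suc b1"]) auto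
        then show "?Z * y \<in> aspan A (box i (max (Suc a) b))" using A by (simp add: aspan_base)
      qed
      with eq show ?thesis by blast
    qed
  qed
  then show ?thesis using mono[of _ "max a b" m] ab by (metis max.bounded_iff)
qed


lemma commute_prod_list:
  "(\<And>k. k \<in> set ks \<Longrightarrow> x * f k = f k * x) \<Longrightarrow> x * (\<Prod>k\<leftarrow>ks. f k) = (\<Prod>k\<leftarrow>ks. f k) * x" for x :: 'r
proof (induction ks)
  case (Cons k ks)
  then have "x * (\<Prod>k\<leftarrow>ks. f k) = (\<Prod>k\<leftarrow>ks. f k) * x" "x * f k = f k * x" by auto
  then show ?case by (simp add: mult.assoc) (metis mult.assoc)
qed simp

lemma prod_list_mult_commuting:
  fixes f g :: "'b \<Rightarrow> 'r"
  assumes "\<And>s t. s \<in> set ts \<Longrightarrow> t \<in> set ts \<Longrightarrow> f s * g t = g t * f s"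
  shows "(\<Prod>t\<leftarrow>ts. f t) * (\<Prod>t\<leftarrow>ts. g t) = (\<Prod>t\<leftarrow>ts. f t * g t)"
  using assms
proof (induction ts)
  case (Cons t ts)
  have "(\<Prod>t\<leftarrow>ts. f t) * g t = g t * (\<Prod>t\<leftarrow>ts. f t)"
    using commute_prod_list[of ts "g t" f] Cons.prems by simp
  then have "f t * (\<Prod>t\<leftarrow>ts. f t) * (g t * (\<Prod>t\<leftarrow>ts. g t)) = f t * g t * ((\<Prod>t\<leftarrow>ts. f t) * (\<Prod>t\<leftarrow>ts. g t))"
    by (metis mult.assoc)
  then show ?case using Cons by simp
qed simp

text \<open>One family of coefficients serves all \<open>x\<close>. The leading coefficient 1 lets
  \<open>T 0 ^ l\<close> be eliminated, and the constant coefficient later determines the value of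
  the symmetrizing form on an eigenvector.\<close>

lemma prod_linear_expand:
  assumes A: "0 \<in> A" "1 \<in> A" "\<And>a b. a \<in> A \<Longrightarrow> b \<in> A \<Longrightarrow> a - b \<in> A" "\<And>a b. a \<in> A \<Longrightarrow> b \<in> A \<Longrightarrow> a * b \<in> A"
    and Q: "\<And>t. t \<in> set ts \<Longrightarrow> Q t \<in> A"
  shows "\<exists>g. (\<forall>x. (\<Prod>t\<leftarrow>ts. x - \<eta> (Q t)) = (\<Sum>j\<le>length ts. \<eta> (g j) * x ^ j)) \<and>
    g (length ts) = 1 \<and> (\<forall>j. g j \<in> A) \<and> g 0 = (\<Prod>t\<leftarrow>ts. - Q t)"
  using Q
proof (induction ts)
  case Nil
  then show ?case using A by (intro exI[of _ "\<lambda>j. if j = 0 then 1 else 0"]) (auto simp: eta_one)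
next
  case (Cons t ts)
  then obtain g where g: "\<And>x. (\<Prod>t\<leftarrow>ts. x - \<eta> (Q t)) = (\<Sum>j\<le>length ts. \<eta> (g j) * x ^ j)"
    "g (length ts) = 1" "\<And>j. g j \<in> A" "g 0 = (\<Prod>t\<leftarrow>ts. - Q t)" by auto
  define h where "h j = (if j = 0 then 0 else g (j - 1)) - Q t * (if j \<le> length ts then g j else 0)" for j
  have "(\<Prod>t\<leftarrow>t # ts. x - \<eta> (Q t)) = (\<Sum>j\<le>length (t # ts). \<eta> (h j) * x ^ j)" for x
  proof -
    have "(\<Prod>t\<leftarrow>t # ts. x - \<eta> (Q t)) = (x - \<eta> (Q t)) * (\<Sum>j\<le>length ts. \<eta> (g j) * x ^ j)"
      by (simp add: g(1))
    also have "\<dots> = (\<Sum>j\<le>length ts. \<eta> (g j) * x ^ Suc j) - (\<Sum>j\<le>length ts. \<eta> (Q t * g j) * x ^ j)"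
      by (simp add: left_diff_distrib sum_distrib_left eta_left_commute[of x] eta_mult mult.assoc
          sum_subtractf)
    also have "(\<Sum>j\<le>length ts. \<eta> (g j) * x ^ Suc j) =
        (\<Sum>j\<le>Suc (length ts). \<eta> (if j = 0 then 0 else g (j - 1)) * x ^ j)"
      by (subst sum.atMost_Suc_shift) (simp add: eta_zero)
    also have "(\<Sum>j\<le>length ts. \<eta> (Q t * g j) * x ^ j) =
        (\<Sum>j\<le>Suc (length ts). \<eta> (Q t * (if j \<le> length ts then g j else 0)) * x ^ j)"
      by (simp add: eta_zero)
    finally have "(\<Prod>t\<leftarrow>t # ts. x - \<eta> (Q t)) =
        (\<Sum>j\<le>Suc (length ts). \<eta> (if j = 0 then 0 else g (j - 1)) * x ^ j) -
        (\<Sum>j\<le>Suc (length ts). \<eta> (Q t * (if j \<le> length ts then g j else 0)) * x ^ j)" .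
    also have "\<dots> = (\<Sum>j\<le>Suc (length ts). \<eta> (h j) * x ^ j)"
      unfolding h_def eta_diff left_diff_distrib by (rule sum_subtractf[symmetric])
    finally show ?thesis by (simp only: list.size add_Suc_right add_0_right)
  qed
  moreover have "h (length (t # ts)) = 1" using g by (simp add: h_def)
  moreover have "h j \<in> A" for j using A g Cons.prems by (auto simp: h_def)
  moreover have "h 0 = (\<Prod>t\<leftarrow>t # ts. - Q t)" using g by (simp add: h_def)
  ultimately show ?case by blast
qed

lemma Lmon_split:
  assumes "1 \<le> i" "i < n"
  shows "(\<Prod>k\<leftarrow>[1..<i]. L k ^ c k) * (L i ^ a * L (Suc i) ^ b) * (\<Prod>k\<leftarrow>[i + 2..<n + 1]. L k ^ c k)
    = Lmon (c(i := a, Suc i := b))"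
proof -
  have 1: "[1..<n + 1] = [1..<i] @ [i, Suc i] @ [i + 2..<n + 1]"
  proof -
    have "[1..<n + 1] = [1..<i] @ [i..<n + 1]"
      using assms upt_add_eq_append[of 1 i "n + 1 - i"] by simp
    also have "[i..<n + 1] = i # Suc i # [i + 2..<n + 1]"
      using assms by (simp add: upt_conv_Cons del: upt_Suc)
    finally show ?thesis by simp
  qed
  have 2: "map (\<lambda>k. L k ^ (c(i := a, Suc i := b)) k) [1..<i] = map (\<lambda>k. L k ^ c k) [1..<i]"
    "map (\<lambda>k. L k ^ (c(i := a, Suc i := b)) k) [i + 2..<n + 1] = map (\<lambda>k. L k ^ c k) [i + 2..<n + 1]"
    by (auto simp del: upt_Suc)
  show ?thesis unfolding Lmon_def 1 map_append list.map 2 prod_list.append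
    by (simp add: mult.assoc del: upt_Suc)
qed

text \<open>Monomials followed by arbitrary words. The span of these is stable under left
  multiplication by all generators, while canonical words enter only in the final reduction.\<close>

definition LT_elts :: "'r set" where
  "LT_elts = {Lmon c * wordT u | c u. (\<forall>k\<in>{1..n}. c k < l) \<and> set u \<subseteq> {1..<n}}"

lemma LT_eltsI: "(\<forall>k\<in>{1..n}. c k < l) \<Longrightarrow> set u \<subseteq> {1..<n} \<Longrightarrow> Lmon c * wordT u \<in> LT_elts"
  unfolding LT_elts_def by blast

lemma T_LT_elts:
  assumes i: "1 \<le> i" "i < n"
    and A: "1 \<in> A" "q \<in> A" "\<And>a b. a \<in> A \<Longrightarrow> b \<in> A \<Longrightarrow> a - b \<in> A" "\<And>a b. a \<in> A \<Longrightarrow> b \<in> A \<Longrightarrow> a * b \<in> A"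
    and c: "\<forall>k\<in>{1..n}. c k < l" and u: "set u \<subseteq> {1..<n}"
  shows "T i * (Lmon c * wordT u) \<in> aspan A LT_elts"
proof -
  define P where "P = (\<Prod>k\<leftarrow>[1..<i]. L k ^ c k)"
  define R where "R = (\<Prod>k\<leftarrow>[i + 2..<n + 1]. L k ^ c k)"
  have P: "T i * P = P * T i" unfolding P_def using i
    by (intro commute_prod_list commute_pow T_L_commute) auto
  have R: "T i * R = R * T i" unfolding R_def using i
    by (intro commute_prod_list commute_pow T_L_commute) auto
  have ab: "c i \<le> l - 1" "c (Suc i) \<le> l - 1" using c i
    by (metis Suc_leI Suc_pred' atLeastAtMost_iff diff_Suc_1 l le_SucI less_Suc_eq_le less_imp_le less_le_trans zero_less_one)+
  obtain r where r: "r \<in> aspan A (box i (l - 1))"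
    "T i * (L i ^ c i * L (Suc i) ^ c (Suc i)) = L i ^ c (Suc i) * L (Suc i) ^ c i * T i + r"
    using T_L_pow[OF i ab A] by blast
  have "T i * (Lmon c * wordT u) = T i * (P * (L i ^ c i * L (Suc i) ^ c (Suc i)) * R * wordT u)"
    using Lmon_split[OF i, of c "c i" "c (Suc i)"] by (simp add: P_def R_def)
  also have "\<dots> = P * (T i * (L i ^ c i * L (Suc i) ^ c (Suc i))) * R * wordT u"
    using P by (simp add: mult.assoc[symmetric])
  also have "\<dots> = P * (L i ^ c (Suc i) * L (Suc i) ^ c i) * (T i * R) * wordT u + P * r * (R * wordT u)"
    unfolding r by (simp add: distrib_left distrib_right mult.assoc)
  also have "\<dots> = Lmon (c(i := c (Suc i), Suc i := c i)) * wordT (i # u) + P * r * (R * wordT u)"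
    unfolding R Lmon_split[OF i, symmetric] by (simp add: P_def R_def mult.assoc)
  finally have eq: "T i * (Lmon c * wordT u) = \<dots>" .
  have "Lmon (c(i := c (Suc i), Suc i := c i)) * wordT (i # u) \<in> LT_elts"
    using c u i by (intro LT_eltsI) auto
  moreover have "P * r * (R * wordT u) \<in> aspan A LT_elts"
  proof (rule aspan_sandwich[OF r(1) _ A(4)])
    fix y assume "y \<in> box i (l - 1)"
    then obtain a b where y: "y = L i ^ a * L (Suc i) ^ b" "a \<le> l - 1" "b \<le> l - 1"
      by (auto simp: box_def)
    have "P * y * (R * wordT u) = Lmon (c(i := a, Suc i := b)) * wordT u"
      unfolding y Lmon_split[OF i, symmetric] by (simp add: P_def R_def mult.assoc)
    moreover have "Lmon (c(i := a, Suc i := b)) * wordT u \<in> LT_elts"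
      using c u y l by (intro LT_eltsI) auto
    ultimately show "P * y * (R * wordT u) \<in> aspan A LT_elts" using A(1) by (simp add: aspan_base)
  qed
  ultimately show ?thesis using A(1) by (simp add: eq aspan_add aspan_base)
qed

lemma T0_LT_elts:
  assumes n: "1 \<le> n"
    and A: "0 \<in> A" "1 \<in> A" "\<And>a b. a \<in> A \<Longrightarrow> b \<in> A \<Longrightarrow> a - b \<in> A" "\<And>a b. a \<in> A \<Longrightarrow> b \<in> A \<Longrightarrow> a * b \<in> A"
      "\<And>s. s < l \<Longrightarrow> Q s \<in> A"
    and c: "\<forall>k\<in>{1..n}. c k < l" and u: "set u \<subseteq> {1..<n}"
  shows "T 0 * (Lmon c * wordT u) \<in> aspan A LT_elts"
proof -
  define R where "R = (\<Prod>k\<leftarrow>[2..<n + 1]. L k ^ c k)"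
  have split: "Lmon (c(1 := a)) = T 0 ^ a * R" for a
  proof -
    have 1: "[1..<n + 1] = 1 # [2..<n + 1]" using n by (simp add: upt_conv_Cons numeral_2_eq_2 del: upt_Suc)
    have 2: "map (\<lambda>k. L k ^ (c(1 := a)) k) [2..<n + 1] = map (\<lambda>k. L k ^ c k) [2..<n + 1]"
      by (auto simp del: upt_Suc)
    show ?thesis unfolding Lmon_def R_def 1 list.map 2 by (simp add: L_1 del: upt_Suc)
  qed
  have mem: "Lmon (c(1 := a)) * wordT u \<in> LT_elts" if "a < l" for a
    using that c u by (intro LT_eltsI) auto
  have eq: "T 0 * (Lmon c * wordT u) = T 0 ^ Suc (c 1) * R * wordT u"
    using split[of "c 1"] by (simp add: mult.assoc)
  show ?thesis
  proof (cases "Suc (c 1) < l")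
    case True
    then show ?thesis using mem[of "Suc (c 1)"] A(2) unfolding eq split[symmetric] by (rule_tac aspan_base)
  next
    case False
    then have cl: "Suc (c 1) = l" using c n by force
    \<comment> \<open>The exponent has reached \<open>l\<close>; the expanded cyclotomic relation
      expresses \<open>T 0 ^ l\<close> through lower powers with coefficients in
      \<open>A\<close>.\<close>
    obtain g where g: "\<And>x. (\<Prod>s\<leftarrow>[0..<l]. x - \<eta> (Q s)) = (\<Sum>j\<le>l. \<eta> (g j) * x ^ j)" "g l = 1" "\<And>j. g j \<in> A"
      using prod_linear_expand[of A "[0..<l]", OF A(1-4)] A(5) by auto
    have "(\<Sum>j\<le>l. \<eta> (g j) * T 0 ^ j) = 0" using g(1)[of "T 0"] cyclotomic by simp
    moreover have "(\<Sum>j\<le>l. \<eta> (g j) * T 0 ^ j) = T 0 ^ l + (\<Sum>j<l. \<eta> (g j) * T 0 ^ j)"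
      using g(2) by (simp add: lessThan_Suc_atMost[symmetric] eta_one add.commute)
    ultimately have "T 0 ^ l = - (\<Sum>j<l. \<eta> (g j) * T 0 ^ j)" by (simp add: add_eq_0_iff2)
    then have "T 0 ^ l * R * wordT u = (\<Sum>j<l. \<eta> (0 - g j) * (T 0 ^ j * R * wordT u))"
      by (simp add: sum_distrib_right sum_negf eta_minus mult.assoc)
    also have "\<dots> = (\<Sum>j<l. \<eta> (0 - g j) * (Lmon (c(1 := j)) * wordT u))" by (simp only: split)
    also have "\<dots> \<in> aspan A LT_elts"
    proof -
      have "(\<Sum>j\<in>J. \<eta> (0 - g j) * (Lmon (c(1 := j)) * wordT u)) \<in> aspan A LT_elts"
        if "finite J" "J \<subseteq> {..<l}" for J
        using that
      proof (induction J rule: finite_induct)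
        case (insert j J)
        have "0 - g j \<in> A" using A(3)[OF A(1) g(3)] .
        then have "\<eta> (0 - g j) * (Lmon (c(1 := j)) * wordT u) \<in> aspan A LT_elts"
          using insert.prems by (intro aspan_base_scale mem) auto
        moreover have "(\<Sum>j\<in>J. \<eta> (0 - g j) * (Lmon (c(1 := j)) * wordT u)) \<in> aspan A LT_elts"
          using insert by blast
        ultimately show ?case unfolding sum.insert[OF insert.hyps] by (rule aspan_add)
      qed (simp add: aspan.zero)
      then show ?thesis by simp
    qed
    finally show ?thesis unfolding eq cl .
  qed
qed

text \<open>Letters are absorbed from the left: \<open>T i\<close> passes the monomial with bounded
  exponents and joins the word behind it, and \<open>T 0\<close> only raises the first
  exponent.\<close>

theorem words_in_aspan:
  assumes n: "1 \<le> n"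
    and A: "0 \<in> A" "1 \<in> A" "q \<in> A" "\<And>a b. a \<in> A \<Longrightarrow> b \<in> A \<Longrightarrow> a - b \<in> A"
      "\<And>a b. a \<in> A \<Longrightarrow> b \<in> A \<Longrightarrow> a * b \<in> A" "\<And>s. s < l \<Longrightarrow> Q s \<in> A"
    and u: "set u \<subseteq> {..<n}"
  shows "wordT u \<in> aspan A basis_elts"
proof -
  have "wordT u \<in> aspan A LT_elts"
    using u
  proof (induction u)
    case Nil
    have "(\<Prod>k\<leftarrow>ks. L k ^ 0) = 1" for ks :: "nat list" by (induction ks) auto
    then have "Lmon (\<lambda>_. 0) * wordT [] = 1" unfolding Lmon_def by simp
    moreover have "Lmon (\<lambda>_. 0) * wordT [] \<in> LT_elts" using l by (intro LT_eltsI) auto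
    ultimately show ?case using A(2) by (simp add: aspan_base)
  next
    case (Cons i u)
    have "T i * wordT u \<in> aspan A LT_elts"
    proof (rule aspan_sandwich_left[OF _ _ A(5)])
      show "wordT u \<in> aspan A LT_elts" using Cons by simp
      fix b assume "b \<in> LT_elts"
      then obtain c v where b: "b = Lmon c * wordT v" "\<forall>k\<in>{1..n}. c k < l" "set v \<subseteq> {1..<n}"
        by (auto simp: LT_elts_def)
      show "T i * b \<in> aspan A LT_elts"
      proof (cases "i = 0")
        case True
        then show ?thesis using T0_LT_elts[OF n A(1,2,4,5,6) b(2,3)] b(1) by simp
      next
        case False
        then show ?thesis using T_LT_elts[OF _ _ A(2,3,4,5) b(2,3), of i] b(1) Cons.prems by simp
      qed
    qed
    then show ?case by simp
  qed
  then have "1 * wordT u \<in> aspan A basis_elts"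
  proof (rule aspan_sandwich_left[OF _ _ A(5)])
    fix b assume "b \<in> LT_elts"
    then obtain c v where b: "b = Lmon c * wordT v" "\<forall>k\<in>{1..n}. c k < l" "set v \<subseteq> {1..<n}"
      by (auto simp: LT_elts_def)
    have "Lmon c * wordT v \<in> aspan A basis_elts"
    proof (rule aspan_sandwich_left[OF wordT_in_aspan[OF A(2,3,4,5) b(3)] _ A(5)])
      fix x assume "x \<in> {wordT (cword j n) | j. is_code n j}"
      then have "Lmon c * x \<in> basis_elts" using b(2) by (auto simp: basis_elts_def)
      then show "Lmon c * x \<in> aspan A basis_elts" using A(2) by (simp add: aspan_base)
    qed
    then show "1 * b \<in> aspan A basis_elts" using b by simp
  qed
  then show ?thesis by simp
qed

end

section \<open>Elements spanning one-dimensional modules\<close>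

context ak_ring
begin

text \<open>The sum of all \<open>T_w\<close> over the symmetric group on \<open>{1..m}\<close>,
  factored through the coset representatives that also build the canonical words.\<close>

primrec symmetrizer :: "nat \<Rightarrow> 'r" where
  "symmetrizer 0 = 1"
| "symmetrizer (Suc m) = symmetrizer m * (\<Sum>j=1..Suc m. wordT (rev [j..<Suc m]))"

text \<open>Among the summands for the last run, right multiplication by \<open>T_i\<close> mixes
  only those for \<open>i\<close> and \<open>Suc i\<close>, and their sum is an eigenvector by the
  quadratic relation. Through any other run the letter passes as a generator of the smaller group,
  where the induction hypothesis absorbs it.\<close>

lemma symmetrizer_T:
  assumes "m \<le> n" "1 \<le> i" "i < m"
  shows "symmetrizer m * T i = \<eta> q * symmetrizer m"
  using assms
proof (induction m arbitrary: i)
  case (Suc m)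
  define y where "y j = symmetrizer m * wordT (rev [j..<Suc m])" for j
  have sum: "symmetrizer (Suc m) = (\<Sum>j=1..Suc m. y j)"
    by (simp add: y_def sum_distrib_left del: upt_Suc sum.cl_ivl_Suc)
  have y1: "y (Suc i) * T i = y i"
  proof -
    have "rev [i..<Suc m] = rev [Suc i..<Suc m] @ [i]"
      using Suc.prems rev_upt_split[of i "Suc i" "Suc m"] by (simp del: upt_Suc) (simp add: upt_rec)
    then show ?thesis by (simp add: y_def mult.assoc del: upt_Suc)
  qed
  have y2: "y i * T i = \<eta> (q - 1) * y i + \<eta> q * y (Suc i)"
  proof -
    have "y i * T i = y (Suc i) * (T i * T i)" by (simp add: y1[symmetric] mult.assoc)
    also have "\<dots> = \<eta> (q - 1) * (y (Suc i) * T i) + \<eta> q * y (Suc i)"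
      using Suc.prems by (simp add: quadratic distrib_left eta_left_commute[of "y (Suc i)"] eta_central[of q])
    finally show ?thesis by (simp add: y1)
  qed
  have y3: "y j * T i = \<eta> q * y j" if j: "j \<in> {1..Suc m}" "j \<noteq> i" "j \<noteq> Suc i" for j
  proof -
    obtain i' where i': "1 \<le> i'" "i' < m" "braid_eq (rev [j..<Suc m] @ [i]) (i' # rev [j..<Suc m])"
    proof (cases "i < j")
      case True
      then show ?thesis using that[of i] j Suc.prems braid_eq_commute_letter[of "rev [j..<Suc m]" i]
        by (auto simp del: upt_Suc)
    next
      case False
      then show ?thesis using that[of "i - 1"] j Suc.prems braid_eq_descending[of j i "Suc m"]
        by (auto simp del: upt_Suc)
    qed
    have "wordT (rev [j..<Suc m] @ [i]) = wordT (i' # rev [j..<Suc m])"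
      using j Suc.prems by (intro wordT_braid_eq[OF i'(3)]) auto
    then have "y j * T i = symmetrizer m * T i' * wordT (rev [j..<Suc m])"
      by (simp add: y_def mult.assoc del: upt_Suc)
    also have "\<dots> = \<eta> q * y j" using Suc.IH[of i'] i' Suc.prems by (simp add: y_def mult.assoc del: upt_Suc)
    finally show ?thesis .
  qed
  have ii: "{1..Suc m} = {i, Suc i} \<union> ({1..Suc m} - {i, Suc i})" using Suc.prems by auto
  have S: "(\<Sum>j=1..Suc m. f j) = f i + f (Suc i) + (\<Sum>j\<in>{1..Suc m} - {i, Suc i}. f j)" for f :: "nat \<Rightarrow> 'r"
    by (subst ii, subst sum.union_disjoint) (auto simp: add.assoc)
  have "symmetrizer (Suc m) * T i = (\<Sum>j=1..Suc m. y j * T i)" by (simp only: sum sum_distrib_right)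
  also have "\<dots> = y i * T i + y (Suc i) * T i + (\<Sum>j\<in>{1..Suc m} - {i, Suc i}. y j * T i)" by (rule S)
  also have "(\<Sum>j\<in>{1..Suc m} - {i, Suc i}. y j * T i) = (\<Sum>j\<in>{1..Suc m} - {i, Suc i}. \<eta> q * y j)"
    by (intro sum.cong refl y3) auto
  also have "y i * T i + y (Suc i) * T i = \<eta> q * y i + \<eta> q * y (Suc i)"
    by (simp add: y1 y2 eta_diff left_diff_distrib eta_one)
  also have "\<dots> + (\<Sum>j\<in>{1..Suc m} - {i, Suc i}. \<eta> q * y j) = (\<Sum>j=1..Suc m. \<eta> q * y j)" by (rule S[symmetric])
  finally show ?case by (simp only: sum sum_distrib_left)
qed simp

section \<open>The symmetric product of the \<open>L k - Q t\<close> and the eigenvector\<close>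

definition others :: "nat \<Rightarrow> nat list" where "others s = [0..<s] @ [Suc s..<l]"

definition Lfactor :: "nat \<Rightarrow> nat \<Rightarrow> 'r" where "Lfactor s k = (\<Prod>t\<leftarrow>others s. L k - \<eta> (Q t))"

definition Lprod :: "nat \<Rightarrow> 'r" where "Lprod s = (\<Prod>k\<leftarrow>[1..<n + 1]. Lfactor s k)"

lemma L_Lfactor_commute:
  assumes "1 \<le> j" "1 \<le> k" "j \<le> n" "k \<le> n"
  shows "L j * Lfactor s k = Lfactor s k * L j"
  unfolding Lfactor_def using L_commute[OF assms]
  by (intro commute_prod_list) (simp add: left_diff_distrib right_diff_distrib eta_central)

text \<open>\<open>Lprod s\<close> is symmetric in the \<open>L_k\<close>. Only the factors of
  \<open>L_i\<close> and \<open>L_{i+1}\<close> are affected, and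
  \<open>(L_i - a) (L_{i+1} - a)\<close> involves just the sum and the product of the two, both of
  which commute with \<open>T_i\<close>.\<close>

lemma T_Lprod_commute:
  assumes i: "1 \<le> i" "i < n"
  shows "T i * Lprod s = Lprod s * T i"
proof -
  have split: "[1..<n + 1] = [1..<i] @ [i, Suc i] @ [i + 2..<n + 1]"
  proof -
    have "[1..<n + 1] = [1..<i] @ [i..<n + 1]"
      using assms upt_add_eq_append[of 1 i "n + 1 - i"] by simp
    also have "[i..<n + 1] = i # Suc i # [i + 2..<n + 1]"
      using assms by (simp add: upt_conv_Cons del: upt_Suc)
    finally show ?thesis by simp
  qed
  have far: "T i * Lfactor s k = Lfactor s k * T i" if "1 \<le> k" "k \<le> n" "i \<noteq> k" "Suc i \<noteq> k" for k
    unfolding Lfactor_def using T_L_commute[of k i] that i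
    by (intro commute_prod_list) (simp add: left_diff_distrib right_diff_distrib eta_central)
  \<comment> \<open>Commutativity of the \<open>L_k\<close> allows the two factors to be paired
    parameter by parameter.\<close>
  have "Lfactor s i * Lfactor s (Suc i) = (\<Prod>t\<leftarrow>others s. (L i - \<eta> (Q t)) * (L (Suc i) - \<eta> (Q t)))"
    unfolding Lfactor_def using L_commute[of i "Suc i"] i
    by (intro prod_list_mult_commuting)
       (simp add: left_diff_distrib right_diff_distrib eta_central[of _ "L _"] eta_mult[symmetric] mult.commute)
  moreover have "T i * ((L i - \<eta> a) * (L (Suc i) - \<eta> a)) = ((L i - \<eta> a) * (L (Suc i) - \<eta> a)) * T i" for a
  proof -
    have LL: "L (Suc i) * L i = L i * L (Suc i)" using L_commute[of i "Suc i"] i by simp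
    have 1: "T i * (L i * L (Suc i)) = L i * L (Suc i) * T i"
    proof -
      have "T i * (L i * L (Suc i)) = L (Suc i) * (T i * L (Suc i)) - \<eta> (q - 1) * (L (Suc i) * L (Suc i))"
        by (simp add: mult.assoc[symmetric] T_L1[OF i] left_diff_distrib)
      also have "\<dots> = L (Suc i) * L i * T i"
        by (simp add: T_L2[OF i] distrib_left L_eta mult.assoc)
      finally show ?thesis using LL by simp
    qed
    have 2: "T i * (L i + L (Suc i)) = (L i + L (Suc i)) * T i"
      by (simp add: distrib_left distrib_right T_L1[OF i] T_L2[OF i])
    have e: "(L i - \<eta> a) * (L (Suc i) - \<eta> a) = L i * L (Suc i) - \<eta> a * (L i + L (Suc i)) + \<eta> (a * a)"
      by (simp add: left_diff_distrib right_diff_distrib distrib_left eta_central[of a "L i"] eta_mult)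
    have "T i * (\<eta> a * (L i + L (Suc i))) = \<eta> a * (L i + L (Suc i)) * T i"
      by (simp only: T_eta 2 mult.assoc)
    then show ?thesis unfolding e
      by (simp only: distrib_left distrib_right left_diff_distrib right_diff_distrib 1 eta_central[of "a * a"])
  qed
  ultimately have mid: "T i * (Lfactor s i * Lfactor s (Suc i)) = Lfactor s i * Lfactor s (Suc i) * T i"
    by (simp add: commute_prod_list)
  define P where "P = (\<Prod>k\<leftarrow>[1..<i]. Lfactor s k)"
  define R where "R = (\<Prod>k\<leftarrow>[i + 2..<n + 1]. Lfactor s k)"
  have "T i * P = P * T i" unfolding P_def using i by (intro commute_prod_list far) auto
  moreover have "T i * R = R * T i" unfolding R_def using i by (intro commute_prod_list far) auto
  moreover have "Lprod s = P * (Lfactor s i * Lfactor s (Suc i)) * R"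
    unfolding Lprod_def split by (simp add: P_def R_def mult.assoc)
  ultimately show ?thesis using mid by (metis mult.assoc)
qed

text \<open>\<open>Lfactor s 1\<close> is the cyclotomic polynomial in \<open>T 0\<close> without
  the factor for \<open>s\<close>, so \<open>T 0 - Q s\<close> annihilates it; the other factors
  commute with \<open>T 0\<close>, which is \<open>L 1\<close>.\<close>

lemma Lprod_T0:
  assumes "1 \<le> n" "s < l"
  shows "Lprod s * T 0 = \<eta> (Q s) * Lprod s"
proof -
  define R where "R = (\<Prod>k\<leftarrow>[2..<n + 1]. Lfactor s k)"
  have split: "[1..<n + 1] = 1 # [2..<n + 1]"
    using assms by (simp add: upt_conv_Cons numeral_2_eq_2 del: upt_Suc)
  have R: "R * T 0 = T 0 * R"
    unfolding R_def L_1[symmetric] using assms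
    by (intro commute_prod_list[symmetric] L_Lfactor_commute) auto
  have "Lfactor s 1 * (T 0 - \<eta> (Q s)) = 0"
  proof -
    have "[0..<l] = [0..<s] @ s # [Suc s..<l]"
      using assms upt_add_eq_append[of 0 s "l - s"] by (simp add: upt_conv_Cons)
    then have "0 = (\<Prod>t\<leftarrow>[0..<s]. T 0 - \<eta> (Q t)) * ((T 0 - \<eta> (Q s)) * (\<Prod>t\<leftarrow>[Suc s..<l]. T 0 - \<eta> (Q t)))"
      using cyclotomic by simp
    also have "(T 0 - \<eta> (Q s)) * (\<Prod>t\<leftarrow>[Suc s..<l]. T 0 - \<eta> (Q t)) = (\<Prod>t\<leftarrow>[Suc s..<l]. T 0 - \<eta> (Q t)) * (T 0 - \<eta> (Q s))"
      by (intro commute_prod_list)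
         (simp add: left_diff_distrib right_diff_distrib eta_central[of _ "T 0"] eta_mult[symmetric] mult.commute)
    finally show ?thesis by (simp add: Lfactor_def others_def L_1 mult.assoc)
  qed
  then have F: "Lfactor s 1 * T 0 = \<eta> (Q s) * Lfactor s 1" by (simp add: right_diff_distrib eta_central)
  have "Lprod s = Lfactor s 1 * R" unfolding Lprod_def split by (simp add: R_def del: upt_Suc)
  then have "Lprod s * T 0 = Lfactor s 1 * (R * T 0)" by (simp only: mult.assoc)
  also have "\<dots> = \<eta> (Q s) * Lfactor s 1 * R" by (simp only: R mult.assoc[symmetric] F)
  finally show ?thesis using \<open>Lprod s = Lfactor s 1 * R\<close> by (simp only: mult.assoc)
qed

definition one_dim :: "nat \<Rightarrow> 'r" where "one_dim s = Lprod s * symmetrizer n"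

lemma one_dim_T:
  assumes "1 \<le> i" "i < n"
  shows "one_dim s * T i = \<eta> q * one_dim s"
  using symmetrizer_T[of n i] assms by (simp add: one_dim_def mult.assoc eta_left_commute[of "Lprod s"])

text \<open>\<open>T i\<close> is absorbed by the symmetrizer, \<open>T 0\<close> by
  \<open>Lprod s\<close>; each of them has to stand on the right when its letter arrives.\<close>

lemma one_dim_alt:
  assumes "m \<le> n"
  shows "Lprod s * symmetrizer m = symmetrizer m * Lprod s"
  using assms
proof (induction m)
  case (Suc m)
  have "wordT (rev [j..<Suc m]) * Lprod s = Lprod s * wordT (rev [j..<Suc m])" if "j \<in> {1..Suc m}" for j
    using T_Lprod_commute Suc.prems that by (intro wordT_commute) auto
  then have "Lprod s * (\<Sum>j=1..Suc m. wordT (rev [j..<Suc m])) =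
      (\<Sum>j=1..Suc m. wordT (rev [j..<Suc m])) * Lprod s"
    unfolding sum_distrib_left sum_distrib_right by (intro sum.cong) auto
  moreover have "Lprod s * symmetrizer m = symmetrizer m * Lprod s" using Suc by simp
  ultimately show ?case unfolding symmetrizer.simps by (metis mult.assoc)
qed simp

lemma one_dim_T0:
  assumes "1 \<le> n" "s < l"
  shows "one_dim s * T 0 = \<eta> (Q s) * one_dim s"
  using Lprod_T0[OF assms]
  by (simp add: one_dim_def one_dim_alt mult.assoc eta_left_commute[of "symmetrizer n"])

text \<open>The linear character that belongs to the one-row diagram in component
  \<open>s\<close>.\<close>

definition lin_char :: "nat \<Rightarrow> nat list \<Rightarrow> 'k" where
  "lin_char s u = (\<Prod>i\<leftarrow>u. if i = 0 then Q s else q)"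

lemma one_dim_word:
  assumes "1 \<le> n" "s < l" "set u \<subseteq> {..<n}"
  shows "one_dim s * wordT u = \<eta> (lin_char s u) * one_dim s"
  using assms(3)
proof (induction u)
  case (Cons i u)
  have "one_dim s * T i = \<eta> (if i = 0 then Q s else q) * one_dim s"
    using one_dim_T0 one_dim_T Cons.prems assms by simp
  then have "one_dim s * wordT (i # u) = \<eta> (if i = 0 then Q s else q) * (one_dim s * wordT u)"
    by (simp add: mult.assoc[symmetric])
  then show ?case using Cons by (simp add: lin_char_def eta_mult mult.assoc)
qed (simp add: lin_char_def eta_one)

lemma one_dim_prod_list:
  assumes "\<And>x. x \<in> set xs \<Longrightarrow> one_dim s * f x = \<eta> (g x) * one_dim s"
  shows "one_dim s * (\<Prod>x\<leftarrow>xs. f x) = \<eta> (\<Prod>x\<leftarrow>xs. g x) * one_dim s"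
  using assms
proof (induction xs)
  case (Cons x xs)
  have "one_dim s * (f x * (\<Prod>x\<leftarrow>xs. f x)) = \<eta> (g x) * (one_dim s * (\<Prod>x\<leftarrow>xs. f x))"
    using Cons.prems by (simp add: mult.assoc[symmetric])
  then show ?case using Cons by (simp add: eta_mult mult.assoc)
qed (simp add: eta_one)

text \<open>The word has \<open>2 (k - 1)\<close> letters besides 0, half of which are compensated
  by the normalising power of \<open>q\<close> in \<open>L k\<close>.\<close>

lemma one_dim_L:
  assumes "1 \<le> k" "k \<le> n" "s < l"
  shows "one_dim s * L k = \<eta> (q ^ (k - 1) * Q s) * one_dim s"
proof -
  have r: "(\<Prod>i\<leftarrow>is. if i = 0 then Q s else q) = q ^ length is" if "0 \<notin> set is" for "is" :: "nat list"
    using that by (induction "is") auto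
  have "lin_char s (rev [1..<k] @ [0] @ [1..<k]) = q ^ (k - 1) * Q s * q ^ (k - 1)"
    unfolding lin_char_def map_append prod_list.append by (subst r, simp, subst r, simp_all)
  moreover have "q powi (1 - int k) = inverse (q ^ (k - 1))"
    using assms by (simp add: power_int_def nat_diff_distrib power_inverse)
  ultimately have "q powi (1 - int k) * lin_char s (rev [1..<k] @ [0] @ [1..<k]) = q ^ (k - 1) * Q s"
    using q0 by simp
  moreover have "one_dim s * wordT (rev [1..<k] @ [0] @ [1..<k]) =
      \<eta> (lin_char s (rev [1..<k] @ [0] @ [1..<k])) * one_dim s"
    using assms by (intro one_dim_word) auto
  ultimately show ?thesis
    unfolding L_def eta_left_commute[of "one_dim s"]
    by (simp only: mult.assoc[symmetric] eta_mult[symmetric])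
qed

text \<open>A run contributes \<open>q\<close> to its length, and the runs of one level have the
  lengths \<open>0, ..., m\<close>; so each level gives a q-integer and the total is a
  q-factorial.\<close>

lemma one_dim_symmetrizer:
  assumes "m \<le> n" "1 \<le> n" "s < l"
  shows "one_dim s * symmetrizer m = \<eta> (\<Prod>k=1..m. q_int q k) * one_dim s"
  using assms(1)
proof (induction m)
  case (Suc m)
  have "one_dim s * (\<Sum>j=1..Suc m. wordT (rev [j..<Suc m])) = (\<Sum>j=1..Suc m. \<eta> (q ^ (Suc m - j)) * one_dim s)"
    unfolding sum_distrib_left
  proof (rule sum.cong[OF refl])
    fix j assume j: "j \<in> {1..Suc m}"
    have "lin_char s (rev [j..<Suc m]) = (\<Prod>i\<leftarrow>rev [j..<Suc m]. q)"
      unfolding lin_char_def using j by (intro arg_cong[of _ _ prod_list] map_cong) auto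
    also have "\<dots> = q ^ (Suc m - j)" by (simp add: map_replicate_const del: upt_Suc)
    finally show "one_dim s * wordT (rev [j..<Suc m]) = \<eta> (q ^ (Suc m - j)) * one_dim s"
      using one_dim_word[OF assms(2,3), of "rev [j..<Suc m]"] j Suc.prems by (force simp del: upt_Suc)
  qed
  also have "\<dots> = \<eta> (\<Sum>j=1..Suc m. q ^ (Suc m - j)) * one_dim s"
  proof -
    have *: "(\<Sum>j\<in>J. \<eta> (f j) * one_dim s) = \<eta> (\<Sum>j\<in>J. f j) * one_dim s" if "finite J" for J and f :: "nat \<Rightarrow> 'k"
      using that by (induction J rule: finite_induct) (auto simp: eta_zero eta_add distrib_right)
    show ?thesis by (rule *) simp
  qed
  also have "(\<Sum>j=1..Suc m. q ^ (Suc m - j)) = q_int q (Suc m)"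
    unfolding q_int_def by (rule sum.reindex_bij_witness[of _ "\<lambda>k. Suc m - k" "\<lambda>j. Suc m - j"]) auto
  finally have "one_dim s * symmetrizer (Suc m) =
      \<eta> (\<Prod>k=1..m. q_int q k) * (\<eta> (q_int q (Suc m)) * one_dim s)"
    using Suc.IH Suc.prems unfolding symmetrizer.simps
    by (simp only: mult.assoc[symmetric] Suc_leD) (simp only: mult.assoc)
  then show ?case by (simp add: eta_mult mult.assoc)
qed (simp add: eta_one)

text \<open>The factors of the second copy are replaced by their eigenvalues on the first. Taken
  over all \<open>s\<close>, the nonvanishing of the resulting scalar is the separation of the
  parameters.\<close>

lemma one_dim_square:
  assumes "1 \<le> n" "s < l"
  shows "one_dim s * one_dim s =
    \<eta> ((\<Prod>k\<leftarrow>[1..<n + 1]. \<Prod>t\<leftarrow>others s. q ^ (k - 1) * Q s - Q t) * (\<Prod>k=1..n. q_int q k)) * one_dim s"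
proof -
  have "one_dim s * Lfactor s k = \<eta> (\<Prod>t\<leftarrow>others s. q ^ (k - 1) * Q s - Q t) * one_dim s"
    if "k \<in> set [1..<n + 1]" for k
  proof -
    have "1 \<le> k" "k \<le> n" using that by auto
    from one_dim_L[OF this assms(2)] show ?thesis
      unfolding Lfactor_def
      by (intro one_dim_prod_list) (simp add: right_diff_distrib left_diff_distrib eta_diff eta_central)
  qed
  then have "one_dim s * Lprod s = \<eta> (\<Prod>k\<leftarrow>[1..<n + 1]. \<Prod>t\<leftarrow>others s. q ^ (k - 1) * Q s - Q t) * one_dim s"
    unfolding Lprod_def by (rule one_dim_prod_list)
  then have "one_dim s * (Lprod s * symmetrizer n) =
     \<eta> (\<Prod>k\<leftarrow>[1..<n + 1]. \<Prod>t\<leftarrow>others s. q ^ (k - 1) * Q s - Q t) * (one_dim s * symmetrizer n)"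
    by (simp only: mult.assoc[symmetric])
  then show ?thesis using one_dim_symmetrizer[of n s] assms
    by (simp only: one_dim_def[symmetric] eta_mult mult.assoc order_refl)
qed

section \<open>Expansion of the eigenvector in monomials\<close>

definition nontrivial_elts :: "'r set" where
  "nontrivial_elts = {Lmon c * wordT (cword j n) | c j. (\<forall>k\<in>{1..n}. c k < l) \<and> is_code n j \<and>
     \<not> ((\<forall>k\<in>{1..n}. c k = 0) \<and> cword j n = [])}"

text \<open>A canonical word followed by a run is again a canonical word, and it is empty only if
  both parts are.\<close>

lemma symmetrizer_expand:
  "\<exists>r \<in> aspan UNIV {wordT (cword j m) | j. is_code m j \<and> cword j m \<noteq> []}. symmetrizer m = 1 + r"
proof (induction m)
  case (Suc m)
  let ?B = "\<lambda>m. {wordT (cword j m) | j. is_code m j \<and> cword j m \<noteq> []}"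
  obtain r where r: "r \<in> aspan UNIV (?B m)" "symmetrizer m = 1 + r" using Suc by blast
  have step: "wordT (cword j m) * wordT (rev [i..<Suc m]) \<in> ?B (Suc m)"
    if "is_code m j" "i \<in> {1..Suc m}" "cword j m \<noteq> [] \<or> i \<le> m" for j i
  proof -
    define j' where "j' = j(Suc m := i)"
    have "cword j' (Suc m) = cword j m @ rev [i..<Suc m]" "is_code (Suc m) j'"
      using that by (auto simp: j'_def is_code_def intro: cword_cong)
    moreover have "cword j m @ rev [i..<Suc m] \<noteq> []" using that(3) by auto
    ultimately show ?thesis using wordT_simps(3) by (smt (verit, best) mem_Collect_eq)
  qed
  have 1: "(\<Sum>i\<in>I. wordT (rev [i..<Suc m])) \<in> aspan UNIV (?B (Suc m))" if "I \<subseteq> {1..m}" "finite I" for I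
    using that(2,1)
  proof (induction I rule: finite_induct)
    case (insert i I)
    have "wordT (cword (\<lambda>k. k) m) * wordT (rev [i..<Suc m]) \<in> ?B (Suc m)"
      using insert cword_self by (intro step) auto
    then have "wordT (rev [i..<Suc m]) \<in> ?B (Suc m)"
      unfolding cword_self(1) wordT_simps mult_1_left .
    then have "wordT (rev [i..<Suc m]) \<in> aspan UNIV (?B (Suc m))" by (rule aspan_base) simp
    moreover have "(\<Sum>i\<in>I. wordT (rev [i..<Suc m])) \<in> aspan UNIV (?B (Suc m))" using insert by blast
    ultimately show ?case unfolding sum.insert[OF insert.hyps] by (rule aspan_add)
  qed (simp add: aspan.zero)
  have 2: "(\<Sum>i\<in>I. r * wordT (rev [i..<Suc m])) \<in> aspan UNIV (?B (Suc m))" if "I \<subseteq> {1..Suc m}" "finite I" for I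
    using that(2,1)
  proof (induction I rule: finite_induct)
    case (insert i I)
    have "r * wordT (rev [i..<Suc m]) \<in> aspan UNIV (?B (Suc m))"
    proof (rule aspan_sandwich_right[OF r(1)])
      fix b assume "b \<in> ?B m"
      then obtain j where j: "b = wordT (cword j m)" "is_code m j" "cword j m \<noteq> []" by blast
      have "b * wordT (rev [i..<Suc m]) \<in> ?B (Suc m)"
        unfolding j(1) using insert.prems j by (intro step) auto
      then show "b * wordT (rev [i..<Suc m]) \<in> aspan UNIV (?B (Suc m))" by (rule aspan_base) simp
    qed simp
    moreover have "(\<Sum>i\<in>I. r * wordT (rev [i..<Suc m])) \<in> aspan UNIV (?B (Suc m))" using insert by blast
    ultimately show ?case unfolding sum.insert[OF insert.hyps] by (rule aspan_add)
  qed (simp add: aspan.zero)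
  have "(\<Sum>i=1..Suc m. wordT (rev [i..<Suc m])) = 1 + (\<Sum>i=1..m. wordT (rev [i..<Suc m]))"
    by (simp add: add.commute)
  then have "symmetrizer (Suc m) =
     1 + ((\<Sum>i=1..m. wordT (rev [i..<Suc m])) + (\<Sum>i=1..Suc m. r * wordT (rev [i..<Suc m])))"
    by (simp only: symmetrizer.simps r distrib_right mult_1_left sum_distrib_left[symmetric])
       (simp only: add.assoc)
  then show ?case using 1[of "{1..m}"] 2[of "{1..Suc m}"] aspan_add by blast
qed (auto intro: bexI[of _ 0] aspan.zero)

text \<open>Each factor is a polynomial of degree \<open>l - 1\<close> in its \<open>L k\<close>, so
  exponents stay below \<open>l\<close>; the constant terms multiply to the displayed power.\<close>

lemma Lprod_expand:
  assumes "s < l"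
  shows "\<exists>r \<in> aspan UNIV {Lmon c | c. (\<forall>k\<in>{1..n}. c k < l) \<and> \<not> (\<forall>k\<in>{1..n}. c k = 0)}.
    Lprod s = \<eta> ((\<Prod>t\<leftarrow>others s. - Q t) ^ n) + r"
proof -
  let ?B = "\<lambda>ks. {(\<Prod>k\<leftarrow>ks. L k ^ c k) | c. (\<forall>k\<in>set ks. c k < l) \<and> \<not> (\<forall>k\<in>set ks. c k = 0)}"
  let ?\<kappa> = "\<Prod>t\<leftarrow>others s. - Q t"
  have len: "length (others s) = l - 1" using assms by (simp add: others_def)
  obtain g where g: "\<And>x. (\<Prod>t\<leftarrow>others s. x - \<eta> (Q t)) = (\<Sum>j\<le>l - 1. \<eta> (g j) * x ^ j)" "g 0 = ?\<kappa>"
    using prod_linear_expand[of UNIV "others s"] len by auto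
  have "\<exists>r\<in>aspan UNIV (?B ks). (\<Prod>k\<leftarrow>ks. Lfactor s k) = \<eta> (?\<kappa> ^ length ks) + r" if "distinct ks" for ks
    using that
  proof (induction ks)
    case (Cons k ks)
    then obtain r where r: "r \<in> aspan UNIV (?B ks)" "(\<Prod>k\<leftarrow>ks. Lfactor s k) = \<eta> (?\<kappa> ^ length ks) + r"
      by auto
    have mem: "L k ^ a * (\<Prod>k\<leftarrow>ks. L k ^ c k) \<in> ?B (k # ks)"
      if "a < l" "\<forall>k\<in>set ks. c k < l" "a \<noteq> 0 \<or> \<not> (\<forall>k\<in>set ks. c k = 0)" for a c
    proof -
      have "(\<Prod>i\<leftarrow>k # ks. L i ^ (c(k := a)) i) = L k ^ a * (\<Prod>i\<leftarrow>ks. L i ^ c i)"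
        using Cons.prems by (auto intro!: arg_cong2[of _ _ _ _ "(*)"] arg_cong[of _ _ prod_list])
      moreover have "(\<Prod>i\<leftarrow>k # ks. L i ^ (c(k := a)) i) \<in> ?B (k # ks)"
        using that Cons.prems by (intro CollectI exI[of _ "c(k := a)"]) auto
      ultimately show ?thesis by simp
    qed
    have z: "(\<Prod>k\<leftarrow>ks. L k ^ (\<lambda>_. 0) k) = 1" by (induction ks) auto
    have f: "Lfactor s k = \<eta> ?\<kappa> + (\<Sum>j=1..l - 1. \<eta> (g j) * L k ^ j)"
      unfolding Lfactor_def g(1) by (simp add: sum.atMost_shift g(2) sum.atLeast1_atMost_eq)
    have sums: "(\<Sum>j\<in>J. \<eta> (g j) * L k ^ j) * x \<in> aspan UNIV (?B (k # ks))"
      if "finite J" "J \<subseteq> {1..l - 1}" "\<And>j. j \<in> J \<Longrightarrow> L k ^ j * x \<in> aspan UNIV (?B (k # ks))" for J x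
      using that
    proof (induction J rule: finite_induct)
      case (insert j J)
      have "\<eta> (g j) * L k ^ j * x + (\<Sum>j\<in>J. \<eta> (g j) * L k ^ j) * x \<in> aspan UNIV (?B (k # ks))"
        using insert by (intro aspan_add) (auto simp: mult.assoc intro!: aspan_scale)
      then show ?case using insert by (simp add: distrib_right)
    qed (simp add: aspan.zero)
    define S where "S = (\<Sum>j=1..l - 1. \<eta> (g j) * L k ^ j)"
    have 1: "S * \<eta> (?\<kappa> ^ length ks) \<in> aspan UNIV (?B (k # ks))"
      unfolding S_def
    proof (intro sums)
      fix j assume j: "j \<in> {1..l - 1}"
      have "L k ^ j * 1 \<in> ?B (k # ks)" unfolding z[symmetric] using j l by (intro mem) auto
      then have "\<eta> (?\<kappa> ^ length ks) * (L k ^ j * 1) \<in> aspan UNIV (?B (k # ks))"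
        by (intro aspan_base_scale) auto
      then show "L k ^ j * \<eta> (?\<kappa> ^ length ks) \<in> aspan UNIV (?B (k # ks))" by (simp add: eta_central)
    qed auto
    have r': "L k ^ j * r \<in> aspan UNIV (?B (k # ks))" if "j < l" for j
    proof (rule aspan_sandwich_left[OF r(1)])
      fix b assume "b \<in> ?B ks"
      then have "L k ^ j * b \<in> ?B (k # ks)" using mem that by blast
      then show "L k ^ j * b \<in> aspan UNIV (?B (k # ks))" by (simp add: aspan_base)
    qed simp
    have 2: "S * r \<in> aspan UNIV (?B (k # ks))" unfolding S_def by (intro sums r') auto
    have 3: "\<eta> ?\<kappa> * r \<in> aspan UNIV (?B (k # ks))" using r'[of 0] l by (intro aspan_scale) auto
    have "(\<Prod>k\<leftarrow>k # ks. Lfactor s k) =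
        \<eta> (?\<kappa> ^ length (k # ks)) + (\<eta> ?\<kappa> * r + (S * \<eta> (?\<kappa> ^ length ks) + S * r))"
      by (simp add: r(2) f[folded S_def] distrib_left distrib_right eta_mult add.assoc)
    then show ?case using 1 2 3 aspan_add by blast
  qed (auto intro: bexI[of _ 0] aspan.zero simp: eta_one)
  from this[of "[1..<n + 1]"] have
    "\<exists>r\<in>aspan UNIV (?B [1..<n + 1]). (\<Prod>k\<leftarrow>[1..<n + 1]. Lfactor s k) = \<eta> (?\<kappa> ^ n) + r" by (simp del: upt_Suc)
  moreover have e: "set [1..<n + 1] = {1..n}" by auto
  ultimately show ?thesis unfolding Lprod_def Lmon_def e by simp
qed

text \<open>The symmetrizing form is 1 at 1 and 0 on \<open>nontrivial_elts\<close>. Its value at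
  \<open>one_dim s\<close> is therefore the displayed power, which is nonzero for nonzero
  parameters.\<close>

theorem one_dim_expand:
  assumes "s < l"
  shows "\<exists>r \<in> aspan UNIV nontrivial_elts. one_dim s = \<eta> ((\<Prod>t\<leftarrow>others s. - Q t) ^ n) + r"
proof -
  let ?\<kappa> = "(\<Prod>t\<leftarrow>others s. - Q t) ^ n"
  let ?B1 = "{Lmon c | c. (\<forall>k\<in>{1..n}. c k < l) \<and> \<not> (\<forall>k\<in>{1..n}. c k = 0)}"
  let ?B2 = "{wordT (cword j n) | j. is_code n j \<and> cword j n \<noteq> []}"
  obtain r1 where r1: "r1 \<in> aspan UNIV ?B1" "Lprod s = \<eta> ?\<kappa> + r1" using Lprod_expand[OF assms] by blast
  obtain r2 where r2: "r2 \<in> aspan UNIV ?B2" "symmetrizer n = 1 + r2" using symmetrizer_expand by blast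
  have mem: "Lmon c * wordT (cword j n) \<in> aspan UNIV nontrivial_elts"
    if "\<forall>k\<in>{1..n}. c k < l" "is_code n j" "\<not> ((\<forall>k\<in>{1..n}. c k = 0) \<and> cword j n = [])" for c j
  proof (rule aspan_base)
    show "Lmon c * wordT (cword j n) \<in> nontrivial_elts" unfolding nontrivial_elts_def using that by blast
  qed simp
  have z: "Lmon (\<lambda>_. 0) = 1" 
  proof -
    have "(\<Prod>k\<leftarrow>ks. L k ^ 0) = 1" for ks :: "nat list" by (induction ks) auto
    then show ?thesis unfolding Lmon_def by blast
  qed
  have 1: "r1 * 1 \<in> aspan UNIV nontrivial_elts"
  proof (rule aspan_sandwich_right[OF r1(1)])
    fix b assume "b \<in> ?B1"
    then obtain c where c: "b = Lmon c" "\<forall>k\<in>{1..n}. c k < l" "\<not> (\<forall>k\<in>{1..n}. c k = 0)" by blast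
    show "b * 1 \<in> aspan UNIV nontrivial_elts"
      using mem[OF c(2) cword_self(2)] c(1,3) by (simp add: cword_self(1))
  qed simp
  have 2: "1 * r2 \<in> aspan UNIV nontrivial_elts"
  proof (rule aspan_sandwich_left[OF r2(1)])
    fix b assume "b \<in> ?B2"
    then obtain j where j: "b = wordT (cword j n)" "is_code n j" "cword j n \<noteq> []" by blast
    show "1 * b \<in> aspan UNIV nontrivial_elts"
      using mem[of "\<lambda>_. 0" j] l j by (simp add: z)
  qed simp
  have 3: "r1 * r2 \<in> aspan UNIV nontrivial_elts"
  proof (rule aspan_sandwich_right[OF r1(1)])
    fix b assume "b \<in> ?B1"
    then obtain c where c: "b = Lmon c" "\<forall>k\<in>{1..n}. c k < l" "\<not> (\<forall>k\<in>{1..n}. c k = 0)" by blast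
    show "b * r2 \<in> aspan UNIV nontrivial_elts"
    proof (rule aspan_sandwich_left[OF r2(1)])
      fix d assume "d \<in> ?B2"
      then obtain j where j: "d = wordT (cword j n)" "is_code n j" "cword j n \<noteq> []" by blast
      show "b * d \<in> aspan UNIV nontrivial_elts"
        unfolding c(1) j(1) using c j by (intro mem) auto
    qed simp
  qed simp
  have "one_dim s = \<eta> ?\<kappa> + (r1 * 1 + (\<eta> ?\<kappa> * (1 * r2) + r1 * r2))"
    by (simp add: one_dim_def r1 r2 distrib_left distrib_right add_ac)
  moreover have "\<eta> ?\<kappa> * (1 * r2) \<in> aspan UNIV nontrivial_elts" using 2 by (rule aspan_scale) simp
  ultimately show ?thesis using 1 3 by (intro bexI[of _ "r1 * 1 + (\<eta> ?\<kappa> * (1 * r2) + r1 * r2)"] aspan_add)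
qed

end

section \<open>The seminormal representation on paths\<close>

lemma free_alg_induct [case_names zero step]:
  fixes x :: "'b \<Rightarrow>\<^sub>0 'a::ab_group_add"
  assumes "P 0" and "\<And>x w c. w \<notin> Poly_Mapping.keys x \<Longrightarrow> c \<noteq> 0 \<Longrightarrow> P x \<Longrightarrow> P (Poly_Mapping.single w c + x)"
  shows "P x"
proof (induction x rule: update_induct)
  case (update f a b)
  have "Poly_Mapping.update a b f = Poly_Mapping.single a b + f"
  proof (rule poly_mapping_eqI)
    fix k
    show "Poly_Mapping.lookup (Poly_Mapping.update a b f) k = Poly_Mapping.lookup (Poly_Mapping.single a b + f) k"
      using update(1) by (auto simp: lookup_update lookup_add lookup_single in_keys_iff when_def)
  qed
  then show ?case using assms(2) update by simp
qed (rule assms(1))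

text \<open>The formula of \<open>free_op\<close> with the operators of the generators left open, so
  that paths, tableaux and linear functions on words are instances of one construction.\<close>

definition rep :: "(nat \<Rightarrow> ('x \<Rightarrow> 'k) \<Rightarrow> 'x \<Rightarrow> 'k) \<Rightarrow> 'k::field free_alg \<Rightarrow> ('x \<Rightarrow> 'k) \<Rightarrow> 'x \<Rightarrow> 'k" where
  "rep G x v = (\<lambda>u. \<Sum>w\<in>Poly_Mapping.keys x. Poly_Mapping.lookup x w * foldr G (letters w) v u)"

definition linear_ops :: "(nat \<Rightarrow> ('x \<Rightarrow> 'k::field) \<Rightarrow> 'x \<Rightarrow> 'k) \<Rightarrow> bool" where
  "linear_ops G \<longleftrightarrow> (\<forall>k v v' c. G k (\<lambda>u. c * v u + v' u) = (\<lambda>u. c * G k v u + G k v' u))"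

lemma foldr_linear:
  assumes "linear_ops G"
  shows "foldr G ks (\<lambda>u. c * v u + v' u) = (\<lambda>u. c * foldr G ks v u + foldr G ks v' u)"
proof (induction ks)
  case (Cons k ks)
  then show ?case using assms unfolding linear_ops_def by simp
qed simp

lemma foldr_linear_zero:
  assumes "linear_ops G"
  shows "foldr G ks (\<lambda>u. 0) = (\<lambda>u. 0)"
  using foldr_linear[OF assms, of ks "-1" "\<lambda>u. 0" "\<lambda>u. 0"] by (simp add: fun_eq_iff)

lemma foldr_linear_sum:
  assumes "linear_ops G" "finite S"
  shows "foldr G ks (\<lambda>u. \<Sum>i\<in>S. c i * v i u) = (\<lambda>u. \<Sum>i\<in>S. c i * foldr G ks (v i) u)"
  using assms(2)
proof (induction S rule: finite_induct)
  case (insert i S)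
  then show ?case
    using foldr_linear[OF assms(1), of ks "c i" "v i" "\<lambda>u. \<Sum>i\<in>S. c i * v i u"] by simp
qed (simp add: foldr_linear_zero[OF assms(1)])

lemma rep_superset:
  assumes "finite S" "Poly_Mapping.keys x \<subseteq> S"
  shows "rep G x v u = (\<Sum>w\<in>S. Poly_Mapping.lookup x w * foldr G (letters w) v u)"
  unfolding rep_def using assms by (intro sum.mono_neutral_left) (auto simp: in_keys_iff)

lemma rep_add: "rep G (x + y) v u = rep G x v u + rep G y v u"
proof -
  let ?S = "Poly_Mapping.keys x \<union> Poly_Mapping.keys y"
  have "finite ?S" "Poly_Mapping.keys (x + y) \<subseteq> ?S" using Poly_Mapping.keys_add[of x y] by auto
  then show ?thesis
    by (simp add: rep_superset[of ?S] lookup_add distrib_right sum.distrib)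
qed

lemma rep_zero: "rep G 0 v u = 0" by (simp add: rep_def)

lemma rep_uminus: "rep G (- x) v u = - rep G x v u"
  using rep_add[of G x "- x" v u] by (simp add: rep_zero eq_neg_iff_add_eq_0 add.commute)

lemma rep_diff: "rep G (x - y) v u = rep G x v u - rep G y v u"
  using rep_add[of G x "- y" v u] by (simp add: rep_uminus)

lemma rep_single: "rep G (Poly_Mapping.single w c) v u = c * foldr G (letters w) v u"
  by (simp add: rep_def)

lemma rep_gen: "rep G (free_gen i) v = G i v"
  by (simp add: rep_single free_gen_def fun_eq_iff)

lemma rep_const: "rep G (free_const c) v u = c * v u"
  by (simp add: rep_single free_const_def zero_free_monoid_def)

lemma rep_one: "rep G 1 v = v"
  using rep_const[of G 1 v] by (simp add: free_const_def fun_eq_iff)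

lemma rep_linear_sum:
  assumes "linear_ops G" "finite S"
  shows "rep G x (\<lambda>u. \<Sum>i\<in>S. c i * v i u) u = (\<Sum>i\<in>S. c i * rep G x (v i) u)"
  unfolding rep_def foldr_linear_sum[OF assms]
  by (simp add: sum_distrib_left sum.swap[of _ S] mult.left_commute)

lemma rep_mult:
  assumes "linear_ops G"
  shows "rep G (x * y) v = rep G x (rep G y v)"
proof -
  have "rep G (x * y) v u = rep G x (rep G y v) u" for u
  proof (induction x rule: free_alg_induct)
    case (step x w c)
    have "rep G (Poly_Mapping.single w c * y) v u = c * foldr G (letters w) (rep G y v) u"
    proof (induction y rule: free_alg_induct)
      case zero
      then show ?case using foldr_linear_zero[OF assms] by (simp add: rep_zero[abs_def] rep_def)
    next
      case (step y w' c')
      have "rep G (Poly_Mapping.single w' c' + y) v = (\<lambda>u. c' * foldr G (letters w') v u + rep G y v u)"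
        by (simp add: rep_add rep_single fun_eq_iff)
      then show ?case
        using step by (simp add: distrib_left rep_add mult_single rep_single foldr_linear[OF assms]
            plus_free_monoid_def)
    qed
    then show ?case using step by (simp add: distrib_right rep_add rep_single)
  qed (simp add: rep_zero)
  then show ?thesis by blast
qed

text \<open>The two families of operators are compared only at points of \<open>W\<close>; locality
  of \<open>G'\<close> on \<open>W\<close> carries the comparison through a word. It serves to
  append a node to paths and to pass between tableaux and paths.\<close>

lemma rep_transport:
  assumes "\<And>k v p. k \<in> K \<Longrightarrow> p \<in> W \<Longrightarrow> G k v (\<iota> p) = G' k (\<lambda>r. v (\<iota> r)) p"
    and loc: "\<And>k v v' p. k \<in> K \<Longrightarrow> p \<in> W \<Longrightarrow> (\<And>r. r \<in> W \<Longrightarrow> v r = v' r) \<Longrightarrow> G' k v p = G' k v' p"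
    and x: "\<And>w. w \<in> Poly_Mapping.keys x \<Longrightarrow> set (letters w) \<subseteq> K" and p: "p \<in> W"
  shows "rep G x v (\<iota> p) = rep G' x (\<lambda>r. v (\<iota> r)) p"
proof -
  have "foldr G ks v (\<iota> p) = foldr G' ks (\<lambda>r. v (\<iota> r)) p" if "set ks \<subseteq> K" "p \<in> W" for ks p
    using that
  proof (induction ks arbitrary: p)
    case (Cons k ks)
    have "foldr G (k # ks) v (\<iota> p) = G' k (\<lambda>r. foldr G ks v (\<iota> r)) p" using assms(1)[of k p] Cons.prems by simp
    also have "\<dots> = G' k (foldr G' ks (\<lambda>r. v (\<iota> r))) p" using Cons by (intro loc) auto
    finally show ?case by simp
  qed simp
  then show ?thesis unfolding rep_def using x p by (intro sum.cong refl) auto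
qed

lemma rep_local:
  assumes loc: "\<And>k v v' p. k \<in> K \<Longrightarrow> p \<in> W \<Longrightarrow> (\<And>r. r \<in> W \<Longrightarrow> v r = v' r) \<Longrightarrow> G k v p = G k v' p"
    and x: "\<And>w. w \<in> Poly_Mapping.keys x \<Longrightarrow> set (letters w) \<subseteq> K" and p: "p \<in> W"
    and v: "\<And>r. r \<in> W \<Longrightarrow> v r = v' r"
  shows "rep G x v p = rep G x v' p"
proof -
  have "foldr G ks v p = foldr G ks v' p" if "set ks \<subseteq> K" "p \<in> W" for ks p
    using that
  proof (induction ks arbitrary: p)
    case (Cons k ks)
    then show ?case by (simp, intro loc) auto
  qed (use v in simp)
  then show ?thesis unfolding rep_def using x p by (intro sum.cong refl) auto
qed

lemma free_algebra_single_add: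
  assumes "Poly_Mapping.single w c + x \<in> carrier (free_algebra n)" "w \<notin> Poly_Mapping.keys x" "c \<noteq> 0"
  shows "set (letters w) \<subseteq> {..<n}" "x \<in> carrier (free_algebra n)"
proof -
  have k: "Poly_Mapping.keys (Poly_Mapping.single w c + x) = insert w (Poly_Mapping.keys x)"
    using assms(2,3) by (auto simp: in_keys_iff lookup_add lookup_single when_def split: if_splits)
  show "set (letters w) \<subseteq> {..<n}" "x \<in> carrier (free_algebra n)"
    using assms(1) unfolding free_algebra_carrier_iff k by auto
qed

lemma ideal_free_algebraI:
  fixes N :: "'k::field free_alg set"
  assumes "N \<subseteq> carrier (free_algebra n)" "0 \<in> N" "\<And>x y. x \<in> N \<Longrightarrow> y \<in> N \<Longrightarrow> x + y \<in> N"
    "\<And>x r. x \<in> N \<Longrightarrow> r \<in> carrier (free_algebra n) \<Longrightarrow> r * x \<in> N"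
    "\<And>x r. x \<in> N \<Longrightarrow> r \<in> carrier (free_algebra n) \<Longrightarrow> x * r \<in> N"
  shows "ideal N (free_algebra n)"
proof (rule idealI)
  show "ring (free_algebra n :: 'k free_alg ring)" by (rule ring_free_algebra)
  interpret R: ring "free_algebra n :: 'k free_alg ring" by (rule ring_free_algebra)
  show "subgroup N (add_monoid (free_algebra n))"
  proof (rule R.add.subgroupI)
    show "N \<subseteq> carrier (free_algebra n)" "N \<noteq> {}" using assms(1,2) by auto
    fix x assume x: "x \<in> N"
    have "- 1 * x \<in> N" using assms(4)[OF x, of "- 1"] by (simp add: free_algebra_closed)
    moreover have "\<ominus>\<^bsub>free_algebra n\<^esub> x = - x"
      using x assms(1) by (intro R.minus_equality) (auto simp: free_algebra_simps free_algebra_closed)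
    ultimately show "\<ominus>\<^bsub>free_algebra n\<^esub> x \<in> N" by simp
  qed (use assms(3) in \<open>simp add: free_algebra_simps\<close>)
qed (use assms in \<open>auto simp: free_algebra_simps\<close>)

section \<open>Multidiagrams and paths of nodes\<close>

type_synonym node = "nat \<times> nat \<times> nat"

definition content :: "node \<Rightarrow> int" where
  "content x = (case x of (s, i, j) \<Rightarrow> int j - int i)"

definition addable :: "nat \<Rightarrow> node set \<Rightarrow> node \<Rightarrow> bool" where
  "addable l D x = (case x of (s, i, j) \<Rightarrow> s < l \<and> 1 \<le> i \<and> 1 \<le> j \<and> (s, i, j) \<notin> D \<and>
     (1 < i \<longrightarrow> (s, i - 1, j) \<in> D) \<and> (1 < j \<longrightarrow> (s, i, j - 1) \<in> D))"

primrec path_from :: "nat \<Rightarrow> node set \<Rightarrow> node list \<Rightarrow> bool" where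
  "path_from l D [] = True"
| "path_from l D (x # p) = (addable l D x \<and> path_from l (insert x D) p)"

abbreviation "path l \<equiv> path_from l {}"

definition paths :: "nat \<Rightarrow> nat \<Rightarrow> node list set" where
  "paths l n = {p. path l p \<and> length p = n}"

lemma path_from_append: "path_from l D (u @ w) \<longleftrightarrow> path_from l D u \<and> path_from l (set u \<union> D) w"
  by (induction u arbitrary: D) auto

lemma path_from_distinct: "path_from l D p \<Longrightarrow> distinct p \<and> set p \<inter> D = {}"
  by (induction p arbitrary: D) (auto simp: addable_def)

definition closed_diagram :: "nat \<Rightarrow> node set \<Rightarrow> bool" where
  "closed_diagram l D \<longleftrightarrow> (\<forall>s i j. (s, i, j) \<in> D \<longrightarrow> s < l \<and> 1 \<le> i \<and> 1 \<le> j \<and>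
     (1 < i \<longrightarrow> (s, i - 1, j) \<in> D) \<and> (1 < j \<longrightarrow> (s, i, j - 1) \<in> D))"

lemma closed_diagram_insert: "closed_diagram l D \<Longrightarrow> addable l D x \<Longrightarrow> closed_diagram l (insert x D)"
  by (auto simp: closed_diagram_def addable_def split: prod.splits)

lemma path_from_closed: "closed_diagram l D \<Longrightarrow> path_from l D p \<Longrightarrow> closed_diagram l (set p \<union> D)"
proof (induction p arbitrary: D)
  case (Cons x p)
  then show ?case using Cons.IH[of "insert x D"] closed_diagram_insert by auto
qed simp

lemma path_closed: "path l p \<Longrightarrow> closed_diagram l (set p)"
  using path_from_closed[of l "{}" p] by (simp add: closed_diagram_def)

lemma closed_diagram_down:
  assumes "closed_diagram l D" "(s, i, j) \<in> D" "1 \<le> i'" "i' \<le> i" "1 \<le> j'" "j' \<le> j"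
  shows "(s, i', j') \<in> D"
proof -
  have 1: "(s, i - k, j) \<in> D" if "k < i" for k using that
  proof (induction k)
    case (Suc k)
    then have "(s, i - k - 1, j) \<in> D" using assms(1) unfolding closed_diagram_def
      by (metis Suc_lessD less_diff_conv plus_1_eq_Suc)
    then show ?case by simp
  qed (use assms in simp)
  have 2: "(s, i', j - k) \<in> D" if "k < j" for k using that
  proof (induction k)
    case 0
    then show ?case using 1[of "i - i'"] assms by simp
  next
    case (Suc k)
    then have "(s, i', j - k - 1) \<in> D" using assms(1) unfolding closed_diagram_def
      by (metis Suc_lessD less_diff_conv plus_1_eq_Suc)
    then show ?case by simp
  qed
  from 2[of "j - j'"] assms show ?thesis by simp
qed

text \<open>The first \<open>j\<close> nodes of the first row of component \<open>s\<close> and the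
  nodes of the first column of component \<open>t\<close> from row 2 to row \<open>i'\<close> are
  disjoint, also when \<open>s = t\<close>.\<close>

lemma card_arm_leg:
  assumes D: "closed_diagram l D" "finite D" and x: "(s, i, j) \<in> D" and y: "(t, i', j') \<in> D"
  shows "j + i' \<le> Suc (card D)"
proof -
  have "1 \<le> i" "1 \<le> j" "1 \<le> i'" "1 \<le> j'" using D(1) x y by (auto simp: closed_diagram_def)
  let ?A = "(\<lambda>k. (s, 1, k)) ` {1..j}" and ?B = "(\<lambda>k. (t, k, 1)) ` {2..i'}"
  have "?A \<subseteq> D" using closed_diagram_down[OF D(1) x] \<open>1 \<le> i\<close> by auto
  moreover have "?B \<subseteq> D" using closed_diagram_down[OF D(1) y] \<open>1 \<le> j'\<close> by auto
  ultimately have "card (?A \<union> ?B) \<le> card D" using D(2) by (intro card_mono) auto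
  moreover have "card (?A \<union> ?B) = j + (i' - 1)"
    by (subst card_Un_disjoint) (auto simp: card_image inj_on_def)
  ultimately show ?thesis using \<open>1 \<le> i'\<close> by simp
qed

lemma content_diff_less:
  assumes "closed_diagram l D" "finite D" "x \<in> D" "y \<in> D"
  shows "\<bar>content x - content y\<bar> < int (card D)"
proof -
  obtain s i j t i' j' where xy: "x = (s, i, j)" "y = (t, i', j')" by (cases x, cases y) auto
  have "1 \<le> i" "1 \<le> j" "1 \<le> i'" "1 \<le> j'" using assms xy by (auto simp: closed_diagram_def)
  then show ?thesis
    using card_arm_leg[of l D s i j t i' j'] card_arm_leg[of l D t i' j' s i j] assms
    by (auto simp: content_def xy)
qed

definition adjacent :: "node \<Rightarrow> node \<Rightarrow> bool" where
  "adjacent x y = (case x of (s, i, j) \<Rightarrow> y = (s, i, Suc j) \<or> y = (s, Suc i, j))"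

text \<open>Only the left and the upper neighbour of \<open>y\<close> can be prerequisites for
  adding \<open>y\<close>.\<close>

lemma addable_swap:
  assumes "addable l D x" "addable l (insert x D) y"
  shows "addable l D y \<and> addable l (insert y D) x \<longleftrightarrow> \<not> adjacent x y"
  using assms unfolding addable_def adjacent_def by (cases x; cases y) auto

text \<open>Of two nodes on one diagonal, the lower one requires its upper neighbour in the diagram,
  and that neighbour forces the other node into the diagram as well.\<close>

lemma addable_distinct_content:
  assumes D: "closed_diagram l D" and x: "addable l D x" and y: "addable l D y"
    and "fst x = fst y" "x \<noteq> y"
  shows "content x \<noteq> content y"
proof
  assume c: "content x = content y"
  have *: False if xx: "addable l D (s, i, j)" and yy: "addable l D (s, i', j')" and "i < i'"
     "int j - int i = int j' - int i'" for s i j i' j'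
  proof -
    have "(s, i' - 1, j') \<in> D" "1 \<le> i" "1 \<le> j" using xx yy \<open>i < i'\<close> by (auto simp: addable_def)
    from closed_diagram_down[OF D this(1), of i j] this(2,3) that have "(s, i, j) \<in> D" by auto
    then show False using xx by (simp add: addable_def)
  qed
  obtain s i j i' j' where xy: "x = (s, i, j)" "y = (s, i', j')" using assms(4) by (cases x, cases y) auto
  then show False using *[of s i j i' j'] *[of s i' j' i j] assms c
    by (cases i i' rule: linorder_cases) (auto simp: content_def)
qed

lemma consecutive_distinct_content:
  assumes D: "closed_diagram l D" and x: "addable l D x" and y: "addable l (insert x D) y"
    and "fst x = fst y"
  shows "content x \<noteq> content y"
proof (cases "adjacent x y")
  case True
  then show ?thesis by (auto simp: adjacent_def content_def split: prod.splits)
next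
  case False
  then have "addable l D y" using addable_swap[OF x y] by simp
  moreover have "x \<noteq> y" using y by (auto simp: addable_def split: prod.splits)
  ultimately show ?thesis using addable_distinct_content[OF D x] assms by blast
qed

text \<open>Unless both consecutive pairs are adjacent, an exchange brings \<open>x\<close> and
  \<open>z\<close> together. If both are adjacent and the contents agree, \<open>z\<close> is the
  diagonal successor of \<open>x\<close>; one of its two predecessors is then already in
  \<open>D\<close> and forces \<open>x\<close> into \<open>D\<close>. This provides the third
  denominator of the Yang-Baxter identity.\<close>

lemma consecutive3_distinct_content:
  assumes D: "closed_diagram l D" and x: "addable l D x" and y: "addable l (insert x D) y"
    and z: "addable l (insert y (insert x D)) z" and "fst x = fst z"
  shows "content x \<noteq> content z"
proof (cases "adjacent y z")
  case False
  then have "addable l (insert x D) z" using addable_swap[OF y z] by simp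
  then show ?thesis using consecutive_distinct_content[OF D x] assms by blast
next
  case yz: True
  show ?thesis
  proof (cases "adjacent x y")
    case False
    then have "addable l D y" "addable l (insert y D) x" using addable_swap[OF x y] by auto
    then show ?thesis using consecutive_distinct_content[of l "insert y D" x z] closed_diagram_insert[OF D]
      z assms by (simp add: insert_commute)
  next
    case xy: True
    show ?thesis
    proof
      assume c: "content x = content z"
      obtain s i j where X: "x = (s, i, j)" by (cases x) auto
      from xy yz c have Z: "z = (s, Suc i, Suc j)" and Y: "y = (s, i, Suc j) \<or> y = (s, Suc i, j)"
        by (auto simp: X adjacent_def content_def)
      have "1 \<le> i" "1 \<le> j" using x by (auto simp: X addable_def)
      then have "(s, Suc i, j) \<in> insert y (insert x D)" "(s, i, Suc j) \<in> insert y (insert x D)"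
        using z by (auto simp: Z addable_def)
      then have "(s, Suc i, j) \<in> D \<or> (s, i, Suc j) \<in> D" using Y X by auto
      then have "(s, i, j) \<in> D" using closed_diagram_down[OF D] \<open>1 \<le> i\<close> \<open>1 \<le> j\<close> by (metis le_SucI order_refl)
      then show False using x by (simp add: X addable_def)
    qed
  qed
qed

lemma length_paths: "p \<in> paths l n \<Longrightarrow> length p = n" and path_paths: "p \<in> paths l n \<Longrightarrow> path l p"
  by (auto simp: paths_def)

lemma paths_Suc: "paths l (Suc n) = {p @ [x] | p x. p \<in> paths l n \<and> addable l (set p) x}"
proof -
  have "p \<in> {p @ [x] | p x. p \<in> paths l n \<and> addable l (set p) x}" if "p \<in> paths l (Suc n)" for p
    using that by (cases p rule: rev_cases) (auto simp: paths_def path_from_append)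
  then show ?thesis by (auto simp: paths_def path_from_append)
qed

lemma finite_addable:
  assumes "finite D"
  shows "finite {x. addable l D x}"
proof -
  have "{x. addable l D x} \<subseteq> {..<l} \<times> {1} \<times> {1} \<union> (\<lambda>(s, i, j). (s, Suc i, j)) ` D \<union> (\<lambda>(s, i, j). (s, i, Suc j)) ` D"
  proof
    fix x assume "x \<in> {x. addable l D x}"
    then obtain s i j where x: "x = (s, i, j)" "addable l D (s, i, j)" by (cases x) auto
    show "x \<in> {..<l} \<times> {1} \<times> {1} \<union> (\<lambda>(s, i, j). (s, Suc i, j)) ` D \<union> (\<lambda>(s, i, j). (s, i, Suc j)) ` D"
    proof (cases "1 < i")
      case True
      then have "(s, i - 1, j) \<in> D" "Suc (i - 1) = i" using x by (auto simp: addable_def)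
      then show ?thesis using x by (force intro: rev_image_eqI)
    next
      case i: False
      show ?thesis
      proof (cases "1 < j")
        case True
        then have "(s, i, j - 1) \<in> D" "Suc (j - 1) = j" using x by (auto simp: addable_def)
        then show ?thesis using x by (force intro: rev_image_eqI)
      qed (use i x in \<open>auto simp: addable_def\<close>)
    qed
  qed
  then show ?thesis using assms by (auto intro: finite_subset)
qed

lemma finite_paths: "finite (paths l n)"
proof (induction n)
  case (Suc n)
  have "paths l (Suc n) = (\<Union>p\<in>paths l n. (\<lambda>x. p @ [x]) ` {x. addable l (set p) x})"
    unfolding paths_Suc by auto
  then show ?case using Suc by (simp add: finite_addable)
qed (simp add: paths_def)

section \<open>Seminormal operators on paths\<close>

definition residue :: "'k::field \<Rightarrow> (nat \<Rightarrow> 'k) \<Rightarrow> node \<Rightarrow> 'k" where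
  "residue q Q x = q powi content x * Q (fst x)"

text \<open>The value at \<open>p\<close> collects the contributions of \<open>p\<close> and of the
  exchanged path \<open>p'\<close>. The coefficient from \<open>p'\<close> to \<open>p\<close> is
  \<open>1 + a\<close> with the two nodes in the opposite order; as the two values of
  \<open>a\<close> sum to \<open>q - 1\<close>, it is \<open>q - a\<close>. For adjacent nodes
  \<open>p'\<close> is not a path and \<open>a\<close> itself is \<open>q\<close> or
  \<open>-1\<close>, which accounts for the row and column cases.\<close>

definition path_op :: "nat \<Rightarrow> 'k::field \<Rightarrow> (nat \<Rightarrow> 'k) \<Rightarrow> nat \<Rightarrow> (node list \<Rightarrow> 'k) \<Rightarrow> node list \<Rightarrow> 'k" where
  "path_op l q Q k v p =
     (if k = 0 then Q (fst (hd p)) * v p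
      else
        let x = p ! (k - 1); y = p ! k; a = seminormal_coeff q Q x y; p' = p[k - 1 := y, k := x]
        in a * v p + (if path l p' then (q - a) * v p' else 0))"

lemma path_op_0: "path_op l q Q 0 v p = Q (fst (hd p)) * v p"
  by (simp add: path_op_def)

lemma path_op_swap:
  assumes "k = Suc (length u)"
  shows "path_op l q Q k v (u @ x # y # w) = seminormal_coeff q Q x y * v (u @ x # y # w) +
    (if path l (u @ y # x # w) then (q - seminormal_coeff q Q x y) * v (u @ y # x # w) else 0)"
  using assms by (simp add: path_op_def Let_def nth_append list_update_append)

lemma linear_path_op: "linear_ops (path_op l q Q)"
  unfolding linear_ops_def path_op_def Let_def by (auto simp: fun_eq_iff algebra_simps)

lemma split_at:
  assumes "1 \<le> k" "k < length p"
  obtains u x y w where "p = u @ x # y # w" "k = Suc (length u)"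
proof -
  have "p = take (k - 1) p @ drop (k - 1) p" by simp
  also have "drop (k - 1) p = p ! (k - 1) # drop (Suc (k - 1)) p"
    using assms by (intro Cons_nth_drop_Suc[symmetric]) simp
  also have "drop (Suc (k - 1)) p = p ! k # drop (Suc k) p"
    using assms by (simp add: Cons_nth_drop_Suc)
  finally have "p = take (k - 1) p @ p ! (k - 1) # p ! k # drop (Suc k) p" .
  moreover have "k = Suc (length (take (k - 1) p))" using assms by simp
  ultimately show thesis using that by blast
qed

text \<open>The restriction to paths through the same nodes makes the operators block diagonal with
  respect to shapes.\<close>

lemma path_op_local:
  assumes "k < n" "p \<in> paths l n" "\<And>r. r \<in> paths l n \<Longrightarrow> set r = set p \<Longrightarrow> v r = v' r"
  shows "path_op l q Q k v p = path_op l q Q k v' p"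
proof (cases "k = 0")
  case True
  then show ?thesis using assms by (simp add: path_op_0)
next
  case False
  then have "1 \<le> k" "k < length p" using assms length_paths[of p l n] by auto
  then obtain u x y w where p: "p = u @ x # y # w" "k = Suc (length u)" by (rule split_at)
  have "v (u @ x # y # w) = v' (u @ x # y # w)" using assms p by blast
  moreover have "v (u @ y # x # w) = v' (u @ y # x # w)" if "path l (u @ y # x # w)"
    using that assms(2) p by (intro assms(3)) (auto simp: paths_def)
  ultimately show ?thesis unfolding p(1) path_op_swap[OF p(2)] by simp
qed

lemma q_int_eq: "(q - 1) * q_int q m = q ^ m - 1" for q :: "'k::field"
  unfolding q_int_def using power_diff_1_eq[of q m] by (simp add: mult.commute)

lemma q_int_1: "q_int 1 m = of_nat m"
  by (simp add: q_int_def)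

lemma divide_diff_flip: "X / (X - Y) = - (X / (Y - X))" for X Y :: "'k::field"
  using minus_divide_right[of X "Y - X"] by simp

lemma divide_diff_sum:
  fixes X Y :: "'k::field"
  assumes "X \<noteq> Y"
  shows "Y / (Y - X) + X / (X - Y) = 1"
  unfolding divide_diff_flip[of X Y] using assms by (simp add: diff_divide_distrib[symmetric])

locale separated =
  fixes l n :: nat and q :: "'k::field" and Q :: "nat \<Rightarrow> 'k"
  assumes l: "1 \<le> l" and q0: "q \<noteq> 0" and Q0: "s < l \<Longrightarrow> Q s \<noteq> 0"
    and q_int_nz: "1 \<le> m \<Longrightarrow> m \<le> n \<Longrightarrow> q_int q m \<noteq> 0"
    and Q_sep: "s < l \<Longrightarrow> t < l \<Longrightarrow> s \<noteq> t \<Longrightarrow> \<bar>d\<bar> < int n \<Longrightarrow> q powi d * Q s \<noteq> Q t"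
begin

abbreviation "a \<equiv> seminormal_coeff q Q"
abbreviation "res \<equiv> residue q Q"
abbreviation "F \<equiv> path_op l q Q"

lemma powi_nz: "q powi d \<noteq> 0" using q0 by simp

lemma of_int_nz:
  assumes "q = 1" "d \<noteq> 0" "\<bar>d\<bar> \<le> int n"
  shows "of_int d \<noteq> (0 :: 'k)"
proof -
  have "q_int q (nat \<bar>d\<bar>) \<noteq> 0" using assms by (intro q_int_nz) auto
  then have "of_nat (nat \<bar>d\<bar>) \<noteq> (0 :: 'k)" using assms by (simp add: q_int_1)
  moreover have "d = int (nat \<bar>d\<bar>) \<or> d = - int (nat \<bar>d\<bar>)" by auto
  ultimately show ?thesis by (metis of_int_of_nat_eq of_int_minus neg_equal_0_iff_equal)
qed

lemma powi_ne_1: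
  assumes "q \<noteq> 1" "d \<noteq> 0" "\<bar>d\<bar> \<le> int n"
  shows "q powi d \<noteq> 1"
proof -
  have "q_int q (nat \<bar>d\<bar>) \<noteq> 0" using assms by (intro q_int_nz) auto
  then have *: "q ^ nat \<bar>d\<bar> \<noteq> 1" using q_int_eq[of q "nat \<bar>d\<bar>"] assms by auto
  show ?thesis
  proof (cases "d \<ge> 0")
    case True
    then show ?thesis using * by (simp add: power_int_nonneg_exp)
  next
    case False
    then have "q powi d = inverse (q ^ nat \<bar>d\<bar>)" by (simp add: power_int_def power_inverse)
    then show ?thesis using * by (metis inverse_1 inverse_inverse_eq)
  qed
qed

text \<open>Nonvanishing of the denominator in \<open>seminormal_coeff\<close>. For
  \<open>q = 1\<close> the residues within a component coincide and the difference of contents takes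
  their place.\<close>

definition good :: "node \<Rightarrow> node \<Rightarrow> bool" where
  "good x y \<longleftrightarrow> fst x < l \<and> fst y < l \<and>
     (if fst x = fst y \<and> q = 1 then of_int (content y - content x) \<noteq> (0 :: 'k) else res x \<noteq> res y)"

lemma good_sym: "good x y \<Longrightarrow> good y x"
  by (auto simp: good_def)

lemma goodI:
  assumes "fst x < l" "fst y < l" "fst x = fst y \<Longrightarrow> content x \<noteq> content y \<and> \<bar>content x - content y\<bar> \<le> int n"
    "fst x \<noteq> fst y \<Longrightarrow> \<bar>content x - content y\<bar> < int n"
  shows "good x y"
proof (cases "fst x = fst y")
  case True
  show ?thesis
  proof (cases "q = 1")
    case q: True
    have "of_int (content y - content x) \<noteq> (0 :: 'k)" using assms True by (intro of_int_nz[OF q]) auto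
    then show ?thesis unfolding good_def using assms True q by simp
  next
    case q: False
    have "q powi (content x - content y) \<noteq> 1" using assms True by (intro powi_ne_1 q) auto
    then have "q powi content x \<noteq> q powi content y" using powi_nz by (simp add: power_int_diff q0)
    then show ?thesis using True q assms Q0[of "fst x"] by (auto simp: good_def residue_def)
  qed
next
  case False
  have "q powi (content x - content y) * Q (fst x) \<noteq> Q (fst y)" using assms False by (intro Q_sep) auto
  then have "res x \<noteq> res y" using powi_nz by (auto simp: residue_def power_int_diff q0 field_simps)
  then show ?thesis using False assms by (simp add: good_def)
qed

text \<open>For \<open>q \<noteq> 1\<close> the branch for equal components is the same rational
  function of the residues, because the common parameter cancels.\<close>

lemma a_eq_res:
  assumes "q \<noteq> 1" "good x y"
  shows "a x y = (q - 1) * res y / (res y - res x)"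
proof (cases "fst x = fst y")
  case True
  obtain s i j i' j' where xy: "x = (s, i, j)" "y = (s, i', j')" using True by (cases x, cases y) auto
  let ?d = "content y - content x"
  have "a x y = q powi ?d * (q - 1) / (q powi ?d - 1)"
    using assms by (simp add: seminormal_coeff_def xy content_def Let_def)
  moreover have "Q s \<noteq> 0" using assms Q0 by (auto simp: good_def xy)
  moreover have "q powi ?d * res x = res y" using powi_nz by (simp add: residue_def xy power_int_diff q0)
  moreover have "res x \<noteq> 0" using calculation(2) powi_nz by (simp add: residue_def xy)
  moreover have "res x \<noteq> res y" using assms by (simp add: good_def)
  moreover have "q powi ?d \<noteq> 1" using calculation(3,5) by auto
  moreover have "(q - 1) * (D * X) / (D * X - X) = D * (q - 1) / (D - 1)" if "X \<noteq> 0" for D X :: 'k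
  proof -
    have "(q - 1) * (D * X) / (D * X - X) = (D * (q - 1) * X) / ((D - 1) * X)"
      by (simp add: algebra_simps)
    then show ?thesis using that by simp
  qed
  ultimately have "a x y = (q - 1) * (q powi ?d * res x) / (q powi ?d * res x - res x)" by metis
  then show ?thesis using \<open>q powi ?d * res x = res y\<close> by simp
next
  case False
  then show ?thesis
    by (cases x, cases y) (simp add: seminormal_coeff_def residue_def content_def Let_def)
qed

lemma a_q1:
  assumes "q = 1"
  shows "a x y = (if fst x = fst y then 1 / of_int (content y - content x) else 0)"
  using assms by (cases x, cases y) (simp add: seminormal_coeff_def content_def Let_def)

lemma a_sum:
  assumes "good x y"
  shows "a x y + a y x = q - 1"
proof (cases "q = 1")
  case True
  have "of_int (content x - content y) = - (of_int (content y - content x) :: 'k)" by simp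
  then have "1 / of_int (content y - content x) + 1 / of_int (content x - content y) = (0 :: 'k)"
    by (simp only: divide_minus_right) simp
  then show ?thesis unfolding a_q1[OF True] by (auto simp: True)
next
  case False
  have "res x \<noteq> res y" using assms False by (simp add: good_def)
  then have "res y / (res y - res x) + res x / (res x - res y) = 1" by (rule divide_diff_sum)
  then have "(q - 1) * (res y / (res y - res x) + res x / (res x - res y)) = q - 1" by simp
  then show ?thesis using a_eq_res[OF False assms] a_eq_res[OF False good_sym[OF assms]]
    by (simp add: distrib_left)
qed

text \<open>Together with \<open>a_sum\<close> this makes the off-diagonal part of
  \<open>T_k L_k T_k\<close> vanish.\<close>

lemma a_res:
  assumes "good x y"
  shows "a x y * res x + a y x * res y = 0"
proof (cases "q = 1")
  case True
  have "a x y + a y x = 0" using a_sum[OF assms] True by simp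
  moreover have "a x y = 0 \<or> Q (fst x) = Q (fst y)" unfolding a_q1[OF True] by auto
  moreover have "res z = Q (fst z)" for z using True by (simp add: residue_def)
  ultimately show ?thesis by (auto simp: distrib_right[symmetric] add_eq_0_iff)
next
  case False
  have "res x \<noteq> res y" using assms False by (simp add: good_def)
  moreover
  have "(q - 1) * Y / (Y - X) * X + (q - 1) * X / (X - Y) * Y = 0" if "X \<noteq> Y" for X Y :: 'k
    unfolding times_divide_eq_right[symmetric] divide_diff_flip[of X Y] by simp
  ultimately show ?thesis using a_eq_res[OF False assms] a_eq_res[OF False good_sym[OF assms]]
    by simp
qed

text \<open>In terms of residues this is an identity of rational functions with the differences as
  denominators. For \<open>q = 1\<close> it is the addition of reciprocals of content differences,
  and both sides vanish unless all three components agree.\<close>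

lemma a_yang_baxter:
  assumes "good x y" "good y z" "good x z"
  shows "a x y * a y z = a x z * (a x y + a y z - (q - 1))"
proof (cases "q = 1")
  case True
  show ?thesis
  proof (cases "fst x = fst y \<and> fst y = fst z")
    case same: True
    let ?u = "of_int (content y - content x) :: 'k" and ?v = "of_int (content z - content y) :: 'k"
    have nz: "?u \<noteq> 0" "?v \<noteq> 0" "?u + ?v \<noteq> 0"
      using assms same True unfolding good_def by auto
    have "a x y = 1 / ?u" "a y z = 1 / ?v" "a x z = 1 / (?u + ?v)" unfolding a_q1[OF True] using same by simp_all
    moreover have "1 / U * (1 / V) = 1 / (U + V) * (1 / U + 1 / V - (q - 1))"
      if "U \<noteq> 0" "V \<noteq> 0" "U + V \<noteq> 0" for U V :: 'k
      unfolding True using that by (simp add: add_frac_eq) (simp add: add.commute)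
    ultimately show ?thesis using nz by metis
  next
    case False
    then show ?thesis unfolding a_q1[OF True] by (auto simp: True)
  qed
next
  case False
  have nz: "res x \<noteq> res y" "res y \<noteq> res z" "res x \<noteq> res z" using assms False by (auto simp: good_def)
  have *: "Y / (Y - X) * (Z / (Z - Y)) = Z / (Z - X) * (Y / (Y - X) + Z / (Z - Y) - 1)"
    if "X \<noteq> Y" "Y \<noteq> Z" "X \<noteq> Z" for X Y Z :: 'k
    using that by (simp add: divide_simps) (simp add: algebra_simps)
  have ring: "c * c * (W * (U + V - 1)) = c * W * (c * U + c * V - c)" for c U V W :: 'k
    by (simp add: algebra_simps)
  have "a x y * a y z = (q - 1) * (q - 1) * (res y / (res y - res x) * (res z / (res z - res y)))"
    using a_eq_res[OF False] assms by simp
  also have "\<dots> = (q - 1) * (res z / (res z - res x)) *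
     ((q - 1) * (res y / (res y - res x)) + (q - 1) * (res z / (res z - res y)) - (q - 1))"
    unfolding *[OF nz] using ring by blast
  finally show ?thesis using a_eq_res[OF False] assms by simp
qed

lemma a_adjacent:
  assumes "adjacent x y"
  shows "a x y = q \<or> a x y = - 1"
proof -
  obtain s i j where x: "x = (s, i, j)" by (cases x) auto
  have inv: "inverse q - 1 = - (inverse q * (q - 1))" using q0 by (simp add: right_diff_distrib)
  have "a x y = q" if "y = (s, i, Suc j)"
    by (simp add: seminormal_coeff_def x that)
  moreover have "a x y = - 1" if "y = (s, Suc i, j)"
    using q0 by (simp add: seminormal_coeff_def Let_def x that power_int_minus inv)
  ultimately show ?thesis using assms by (auto simp: adjacent_def x)
qed

section \<open>The defining relations on paths\<close>

lemma path_distinct: "path l p \<Longrightarrow> distinct p" using path_from_distinct by blast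

lemma path_good2:
  assumes "path l (u @ x # y # w)" "length (u @ x # y # w) \<le> n"
  shows "good x y"
proof -
  have D: "closed_diagram l (set u)" "addable l (set u) x" "addable l (insert x (set u)) y"
    using assms path_closed by (auto simp: path_from_append)
  have c: "closed_diagram l (set (u @ x # y # w))" using path_closed[OF assms(1)] .
  have "\<bar>content x - content y\<bar> < int (card (set (u @ x # y # w)))"
    by (rule content_diff_less[OF c]) auto
  then have "\<bar>content x - content y\<bar> < int n"
    using assms(2) card_length[of "u @ x # y # w"] by linarith
  then show ?thesis using D consecutive_distinct_content[OF D(1,2,3)]
    by (intro goodI) (auto simp: addable_def split: prod.splits)
qed

lemma path_good3:
  assumes "path l (u @ x # y # z # w)" "length (u @ x # y # z # w) \<le> n"
  shows "good x z"
proof -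
  have D: "closed_diagram l (set u)" "addable l (set u) x" "addable l (insert x (set u)) y"
    "addable l (insert y (insert x (set u))) z"
    using assms path_closed by (auto simp: path_from_append)
  have c: "closed_diagram l (set (u @ x # y # z # w))" using path_closed[OF assms(1)] .
  have "\<bar>content x - content z\<bar> < int (card (set (u @ x # y # z # w)))"
    by (rule content_diff_less[OF c]) auto
  then have "\<bar>content x - content z\<bar> < int n"
    using assms(2) card_length[of "u @ x # y # z # w"] by linarith
  then show ?thesis using D consecutive3_distinct_content[OF D]
    by (intro goodI) (auto simp: addable_def split: prod.splits)
qed

lemma path_swap:
  assumes "path l (u @ x # y # w)"
  shows "path l (u @ y # x # w) \<longleftrightarrow> \<not> adjacent x y"
  using assms addable_swap[of l "set u" x y] by (auto simp: path_from_append insert_commute)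

text \<open>On a path and its exchange the diagonal entries are \<open>a x y\<close> and
  \<open>q - 1 - a x y\<close>; if the exchange is not a path, the single entry is one of the roots
  \<open>q\<close> and \<open>-1\<close>.\<close>

lemma F_quadratic:
  assumes "p \<in> paths l n" "1 \<le> k" "k < n"
  shows "F k (F k v) p = (q - 1) * F k v p + q * v p"
proof -
  have "1 \<le> k" "k < length p" using assms length_paths by auto
  then obtain u x y w where p: "p = u @ x # y # w" "k = Suc (length u)" by (rule split_at)
  have path: "path l (u @ x # y # w)" "length (u @ x # y # w) \<le> n" using assms p by (auto simp: paths_def)
  have ayx: "a y x = q - 1 - a x y" using a_sum[OF path_good2[OF path]] by (simp add: algebra_simps)
  show ?thesis
  proof (cases "adjacent x y")
    case True
    then show ?thesis unfolding p(1) path_op_swap[OF p(2)]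
      using path_swap[OF path(1)] a_adjacent[OF True] by (auto simp: algebra_simps)
  next
    case False
    then show ?thesis unfolding p(1) path_op_swap[OF p(2)]
      using path_swap[OF path(1)] path(1) by (simp add: ayx) (simp add: algebra_simps)
  qed
qed

text \<open>Only the orders of three consecutive nodes matter. The two sides differ by multiples of
  the Yang-Baxter defect \<open>E\<close> off the diagonal and by \<open>D\<close> on it. A blocked
  exchange makes the corresponding coefficient \<open>q\<close> or \<open>-1\<close>, and
  \<open>D\<close> has to be examined separately for these values.\<close>

lemma F_braid:
  assumes "p \<in> paths l n" "1 \<le> k" "k + 1 < n"
  shows "F k (F (Suc k) (F k v)) p = F (Suc k) (F k (F (Suc k) v)) p"
proof -
  have "1 \<le> k" "k < length p" using assms length_paths by auto
  then obtain u x y w' where p': "p = u @ x # y # w'" "k = Suc (length u)" by (rule split_at)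
  then obtain z w where "w' = z # w" using assms length_paths[OF assms(1)] by (cases w') auto
  with p' have p: "p = u @ x # y # z # w" by simp
  have k: "k = Suc (length u)" "Suc k = Suc (length (u @ [s]))" for s using p' by auto
  have path: "path l (u @ x # y # z # w)" "length (u @ x # y # z # w) \<le> n"
    using assms p by (auto simp: paths_def)
  have S1: "F k v (u @ r # s # t # w) = a r s * v (u @ r # s # t # w) +
      (if path l (u @ s # r # t # w) then (q - a r s) * v (u @ s # r # t # w) else 0)" for r s t v
    by (rule path_op_swap[OF k(1)])
  have S2: "F (Suc k) v (u @ r # s # t # w) = a s t * v (u @ r # s # t # w) +
      (if path l (u @ r # t # s # w) then (q - a s t) * v (u @ r # t # s # w) else 0)" for r s t v
    using path_op_swap[OF k(2)[of r], of l q Q v s t w] by simp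
  have good: "good x y" "good y z" "good x z"
    using path_good2[of u x y "z # w"] path_good2[of "u @ [x]" y z w] path_good3[OF path] path by auto
  define A B C where "A = a x y" and "B = a y z" and "C = a x z"
  have eqs: "a x y = A" "a y z = B" "a x z = C" "a y x = q - 1 - A" "a z y = q - 1 - B" "a z x = q - 1 - C"
    using a_sum[OF good(1)] a_sum[OF good(2)] a_sum[OF good(3)]
    by (auto simp: A_def B_def C_def algebra_simps)
  have yb: "A * B = C * (A + B - (q - 1))" using a_yang_baxter[OF good] by (simp add: A_def B_def C_def)
  have P: "path l (u @ y # x # z # w) \<longleftrightarrow> \<not> adjacent x y"
    "path l (u @ x # z # y # w) \<longleftrightarrow> \<not> adjacent y z"
    using path_swap[of u x y "z # w"] path_swap[of "u @ [x]" y z w] path by auto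
  have P1: "path l (u @ y # z # x # w) \<longleftrightarrow> \<not> adjacent x z" if "path l (u @ y # x # z # w)"
    using path_swap[of "u @ [y]" x z w] that by auto
  have P2: "path l (u @ z # x # y # w) \<longleftrightarrow> \<not> adjacent x z" if "path l (u @ x # z # y # w)"
    using path_swap[of "u" x z "y # w"] that by auto
  have P3: "path l (u @ z # y # x # w) \<longleftrightarrow> \<not> adjacent y z" if "path l (u @ y # z # x # w)"
    using path_swap[of u y z "x # w"] that by auto
  have P4: "path l (u @ z # y # x # w) \<longleftrightarrow> \<not> adjacent x y" if "path l (u @ z # x # y # w)"
    using path_swap[of "u @ [z]" x y w] that by auto
  have adj: "adjacent x y \<Longrightarrow> A = q \<or> A = -1" "adjacent y z \<Longrightarrow> B = q \<or> B = -1" "adjacent x z \<Longrightarrow> C = q \<or> C = -1"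
    using a_adjacent by (auto simp: A_def B_def C_def)
  define Vxyz Vyxz Vxzy Vyzx Vzxy Vzyx where V: "Vxyz = v (u @ x # y # z # w)" "Vyxz = v (u @ y # x # z # w)"
    "Vxzy = v (u @ x # z # y # w)" "Vyzx = v (u @ y # z # x # w)" "Vzxy = v (u @ z # x # y # w)"
    "Vzyx = v (u @ z # y # x # w)"
  note rules = S1 S2 eqs V[symmetric] P path(1)
  define E where "E = A * B - C * (A + B - (q - 1))"
  define D where "D = A * B * (A - B) + C * ((if adjacent x y then 0 else (q - A) * (1 + A)) -
      (if adjacent y z then 0 else (q - B) * (1 + B)))"
  \<comment> \<open>The adjacencies decide which of the six orders are paths, so that one expansion
    is needed for each combination of them.\<close>
  have "F k (F (Suc k) (F k v)) p - F (Suc k) (F k (F (Suc k) v)) p =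
      Vxyz * D + (if adjacent x y then 0 else Vyxz * (q - A) * E) -
      (if adjacent y z then 0 else Vxzy * (q - B) * E)"
    unfolding p D_def E_def using P1 P2 P3 P4
    by (cases "adjacent x y"; cases "adjacent y z"; cases "adjacent x z"; simp add: rules)
       (simp_all add: algebra_simps)
  moreover have "E = 0" using yb by (simp add: E_def)
  moreover have "D = 0"
  proof (cases "adjacent x y")
    case xy: True
    show ?thesis
    proof (cases "adjacent y z")
      case yz: True
      \<comment> \<open>If the two roots were different, then \<open>A + B = q - 1\<close>, and the
        Yang-Baxter identity would give \<open>- q = 0\<close>.\<close>
      have "A = B" using adj(1)[OF xy] adj(2)[OF yz] yb q0 by auto
      then show ?thesis using xy yz by (simp add: D_def)
    next
      case yz: False
      from adj(1)[OF xy] have "A * B * (A - B) = C * ((q - B) * (1 + B))"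
      proof
        assume A: "A = q"
        have "A * B = C * (1 + B)" using yb by (simp add: A algebra_simps)
        then have "A * B * (A - B) = C * (1 + B) * (A - B)" by (rule arg_cong)
        then show ?thesis unfolding A by (simp only: mult_ac)
      next
        assume A: "A = - 1"
        have B: "B = C * (q - B)" using yb by (simp add: A algebra_simps)
        have "A * B * (A - B) = B * (1 + B)" by (simp add: A algebra_simps)
        also have "\<dots> = C * (q - B) * (1 + B)" by (rule arg_cong[OF B, of "\<lambda>t. t * (1 + B)"])
        finally show ?thesis by (simp only: mult.assoc)
      qed
      then show ?thesis using xy yz by (simp add: D_def)
    qed
  next
    case xy: False
    show ?thesis
    proof (cases "adjacent y z")
      case yz: True
      from adj(2)[OF yz] have "A * B * (B - A) = C * ((q - A) * (1 + A))"
      proof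
        assume B: "B = q"
        have "A * B = C * (1 + A)" using yb by (simp add: B algebra_simps)
        then have "A * B * (B - A) = C * (1 + A) * (B - A)" by (rule arg_cong)
        then show ?thesis unfolding B by (simp only: mult_ac)
      next
        assume B: "B = - 1"
        have A: "A = C * (q - A)" using yb by (simp add: B algebra_simps)
        have "A * B * (B - A) = A * (1 + A)" by (simp add: B algebra_simps)
        also have "\<dots> = C * (q - A) * (1 + A)" by (rule arg_cong[OF A, of "\<lambda>t. t * (1 + A)"])
        finally show ?thesis by (simp only: mult.assoc)
      qed
      then show ?thesis using xy yz by (simp add: D_def algebra_simps)
    next
      case yz: False
      have "D = (A - B) * E" using xy yz by (simp add: D_def E_def algebra_simps)
      then show ?thesis using \<open>E = 0\<close> by simp
    qed
  qed
  ultimately show ?thesis by (simp split: if_splits)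
qed

end

context separated
begin

lemma F_far_commute:
  assumes p: "p \<in> paths l n" and k: "1 \<le> k" "k + 1 < m" "m < n"
  shows "F k (F m v) p = F m (F k v) p"
proof -
  have "1 \<le> k" "k < length p" using assms length_paths by auto
  then obtain u x y w where 1: "p = u @ x # y # w" "k = Suc (length u)" by (rule split_at)
  have "1 \<le> m - k - 1" "m - k - 1 < length w" using 1 k length_paths[OF p] by auto
  then obtain u' x' y' w' where 2: "w = u' @ x' # y' # w'" "m - k - 1 = Suc (length u')" by (rule split_at)
  have m: "m = Suc (length (u @ r # s # u'))" for r s using 1 2 k by auto
  have S1: "F k v (u @ r # s # w) = a r s * v (u @ r # s # w) +
     (if path l (u @ s # r # w) then (q - a r s) * v (u @ s # r # w) else 0)" for r s w v
    by (rule path_op_swap[OF 1(2)])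
  have S2: "F m v (u @ r # s # u' @ r' # s' # w') = a r' s' * v (u @ r # s # u' @ r' # s' # w') +
     (if path l (u @ r # s # u' @ s' # r' # w') then (q - a r' s') * v (u @ r # s # u' @ s' # r' # w') else 0)"
    for r s r' s' v using path_op_swap[OF m[of r s], of l q Q v r' s' w'] by simp
  have P: "path l (u @ x # y # u' @ x' # y' # w')" using p 1 2 by (simp add: paths_def)
  then have "path l (u @ y # x # u' @ y' # x' # w') \<longleftrightarrow>
      path l (u @ y # x # u' @ x' # y' # w') \<and> path l (u @ x # y # u' @ y' # x' # w')"
    by (auto simp: path_from_append insert_commute)
  then show ?thesis unfolding 1(1) 2(1) by (simp add: S1 S2) (simp add: algebra_simps)
qed

lemma F_0_commute:
  assumes p: "p \<in> paths l n" and k: "1 < k" "k < n"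
  shows "F 0 (F k v) p = F k (F 0 v) p"
proof -
  have "1 \<le> k" "k < length p" using assms length_paths by auto
  then obtain u x y w where 1: "p = u @ x # y # w" "k = Suc (length u)" by (rule split_at)
  then have "u \<noteq> []" using k by auto
  then show ?thesis unfolding 1(1) path_op_swap[OF 1(2)] path_op_0 by (simp add: algebra_simps)
qed

text \<open>The word lacks the normalising power of \<open>q\<close> in \<open>L k\<close>. The word
  for \<open>Suc k\<close> is \<open>T_k X T_k\<close> with \<open>X\<close> diagonal by induction;
  the contribution of the exchanged path cancels by \<open>a_res\<close>, and the diagonal entry
  becomes \<open>q\<close> times the residue of the next node, up to the power already
  present.\<close>

lemma F_L_word:
  assumes "p \<in> paths l n" "1 \<le> k" "k \<le> n"
  shows "foldr F (rev [1..<k] @ [0] @ [1..<k]) v p = q ^ (k - 1) * res (p ! (k - 1)) * v p"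
  using assms(2,1,3)
proof (induction k arbitrary: p v rule: nat_induct_at_least)
  case base
  then have "length p = n" "1 \<le> n" by (auto simp: paths_def)
  then obtain x w where p: "p = x # w" by (cases p) auto
  then have "content x = 0" using base by (auto simp: paths_def addable_def content_def split: prod.splits)
  then show ?case using p by (simp add: path_op_0 residue_def)
next
  case (Suc k)
  define X where "X = foldr F (rev [1..<k] @ [0] @ [1..<k])"
  have fold: "foldr F (rev [1..<Suc k] @ [0] @ [1..<Suc k]) v = F k (X (F k v))"
    using Suc.hyps by (simp add: X_def)
  have "1 \<le> k" "k < length p" using Suc length_paths by auto
  then obtain u x y w where p: "p = u @ x # y # w" "k = Suc (length u)" by (rule split_at)
  have path: "path l (u @ x # y # w)" "length (u @ x # y # w) \<le> n" using Suc p by (auto simp: paths_def)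
  have W: "X v' (u @ r # s # w) = q ^ (k - 1) * res r * v' (u @ r # s # w)"
    if "path l (u @ r # s # w)" for r s v'
    using Suc.IH[of "u @ r # s # w" v', folded X_def] that Suc.prems p by (auto simp: paths_def nth_append)
  have g: "good x y" using path_good2[OF path] .
  define A where "A = a x y"
  have ayx: "a x y = A" "a y x = q - 1 - A" using a_sum[OF g] by (auto simp: A_def algebra_simps)
  have r: "A * res x + (q - 1 - A) * res y = 0" using a_res[OF g] by (simp add: ayx)
  have "F k (X (F k v)) p = q ^ (k - 1) * (q * res y * v p)"
  proof (cases "adjacent x y")
    case True
    then have "F k (X (F k v)) p = q ^ (k - 1) * (A * A * res x * v p)"
      unfolding p(1) path_op_swap[OF p(2)] using path_swap[OF path(1)] path(1)
      by (simp add: W path_op_swap[OF p(2)] ayx mult_ac)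
    moreover have "A * A * res x = q * res y"
    proof -
      have "A * res x = (A - (q - 1)) * res y" using r by (simp add: algebra_simps)
      then have "A * (A * res x) = A * ((A - (q - 1)) * res y)" by (rule arg_cong)
      \<comment> \<open>For adjacent nodes \<open>A\<close> is a root of the quadratic
        relation.\<close>
      moreover have "A * (A - (q - 1)) = q" using a_adjacent[OF True] by (auto simp: A_def algebra_simps)
      ultimately show ?thesis by (metis mult.assoc)
    qed
    ultimately show ?thesis by simp
  next
    case False
    then have "F k (X (F k v)) p = q ^ (k - 1) *
      ((A * A * res x + (q - A) * (1 + A) * res y) * v p +
       (q - A) * (A * res x + (q - 1 - A) * res y) * v (u @ y # x # w))"
      unfolding p(1) path_op_swap[OF p(2)] using path_swap[OF path(1)] path(1)
      by (simp add: W path_op_swap[OF p(2)] ayx) (simp add: algebra_simps)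
    moreover have "A * A * res x + (q - A) * (1 + A) * res y = q * res y + A * (A * res x + (q - 1 - A) * res y)"
      by (simp add: algebra_simps)
    ultimately show ?thesis using r by simp
  qed
  moreover have "p ! (Suc k - 1) = y" using p by (simp add: nth_append)
  moreover have "q ^ (Suc k - 1) = q ^ (k - 1) * q" using Suc.hyps by (cases k) auto
  ultimately show ?case unfolding fold by simp
qed

text \<open>\<open>T_1 T_0 T_1\<close> is a multiple of \<open>L_2\<close> and hence diagonal, as is
  \<open>T_0\<close>.\<close>

lemma F_0_braid:
  assumes "p \<in> paths l n" "2 \<le> n"
  shows "F 0 (F 1 (F 0 (F 1 v))) p = F 1 (F 0 (F 1 (F 0 v))) p"
proof -
  have L2: "F 1 (F 0 (F 1 v)) r = q * res (r ! 1) * v r" if "r \<in> paths l n" for r v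
    using F_L_word[OF that, of 2 v] assms(2) by (simp add: upt_rec)
  show ?thesis unfolding L2[OF assms(1)] path_op_0 using L2[OF assms(1)] by simp
qed

lemma rep_cyclotomic:
  assumes "p \<in> paths l n" "1 \<le> n"
  shows "rep F (\<Prod>s\<leftarrow>[0..<l]. free_gen 0 - free_const (Q s)) v p = 0"
proof -
  have "rep F (\<Prod>s\<leftarrow>ss. free_gen 0 - free_const (Q s)) v p = (\<Prod>s\<leftarrow>ss. Q (fst (hd p)) - Q s) * v p" for ss v
    by (induction ss arbitrary: v)
       (simp_all add: rep_one rep_mult[OF linear_path_op] rep_diff rep_gen rep_const path_op_0 algebra_simps)
  moreover have "fst (hd p) < l"
    using assms by (cases p) (auto simp: paths_def addable_def split: prod.splits)
  then have "(\<Prod>s\<leftarrow>[0..<l]. Q (fst (hd p)) - Q s) = 0" by (auto simp: prod_list_zero_iff)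
  ultimately show ?thesis by simp
qed

lemma rep_F_relations:
  assumes "r \<in> ak_relations l n q Q" "p \<in> paths l n" "1 \<le> n"
  shows "rep F r v p = 0"
proof -
  note rules = rep_mult[OF linear_path_op] rep_diff rep_add rep_gen rep_const rep_one
  consider "r = (\<Prod>s\<leftarrow>[0..<l]. free_gen 0 - free_const (Q s))"
    | i where "1 \<le> i" "i < n" "r = (free_gen i - free_const q) * (free_gen i + 1)"
    | "2 \<le> n" "r = free_gen 0 * free_gen 1 * free_gen 0 * free_gen 1
              - free_gen 1 * free_gen 0 * free_gen 1 * free_gen 0"
    | i where "1 \<le> i" "i + 1 < n" "r = free_gen i * free_gen (i + 1) * free_gen i
        - free_gen (i + 1) * free_gen i * free_gen (i + 1)"
    | i j where "i + 1 < j" "j < n" "r = free_gen i * free_gen j - free_gen j * free_gen i"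
    using assms(1) unfolding ak_relations_def by (auto split: if_splits)
  then show ?thesis
  proof cases
    case 1
    then show ?thesis using rep_cyclotomic assms by simp
  next
    case (2 i)
    have "rep F (free_gen i + 1) v = (\<lambda>u. 1 * F i v u + v u)" by (simp add: rules fun_eq_iff)
    then have "rep F r v p = F i (\<lambda>u. 1 * F i v u + v u) p - q * (1 * F i v p + v p)"
      unfolding 2(3) by (simp only: rules)
    also have "F i (\<lambda>u. 1 * F i v u + v u) p = F i (F i v) p + F i v p"
    proof -
      have "F i (\<lambda>u. 1 * F i v u + v u) = (\<lambda>u. 1 * F i (F i v) u + F i v u)"
        using linear_path_op[of l q Q] unfolding linear_ops_def by blast
      then show ?thesis by simp
    qed
    finally show ?thesis using F_quadratic[OF assms(2) 2(1,2)] by (simp add: algebra_simps)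
  next
    case 3
    then show ?thesis using F_0_braid[OF assms(2)] by (simp add: rules)
  next
    case (4 i)
    then show ?thesis using F_braid[OF assms(2), of i] by (simp add: rules)
  next
    case (5 i j)
    then show ?thesis using F_far_commute[OF assms(2), of i j] F_0_commute[OF assms(2), of j]
      by (cases "i = 0") (simp_all add: rules)
  qed
qed

lemma rep_F_local:
  assumes "x \<in> carrier (free_algebra n)" "p \<in> paths l n" "\<And>r. r \<in> paths l n \<Longrightarrow> v r = v' r"
  shows "rep F x v p = rep F x v' p"
proof (rule rep_local[of "{..<n}" "paths l n"])
  show "\<And>w. w \<in> Poly_Mapping.keys x \<Longrightarrow> set (letters w) \<subseteq> {..<n}"
    using assms(1) by (simp add: free_algebra_carrier_iff)
  show "F k v p = F k v' p" if "k \<in> {..<n}" "p \<in> paths l n" "\<And>r. r \<in> paths l n \<Longrightarrow> v r = v' r" for k v v' p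
    using that by (intro path_op_local[of k n p l]) auto
qed (use assms in auto)

text \<open>The annihilator is formed with all functions but only with paths of length
  \<open>n\<close>, since nothing is known about the operators elsewhere; locality shows that it is
  nevertheless a left ideal.\<close>

lemma rep_F_ideal:
  assumes "x \<in> ak_ideal l n q Q" "p \<in> paths l n" "1 \<le> n"
  shows "rep F x v p = 0"
proof -
  let ?J = "{x \<in> carrier (free_algebra n). \<forall>v. \<forall>p\<in>paths l n. rep F x v p = 0}"
  have "ideal ?J (free_algebra n)"
  proof (rule ideal_free_algebraI)
    fix x r :: "'k free_alg" assume x: "x \<in> ?J" and r: "r \<in> carrier (free_algebra n)"
    have "rep F (r * x) v p = 0" if "p \<in> paths l n" for v p
    proof -
      have "rep F (r * x) v p = rep F r (\<lambda>_. 0) p"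
        unfolding rep_mult[OF linear_path_op] using x that by (intro rep_F_local[OF r that]) auto
      also have "\<dots> = 0" by (simp add: rep_def foldr_linear_zero[OF linear_path_op])
      finally show ?thesis .
    qed
    then show "r * x \<in> ?J" using x r free_algebra_closed(3) by auto
    show "x * r \<in> ?J" using x r free_algebra_closed(3) by (auto simp: rep_mult[OF linear_path_op])
  qed (auto simp: rep_zero rep_add free_algebra_closed)
  moreover have "ak_relations l n q Q \<subseteq> ?J"
    using ak_relations_carrier[OF assms(3)] rep_F_relations[OF _ _ assms(3)] by blast
  ultimately have "ak_ideal l n q Q \<subseteq> ?J"
    unfolding ak_ideal_def by (intro ring.genideal_minimal[OF ring_free_algebra])
  then show ?thesis using assms by blast
qed

end

section \<open>Hook lengths\<close>

lemma partition_antimono: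
  assumes "is_partition p" "1 \<le> i" "i \<le> i'"
  shows "p i' \<le> p i"
proof -
  have "p (i + k) \<le> p i" for k
  proof (induction k)
    case (Suc k)
    have "p (Suc (i + k)) \<le> p (i + k)" using assms unfolding is_partition_def by simp
    then show ?case using Suc by simp
  qed simp
  from this[of "i' - i"] assms show ?thesis by simp
qed

lemma partition_set_finite:
  assumes "is_partition p" "1 \<le> j"
  shows "finite {i. 1 \<le> i \<and> j \<le> p i}"
proof (rule finite_subset)
  show "{i. 1 \<le> i \<and> j \<le> p i} \<subseteq> {i. p i \<noteq> 0}" using assms by auto
  show "finite {i. p i \<noteq> 0}" using assms by (simp add: is_partition_def)
qed

lemma conj_part_iff:
  assumes p: "is_partition p" "1 \<le> i" "1 \<le> j"
  shows "i \<le> conj_part p j \<longleftrightarrow> j \<le> p i"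
proof
  let ?S = "{i. 1 \<le> i \<and> j \<le> p i}"
  have fin: "finite ?S" by (rule partition_set_finite) (use p in auto)
  show "i \<le> conj_part p j" if "j \<le> p i"
  proof -
    have "{1..i} \<subseteq> ?S" using that partition_antimono[OF p(1)] by (auto intro: le_trans)
    then show ?thesis unfolding conj_part_def using card_mono[OF fin, of "{1..i}"] by simp
  qed
  show "j \<le> p i" if "i \<le> conj_part p j"
  proof (rule ccontr)
    assume "\<not> j \<le> p i"
    then have "?S \<subseteq> {1..<i}"
      using partition_antimono[OF p(1) p(2)] by (auto simp: not_le) (meson le_less_trans not_le)
    from card_mono[OF _ this] have "card ?S \<le> i - 1" by simp
    then show False using that p(2) by (simp add: conj_part_def)
  qed
qed

lemma conj_part_antimono:
  assumes p: "is_partition p" "1 \<le> j" "j \<le> j'"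
  shows "conj_part p j' \<le> conj_part p j"
proof (cases "conj_part p j' = 0")
  case False
  then have "1 \<le> conj_part p j'" by simp
  then show ?thesis using conj_part_iff[OF p(1), of "conj_part p j'" j'] conj_part_iff[OF p(1), of "conj_part p j'" j] p
    by simp
qed simp

lemma young_finite:
  assumes "is_partition p"
  shows "finite (young p)"
proof -
  have "young p \<subseteq> (SIGMA i:{i. p i \<noteq> 0}. {1..p i})" by (auto simp: young_def)
  moreover have "finite (SIGMA i:{i. p i \<noteq> 0}. {1..p i})"
    using assms by (intro finite_SigmaI) (auto simp: is_partition_def)
  ultimately show ?thesis by (rule finite_subset)
qed

lemma young_iff_conj: "is_partition p \<Longrightarrow> (i, j) \<in> young p \<longleftrightarrow> 1 \<le> i \<and> 1 \<le> j \<and> i \<le> conj_part p j"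
  using conj_part_iff[of p i j] by (auto simp: young_def)

lemma part_zero_iff:
  assumes "is_partition p" "1 \<le> i"
  shows "p i = 0 \<longleftrightarrow> conj_part p 1 < i"
  using conj_part_iff[OF assms, of 1] by auto

lemma psize_eq:
  assumes p: "is_partition p" "conj_part p 1 \<le> N"
  shows "psize p = (\<Sum>i=1..N. p i)"
proof -
  have "p i = 0" if "i \<notin> {1..N}" for i
  proof (cases "i = 0")
    case True
    then show ?thesis using p(1) by (simp add: is_partition_def)
  next
    case False
    then show ?thesis using that part_zero_iff[OF p(1), of i] p(2) by simp
  qed
  then have "{i. p i \<noteq> 0} \<subseteq> {1..N}" by (metis (mono_tags) mem_Collect_eq subsetI)
  then show ?thesis unfolding psize_def by (intro sum.mono_neutral_left) auto
qed

text \<open>The first row and the first column have only the corner in common.\<close>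

lemma psize_bound:
  assumes p: "is_partition p"
  shows "p 1 + conj_part p 1 \<le> psize p + 1"
proof (cases "conj_part p 1")
  case 0
  then show ?thesis using part_zero_iff[OF p, of 1] by simp
next
  case (Suc N)
  have "psize p = p 1 + (\<Sum>i=2..Suc N. p i)"
    using psize_eq[OF p, of "Suc N"] Suc by (simp add: sum.atLeast_Suc_atMost numeral_2_eq_2)
  moreover have "(\<Sum>i=2..Suc N. 1) \<le> (\<Sum>i=2..Suc N. p i)"
  proof (rule sum_mono)
    fix i assume "i \<in> {2..Suc N}"
    then show "1 \<le> p i" using part_zero_iff[OF p, of i] Suc by auto
  qed
  ultimately show ?thesis using Suc by simp
qed

lemma conj_part_le_psize:
  assumes p: "is_partition p"
  shows "conj_part p 1 \<le> psize p" "1 \<le> i \<Longrightarrow> p i \<le> psize p"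
proof -
  show c: "conj_part p 1 \<le> psize p"
    using psize_bound[OF p] part_zero_iff[OF p, of 1] by (cases "p 1 = 0") auto
  show "1 \<le> i \<Longrightarrow> p i \<le> psize p"
    using psize_bound[OF p] partition_antimono[OF p, of 1 i] part_zero_iff[OF p, of 1]
    by (cases "p 1 = 0") auto
qed

lemma card_young: assumes "is_partition p" shows "card (young p) = psize p"
proof -
  have "young p = (SIGMA i:{1..conj_part p 1}. {1..p i})"
    using part_zero_iff[OF assms] by (auto simp: young_def) (metis One_nat_def le_zero_eq not_less not_less_eq_eq)
  then show ?thesis using psize_eq[OF assms order_refl] by simp
qed

text \<open>The complementarity of the beta numbers of a partition and its conjugate. When the
  boundary steps of the diagram are labelled consecutively, the horizontal steps of the columns
  before \<open>b\<close> and the vertical steps of the rows beyond \<open>conj_part p b\<close>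
  fill an interval. Passing from \<open>b\<close> to \<open>Suc b\<close> adds the step of column
  \<open>b\<close> and those of the rows of length exactly \<open>b\<close>.\<close>

lemma beta_complement:
  fixes f :: "int \<Rightarrow> 'a::comm_monoid_mult"
  assumes p: "is_partition p" "conj_part p 1 \<le> N" "1 \<le> b"
  shows "(\<Prod>j\<in>{1..<b}. f (int (conj_part p j) - int j + 1)) *
    (\<Prod>i\<in>{conj_part p b<..N}. f (int i - int (p i))) =
    (\<Prod>h\<in>{int (conj_part p b) - int b + 2..int N}. f h)"
  using assms(3)
proof (induction b rule: nat_induct_at_least)
  case base
  have "(\<Prod>i\<in>{conj_part p 1<..N}. f (int i - int (p i))) = (\<Prod>i\<in>{conj_part p 1<..N}. f (int i))"
  proof (rule prod.cong[OF refl])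
    fix i assume "i \<in> {conj_part p 1<..N}"
    then have "p i = 0" using part_zero_iff[OF p(1), of i] by auto
    then show "f (int i - int (p i)) = f (int i)" by simp
  qed
  also have "\<dots> = (\<Prod>h\<in>{int (conj_part p 1) - int 1 + 2..int N}. f h)"
    by (rule prod.reindex_bij_witness[of _ nat int]) auto
  finally show ?case by simp
next
  case (Suc b)
  let ?r = "conj_part p b" and ?r' = "conj_part p (Suc b)"
  have r: "?r' \<le> ?r" "?r \<le> N"
    using conj_part_antimono[OF p(1), of b "Suc b"] conj_part_antimono[OF p(1), of 1 b] Suc p by auto
  have pi: "p i = b" if "i \<in> {?r'<..?r}" for i
    using that conj_part_iff[OF p(1), of i b] conj_part_iff[OF p(1), of i "Suc b"] Suc by auto
  have "(\<Prod>j\<in>{1..<Suc b}. f (int (conj_part p j) - int j + 1)) *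
    (\<Prod>i\<in>{?r'<..N}. f (int i - int (p i))) =
    (\<Prod>j\<in>{1..<b}. f (int (conj_part p j) - int j + 1)) * f (int ?r - int b + 1) *
    ((\<Prod>i\<in>{?r'<..?r}. f (int i - int (p i))) * (\<Prod>i\<in>{?r<..N}. f (int i - int (p i))))"
    using Suc r by (subst prod.union_disjoint[symmetric]) (auto simp: ivl_disj_un prod.atLeastLessThan_Suc)
  also have "(\<Prod>i\<in>{?r'<..?r}. f (int i - int (p i))) = (\<Prod>i\<in>{?r'<..?r}. f (int i - int b))"
    using pi by (intro prod.cong) auto
  also have "\<dots> = (\<Prod>h\<in>{int ?r' - int b + 1..int ?r - int b}. f h)"
    by (rule prod.reindex_bij_witness[of _ "\<lambda>h. nat (h + int b)" "\<lambda>i. int i - int b"]) auto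
  also have "(\<Prod>j\<in>{1..<b}. f (int (conj_part p j) - int j + 1)) * f (int ?r - int b + 1) *
      ((\<Prod>h\<in>{int ?r' - int b + 1..int ?r - int b}. f h) * (\<Prod>i\<in>{?r<..N}. f (int i - int (p i)))) =
      (\<Prod>h\<in>{int ?r' - int b + 1..int ?r - int b}. f h) * (f (int ?r - int b + 1) *
      (\<Prod>h\<in>{int ?r - int b + 2..int N}. f h))"
    unfolding Suc.IH[symmetric] by (simp only: mult_ac)
  also have "f (int ?r - int b + 1) * (\<Prod>h\<in>{int ?r - int b + 2..int N}. f h) = (\<Prod>h\<in>{int ?r - int b + 1..int N}. f h)"
  proof -
    have "{int ?r - int b + 1..int N} = insert (int ?r - int b + 1) {int ?r - int b + 2..int N}"
      using r Suc by auto
    then show ?thesis by simp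
  qed
  also have "(\<Prod>h\<in>{int ?r' - int b + 1..int ?r - int b}. f h) * \<dots> = (\<Prod>h\<in>{int ?r' - int b + 1..int N}. f h)"
    using r Suc by (subst prod.union_disjoint[symmetric]) (auto intro!: prod.cong)
  finally show ?case by (simp add: algebra_simps)
qed

section \<open>Hook products when a node is added\<close>

definition add_box :: "(nat \<Rightarrow> nat) \<Rightarrow> nat \<Rightarrow> nat \<Rightarrow> nat" where
  "add_box p k = p(k := Suc (p k))"

lemma young_add_box: "1 \<le> k \<Longrightarrow> young (add_box p k) = insert (k, Suc (p k)) (young p)"
  by (auto simp: young_def add_box_def split: if_splits)

lemma conj_part_add_box:
  assumes p: "is_partition p" "is_partition (add_box p k)" "1 \<le> k" "1 \<le> j"
  shows "conj_part (add_box p k) j = (if j = Suc (p k) then Suc (conj_part p j) else conj_part p j)"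
    and "conj_part p (Suc (p k)) = k - 1"
proof -
  let ?S = "{i. 1 \<le> i \<and> j \<le> p i}"
  have fin: "finite ?S" by (rule partition_set_finite) (use p in auto)
  have "{i. 1 \<le> i \<and> j \<le> add_box p k i} = (if j = Suc (p k) then insert k ?S else ?S)"
    using p(3) by (auto simp: add_box_def)
  then show "conj_part (add_box p k) j = (if j = Suc (p k) then Suc (conj_part p j) else conj_part p j)"
    unfolding conj_part_def using fin by auto
  show "conj_part p (Suc (p k)) = k - 1"
  proof (rule antisym)
    show "conj_part p (Suc (p k)) \<le> k - 1"
      using conj_part_iff[OF p(1,3), of "Suc (p k)"] by auto
    show "k - 1 \<le> conj_part p (Suc (p k))"
    proof (cases "k = 1")
      case False
      then have "add_box p k k \<le> add_box p k (k - 1)" 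
        using partition_antimono[OF p(2), of "k - 1" k] p(3) by simp
      then have "Suc (p k) \<le> p (k - 1)" using False p(3) by (simp add: add_box_def split: if_splits)
      then show ?thesis using conj_part_iff[OF p(1), of "k - 1" "Suc (p k)"] False p(3) by simp
    qed simp
  qed
qed

abbreviation hook_prod :: "(int \<Rightarrow> 'a::comm_monoid_mult) \<Rightarrow> (nat \<Rightarrow> nat) \<Rightarrow> (nat \<Rightarrow> nat) \<Rightarrow> 'a" where
  "hook_prod f p m \<equiv> \<Prod>(i, j)\<in>young p. f (hook p m i j)"

lemma row_col_split:
  assumes p: "is_partition p" "1 \<le> k" "1 \<le> b"
  shows "(\<Prod>(i, j)\<in>young p. g i j) = (\<Prod>(i, j)\<in>{x\<in>young p. fst x \<noteq> k}. g i j) * (\<Prod>j\<in>{1..p k}. g k j)"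
    and "(\<Prod>(i, j)\<in>young p. g i j) = (\<Prod>(i, j)\<in>{x\<in>young p. snd x \<noteq> b}. g i j) * (\<Prod>i\<in>{1..conj_part p b}. g i b)"
proof -
  have *: "prod h (young p) = prod h {x\<in>young p. P x} * prod h {x\<in>young p. \<not> P x}" for P and h :: "nat \<times> nat \<Rightarrow> 'a"
    using young_finite[OF p(1)] by (subst prod.union_disjoint[symmetric]) (auto intro!: prod.cong)
  have "{x\<in>young p. \<not> fst x \<noteq> k} = Pair k ` {1..p k}" using p by (auto simp: young_def)
  then have "(\<Prod>(i, j)\<in>{x\<in>young p. \<not> fst x \<noteq> k}. g i j) = (\<Prod>j\<in>{1..p k}. g k j)"
    by (simp add: prod.reindex inj_on_def)
  then show "(\<Prod>(i, j)\<in>young p. g i j) = (\<Prod>(i, j)\<in>{x\<in>young p. fst x \<noteq> k}. g i j) * (\<Prod>j\<in>{1..p k}. g k j)"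
    using *[of "\<lambda>(i, j). g i j" "\<lambda>x. fst x \<noteq> k"] by simp
  have "{x\<in>young p. \<not> snd x \<noteq> b} = (\<lambda>i. (i, b)) ` {1..conj_part p b}"
    using p young_iff_conj[OF p(1)] by auto
  then have "(\<Prod>(i, j)\<in>{x\<in>young p. \<not> snd x \<noteq> b}. g i j) = (\<Prod>i\<in>{1..conj_part p b}. g i b)"
    by (simp add: prod.reindex inj_on_def)
  then show "(\<Prod>(i, j)\<in>young p. g i j) = (\<Prod>(i, j)\<in>{x\<in>young p. snd x \<noteq> b}. g i j) * (\<Prod>i\<in>{1..conj_part p b}. g i b)"
    using *[of "\<lambda>(i, j). g i j" "\<lambda>x. snd x \<noteq> b"] by simp
qed

text \<open>A new node in the left partition changes arm lengths in its row only; legs are measured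
  in \<open>m\<close>.\<close>

lemma hook_prod_add_left:
  assumes p: "is_partition p" "is_partition (add_box p k)" "1 \<le> k"
    and b: "b = Suc (p k)" and c: "c = int b - int k"
  shows "hook_prod f (add_box p k) m * (\<Prod>j\<in>{1..<b}. f (c + int (conj_part m j) - int j)) =
    hook_prod f p m * (\<Prod>j\<in>{1..b}. f (c + int (conj_part m j) - int j + 1))"
proof -
  let ?p = "add_box p k"
  have same: "{x\<in>young ?p. fst x \<noteq> k} = {x\<in>young p. fst x \<noteq> k}" using p(3) by (auto simp: young_add_box)
  have "(\<Prod>(i, j)\<in>{x\<in>young ?p. fst x \<noteq> k}. f (hook ?p m i j)) = (\<Prod>(i, j)\<in>{x\<in>young p. fst x \<noteq> k}. f (hook p m i j))"
    unfolding same by (intro prod.cong) (auto simp: hook_def add_box_def)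
  moreover have "(\<Prod>j\<in>{1..?p k}. f (hook ?p m k j)) = (\<Prod>j\<in>{1..b}. f (c + int (conj_part m j) - int j + 1))"
    by (intro prod.cong) (auto simp: hook_def add_box_def b c algebra_simps)
  moreover have "(\<Prod>j\<in>{1..p k}. f (hook p m k j)) = (\<Prod>j\<in>{1..<b}. f (c + int (conj_part m j) - int j))"
    by (intro prod.cong) (auto simp: hook_def b c algebra_simps)
  ultimately show ?thesis
    unfolding row_col_split(1)[OF p(2,3), of 1 "\<lambda>i j. f (hook ?p m i j)", OF order_refl]
      row_col_split(1)[OF p(1,3), of 1 "\<lambda>i j. f (hook p m i j)", OF order_refl]
    by (simp only: mult_ac)
qed

text \<open>A new node in the right partition changes leg lengths in its column only; arms are
  measured in \<open>m\<close>.\<close>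

lemma hook_prod_add_right:
  assumes p: "is_partition p" "is_partition (add_box p k)" "1 \<le> k" and m: "is_partition m"
    and b: "b = Suc (p k)" and c: "c = int b - int k"
  shows "hook_prod g m (add_box p k) * (\<Prod>i\<in>{1..conj_part m b}. g (int (m i) - int i - c)) =
    hook_prod g m p * (\<Prod>i\<in>{1..conj_part m b}. g (int (m i) - int i - c + 1))"
proof -
  let ?p = "add_box p k"
  have b1: "1 \<le> b" using b by simp
  have cb: "conj_part p b = k - 1" "conj_part ?p b = k"
    using conj_part_add_box[OF p, of b] p(3) b by auto
  have "(\<Prod>(i, j)\<in>{x\<in>young m. snd x \<noteq> b}. g (hook m ?p i j)) = (\<Prod>(i, j)\<in>{x\<in>young m. snd x \<noteq> b}. g (hook m p i j))"
    using conj_part_add_box(1)[OF p] b by (intro prod.cong) (auto simp: hook_def young_def)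
  moreover have "(\<Prod>i\<in>{1..conj_part m b}. g (hook m ?p i b)) = (\<Prod>i\<in>{1..conj_part m b}. g (int (m i) - int i - c + 1))"
    using cb by (intro prod.cong) (auto simp: hook_def c algebra_simps)
  moreover have "(\<Prod>i\<in>{1..conj_part m b}. g (hook m p i b)) = (\<Prod>i\<in>{1..conj_part m b}. g (int (m i) - int i - c))"
    using cb p(3) by (intro prod.cong) (auto simp: hook_def c algebra_simps of_nat_diff)
  ultimately show ?thesis
    unfolding row_col_split(2)[OF m order_refl b1, of "\<lambda>i j. g (hook m ?p i j)"]
      row_col_split(2)[OF m order_refl b1, of "\<lambda>i j. g (hook m p i j)"]
    by (simp only: mult_ac)
qed

text \<open>The node is first added on the right and then on the left; the factor \<open>f 1\<close>
  is the hook of the new node itself.\<close>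

lemma hook_prod_add_both:
  assumes p: "is_partition p" "is_partition (add_box p k)" "1 \<le> k"
    and b: "b = Suc (p k)" and c: "c = int b - int k"
  shows "hook_prod f (add_box p k) (add_box p k) *
      ((\<Prod>j\<in>{1..<b}. f (c + int (conj_part p j) - int j)) * (\<Prod>i\<in>{1..<k}. f (int (p i) - int i - c))) =
    hook_prod f p p * f 1 *
      ((\<Prod>j\<in>{1..<b}. f (c + int (conj_part p j) - int j + 1)) * (\<Prod>i\<in>{1..<k}. f (int (p i) - int i - c + 1)))"
proof -
  let ?p = "add_box p k"
  have b1: "1 \<le> b" using b by simp
  have cb: "conj_part p b = k - 1" "conj_part ?p b = k"
    using conj_part_add_box[OF p, of b] p(3) b by auto
  have k: "{1..k - 1} = {1..<k}" using p(3) by auto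
  have R: "hook_prod f p ?p * (\<Prod>i\<in>{1..<k}. f (int (p i) - int i - c)) =
    hook_prod f p p * (\<Prod>i\<in>{1..<k}. f (int (p i) - int i - c + 1))"
    using hook_prod_add_right[OF p p(1) b c, of f] unfolding cb k .
  have L: "hook_prod f ?p ?p * (\<Prod>j\<in>{1..<b}. f (c + int (conj_part ?p j) - int j)) =
    hook_prod f p ?p * (\<Prod>j\<in>{1..b}. f (c + int (conj_part ?p j) - int j + 1))"
    by (rule hook_prod_add_left[OF p b c])
  have e: "conj_part ?p j = conj_part p j" if "j \<in> {1..<b}" for j
    using conj_part_add_box(1)[OF p, of j] that b by auto
  have 1: "(\<Prod>j\<in>{1..<b}. f (c + int (conj_part ?p j) - int j)) = (\<Prod>j\<in>{1..<b}. f (c + int (conj_part p j) - int j))"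
    using e by (intro prod.cong) auto
  have "{1..b} = insert b {1..<b}" using b1 by auto
  then have 2: "(\<Prod>j\<in>{1..b}. f (c + int (conj_part ?p j) - int j + 1)) =
     f 1 * (\<Prod>j\<in>{1..<b}. f (c + int (conj_part p j) - int j + 1))"
    using e cb by (auto intro!: prod.cong arg_cong2[of _ _ _ _ "(*)"] simp: c)
  have "hook_prod f ?p ?p * (\<Prod>j\<in>{1..<b}. f (c + int (conj_part p j) - int j)) * (\<Prod>i\<in>{1..<k}. f (int (p i) - int i - c)) =
     f 1 * (\<Prod>j\<in>{1..<b}. f (c + int (conj_part p j) - int j + 1)) * (hook_prod f p ?p * (\<Prod>i\<in>{1..<k}. f (int (p i) - int i - c)))"
    using L unfolding 1 2 by (simp only: mult_ac)
  then show ?thesis unfolding R by (simp only: mult_ac)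
qed

text \<open>Rewrites the change of the hook products as a quotient over the rows of
  \<open>m\<close>. The hooks in the row of the new node run over columns of \<open>m\<close>, and
  \<open>beta_complement\<close> converts them into the rows beyond
  \<open>conj_part m (Suc (p k))\<close>. The hooks in its column run over the remaining rows, and
  each is reflected by \<open>fg\<close> at the cost of one factor \<open>q\<close>. The index
  \<open>Suc N\<close> stands for the empty row below \<open>m\<close>.\<close>

lemma cross_hook_ratio:
  fixes f g :: "int \<Rightarrow> 'a::field" and q :: 'a
  assumes p: "is_partition p" "is_partition (add_box p k)" "1 \<le> k" and m: "is_partition m"
    and fg: "\<And>h. g (h + 1) * f (- h) = q * f (- h - 1) * g h"
    and nz: "\<And>h. \<bar>h\<bar> < int n \<Longrightarrow> f h \<noteq> 0" "\<And>h. \<bar>h\<bar> < int n \<Longrightarrow> g h \<noteq> 0"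
    and size: "psize p + psize m < n"
    and N: "N = conj_part m 1" and c: "c = int (Suc (p k)) - int k"
  shows "hook_prod f (add_box p k) m * hook_prod g m (add_box p k) * (\<Prod>i=1..N. f (c - (int (m i) - int i))) =
    hook_prod f p m * hook_prod g m p * q ^ conj_part m (Suc (p k)) *
      (\<Prod>i=1..Suc N. f (c - (int (m i) - int i + 1)))"
proof -
  define b where "b = Suc (p k)"
  let ?r = "conj_part m b" and ?p = "add_box p k"
  have c': "c = int b - int k" using c b_def by simp
  have b1: "1 \<le> b" by (simp add: b_def)
  have r: "?r \<le> N" using conj_part_antimono[OF m, of 1 b] b1 N by simp
  have bounds: "N \<le> psize m" "p k \<le> psize p" "k \<le> Suc (psize p)"
  proof -
    show "N \<le> psize m" "p k \<le> psize p" using conj_part_le_psize[OF m] conj_part_le_psize[OF p(1)] p(3) N by auto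
    have "k - 1 \<le> conj_part p 1"
      using conj_part_add_box(2)[OF p] conj_part_antimono[OF p(1), of 1 "Suc (p k)"] by (metis Suc_leI le_refl zero_less_Suc One_nat_def Suc_le_mono le0)
    then show "k \<le> Suc (psize p)" using conj_part_le_psize(1)[OF p(1)] by simp
  qed
  \<comment> \<open>The bounds on hook lengths make this product nonzero, so that it can be inserted
    and cancelled again.\<close>
  define Gm where "Gm = (\<Prod>i\<in>{1..?r}. g (int (m i) - int i - c))"
  have Gm0: "Gm \<noteq> 0"
    unfolding Gm_def
  proof (subst prod_zero_iff, simp, clarify)
    fix i assume i: "i \<in> {1..?r}" and z: "g (int (m i) - int i - c) = 0"
    have "b \<le> m i" using conj_part_iff[OF m, of i b] i b1 by simp
    moreover have "m i \<le> psize m" using conj_part_le_psize(2)[OF m] i by simp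
    ultimately have "\<bar>int (m i) - int i - c\<bar> < int n" using i r bounds size p(3) c' b1 by auto
    then show False using nz(2) z by blast
  qed
  have 1: "hook_prod g m ?p * (\<Prod>i\<in>{1..?r}. f (c - (int (m i) - int i))) =
     hook_prod g m p * (q ^ ?r * (\<Prod>i\<in>{1..?r}. f (c - (int (m i) - int i + 1))))"
  proof -
    have "Gm * (hook_prod g m ?p * (\<Prod>i\<in>{1..?r}. f (c - (int (m i) - int i)))) =
       (hook_prod g m ?p * Gm) * (\<Prod>i\<in>{1..?r}. f (c - (int (m i) - int i)))" by (simp only: mult_ac)
    also have "hook_prod g m ?p * Gm = hook_prod g m p * (\<Prod>i\<in>{1..?r}. g (int (m i) - int i - c + 1))"
      unfolding Gm_def by (rule hook_prod_add_right[OF p m b_def c'])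
    also have "\<dots> * (\<Prod>i\<in>{1..?r}. f (c - (int (m i) - int i))) =
       hook_prod g m p * (\<Prod>i\<in>{1..?r}. g (int (m i) - int i - c + 1) * f (c - (int (m i) - int i)))"
      by (simp add: prod.distrib mult_ac)
    also have "(\<Prod>i\<in>{1..?r}. g (int (m i) - int i - c + 1) * f (c - (int (m i) - int i))) =
       (\<Prod>i\<in>{1..?r}. q * f (c - (int (m i) - int i + 1)) * g (int (m i) - int i - c))"
    proof (intro prod.cong refl)
      fix i
      show "g (int (m i) - int i - c + 1) * f (c - (int (m i) - int i)) =
         q * f (c - (int (m i) - int i + 1)) * g (int (m i) - int i - c)"
        using fg[of "int (m i) - int i - c"] by (simp add: algebra_simps)
    qed
    also have "\<dots> = q ^ ?r * (\<Prod>i\<in>{1..?r}. f (c - (int (m i) - int i + 1))) * Gm"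
      by (simp add: prod.distrib Gm_def)
    finally have "Gm * (hook_prod g m ?p * (\<Prod>i\<in>{1..?r}. f (c - (int (m i) - int i)))) =
       Gm * (hook_prod g m p * (q ^ ?r * (\<Prod>i\<in>{1..?r}. f (c - (int (m i) - int i + 1)))))"
      by (simp only: mult_ac)
    then show ?thesis using Gm0 by simp
  qed
  define F where "F h = f (c + h)" for h
  define X where "X = (\<Prod>h\<in>{int ?r - int b + 1..int N - 1}. F h)"
  have X0: "X \<noteq> 0" unfolding X_def
  proof (subst prod_zero_iff, simp, clarify)
    fix h assume h: "h \<in> {int ?r - int b + 1..int N - 1}" and z: "F h = 0"
    have "\<bar>c + h\<bar> < int n" using h bounds size p(3) c' b_def by auto
    then show False using nz(1) z by (auto simp: F_def)
  qed
  let ?U = "\<Prod>i\<in>{?r<..N}. F (int i - int (m i))" and ?V = "\<Prod>i\<in>{?r<..N}. F (int i - 1 - int (m i))"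
  have M1: "(\<Prod>j\<in>{1..<b}. F (int (conj_part m j) - int j + 1)) * ?U = (\<Prod>h\<in>{int ?r - int b + 2..int N}. F h)"
    using beta_complement[OF m _ b1, of N F] N by simp
  have M0: "(\<Prod>j\<in>{1..<b}. F (int (conj_part m j) - int j)) * ?V = X"
  proof -
    have "(\<Prod>j\<in>{1..<b}. F (int (conj_part m j) - int j)) * ?V = (\<Prod>h\<in>{int ?r - int b + 2..int N}. F (h - 1))"
      using beta_complement[OF m _ b1, of N "\<lambda>h. F (h - 1)"] N by (simp add: algebra_simps)
    also have "\<dots> = X" unfolding X_def
      by (rule prod.reindex_bij_witness[of _ "\<lambda>h. h + 1" "\<lambda>h. h - 1"]) auto
    finally show ?thesis .
  qed
  have L: "hook_prod f ?p m * (\<Prod>j\<in>{1..<b}. F (int (conj_part m j) - int j)) =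
     hook_prod f p m * (\<Prod>j\<in>{1..b}. F (int (conj_part m j) - int j + 1))"
    using hook_prod_add_left[OF p b_def c', of f m] by (simp add: F_def algebra_simps)
  \<comment> \<open>The two intervals differ by a shift of one. The label contributed by column
    \<open>b\<close> completes one of them, and the surplus is the label \<open>N\<close>, which is
    the factor of the empty row.\<close>
  have Fint: "F (int ?r - int b + 1) * (\<Prod>h\<in>{int ?r - int b + 2..int N}. F h) = X * F (int N)"
  proof -
    have "{int ?r - int b + 1..int N} = insert (int ?r - int b + 1) {int ?r - int b + 2..int N}"
      using r b1 by auto
    then have 1: "(\<Prod>h\<in>{int ?r - int b + 1..int N}. F h) = F (int ?r - int b + 1) * (\<Prod>h\<in>{int ?r - int b + 2..int N}. F h)"
      by simp
    have "{int ?r - int b + 1..int N} = insert (int N) {int ?r - int b + 1..int N - 1}" using r b1 by auto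
    then have "(\<Prod>h\<in>{int ?r - int b + 1..int N}. F h) = F (int N) * X" by (simp add: X_def)
    then show ?thesis using 1 by (simp only: mult.commute)
  qed
  have 2: "hook_prod f ?p m * ?U = hook_prod f p m * (?V * F (int N))"
  proof -
    have "{1..b} = insert b {1..<b}" using b1 by auto
    then have Lb: "(\<Prod>j\<in>{1..b}. F (int (conj_part m j) - int j + 1)) =
       F (int ?r - int b + 1) * (\<Prod>j\<in>{1..<b}. F (int (conj_part m j) - int j + 1))" by simp
    have "X * (hook_prod f ?p m * ?U) = hook_prod f ?p m * (\<Prod>j\<in>{1..<b}. F (int (conj_part m j) - int j)) * ?V * ?U"
      unfolding M0[symmetric] by (simp only: mult_ac)
    also have "\<dots> = hook_prod f p m * F (int ?r - int b + 1) * ((\<Prod>j\<in>{1..<b}. F (int (conj_part m j) - int j + 1)) * ?U) * ?V"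
      unfolding L Lb by (simp only: mult_ac)
    also have "\<dots> = hook_prod f p m * (F (int ?r - int b + 1) * (\<Prod>h\<in>{int ?r - int b + 2..int N}. F h)) * ?V"
      unfolding M1 by (simp only: mult_ac)
    also have "\<dots> = X * (hook_prod f p m * (?V * F (int N)))" unfolding Fint by (simp only: mult_ac)
    finally show ?thesis using X0 by simp
  qed
  have mN: "m (Suc N) = 0" using part_zero_iff[OF m, of "Suc N"] N by simp
  have split: "(\<Prod>i=1..N. h i) = (\<Prod>i\<in>{1..?r}. h i) * (\<Prod>i\<in>{?r<..N}. h i)" for h :: "nat \<Rightarrow> 'a"
    using r by (subst prod.union_disjoint[symmetric]) (auto intro!: prod.cong)
  have "(\<Prod>i=1..Suc N. f (c - (int (m i) - int i + 1))) =
     (\<Prod>i=1..N. f (c - (int (m i) - int i + 1))) * F (int N)"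
    using mN by (simp add: F_def)
  also have "\<dots> = (\<Prod>i\<in>{1..?r}. f (c - (int (m i) - int i + 1))) * (?V * F (int N))"
    unfolding split by (simp add: F_def algebra_simps)
  finally have e2: "(\<Prod>i=1..Suc N. f (c - (int (m i) - int i + 1))) = \<dots>" .
  have e1: "(\<Prod>i=1..N. f (c - (int (m i) - int i))) = (\<Prod>i\<in>{1..?r}. f (c - (int (m i) - int i))) * ?U"
    unfolding split by (simp add: F_def algebra_simps)
  have "hook_prod f ?p m * hook_prod g m ?p * (\<Prod>i=1..N. f (c - (int (m i) - int i))) =
     (hook_prod f ?p m * ?U) * (hook_prod g m ?p * (\<Prod>i\<in>{1..?r}. f (c - (int (m i) - int i))))"
    unfolding e1 by (simp only: mult_ac)
  also have "\<dots> = hook_prod f p m * hook_prod g m p * q ^ ?r * (\<Prod>i=1..Suc N. f (c - (int (m i) - int i + 1)))"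
    unfolding 1 2 e2 by (simp only: mult_ac)
  finally show ?thesis unfolding b_def .
qed

text \<open>The argument of \<open>cross_hook_ratio\<close> applies, except that arms and legs now
  belong to the same partition and row \<open>k\<close> would contribute the factor
  \<open>f 0\<close>. Hence the index \<open>k\<close> is left out on the right.\<close>

lemma same_hook_ratio:
  fixes f :: "int \<Rightarrow> 'a::field" and q :: 'a
  assumes p: "is_partition p" "is_partition (add_box p k)" "1 \<le> k"
    and f1: "f 1 = 1" and ff: "\<And>h. f (h + 1) * f (- h) = q * f (- h - 1) * f h"
    and nz: "\<And>h. 0 < h \<Longrightarrow> h \<le> int n \<Longrightarrow> f h \<noteq> 0"
    and size: "psize p < n"
    and N: "N = conj_part p 1" and c: "c = int (Suc (p k)) - int k"
  shows "hook_prod f (add_box p k) (add_box p k) * (\<Prod>i=1..N. f (c - (int (p i) - int i))) =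
    hook_prod f p p * q ^ conj_part p (Suc (p k)) *
      (\<Prod>i\<in>{1..Suc N} - {k}. f (c - (int (p i) - int i + 1)))"
proof -
  define b where "b = Suc (p k)"
  let ?p = "add_box p k"
  have c': "c = int b - int k" using c b_def by simp
  have b1: "1 \<le> b" by (simp add: b_def)
  have cb: "conj_part p b = k - 1" using conj_part_add_box(2)[OF p, of 1] b_def by simp
  have kN: "k \<le> Suc N" using cb conj_part_antimono[OF p(1), of 1 b] b1 N by simp
  have large: "b \<le> p i" if "1 \<le> i" "i < k" for i
  proof -
    have "i \<le> k - 1" using that by simp
    then show ?thesis using conj_part_iff[OF p(1) that(1) b1] cb by metis
  qed
  have small: "p i \<le> p k" if "k \<le> i" for i using partition_antimono[OF p(1,3) that] .
  have bound: "p 1 + N \<le> Suc (psize p)" using psize_bound[OF p(1)] N by simp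
  have p1: "p i \<le> p 1" if "1 \<le> i" for i using partition_antimono[OF p(1) _ that] by simp
  define G where "G = (\<Prod>i\<in>{1..<k}. f (int (p i) - int i - c))"
  have G0: "G \<noteq> 0" unfolding G_def
  proof (subst prod_zero_iff, simp, clarify)
    fix i assume i: "i \<in> {1..<k}" and z: "f (int (p i) - int i - c) = 0"
    have "0 < int (p i) - int i - c" using large[of i] i c' by auto
    moreover have "int (p i) - int i - c \<le> int n" using p1[of i] i c' bound kN size b1 by auto
    ultimately show False using nz z by blast
  qed
  define F where "F h = f (c + h)" for h
  define X where "X = (\<Prod>h\<in>{int k - int b + 1..int N - 1}. F h)"
  have X0: "X \<noteq> 0" unfolding X_def
  proof (subst prod_zero_iff, simp, clarify)
    fix h assume h: "h \<in> {int k - int b + 1..int N - 1}" and z: "F h = 0"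
    have "0 < c + h" "c + h \<le> int n" using h p1[OF p(3)] c' bound size b_def p(3) by auto
    then show False using nz z by (auto simp: F_def)
  qed
  let ?U = "\<Prod>i\<in>{k..N}. F (int i - int (p i))" and ?V = "\<Prod>i\<in>{k<..N}. F (int i - 1 - int (p i))"
  have kr: "{k - 1<..N} = {k..N}" using p(3) by auto
  have M1: "(\<Prod>j\<in>{1..<b}. F (int (conj_part p j) - int j + 1)) * ?U = (\<Prod>h\<in>{int k - int b + 1..int N}. F h)"
    using beta_complement[OF p(1) _ b1, of N F] N p(3) unfolding cb kr by (simp add: of_nat_diff algebra_simps)
  have M0: "(\<Prod>j\<in>{1..<b}. F (int (conj_part p j) - int j)) * ?V = X"
  proof -
    \<comment> \<open>\<open>beta_complement\<close> holds for arbitrary functions; prescribing the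
      value 1 at the label of row \<open>k\<close> removes the factor \<open>f 0\<close> from the
      shifted product.\<close>
    define E where "E h = (if h = int k - int b + 1 then 1 else F (h - 1))" for h
    have "(\<Prod>j\<in>{1..<b}. E (int (conj_part p j) - int j + 1)) * (\<Prod>i\<in>{k..N}. E (int i - int (p i))) =
        (\<Prod>h\<in>{int k - int b + 1..int N}. E h)"
      using beta_complement[OF p(1) _ b1, of N E] N p(3) unfolding cb kr by (simp add: of_nat_diff algebra_simps)
    moreover have "(\<Prod>j\<in>{1..<b}. E (int (conj_part p j) - int j + 1)) = (\<Prod>j\<in>{1..<b}. F (int (conj_part p j) - int j))"
    proof (rule prod.cong[OF refl])
      fix j assume j: "j \<in> {1..<b}"
      then have "k \<le> conj_part p j" using conj_part_iff[OF p(1,3), of j] b_def by simp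
      then show "E (int (conj_part p j) - int j + 1) = F (int (conj_part p j) - int j)"
        using j by (simp add: E_def)
    qed
    moreover have "(\<Prod>i\<in>{k..N}. E (int i - int (p i))) = ?V"
    proof (cases "k \<le> N")
      case True
      then have "{k..N} = insert k {k<..N}" by auto
      moreover have "E (int k - int (p k)) = 1" by (simp add: E_def b_def)
      moreover have "(\<Prod>i\<in>{k<..N}. E (int i - int (p i))) = ?V"
      proof (rule prod.cong[OF refl])
        fix i assume "i \<in> {k<..N}"
        then have "k < i" "p i \<le> p k" using small[of i] by auto
        then have "int i - int (p i) \<noteq> int k - int b + 1" by (simp add: b_def)
        then show "E (int i - int (p i)) = F (int i - 1 - int (p i))" by (simp add: E_def algebra_simps)
      qed
      ultimately show ?thesis by simp
    qed simp
    moreover have "(\<Prod>h\<in>{int k - int b + 1..int N}. E h) = X"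
    proof -
      have "(\<Prod>h\<in>{int k - int b + 1..int N}. E h) = (\<Prod>h\<in>{int k - int b + 2..int N}. E h)"
        by (rule prod.mono_neutral_right) (auto simp: E_def)
      also have "\<dots> = X" unfolding X_def
        by (rule prod.reindex_bij_witness[of _ "\<lambda>h. h + 1" "\<lambda>h. h - 1"]) (auto simp: E_def)
      finally show ?thesis .
    qed
    ultimately show ?thesis by simp
  qed
  define J0 where "J0 = (\<Prod>j\<in>{1..<b}. F (int (conj_part p j) - int j))"
  define J1 where "J1 = (\<Prod>j\<in>{1..<b}. F (int (conj_part p j) - int j + 1))"
  define I0 where "I0 = (\<Prod>i\<in>{1..<k}. f (c - (int (p i) - int i)))"
  define I1 where "I1 = (\<Prod>i\<in>{1..<k}. f (c - (int (p i) - int i + 1)))"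
  define G1 where "G1 = (\<Prod>i\<in>{1..<k}. f (int (p i) - int i - c + 1))"
  have both: "hook_prod f ?p ?p * (J0 * G) = hook_prod f p p * (J1 * G1)"
    using hook_prod_add_both[OF p b_def c', of f] f1
    by (simp add: J0_def J1_def G_def G1_def F_def algebra_simps)
  have GI: "G1 * I0 = q ^ (k - 1) * I1 * G"
  proof -
    have "G1 * I0 = (\<Prod>i\<in>{1..<k}. q * f (c - (int (p i) - int i + 1)) * f (int (p i) - int i - c))"
      unfolding G1_def I0_def prod.distrib[symmetric]
    proof (intro prod.cong refl)
      fix i
      show "f (int (p i) - int i - c + 1) * f (c - (int (p i) - int i)) =
         q * f (c - (int (p i) - int i + 1)) * f (int (p i) - int i - c)"
        using ff[of "int (p i) - int i - c"] by (simp add: algebra_simps)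
    qed
    then show ?thesis by (simp add: prod.distrib G_def I1_def)
  qed
  have "G * (X * (hook_prod f ?p ?p * (I0 * ?U))) = (hook_prod f ?p ?p * (J0 * G)) * I0 * ?U * ?V"
    unfolding M0[symmetric] J0_def by (simp only: mult_ac)
  also have "\<dots> = hook_prod f p p * (G1 * I0) * (J1 * ?U) * ?V" unfolding both by (simp only: mult_ac)
  also have "\<dots> = G * (hook_prod f p p * q ^ (k - 1) * I1 * (\<Prod>h\<in>{int k - int b + 1..int N}. F h) * ?V)"
    unfolding GI M1[folded J1_def] by (simp only: mult_ac)
  finally have main: "X * (hook_prod f ?p ?p * (I0 * ?U)) =
      hook_prod f p p * q ^ (k - 1) * I1 * (\<Prod>h\<in>{int k - int b + 1..int N}. F h) * ?V"
    using G0 by simp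
  have e1: "(\<Prod>i=1..N. f (c - (int (p i) - int i))) = I0 * ?U"
  proof -
    have "{1..N} = {1..<k} \<union> {k..N}" using kN p(3) by auto
    then have "(\<Prod>i=1..N. f (c - (int (p i) - int i))) = I0 * (\<Prod>i\<in>{k..N}. f (c - (int (p i) - int i)))"
      unfolding I0_def by (subst prod.union_disjoint[symmetric]) auto
    then show ?thesis by (simp add: F_def algebra_simps)
  qed
  have e2: "(\<Prod>h\<in>{int k - int b + 1..int N}. F h) * ?V * I1 = X * (\<Prod>i\<in>{1..Suc N} - {k}. f (c - (int (p i) - int i + 1)))"
  proof (cases "k \<le> N")
    case True
    have "{int k - int b + 1..int N} = insert (int N) {int k - int b + 1..int N - 1}" using True b1 by auto
    then have "(\<Prod>h\<in>{int k - int b + 1..int N}. F h) = F (int N) * X" by (simp add: X_def)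
    moreover have "{1..Suc N} - {k} = insert (Suc N) ({1..<k} \<union> {k<..N})" using True p(3) by auto
    moreover have "p (Suc N) = 0" using part_zero_iff[OF p(1), of "Suc N"] N by simp
    moreover have "(\<Prod>i\<in>{1..<k} \<union> {k<..N}. f (c - (int (p i) - int i + 1))) = I1 * ?V"
      unfolding I1_def by (subst prod.union_disjoint) (auto simp: F_def algebra_simps)
    ultimately show ?thesis using True by (simp add: F_def)
  next
    case False
    \<comment> \<open>The node starts a new row at the bottom, and the intervals are empty.\<close>
    then have k: "k = Suc N" using kN by simp
    then have "p k = 0" using part_zero_iff[OF p(1), of "Suc N"] N by simp
    then have "{int k - int b + 1..int N} = {}" "X = 1" using k by (auto simp: b_def X_def)
    moreover have "{1..Suc N} - {k} = {1..<k}" using k by auto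
    ultimately show ?thesis using k by (simp add: I1_def)
  qed
  have "X * (hook_prod f ?p ?p * (\<Prod>i=1..N. f (c - (int (p i) - int i)))) =
     hook_prod f p p * q ^ (k - 1) * ((\<Prod>h\<in>{int k - int b + 1..int N}. F h) * ?V * I1)"
    unfolding e1 main by (simp only: mult_ac)
  also have "\<dots> = X * (hook_prod f p p * q ^ (k - 1) * (\<Prod>i\<in>{1..Suc N} - {k}. f (c - (int (p i) - int i + 1))))"
    unfolding e2 by (simp only: mult_ac)
  finally show ?thesis using X0 cb by (simp add: b_def)
qed

text \<open>Summation by columns: \<open>n_stat\<close> is the sum over the columns of the binomial
  coefficients of their lengths over 2, and each column length of the merged partition is the sum of
  those of the components. \<open>M\<close> is any common bound of the parts.\<close>

lemma n_stat_bar: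
  assumes "\<forall>p\<in>set \<Lambda>. is_partition p" "\<forall>p\<in>set \<Lambda>. \<forall>i. p i \<le> M"
  shows "n_stat (mp_bar \<Lambda>) = (\<Sum>j=1..M. \<Sum>k<(\<Sum>p\<leftarrow>\<Lambda>. conj_part p j). k)"
proof -
  define xs where "xs = rev (sorted_list_of_multiset (mp_parts \<Lambda>))"
  have len: "length xs = size (mp_parts \<Lambda>)"
    by (metis xs_def length_rev mset_sorted_list_of_multiset size_mset)
  have sorted: "xs ! k' \<le> xs ! k" if "k \<le> k'" "k' < length xs" for k k'
    using that sorted_sorted_list_of_multiset[of "mp_parts \<Lambda>"] unfolding xs_def
    by (simp add: rev_nth sorted_iff_nth_mono)
  have mset: "mset xs = mp_parts \<Lambda>" by (simp add: xs_def)
  have size_filter: "size {#x \<in># mp_parts \<Lambda>. j \<le> x#} = (\<Sum>p\<leftarrow>\<Lambda>. conj_part p j)" if "1 \<le> j" for j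
    using assms(1) unfolding mp_parts_def
  proof (induction \<Lambda>)
    case (Cons p \<Lambda>)
    have fin: "finite {i. p i \<noteq> 0}" "p 0 = 0" using Cons.prems by (auto simp: is_partition_def)
    have "size {#x \<in># image_mset p (mset_set {i. p i \<noteq> 0}). j \<le> x#} = card {i. p i \<noteq> 0 \<and> j \<le> p i}"
      using fin by (simp add: filter_mset_image_mset)
    also have "{i. p i \<noteq> 0 \<and> j \<le> p i} = {i. 1 \<le> i \<and> j \<le> p i}"
      using fin that by (auto) (metis One_nat_def Suc_leI gr0I le_zero_eq not_one_le_zero)
    finally show ?case using Cons by (simp add: conj_part_def)
  qed simp
  \<comment> \<open>The list is weakly decreasing, so the positions with entry at least
    \<open>j\<close> form an initial segment.\<close>
  have count: "{k. k < length xs \<and> j \<le> xs ! k} = {..<(\<Sum>p\<leftarrow>\<Lambda>. conj_part p j)}" if "1 \<le> j" for j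
  proof -
    let ?S = "{k. k < length xs \<and> j \<le> xs ! k}"
    have "card ?S = size {#x \<in># mset xs. j \<le> x#}"
      by (metis length_filter_conv_card mset_filter size_mset)
    then have c: "card ?S = (\<Sum>p\<leftarrow>\<Lambda>. conj_part p j)" using size_filter[OF that] mset by simp
    have "\<exists>m. ?S = {..<m}"
    proof (cases "?S = {}")
      case False
      have fin: "finite ?S" by simp
      have "?S = {..<Suc (Max ?S)}"
      proof
        show "?S \<subseteq> {..<Suc (Max ?S)}" using Max_ge[OF fin] by (auto simp: less_Suc_eq_le)
        show "{..<Suc (Max ?S)} \<subseteq> ?S"
        proof
          fix k assume "k \<in> {..<Suc (Max ?S)}"
          then have k: "k \<le> Max ?S" by simp
          have M: "Max ?S < length xs" "j \<le> xs ! Max ?S" using Max_in[OF fin False] by auto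
          then show "k \<in> ?S" using sorted[OF k M(1)] k by simp
        qed
      qed
      then show ?thesis by blast
    qed (auto intro: exI[of _ 0])
    then obtain m where m: "?S = {..<m}" by blast
    then have "card ?S = m" by simp
    then show ?thesis using c m by metis
  qed
  have le: "xs ! k \<le> M" if "k < length xs" for k
  proof -
    have "xs ! k \<in># mp_parts \<Lambda>" using that mset by (metis nth_mem_mset)
    then show ?thesis using assms(2) unfolding mp_parts_def
      by (induction \<Lambda>) (auto split: if_splits)
  qed
  have "n_stat (mp_bar \<Lambda>) = (\<Sum>i=1..length xs. (i - 1) * mp_bar \<Lambda> i)"
    unfolding n_stat_def
  proof (rule sum.mono_neutral_left)
    show "{i. mp_bar \<Lambda> i \<noteq> 0} \<subseteq> {1..length xs}" by (auto simp: mp_bar_def len split: if_splits)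
  qed auto
  also have "\<dots> = (\<Sum>k<length xs. k * xs ! k)"
    by (rule sum.reindex_bij_witness[of _ "Suc" "\<lambda>i. i - 1"]) (auto simp: mp_bar_def len[symmetric] xs_def[symmetric])
  also have "\<dots> = (\<Sum>k<length xs. \<Sum>j=1..M. if j \<le> xs ! k then k else 0)"
  proof (rule sum.cong[OF refl])
    fix k assume "k \<in> {..<length xs}"
    then have "{j\<in>{1..M}. j \<le> xs ! k} = {1..xs ! k}" using le[of k] by auto
    then have "(\<Sum>j=1..M. if j \<le> xs ! k then k else 0) = (\<Sum>j\<in>{1..xs ! k}. k)"
      by (simp add: sum.inter_filter[symmetric])
    then show "k * xs ! k = (\<Sum>j=1..M. if j \<le> xs ! k then k else 0)" by simp
  qed
  also have "\<dots> = (\<Sum>j=1..M. \<Sum>k<length xs. if j \<le> xs ! k then k else 0)" by (rule sum.swap)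
  also have "\<dots> = (\<Sum>j=1..M. \<Sum>k<(\<Sum>p\<leftarrow>\<Lambda>. conj_part p j). k)"
  proof (rule sum.cong[OF refl])
    fix j assume j: "j \<in> {1..M}"
    have "(\<Sum>k<length xs. if j \<le> xs ! k then k else 0) = (\<Sum>k\<in>{k. k < length xs \<and> j \<le> xs ! k}. k)"
      by (simp add: sum.inter_filter[symmetric] lessThan_def)
    then show "(\<Sum>k<length xs. if j \<le> xs ! k then k else 0) = (\<Sum>k<(\<Sum>p\<leftarrow>\<Lambda>. conj_part p j). k)"
      using count[of j] j by simp
  qed
  finally show ?thesis .
qed

lemma sum_list_update_nat:
  "s < length xs \<Longrightarrow> (\<Sum>x\<leftarrow>xs[s := y]. g x) + g (xs ! s) = (\<Sum>x\<leftarrow>xs. g x) + g y" for g :: "'b \<Rightarrow> nat"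
  by (induction xs arbitrary: s) (auto simp: nth_Cons split: nat.splits)

text \<open>Only the column of the new node grows, by one, and its binomial coefficient grows by the
  old length. The resulting power of \<open>q\<close> absorbs the powers of \<open>q\<close> in the
  hook ratios.\<close>

lemma n_stat_add_box:
  assumes \<Lambda>: "\<forall>p\<in>set \<Lambda>. is_partition p" "is_partition (add_box (\<Lambda> ! s) k)" "s < length \<Lambda>" "1 \<le> k"
  shows "n_stat (mp_bar (\<Lambda>[s := add_box (\<Lambda> ! s) k])) =
    n_stat (mp_bar \<Lambda>) + (\<Sum>p\<leftarrow>\<Lambda>. conj_part p (Suc ((\<Lambda> ! s) k)))"
proof -
  let ?p = "\<Lambda> ! s" and ?b = "Suc ((\<Lambda> ! s) k)" and ?\<Lambda> = "\<Lambda>[s := add_box (\<Lambda> ! s) k]"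
  have p: "is_partition ?p" using \<Lambda> by simp
  have \<Lambda>': "\<forall>p\<in>set ?\<Lambda>. is_partition p" using \<Lambda> set_update_subset_insert[of \<Lambda> s "add_box ?p k"] by auto
  have bdd: "\<exists>M. \<forall>i. p i \<le> M" if "is_partition p" for p
    using conj_part_le_psize(2)[OF that] that by (metis is_partition_def le0 less_one not_le)
  obtain M0 where M0: "\<forall>p\<in>set \<Lambda>. \<forall>i. p i \<le> M0"
  proof -
    have "\<exists>M. \<forall>p\<in>set ps. \<forall>i. p i \<le> M" if "\<forall>p\<in>set ps. is_partition p" for ps
      using that
    proof (induction ps)
      case (Cons p ps)
      then obtain M M' where "\<forall>p\<in>set ps. \<forall>i. p i \<le> M" "\<forall>i. p i \<le> M'" using bdd by (metis list.set_intros)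
      then show ?case by (intro exI[of _ "max M M'"]) (auto simp: le_max_iff_disj)
    qed simp
    then show ?thesis using that \<Lambda> by blast
  qed
  let ?M = "Suc M0"
  have M: "\<forall>p\<in>set \<Lambda>. \<forall>i. p i \<le> ?M" using M0 by (auto intro: le_SucI)
  have b: "?b \<in> {1..?M}" using M0 \<Lambda> by auto
  have M': "\<forall>p\<in>set ?\<Lambda>. \<forall>i. p i \<le> ?M"
  proof (intro ballI allI)
    fix r i assume "r \<in> set ?\<Lambda>"
    then have "r = add_box ?p k \<or> r \<in> set \<Lambda>" using set_update_subset_insert[of \<Lambda> s "add_box ?p k"] by auto
    then show "r i \<le> ?M" using M b \<Lambda> by (auto simp: add_box_def)
  qed
  have cp: "(\<Sum>p\<leftarrow>?\<Lambda>. conj_part p j) = (\<Sum>p\<leftarrow>\<Lambda>. conj_part p j) + (if j = ?b then 1 else 0)" if "1 \<le> j" for j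
    using sum_list_update_nat[OF \<Lambda>(3), where y = "add_box ?p k" and g = "\<lambda>p. conj_part p j"]
      conj_part_add_box(1)[OF p \<Lambda>(2,4) that] by (auto split: if_splits)
  have "n_stat (mp_bar ?\<Lambda>) = (\<Sum>j=1..?M. \<Sum>k<(\<Sum>p\<leftarrow>?\<Lambda>. conj_part p j). k)" by (rule n_stat_bar[OF \<Lambda>' M'])
  also have "\<dots> = (\<Sum>j=1..?M. (\<Sum>k<(\<Sum>p\<leftarrow>\<Lambda>. conj_part p j). k) + (if j = ?b then (\<Sum>p\<leftarrow>\<Lambda>. conj_part p ?b) else 0))"
    using cp by (intro sum.cong) auto
  also have "\<dots> = n_stat (mp_bar \<Lambda>) + (\<Sum>p\<leftarrow>\<Lambda>. conj_part p ?b)"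
    using b unfolding sum.distrib n_stat_bar[OF \<Lambda>(1) M] by (simp del: sum.cl_ivl_Suc)
  finally show ?thesis .
qed

text \<open>The q-integers are extended to negative arguments because differences of contents take
  both signs.\<close>

definition q_num :: "'a::field \<Rightarrow> int \<Rightarrow> 'a" where
  "q_num q h = (if q = 1 then of_int h else (q powi h - 1) / (q - 1))"

lemma q_int_q_num: "q_int q m = q_num q (int m)"
proof (cases "q = 1")
  case False
  then show ?thesis using q_int_eq[of q m] by (simp add: q_num_def field_simps)
qed (simp add: q_num_def q_int_1)

lemma q_num_1: "q_num q 1 = 1" by (simp add: q_num_def)

lemma q_num_0: "q_num q 0 = 0" by (simp add: q_num_def)

lemma q_num_reflect:
  fixes q :: "'a::field"
  assumes "q \<noteq> 0"
  shows "q_num q (h + 1) * q_num q (- h) = q * q_num q (- h - 1) * q_num q h"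
proof (cases "q = 1")
  case True
  then show ?thesis by (simp add: q_num_def algebra_simps)
next
  case False
  define D where "D = q powi h"
  have D: "D \<noteq> 0" using assms by (simp add: D_def)
  have p: "q powi (h + 1) = D * q" "q powi (- h) = inverse D" "q powi (- h - 1) = inverse D * inverse q"
    using assms power_int_add[of q h 1] power_int_minus[of q "h + 1"]
    by (auto simp: D_def power_int_minus)
  have "(D * q - 1) * (inverse D - 1) = q * (inverse D * inverse q - 1) * (D - 1)"
    using D assms by (simp add: field_simps)
  then show ?thesis using False
    by (simp add: q_num_def p D_def[symmetric] times_divide_times_eq)
qed

lemma hook_pos:
  assumes "is_partition p" "(i, j) \<in> young p"
  shows "1 \<le> hook p p i j"
  using assms young_iff_conj[OF assms(1), of i j] by (auto simp: hook_def young_def)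

section \<open>The product formula and the effect of one more node\<close>

definition schur_formula :: "nat \<Rightarrow> nat \<Rightarrow> 'a::field \<Rightarrow> (nat \<Rightarrow> 'a) \<Rightarrow> multipartition \<Rightarrow> 'a" where
  "schur_formula l m q Q \<Lambda> =
     (-1) ^ (m * (l - 1)) * q powi (- int (n_stat (mp_bar \<Lambda>))) *
        (\<Prod>s<l. \<Prod>(i, j)\<in>young (\<Lambda> ! s).
           q_int q (nat (hook (\<Lambda> ! s) (\<Lambda> ! s) i j)) *
           (\<Prod>t\<in>{..<l} - {s}.
              (q powi hook (\<Lambda> ! s) (\<Lambda> ! t) i j * Q s * inverse (Q t) - 1)))"

definition cross :: "'a::field \<Rightarrow> (nat \<Rightarrow> 'a) \<Rightarrow> nat \<Rightarrow> nat \<Rightarrow> int \<Rightarrow> 'a" where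
  "cross q Q s t h = q powi h * Q s * inverse (Q t) - 1"

lemma cross_reflect:
  fixes q :: "'a::field"
  assumes "q \<noteq> 0" "Q s \<noteq> 0" "Q t \<noteq> 0"
  shows "cross q Q t s (h + 1) * cross q Q s t (- h) = q * cross q Q s t (- h - 1) * cross q Q t s h"
proof -
  define D where "D = q powi h"
  have D: "D \<noteq> 0" using assms by (simp add: D_def)
  have p: "q powi (h + 1) = D * q" "q powi (- h) = inverse D" "q powi (- h - 1) = inverse D * inverse q"
    using assms power_int_add[of q h 1] power_int_minus[of q "h + 1"]
    by (auto simp: D_def power_int_minus)
  show ?thesis unfolding cross_def p D_def[symmetric] using D assms by (simp add: field_simps)
qed

text \<open>Factors are grouped by ordered pairs of components, the form in which the effect of one
  new node can be isolated.\<close>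

lemma schur_formula_eq:
  assumes "\<Lambda> \<in> multipartitions l m"
  shows "schur_formula l m q Q \<Lambda> =
     (-1) ^ (m * (l - 1)) * q powi (- int (n_stat (mp_bar \<Lambda>))) *
        ((\<Prod>s<l. hook_prod (q_num q) (\<Lambda> ! s) (\<Lambda> ! s)) *
         (\<Prod>s<l. \<Prod>t\<in>{..<l} - {s}. hook_prod (cross q Q s t) (\<Lambda> ! s) (\<Lambda> ! t)))"
proof -
  have p: "is_partition (\<Lambda> ! s)" if "s < l" for s using assms that by (auto simp: multipartitions_def)
  have "(\<Prod>(i, j)\<in>young (\<Lambda> ! s). q_int q (nat (hook (\<Lambda> ! s) (\<Lambda> ! s) i j)) *
           (\<Prod>t\<in>{..<l} - {s}. (q powi hook (\<Lambda> ! s) (\<Lambda> ! t) i j * Q s * inverse (Q t) - 1))) =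
      hook_prod (q_num q) (\<Lambda> ! s) (\<Lambda> ! s) * (\<Prod>t\<in>{..<l} - {s}. hook_prod (cross q Q s t) (\<Lambda> ! s) (\<Lambda> ! t))"
    if s: "s < l" for s
  proof -
    have "(\<Prod>(i, j)\<in>young (\<Lambda> ! s). q_int q (nat (hook (\<Lambda> ! s) (\<Lambda> ! s) i j)) *
           (\<Prod>t\<in>{..<l} - {s}. (q powi hook (\<Lambda> ! s) (\<Lambda> ! t) i j * Q s * inverse (Q t) - 1))) =
      (\<Prod>x\<in>young (\<Lambda> ! s). q_num q (hook (\<Lambda> ! s) (\<Lambda> ! s) (fst x) (snd x)) *
           (\<Prod>t\<in>{..<l} - {s}. cross q Q s t (hook (\<Lambda> ! s) (\<Lambda> ! t) (fst x) (snd x))))"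
    proof (rule prod.cong[OF refl], clarify)
      fix i j assume "(i, j) \<in> young (\<Lambda> ! s)"
      then have "1 \<le> hook (\<Lambda> ! s) (\<Lambda> ! s) i j" by (rule hook_pos[OF p[OF s]])
      then show "q_int q (nat (hook (\<Lambda> ! s) (\<Lambda> ! s) i j)) *
           (\<Prod>t\<in>{..<l} - {s}. (q powi hook (\<Lambda> ! s) (\<Lambda> ! t) i j * Q s * inverse (Q t) - 1)) =
        q_num q (hook (\<Lambda> ! s) (\<Lambda> ! s) (fst (i, j)) (snd (i, j))) *
           (\<Prod>t\<in>{..<l} - {s}. cross q Q s t (hook (\<Lambda> ! s) (\<Lambda> ! t) (fst (i, j)) (snd (i, j))))"
        by (simp add: q_int_q_num cross_def)
    qed
    also have "\<dots> = (\<Prod>x\<in>young (\<Lambda> ! s). q_num q (hook (\<Lambda> ! s) (\<Lambda> ! s) (fst x) (snd x))) *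
        (\<Prod>t\<in>{..<l} - {s}. \<Prod>x\<in>young (\<Lambda> ! s). cross q Q s t (hook (\<Lambda> ! s) (\<Lambda> ! t) (fst x) (snd x)))"
      unfolding prod.distrib by (simp only: prod.swap[of _ "{..<l} - {s}"])
    finally show ?thesis by (simp only: case_prod_beta')
  qed
  then have "(\<Prod>s<l. \<Prod>(i, j)\<in>young (\<Lambda> ! s). q_int q (nat (hook (\<Lambda> ! s) (\<Lambda> ! s) i j)) *
           (\<Prod>t\<in>{..<l} - {s}. (q powi hook (\<Lambda> ! s) (\<Lambda> ! t) i j * Q s * inverse (Q t) - 1))) =
      (\<Prod>s<l. hook_prod (q_num q) (\<Lambda> ! s) (\<Lambda> ! s) * (\<Prod>t\<in>{..<l} - {s}. hook_prod (cross q Q s t) (\<Lambda> ! s) (\<Lambda> ! t)))"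
    by (intro prod.cong) auto
  then show ?thesis unfolding schur_formula_def by (simp add: prod.distrib)
qed

lemma prod_pairs_split:
  fixes B :: "nat \<Rightarrow> nat \<Rightarrow> 'a::comm_monoid_mult"
  assumes "s < l"
  shows "(\<Prod>s'<l. \<Prod>t\<in>{..<l} - {s'}. B s' t) =
    (\<Prod>t\<in>{..<l} - {s}. B s t * B t s) * (\<Prod>s'\<in>{..<l} - {s}. \<Prod>t\<in>{..<l} - {s'} - {s}. B s' t)"
proof -
  have "(\<Prod>s'<l. \<Prod>t\<in>{..<l} - {s'}. B s' t) =
     (\<Prod>t\<in>{..<l} - {s}. B s t) * (\<Prod>s'\<in>{..<l} - {s}. \<Prod>t\<in>{..<l} - {s'}. B s' t)"
    using assms by (subst prod.remove[of _ s]) auto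
  also have "(\<Prod>s'\<in>{..<l} - {s}. \<Prod>t\<in>{..<l} - {s'}. B s' t) =
     (\<Prod>s'\<in>{..<l} - {s}. B s' s * (\<Prod>t\<in>{..<l} - {s'} - {s}. B s' t))"
    using assms by (intro prod.cong refl prod.remove) auto
  finally show ?thesis by (simp add: prod.distrib mult_ac)
qed

lemma mp_size_psize:
  assumes "\<Lambda> \<in> multipartitions l m"
  shows "(\<Sum>s<l. psize (\<Lambda> ! s)) = m"
proof -
  have "length \<Lambda> = l" "(\<Sum>p\<leftarrow>\<Lambda>. psize p) = m" using assms by (auto simp: multipartitions_def mp_size_def)
  then show ?thesis by (simp add: sum_list_sum_nth atLeast0LessThan)
qed

lemma psize_le:
  assumes "\<Lambda> \<in> multipartitions l m"
  shows "s < l \<Longrightarrow> psize (\<Lambda> ! s) \<le> m"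
    and "s < l \<Longrightarrow> t < l \<Longrightarrow> s \<noteq> t \<Longrightarrow> psize (\<Lambda> ! s) + psize (\<Lambda> ! t) \<le> m"
proof -
  show "psize (\<Lambda> ! s) \<le> m" if "s < l"
    unfolding mp_size_psize[OF assms, symmetric] using that by (intro member_le_sum) auto
  show "psize (\<Lambda> ! s) + psize (\<Lambda> ! t) \<le> m" if "s < l" "t < l" "s \<noteq> t"
  proof -
    have "(\<Sum>r\<in>{s, t}. psize (\<Lambda> ! r)) \<le> (\<Sum>s<l. psize (\<Lambda> ! s))" using that by (intro sum_mono2) auto
    then show ?thesis using that mp_size_psize[OF assms] by simp
  qed
qed

context separated
begin

lemma q_num_nz: "0 < \<bar>h\<bar> \<Longrightarrow> \<bar>h\<bar> \<le> int n \<Longrightarrow> q_num q h \<noteq> 0"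
  using of_int_nz[of h] powi_ne_1[of h] by (auto simp: q_num_def)

lemma cross_nz:
  assumes "s < l" "t < l" "s \<noteq> t" "\<bar>h\<bar> < int n"
  shows "cross q Q s t h \<noteq> 0"
  using Q_sep[OF assms] Q0[OF assms(2)] by (auto simp: cross_def field_simps)

definition rows :: "multipartition \<Rightarrow> nat \<Rightarrow> nat" where "rows \<Lambda> t = conj_part (\<Lambda> ! t) 1"

text \<open>The node just past the end of row \<open>i\<close>. It is addable if
  \<open>i = 1\<close> or row \<open>i - 1\<close> is longer; \<open>inner\<close> is the last node
  of a nonempty row.\<close>

definition outer :: "multipartition \<Rightarrow> nat \<Rightarrow> nat \<Rightarrow> node" where "outer \<Lambda> t i = (t, i, Suc ((\<Lambda> ! t) i))"

definition inner :: "multipartition \<Rightarrow> nat \<Rightarrow> nat \<Rightarrow> node" where "inner \<Lambda> t i = (t, i, (\<Lambda> ! t) i)"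

lemma content_outer: "content (outer \<Lambda> t i) = int ((\<Lambda> ! t) i) - int i + 1"
  and content_inner: "content (inner \<Lambda> t i) = int ((\<Lambda> ! t) i) - int i"
  by (auto simp: content_def outer_def inner_def)

definition numer :: "multipartition \<Rightarrow> nat \<Rightarrow> int \<Rightarrow> 'k" where
  "numer \<Lambda> s c = (\<Prod>i=1..rows \<Lambda> s. q_num q (c - content (inner \<Lambda> s i))) *
     (\<Prod>t\<in>{..<l} - {s}. \<Prod>i=1..rows \<Lambda> t. cross q Q s t (c - content (inner \<Lambda> t i)))"

definition denom :: "multipartition \<Rightarrow> nat \<Rightarrow> nat \<Rightarrow> 'k" where
  "denom \<Lambda> s k = (\<Prod>i\<in>{1..Suc (rows \<Lambda> s)} - {k}. q_num q (content (outer \<Lambda> s k) - content (outer \<Lambda> s i))) *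
     (\<Prod>t\<in>{..<l} - {s}. \<Prod>i=1..Suc (rows \<Lambda> t). cross q Q s t (content (outer \<Lambda> s k) - content (outer \<Lambda> t i)))"

definition weight :: "multipartition \<Rightarrow> nat \<Rightarrow> nat \<Rightarrow> 'k" where
  "weight \<Lambda> s k = (-1) ^ (l - 1) * numer \<Lambda> s (content (outer \<Lambda> s k)) / denom \<Lambda> s k"

text \<open>Only pairs of components containing \<open>s\<close> change. The hook ratios contribute
  one power of \<open>q\<close> for each component, and by \<open>n_stat_add_box\<close> the
  exponents add up to the increase of \<open>n_stat\<close>.\<close>

lemma schur_formula_add_box:
  assumes \<Lambda>: "\<Lambda> \<in> multipartitions l m" "m < n" "s < l" "1 \<le> k" "is_partition (add_box (\<Lambda> ! s) k)"
    and \<Lambda>': "\<Lambda>' = \<Lambda>[s := add_box (\<Lambda> ! s) k]" "\<Lambda>' \<in> multipartitions l (Suc m)"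
  shows "schur_formula l (Suc m) q Q \<Lambda>' * numer \<Lambda> s (content (outer \<Lambda> s k)) =
    (-1) ^ (l - 1) * schur_formula l m q Q \<Lambda> * denom \<Lambda> s k"
proof -
  define c where "c = int (Suc ((\<Lambda> ! s) k)) - int k"
  have cc: "content (outer \<Lambda> s k) = c" by (simp add: content_outer c_def)
  let ?b = "Suc ((\<Lambda> ! s) k)"
  have len: "length \<Lambda> = l" and part: "is_partition (\<Lambda> ! t)" if "t < l" for t
    using \<Lambda>(1) that by (auto simp: multipartitions_def)
  have nth: "\<Lambda>' ! s = add_box (\<Lambda> ! s) k" "t \<noteq> s \<Longrightarrow> \<Lambda>' ! t = \<Lambda> ! t" for t
    using \<Lambda>'(1) len \<Lambda>(3) by auto
  let ?A = "\<lambda>\<Lambda> s. hook_prod (q_num q) (\<Lambda> ! s) (\<Lambda> ! s)"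
  let ?B = "\<lambda>\<Lambda> s t. hook_prod (cross q Q s t) (\<Lambda> ! s) (\<Lambda> ! t)"
  have A: "?A \<Lambda>' s * (\<Prod>i=1..rows \<Lambda> s. q_num q (c - content (inner \<Lambda> s i))) =
     ?A \<Lambda> s * q ^ conj_part (\<Lambda> ! s) ?b * (\<Prod>i\<in>{1..Suc (rows \<Lambda> s)} - {k}. q_num q (c - content (outer \<Lambda> s i)))"
    unfolding nth content_outer content_inner
    using psize_le(1)[OF \<Lambda>(1,3)] \<Lambda>(2)
    by (intro same_hook_ratio[OF part[OF \<Lambda>(3)] \<Lambda>(5,4), where n = n])
       (use q_num_nz in \<open>auto simp: q_num_1 q_num_reflect q0 rows_def c_def\<close>)
  have B: "?B \<Lambda>' s t * ?B \<Lambda>' t s * (\<Prod>i=1..rows \<Lambda> t. cross q Q s t (c - content (inner \<Lambda> t i))) =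
     ?B \<Lambda> s t * ?B \<Lambda> t s * q ^ conj_part (\<Lambda> ! t) ?b * (\<Prod>i=1..Suc (rows \<Lambda> t). cross q Q s t (c - content (outer \<Lambda> t i)))"
    if t: "t \<in> {..<l} - {s}" for t
  proof -
    have t': "t < l" "t \<noteq> s" using t by auto
    show ?thesis unfolding nth(1) nth(2)[OF t'(2)] content_outer content_inner
      using psize_le(2)[OF \<Lambda>(1,3) t'(1)] t' \<Lambda>(2)
      by (intro cross_hook_ratio[OF part[OF \<Lambda>(3)] \<Lambda>(5,4) part[OF t'(1)], where n = n])
         (use cross_nz \<Lambda>(3) in \<open>auto simp: cross_reflect q0 Q0 rows_def c_def\<close>)
  qed
  define A0 where "A0 = (\<Prod>s'\<in>{..<l} - {s}. ?A \<Lambda> s')"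
  define B0 where "B0 = (\<Prod>s'\<in>{..<l} - {s}. \<Prod>t\<in>{..<l} - {s'} - {s}. ?B \<Lambda> s' t)"
  have A': "(\<Prod>s<l. ?A \<Lambda> s) = ?A \<Lambda> s * A0" "(\<Prod>s<l. ?A \<Lambda>' s) = ?A \<Lambda>' s * A0"
  proof -
    show "(\<Prod>s<l. ?A \<Lambda> s) = ?A \<Lambda> s * A0" using \<Lambda>(3) unfolding A0_def by (intro prod.remove) auto
    have "(\<Prod>s<l. ?A \<Lambda>' s) = ?A \<Lambda>' s * (\<Prod>s'\<in>{..<l} - {s}. ?A \<Lambda>' s')" using \<Lambda>(3) by (intro prod.remove) auto
    also have "(\<Prod>s'\<in>{..<l} - {s}. ?A \<Lambda>' s') = A0" unfolding A0_def by (intro prod.cong) (auto simp: nth)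
    finally show "(\<Prod>s<l. ?A \<Lambda>' s) = ?A \<Lambda>' s * A0" .
  qed
  have B': "(\<Prod>s<l. \<Prod>t\<in>{..<l} - {s}. ?B \<Lambda> s t) = (\<Prod>t\<in>{..<l} - {s}. ?B \<Lambda> s t * ?B \<Lambda> t s) * B0"
      "(\<Prod>s<l. \<Prod>t\<in>{..<l} - {s}. ?B \<Lambda>' s t) = (\<Prod>t\<in>{..<l} - {s}. ?B \<Lambda>' s t * ?B \<Lambda>' t s) * B0"
  proof -
    show "(\<Prod>s<l. \<Prod>t\<in>{..<l} - {s}. ?B \<Lambda> s t) = (\<Prod>t\<in>{..<l} - {s}. ?B \<Lambda> s t * ?B \<Lambda> t s) * B0"
      unfolding B0_def by (rule prod_pairs_split[OF \<Lambda>(3), of "?B \<Lambda>"])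
    have "(\<Prod>s'\<in>{..<l} - {s}. \<Prod>t\<in>{..<l} - {s'} - {s}. ?B \<Lambda>' s' t) = B0"
      unfolding B0_def by (intro prod.cong) (auto simp: nth)
    then show "(\<Prod>s<l. \<Prod>t\<in>{..<l} - {s}. ?B \<Lambda>' s t) = (\<Prod>t\<in>{..<l} - {s}. ?B \<Lambda>' s t * ?B \<Lambda>' t s) * B0"
      using prod_pairs_split[OF \<Lambda>(3), of "?B \<Lambda>'"] by simp
  qed
  define E where "E = (\<Sum>p\<leftarrow>\<Lambda>. conj_part p ?b)"
  have Epow: "q ^ conj_part (\<Lambda> ! s) ?b * (\<Prod>t\<in>{..<l} - {s}. q ^ conj_part (\<Lambda> ! t) ?b) = q ^ E"
  proof -
    have "E = (\<Sum>t<l. conj_part (\<Lambda> ! t) ?b)"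
      using len[OF \<Lambda>(3)] by (simp add: E_def sum_list_sum_nth atLeast0LessThan)
    also have "q ^ \<dots> = (\<Prod>t<l. q ^ conj_part (\<Lambda> ! t) ?b)" by (simp add: power_sum)
    also have "\<dots> = q ^ conj_part (\<Lambda> ! s) ?b * (\<Prod>t\<in>{..<l} - {s}. q ^ conj_part (\<Lambda> ! t) ?b)"
      using \<Lambda>(3) by (intro prod.remove) auto
    finally show ?thesis by simp
  qed
  have BB: "(\<Prod>t\<in>{..<l} - {s}. ?B \<Lambda>' s t * ?B \<Lambda>' t s) *
      (\<Prod>t\<in>{..<l} - {s}. \<Prod>i=1..rows \<Lambda> t. cross q Q s t (c - content (inner \<Lambda> t i))) =
      (\<Prod>t\<in>{..<l} - {s}. ?B \<Lambda> s t * ?B \<Lambda> t s) * (\<Prod>t\<in>{..<l} - {s}. q ^ conj_part (\<Lambda> ! t) ?b) *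
      (\<Prod>t\<in>{..<l} - {s}. \<Prod>i=1..Suc (rows \<Lambda> t). cross q Q s t (c - content (outer \<Lambda> t i)))"
    unfolding prod.distrib[symmetric] by (rule prod.cong[OF refl], rule B)
  have n: "n_stat (mp_bar \<Lambda>') = n_stat (mp_bar \<Lambda>) + E"
    unfolding \<Lambda>'(1) E_def using \<Lambda> len[OF \<Lambda>(3)] by (intro n_stat_add_box) (auto simp: multipartitions_def)
  have qq: "q powi (- int (n_stat (mp_bar \<Lambda>'))) * q ^ E = q powi (- int (n_stat (mp_bar \<Lambda>)))"
    unfolding n using q0 by (simp add: power_int_diff power_int_minus)
  have sgn: "(-1 :: 'k) ^ (Suc m * (l - 1)) = (-1) ^ (l - 1) * (-1) ^ (m * (l - 1))"
    by (simp add: power_add)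
  let ?P = "(-1) ^ (Suc m * (l - 1)) * q powi (- int (n_stat (mp_bar \<Lambda>')))"
  have "schur_formula l (Suc m) q Q \<Lambda>' * numer \<Lambda> s c =
     ?P * A0 * B0 * (?A \<Lambda>' s * (\<Prod>i=1..rows \<Lambda> s. q_num q (c - content (inner \<Lambda> s i)))) *
     ((\<Prod>t\<in>{..<l} - {s}. ?B \<Lambda>' s t * ?B \<Lambda>' t s) *
      (\<Prod>t\<in>{..<l} - {s}. \<Prod>i=1..rows \<Lambda> t. cross q Q s t (c - content (inner \<Lambda> t i))))"
    unfolding schur_formula_eq[OF \<Lambda>'(2)] numer_def A' B' by (simp only: mult_ac)
  also have "\<dots> = ?P * (q ^ conj_part (\<Lambda> ! s) ?b * (\<Prod>t\<in>{..<l} - {s}. q ^ conj_part (\<Lambda> ! t) ?b)) *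
     (?A \<Lambda> s * A0 * ((\<Prod>t\<in>{..<l} - {s}. ?B \<Lambda> s t * ?B \<Lambda> t s) * B0)) * denom \<Lambda> s k"
    unfolding A BB denom_def cc by (simp only: mult_ac)
  also have "\<dots> = (-1) ^ (Suc m * (l - 1)) * (q powi (- int (n_stat (mp_bar \<Lambda>'))) * q ^ E) *
     (?A \<Lambda> s * A0 * ((\<Prod>t\<in>{..<l} - {s}. ?B \<Lambda> s t * ?B \<Lambda> t s) * B0)) * denom \<Lambda> s k"
    unfolding Epow by (simp only: mult_ac)
  also have "\<dots> = (-1) ^ (l - 1) * schur_formula l m q Q \<Lambda> * denom \<Lambda> s k"
    unfolding qq sgn schur_formula_eq[OF \<Lambda>(1)] A' B' by (simp only: mult_ac)
  finally show ?thesis unfolding cc .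
qed

end

section \<open>Lagrange interpolation at the residues of the addable nodes\<close>

lemma lagrange_interpolation:
  fixes z :: "'i \<Rightarrow> 'a::field"
  assumes I: "finite I" "inj_on z I" and P: "degree P < card I"
  shows "P = (\<Sum>x\<in>I. Polynomial.smult (poly P (z x) / (\<Prod>y\<in>I - {x}. z x - z y)) (\<Prod>y\<in>I - {x}. [:- z y, 1:]))"
    (is "P = ?L")
proof -
  have deg: "degree (\<Prod>y\<in>I - {x}. [:- z y, 1:]) \<le> card I - 1" if "x \<in> I" for x
  proof -
    have "degree (\<Prod>y\<in>I - {x}. [:- z y, 1:]) \<le> sum (degree \<circ> (\<lambda>y. [:- z y, 1:])) (I - {x})"
      by (rule degree_prod_sum_le) (use I in simp)
    also have "\<dots> \<le> (\<Sum>y\<in>I - {x}. 1)" by (intro sum_mono) simp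
    finally show ?thesis using that I by simp
  qed
  have degL: "degree ?L \<le> card I - 1"
    by (intro degree_sum_le I(1)) (use deg degree_smult_le le_trans in blast)
  have nz: "(\<Prod>y\<in>I - {x}. z x - z y) \<noteq> 0" if "x \<in> I" for x
    using I that by (auto simp: inj_on_def)
  have "poly ?L (z w) = poly P (z w)" if w: "w \<in> I" for w
  proof -
    have "poly ?L (z w) = (\<Sum>x\<in>I. poly P (z x) / (\<Prod>y\<in>I - {x}. z x - z y) * (\<Prod>y\<in>I - {x}. z w - z y))"
      by (simp add: poly_sum poly_prod)
    also have "\<dots> = (\<Sum>x\<in>I. if x = w then poly P (z w) else 0)"
    proof (rule sum.cong[OF refl])
      fix x assume x: "x \<in> I"
      show "poly P (z x) / (\<Prod>y\<in>I - {x}. z x - z y) * (\<Prod>y\<in>I - {x}. z w - z y) = (if x = w then poly P (z w) else 0)"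
      proof (cases "x = w")
        case True
        then show ?thesis using nz[OF x] by simp
      next
        case False
        then have "(\<Prod>y\<in>I - {x}. z w - z y) = 0" using w I by (intro prod_zero) auto
        then show ?thesis using False by simp
      qed
    qed
    also have "\<dots> = poly P (z w)" using w I by simp
    finally show ?thesis .
  qed
  then show ?thesis using degL P I
    by (intro poly_eqI_degree[of "z ` I"]) (auto simp: card_image)
qed

lemma lagrange_at_0:
  fixes z :: "'i \<Rightarrow> 'a::field"
  assumes "finite I" "inj_on z I" "degree P < card I"
  shows "(\<Sum>x\<in>I. poly P (z x) * (\<Prod>y\<in>I - {x}. - z y / (z x - z y))) = poly P 0"
proof -
  have "poly P 0 = (\<Sum>x\<in>I. poly P (z x) / (\<Prod>y\<in>I - {x}. z x - z y) * (\<Prod>y\<in>I - {x}. - z y))"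
    by (subst lagrange_interpolation[OF assms]) (simp add: poly_sum poly_prod)
  then show ?thesis by (simp only: prod_dividef times_divide_eq_right times_divide_eq_left)
qed

text \<open>Comparison of the coefficients in degree \<open>card I - 1\<close>. Inside one component
  this replaces evaluation at 0 when \<open>q = 1\<close>.\<close>

lemma lagrange_top_coeff:
  fixes z :: "'i \<Rightarrow> 'a::field"
  assumes "finite I" "inj_on z I" "degree P < card I"
  shows "(\<Sum>x\<in>I. poly P (z x) / (\<Prod>y\<in>I - {x}. z x - z y)) = coeff P (card I - 1)"
proof -
  have 1: "coeff (\<Prod>y\<in>I - {x}. [:- z y, 1:]) (card I - 1) = 1" if "x \<in> I" for x
  proof -
    have "degree (\<Prod>y\<in>J. [:- z y, 1:]) = card J \<and> lead_coeff (\<Prod>y\<in>J. [:- z y, 1:]) = 1" if "finite J" for J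
      using that
    proof (induction J rule: finite_induct)
      case (insert y J)
      let ?R = "\<Prod>y\<in>J. [:- z y, 1:]"
      have R: "?R \<noteq> 0" "degree ?R = card J" "lead_coeff ?R = 1" using insert by auto
      have "degree ([:- z y, 1:] * ?R) = Suc (card J)" using R by (subst degree_mult_eq) auto
      moreover have "lead_coeff ([:- z y, 1:] * ?R) = lead_coeff [:- z y, 1:] * lead_coeff ?R"
        by (rule lead_coeff_mult)
      moreover have "lead_coeff [:- z y, 1:] = 1" by simp
      ultimately show ?case unfolding prod.insert[OF insert.hyps] card_insert_disjoint[OF insert.hyps] R(3) by simp
    qed simp
    from this[of "I - {x}"] show ?thesis using that assms(1) by (metis card_Diff_singleton finite_Diff)
  qed
  have "coeff P (card I - 1) = (\<Sum>x\<in>I. poly P (z x) / (\<Prod>y\<in>I - {x}. z x - z y) * coeff (\<Prod>y\<in>I - {x}. [:- z y, 1:]) (card I - 1))"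
    by (subst lagrange_interpolation[OF assms]) (simp add: coeff_sum)
  then show ?thesis using 1 by simp
qed

lemma poly_unit_root: "poly (Polynomial.smult (1 / (- e)) [:- e, 1:]) x = (x - e) / (- e)" for e x :: "'a::field"
proof -
  have "poly [:- e, 1:] x = x - e" by simp
  then show ?thesis unfolding poly_smult by (simp only: times_divide_eq_left mult_1)
qed

lemma prod_Sigma_remove:
  fixes l :: nat and J :: "nat \<Rightarrow> nat set" and h :: "nat \<times> nat \<Rightarrow> 'a::comm_monoid_mult"
  assumes "s < l" "\<And>t. finite (J t)"
  shows "(\<Prod>x\<in>Sigma {..<l} J. h x) = (\<Prod>i\<in>J s. h (s, i)) * (\<Prod>t\<in>{..<l} - {s}. \<Prod>i\<in>J t. h (t, i))"
proof -
  have "(\<Prod>x\<in>Sigma {..<l} J. h x) = (\<Prod>t<l. \<Prod>i\<in>J t. h (t, i))"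
    using assms(2) by (subst prod.Sigma) auto
  also have "\<dots> = (\<Prod>i\<in>J s. h (s, i)) * (\<Prod>t\<in>{..<l} - {s}. \<Prod>i\<in>J t. h (t, i))"
    using assms(1) by (intro prod.remove) auto
  finally show ?thesis .
qed

section \<open>Weights as interpolation coefficients\<close>

context separated
begin

lemma q_num_res:
  assumes "q \<noteq> 1" "fst x = fst y" "fst y < l"
  shows "q_num q (content x - content y) * (- (q - 1)) = (res x - res y) / (- res y)"
proof -
  have "Q (fst y) \<noteq> 0" using Q0 assms by simp
  then have "(res x - res y) / res y = q powi (content x - content y) - 1"
    using powi_nz[of "content y"] assms(2) by (simp add: residue_def power_int_diff q0 field_simps)
  then have "(res x - res y) / (- res y) = - (q powi (content x - content y) - 1)"
    by (simp only: divide_minus_right)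
  moreover have "q_num q (content x - content y) * (- (q - 1)) = - (q powi (content x - content y) - 1)"
    using assms(1) unfolding q_num_def mult_minus_right by simp
  ultimately show ?thesis by simp
qed

lemma cross_res:
  assumes "fst x = s" "fst y = t" "t < l"
  shows "- cross q Q s t (content x - content y) = (res x - res y) / (- res y)"
proof -
  have "Q t \<noteq> 0" using Q0 assms by simp
  then have "(res x - res y) / res y = cross q Q s t (content x - content y)"
    using powi_nz[of "content y"] assms by (simp add: residue_def cross_def power_int_diff q0 field_simps)
  then show ?thesis by (simp add: divide_minus_right)
qed

lemma res_nz: "fst x < l \<Longrightarrow> res x \<noteq> 0" using Q0 powi_nz by (simp add: residue_def)

context
  fixes \<Lambda> m assumes \<Lambda>: "\<Lambda> \<in> multipartitions l m" and m: "m < n"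
begin

lemma part: "s < l \<Longrightarrow> is_partition (\<Lambda> ! s)" using \<Lambda> by (auto simp: multipartitions_def)

lemma content_outer_bounds:
  assumes "s < l" "1 \<le> i" "i \<le> Suc (rows \<Lambda> s)"
  shows "- int (rows \<Lambda> s) \<le> content (outer \<Lambda> s i)" "content (outer \<Lambda> s i) \<le> int ((\<Lambda> ! s) 1)"
proof -
  show "content (outer \<Lambda> s i) \<le> int ((\<Lambda> ! s) 1)"
    using partition_antimono[OF part[OF assms(1)], of 1 i] assms by (simp add: content_outer)
  show "- int (rows \<Lambda> s) \<le> content (outer \<Lambda> s i)" using assms by (simp add: content_outer)
qed

lemma content_inner_bounds:
  assumes "s < l" "1 \<le> i" "i \<le> rows \<Lambda> s"
  shows "- int (rows \<Lambda> s) \<le> content (inner \<Lambda> s i)" "content (inner \<Lambda> s i) \<le> int ((\<Lambda> ! s) 1)"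
  using content_outer_bounds[of s i] assms part_zero_iff[OF part[OF assms(1)], of i]
  by (auto simp: content_outer content_inner rows_def)

lemma rows_bound: "s < l \<Longrightarrow> (\<Lambda> ! s) 1 + rows \<Lambda> s \<le> n"
  using psize_bound[OF part, of s] psize_le(1)[OF \<Lambda>, of s] m by (simp add: rows_def)

lemma rows_bound2:
  assumes "s < l" "t < l" "s \<noteq> t"
  shows "(\<Lambda> ! s) 1 + rows \<Lambda> t < n"
  using conj_part_le_psize(2)[OF part[OF assms(1)], of 1] conj_part_le_psize(1)[OF part[OF assms(2)]]
    psize_le(2)[OF \<Lambda> assms] m by (simp add: rows_def)

text \<open>A first row and a first column share a corner only within one component; so contents may
  differ by \<open>n\<close> there, but by less than \<open>n\<close> across components. These are
  the two bounds in \<open>goodI\<close>.\<close>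

lemma good_from_bounds:
  assumes "fst x = s" "fst y = t" "s < l" "t < l"
    "- int (rows \<Lambda> s) \<le> content x" "content x \<le> int ((\<Lambda> ! s) 1)"
    "- int (rows \<Lambda> t) \<le> content y" "content y \<le> int ((\<Lambda> ! t) 1)"
    "s = t \<Longrightarrow> content x \<noteq> content y"
  shows "good x y"
  using assms rows_bound[of s] rows_bound2[of s t] rows_bound2[of t s]
  by (intro goodI) auto

lemma content_outer_inj:
  assumes "s < l" "1 \<le> i" "1 \<le> j" "i \<noteq> j"
  shows "content (outer \<Lambda> s i) \<noteq> content (outer \<Lambda> s j)"
  using partition_antimono[OF part[OF assms(1)], of i j] partition_antimono[OF part[OF assms(1)], of j i] assms
  by (cases i j rule: linorder_cases) (auto simp: content_outer)

lemma good_outer: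
  assumes "s < l" "1 \<le> i" "i \<le> Suc (rows \<Lambda> s)" "t < l" "1 \<le> j" "j \<le> Suc (rows \<Lambda> t)" "(s, i) \<noteq> (t, j)"
  shows "good (outer \<Lambda> s i) (outer \<Lambda> t j)"
proof (rule good_from_bounds[of _ s _ t])
  show "fst (outer \<Lambda> s i) = s" "fst (outer \<Lambda> t j) = t" by (auto simp: outer_def)
  show "content (outer \<Lambda> s i) \<noteq> content (outer \<Lambda> t j)" if "s = t"
    using content_outer_inj[of s i j] assms that by auto
qed (use assms content_outer_bounds in auto)

lemma good_inner_outer:
  assumes "s < l" "1 \<le> k" "k \<le> Suc (rows \<Lambda> s)" "u < l" "1 \<le> v" "v \<le> rows \<Lambda> u" "(\<Lambda> ! u) (Suc v) < (\<Lambda> ! u) v"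
  shows "good (inner \<Lambda> u v) (outer \<Lambda> s k)"
proof (rule good_from_bounds[of _ u _ s])
  show "fst (inner \<Lambda> u v) = u" "fst (outer \<Lambda> s k) = s" by (auto simp: outer_def inner_def)
  show "content (inner \<Lambda> u v) \<noteq> content (outer \<Lambda> s k)" if us: "u = s"
  proof (cases "k \<le> v")
    case True
    then show ?thesis using partition_antimono[OF part[OF assms(4)], of k v] assms us
      by (simp add: content_inner content_outer)
  next
    case False
    then show ?thesis using partition_antimono[OF part[OF assms(4)], of "Suc v" k] assms us
      by (simp add: content_inner content_outer)
  qed
qed (use assms content_outer_bounds content_inner_bounds in auto)

lemma denom_nz:
  assumes "s < l" "1 \<le> k" "k \<le> Suc (rows \<Lambda> s)"
  shows "denom \<Lambda> s k \<noteq> 0"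
proof -
  have "q_num q (content (outer \<Lambda> s k) - content (outer \<Lambda> s i)) \<noteq> 0" if "i \<in> {1..Suc (rows \<Lambda> s)} - {k}" for i
    using content_outer_bounds[of s k] content_outer_bounds[of s i] content_outer_inj[of s k i]
      rows_bound[of s] that assms by (intro q_num_nz) auto
  moreover have "cross q Q s t (content (outer \<Lambda> s k) - content (outer \<Lambda> t i)) \<noteq> 0"
    if "t \<in> {..<l} - {s}" "i \<in> {1..Suc (rows \<Lambda> t)}" for t i
    using content_outer_bounds[of s k] content_outer_bounds[of t i] rows_bound2[of s t] rows_bound2[of t s] that assms
    by (intro cross_nz) auto
  ultimately show ?thesis unfolding denom_def by (simp add: prod_zero_iff)
qed

text \<open>An addable node shares its content with no row end of its component, whereas a blocked
  one does, as used in \<open>weight_zero\<close>.\<close>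

lemma numer_nz:
  assumes "s < l" "1 \<le> k" "k \<le> Suc (rows \<Lambda> s)" "k = 1 \<or> (\<Lambda> ! s) k < (\<Lambda> ! s) (k - 1)"
  shows "numer \<Lambda> s (content (outer \<Lambda> s k)) \<noteq> 0"
proof -
  have "q_num q (content (outer \<Lambda> s k) - content (inner \<Lambda> s i)) \<noteq> 0" if i: "i \<in> {1..rows \<Lambda> s}" for i
  proof -
    have "content (outer \<Lambda> s k) \<noteq> content (inner \<Lambda> s i)"
    proof (cases "k \<le> i")
      case True
      then show ?thesis using partition_antimono[OF part[OF assms(1)], of k i] assms
        by (simp add: content_inner content_outer)
    next
      case False
      then have "(\<Lambda> ! s) k < (\<Lambda> ! s) (k - 1)" using assms(4) i by auto
      moreover have "i \<le> k - 1" using False by simp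
      ultimately show ?thesis using partition_antimono[OF part[OF assms(1)], of i "k - 1"] False i
        by (auto simp: content_inner content_outer)
    qed
    then show ?thesis
      using content_outer_bounds[of s k] content_inner_bounds[of s i] rows_bound[of s] i assms
      by (intro q_num_nz) auto
  qed
  moreover have "cross q Q s t (content (outer \<Lambda> s k) - content (inner \<Lambda> t i)) \<noteq> 0"
    if "t \<in> {..<l} - {s}" "i \<in> {1..rows \<Lambda> t}" for t i
    using content_outer_bounds[of s k] content_inner_bounds[of t i] rows_bound2[of s t] rows_bound2[of t s] that assms
    by (intro cross_nz) auto
  ultimately show ?thesis unfolding numer_def by (simp add: prod_zero_iff)
qed

lemma weight_zero:
  assumes "s < l" "1 < k" "k \<le> Suc (rows \<Lambda> s)" "(\<Lambda> ! s) k = (\<Lambda> ! s) (k - 1)"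
  shows "weight \<Lambda> s k = 0"
proof -
  have "content (outer \<Lambda> s k) = content (inner \<Lambda> s (k - 1))" using assms by (simp add: content_inner content_outer)
  then have "(\<Prod>i=1..rows \<Lambda> s. q_num q (content (outer \<Lambda> s k) - content (inner \<Lambda> s i))) = 0"
    using assms by (intro prod_zero) (auto simp: q_num_0 intro!: bexI[of _ "k - 1"])
  then show ?thesis by (simp add: weight_def numer_def)
qed

text \<open>Every factor becomes \<open>(res x - res y) / (- res y)\<close> up to the scalar
  \<open>- (q - 1)\<close> inside component \<open>s\<close> and \<open>- 1\<close> outside.
  Numerator and denominator have equally many factors from component \<open>s\<close>, so the powers
  of \<open>q - 1\<close> cancel; each of the \<open>l - 1\<close> other components has one factor
  more in the denominator, which explains the sign in \<open>weight\<close>.\<close>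

lemma weight_eq_lagrange:
  assumes q: "q \<noteq> 1" and sk: "s < l" "1 \<le> k" "k \<le> Suc (rows \<Lambda> s)"
  defines "I \<equiv> SIGMA t:{..<l}. {1..Suc (rows \<Lambda> t)}" and "E \<equiv> SIGMA t:{..<l}. {1..rows \<Lambda> t}"
  shows "weight \<Lambda> s k =
    (\<Prod>(t, i)\<in>E. (res (outer \<Lambda> s k) - res (inner \<Lambda> t i)) / (- res (inner \<Lambda> t i))) *
    (\<Prod>y\<in>I - {(s, k)}. - res (outer \<Lambda> (fst y) (snd y)) / (res (outer \<Lambda> s k) - res (outer \<Lambda> (fst y) (snd y))))"
proof -
  define x where "x = outer \<Lambda> s k"
  define c where "c = content x"
  define h where "h y = (res x - res y) / (- res y)" for y
  have fx: "fst x = s" by (simp add: x_def outer_def)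
  have same: "h y = q_num q (c - content y) * (- (q - 1))" if "fst y = s" for y
    using q_num_res[OF q, of x y] fx that sk by (simp add: h_def c_def)
  have diff: "h y = - cross q Q s t (c - content y)" if "fst y = t" "t < l" for y t
    using cross_res[OF fx that] by (simp add: h_def c_def)
  have fst: "fst (inner \<Lambda> t i) = t" "fst (outer \<Lambda> t i) = t" for t i by (auto simp: inner_def outer_def)
  have NE: "(\<Prod>(t, i)\<in>E. h (inner \<Lambda> t i)) =
    (- (q - 1)) ^ rows \<Lambda> s * (\<Prod>t\<in>{..<l} - {s}. (-1) ^ rows \<Lambda> t) * numer \<Lambda> s c"
  proof -
    have "(\<Prod>(t, i)\<in>E. h (inner \<Lambda> t i)) =
       (\<Prod>i=1..rows \<Lambda> s. h (inner \<Lambda> s i)) * (\<Prod>t\<in>{..<l} - {s}. \<Prod>i=1..rows \<Lambda> t. h (inner \<Lambda> t i))"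
      unfolding E_def by (subst prod_Sigma_remove[OF sk(1)]) auto
    also have "(\<Prod>i=1..rows \<Lambda> s. h (inner \<Lambda> s i)) = (- (q - 1)) ^ rows \<Lambda> s * (\<Prod>i=1..rows \<Lambda> s. q_num q (c - content (inner \<Lambda> s i)))"
      by (simp add: same fst prod.distrib del: minus_diff_eq mult_minus_right)
    also have "(\<Prod>t\<in>{..<l} - {s}. \<Prod>i=1..rows \<Lambda> t. h (inner \<Lambda> t i)) =
       (\<Prod>t\<in>{..<l} - {s}. (-1) ^ rows \<Lambda> t * (\<Prod>i=1..rows \<Lambda> t. cross q Q s t (c - content (inner \<Lambda> t i))))"
    proof (rule prod.cong[OF refl])
      fix t assume "t \<in> {..<l} - {s}"
      then have "(\<Prod>i=1..rows \<Lambda> t. h (inner \<Lambda> t i)) = (\<Prod>i=1..rows \<Lambda> t. (-1) * cross q Q s t (c - content (inner \<Lambda> t i)))"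
        using diff fst by (intro prod.cong) auto
      then show "(\<Prod>i=1..rows \<Lambda> t. h (inner \<Lambda> t i)) = (-1) ^ rows \<Lambda> t * (\<Prod>i=1..rows \<Lambda> t. cross q Q s t (c - content (inner \<Lambda> t i)))"
        unfolding prod.distrib by simp
    qed
    finally show ?thesis by (simp add: numer_def prod.distrib mult_ac)
  qed
  have DI: "(\<Prod>y\<in>I - {(s, k)}. h (outer \<Lambda> (fst y) (snd y))) =
    (- (q - 1)) ^ rows \<Lambda> s * (\<Prod>t\<in>{..<l} - {s}. (-1) ^ Suc (rows \<Lambda> t)) * denom \<Lambda> s k"
  proof -
    define J where "J t = (if t = s then {1..Suc (rows \<Lambda> s)} - {k} else {1..Suc (rows \<Lambda> t)})" for t
    have "I - {(s, k)} = Sigma {..<l} J" by (auto simp: I_def J_def split: if_splits)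
    then have "(\<Prod>y\<in>I - {(s, k)}. h (outer \<Lambda> (fst y) (snd y))) =
       (\<Prod>i\<in>J s. h (outer \<Lambda> s i)) * (\<Prod>t\<in>{..<l} - {s}. \<Prod>i\<in>J t. h (outer \<Lambda> t i))"
      using prod_Sigma_remove[OF sk(1), of J "\<lambda>y. h (outer \<Lambda> (fst y) (snd y))"] by (simp add: J_def)
    also have "(\<Prod>i\<in>J s. h (outer \<Lambda> s i)) =
        (- (q - 1)) ^ rows \<Lambda> s * (\<Prod>i\<in>{1..Suc (rows \<Lambda> s)} - {k}. q_num q (c - content (outer \<Lambda> s i)))"
      using sk by (simp add: J_def same fst prod.distrib del: minus_diff_eq mult_minus_right)
    also have "(\<Prod>t\<in>{..<l} - {s}. \<Prod>i\<in>J t. h (outer \<Lambda> t i)) =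
       (\<Prod>t\<in>{..<l} - {s}. (-1) ^ Suc (rows \<Lambda> t) * (\<Prod>i=1..Suc (rows \<Lambda> t). cross q Q s t (c - content (outer \<Lambda> t i))))"
    proof (rule prod.cong[OF refl])
      fix t assume t: "t \<in> {..<l} - {s}"
      then have "(\<Prod>i\<in>J t. h (outer \<Lambda> t i)) = (\<Prod>i=1..Suc (rows \<Lambda> t). (-1) * cross q Q s t (c - content (outer \<Lambda> t i)))"
        using diff fst by (intro prod.cong) (auto simp: J_def)
      then show "(\<Prod>i\<in>J t. h (outer \<Lambda> t i)) = (-1) ^ Suc (rows \<Lambda> t) * (\<Prod>i=1..Suc (rows \<Lambda> t). cross q Q s t (c - content (outer \<Lambda> t i)))"
        unfolding prod.distrib by simp
    qed
    finally show ?thesis by (simp add: denom_def prod.distrib mult_ac c_def x_def del: prod.cl_ivl_Suc power_Suc)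
  qed
  have sgn: "(\<Prod>t\<in>{..<l} - {s}. (-1 :: 'k) ^ Suc (rows \<Lambda> t)) = (-1) ^ (l - 1) * (\<Prod>t\<in>{..<l} - {s}. (-1) ^ rows \<Lambda> t)"
    using sk(1) unfolding power_Suc prod.distrib by simp
  have "(\<Prod>(t, i)\<in>E. (res (outer \<Lambda> s k) - res (inner \<Lambda> t i)) / (- res (inner \<Lambda> t i))) *
    (\<Prod>y\<in>I - {(s, k)}. - res (outer \<Lambda> (fst y) (snd y)) / (res (outer \<Lambda> s k) - res (outer \<Lambda> (fst y) (snd y)))) =
    (\<Prod>(t, i)\<in>E. h (inner \<Lambda> t i)) * inverse (\<Prod>y\<in>I - {(s, k)}. h (outer \<Lambda> (fst y) (snd y)))"
    by (simp add: h_def x_def prod_inversef[symmetric] inverse_divide del: divide_minus_right minus_divide_left)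
  also have "\<dots> = numer \<Lambda> s c * inverse ((-1) ^ (l - 1) * denom \<Lambda> s k)"
  proof -
    have nz: "(- (q - 1)) ^ rows \<Lambda> s * (\<Prod>t\<in>{..<l} - {s}. (-1) ^ rows \<Lambda> t) \<noteq> (0 :: 'k)" using q by (simp add: prod_zero_iff)
    have "A * N * inverse (A * (B * D)) = N * inverse (B * D)" if "A \<noteq> 0" for A N B D :: 'k
      using that by (simp add: field_simps)
    from this[OF nz] show ?thesis unfolding NE DI sgn by (simp only: mult_ac)
  qed
  also have "\<dots> = weight \<Lambda> s k"
    by (simp add: weight_def c_def x_def inverse_mult_distrib divide_inverse power_inverse[symmetric] mult_ac)
  finally show ?thesis ..
qed

text \<open>Each component has one interpolation node more than it has row ends, so there are
  \<open>card E + l\<close> of them. After the numerator has used up degree \<open>card E\<close>,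
  this leaves room for \<open>r < l\<close> further powers of the residue.\<close>

lemma weight_sum_q:
  fixes P0 :: "'k poly"
  assumes q: "q \<noteq> 1"
  defines "E \<equiv> SIGMA t:{..<l}. {1..rows \<Lambda> t}"
  assumes P: "\<And>s k. s < l \<Longrightarrow> 1 \<le> k \<Longrightarrow> k \<le> Suc (rows \<Lambda> s) \<Longrightarrow>
      (\<Prod>(t, i)\<in>E. (res (outer \<Lambda> s k) - res (inner \<Lambda> t i)) / (- res (inner \<Lambda> t i))) * g s k = poly P0 (res (outer \<Lambda> s k))"
    and deg: "degree P0 < card E + l"
  shows "(\<Sum>s<l. \<Sum>k=1..Suc (rows \<Lambda> s). weight \<Lambda> s k * g s k) = poly P0 0"
proof -
  define I where "I = (SIGMA t:{..<l}. {1..Suc (rows \<Lambda> t)})"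
  define z where "z y = res (outer \<Lambda> (fst y) (snd y))" for y
  have fin: "finite I" by (simp add: I_def)
  have inj: "inj_on z I"
  proof (rule inj_onI, rule ccontr)
    fix x y assume xy: "x \<in> I" "y \<in> I" "z x = z y" "x \<noteq> y"
    then have "good (outer \<Lambda> (fst x) (snd x)) (outer \<Lambda> (fst y) (snd y))"
      by (intro good_outer) (auto simp: I_def)
    then show False using xy q by (simp add: good_def z_def)
  qed
  have card: "card I = card E + l"
    by (simp add: I_def E_def sum_Suc)
  have "(\<Sum>s<l. \<Sum>k=1..Suc (rows \<Lambda> s). weight \<Lambda> s k * g s k) =
     (\<Sum>x\<in>I. weight \<Lambda> (fst x) (snd x) * g (fst x) (snd x))"
    unfolding I_def by (subst sum.Sigma) (auto simp: case_prod_beta')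
  also have "\<dots> = (\<Sum>x\<in>I. poly P0 (z x) * (\<Prod>y\<in>I - {x}. - z y / (z x - z y)))"
  proof (rule sum.cong[OF refl])
    fix x assume "x \<in> I"
    then obtain s k where x: "x = (s, k)" "s < l" "1 \<le> k" "k \<le> Suc (rows \<Lambda> s)" by (auto simp: I_def)
    show "weight \<Lambda> (fst x) (snd x) * g (fst x) (snd x) = poly P0 (z x) * (\<Prod>y\<in>I - {x}. - z y / (z x - z y))"
      unfolding x(1) z_def fst_conv snd_conv P[OF x(2-4), symmetric]
      unfolding weight_eq_lagrange[OF q x(2-4)] I_def[symmetric] E_def[symmetric]
      by (simp only: mult_ac)
  qed
  also have "\<dots> = poly P0 0" using deg card by (intro lagrange_at_0[OF fin inj]) simp
  finally show ?thesis .
qed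

text \<open>For \<open>q = 1\<close> the residue is constant on a component and the weight splits:
  the other components form the Lagrange coefficient at 0 for the points \<open>Q s\<close>, and
  component \<open>s\<close> itself contributes a coefficient of interpolation in contents.\<close>

lemma weight_q1:
  assumes q: "q = 1" and sk: "s < l" "1 \<le> k" "k \<le> Suc (rows \<Lambda> s)"
  shows "weight \<Lambda> s k = (\<Prod>t\<in>{..<l} - {s}. - Q t / (Q s - Q t)) *
    ((\<Prod>i=1..rows \<Lambda> s. of_int (content (outer \<Lambda> s k)) - of_int (content (inner \<Lambda> s i))) /
     (\<Prod>i\<in>{1..Suc (rows \<Lambda> s)} - {k}. of_int (content (outer \<Lambda> s k)) - of_int (content (outer \<Lambda> s i))))"
proof -
  define A where "A = (\<Prod>i=1..rows \<Lambda> s. of_int (content (outer \<Lambda> s k)) - of_int (content (inner \<Lambda> s i)) :: 'k)"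
  define B where "B = (\<Prod>i\<in>{1..Suc (rows \<Lambda> s)} - {k}. of_int (content (outer \<Lambda> s k)) - of_int (content (outer \<Lambda> s i)) :: 'k)"
  define C where "C t = Q s * inverse (Q t) - 1" for t
  have C: "cross q Q s t h = C t" for t h unfolding cross_def C_def q by simp
  have qn: "q_num q h = of_int h" for h using q by (simp add: q_num_def)
  have C0: "C t \<noteq> 0" if "t \<in> {..<l} - {s}" for t
    using cross_nz[of s t 0] that sk m unfolding C by auto
  have n: "numer \<Lambda> s c = (\<Prod>i=1..rows \<Lambda> s. of_int (c - content (inner \<Lambda> s i))) * (\<Prod>t\<in>{..<l} - {s}. C t ^ rows \<Lambda> t)" for c
    unfolding numer_def C qn by simp
  have d: "denom \<Lambda> s k = B * (\<Prod>t\<in>{..<l} - {s}. C t ^ Suc (rows \<Lambda> t))"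
    unfolding denom_def C qn B_def by simp
  have "weight \<Lambda> s k = (-1) ^ (l - 1) * (A * (\<Prod>t\<in>{..<l} - {s}. C t ^ rows \<Lambda> t)) / (B * (\<Prod>t\<in>{..<l} - {s}. C t ^ Suc (rows \<Lambda> t)))"
    unfolding weight_def n d by (simp add: A_def)
  also have "\<dots> = (-1) ^ (l - 1) * ((\<Prod>t\<in>{..<l} - {s}. C t ^ rows \<Lambda> t) / (\<Prod>t\<in>{..<l} - {s}. C t ^ Suc (rows \<Lambda> t))) * (A / B)"
  proof -
    have "x * (A * X) / (B * Y) = x * (X / Y) * (A / B)" for x X Y by (simp add: mult_ac)
    then show ?thesis .
  qed
  also have "(\<Prod>t\<in>{..<l} - {s}. C t ^ rows \<Lambda> t) / (\<Prod>t\<in>{..<l} - {s}. C t ^ Suc (rows \<Lambda> t)) = (\<Prod>t\<in>{..<l} - {s}. 1 / C t)"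
    unfolding prod_dividef[symmetric] using C0 by (intro prod.cong) auto
  also have "(-1) ^ (l - 1) = (\<Prod>t\<in>{..<l} - {s}. (-1 :: 'k))" using sk(1) by simp
  also have "(\<Prod>t\<in>{..<l} - {s}. (-1 :: 'k)) * (\<Prod>t\<in>{..<l} - {s}. 1 / C t) = (\<Prod>t\<in>{..<l} - {s}. - Q t / (Q s - Q t))"
    unfolding prod.distrib[symmetric]
  proof (rule prod.cong[OF refl])
    fix t assume "t \<in> {..<l} - {s}"
    then have "Q t \<noteq> 0" "C t \<noteq> 0" using Q0 C0 by auto
    moreover have "C t = (Q s - Q t) / Q t" using \<open>Q t \<noteq> 0\<close> by (simp add: C_def field_simps)
    ultimately show "- 1 * (1 / C t) = - Q t / (Q s - Q t)" by simp
  qed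
  finally show ?thesis unfolding A_def B_def .
qed

lemma component_sum_q1:
  fixes P0 :: "'k poly"
  assumes q: "q = 1" and s: "s < l"
    and P: "\<And>k. 1 \<le> k \<Longrightarrow> k \<le> Suc (rows \<Lambda> s) \<Longrightarrow>
      (\<Prod>i=1..rows \<Lambda> s. of_int (content (outer \<Lambda> s k)) - of_int (content (inner \<Lambda> s i))) * g k =
        poly P0 (of_int (content (outer \<Lambda> s k)))"
    and deg: "degree P0 \<le> rows \<Lambda> s"
  shows "(\<Sum>k=1..Suc (rows \<Lambda> s). weight \<Lambda> s k * g k) = (\<Prod>t\<in>{..<l} - {s}. - Q t / (Q s - Q t)) * coeff P0 (rows \<Lambda> s)"
proof -
  define z where "z k = (of_int (content (outer \<Lambda> s k)) :: 'k)" for k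
  let ?I = "{1..Suc (rows \<Lambda> s)}"
  have inj: "inj_on z ?I"
  proof (rule inj_onI, rule ccontr)
    fix x y assume xy: "x \<in> ?I" "y \<in> ?I" "z x = z y" "x \<noteq> y"
    then have "good (outer \<Lambda> s x) (outer \<Lambda> s y)" by (intro good_outer s) auto
    then show False using xy q unfolding good_def by (simp add: z_def outer_def)
  qed
  have "(\<Sum>k\<in>?I. weight \<Lambda> s k * g k) =
    (\<Sum>k\<in>?I. (\<Prod>t\<in>{..<l} - {s}. - Q t / (Q s - Q t)) * (poly P0 (z k) / (\<Prod>i\<in>?I - {k}. z k - z i)))"
  proof (rule sum.cong[OF refl])
    fix k assume "k \<in> ?I"
    then have k: "1 \<le> k" "k \<le> Suc (rows \<Lambda> s)" by auto
    show "weight \<Lambda> s k * g k = (\<Prod>t\<in>{..<l} - {s}. - Q t / (Q s - Q t)) * (poly P0 (z k) / (\<Prod>i\<in>?I - {k}. z k - z i))"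
      unfolding weight_q1[OF q s k] z_def P[OF k, symmetric] by (simp only: mult.assoc times_divide_eq_left)
  qed
  also have "\<dots> = (\<Prod>t\<in>{..<l} - {s}. - Q t / (Q s - Q t)) * coeff P0 (card ?I - 1)"
    unfolding sum_distrib_left[symmetric] using deg by (subst lagrange_top_coeff[OF _ inj]) auto
  finally show ?thesis by simp
qed

lemma monic_prod_linear:
  assumes "finite J"
  shows "degree (\<Prod>i\<in>J. [:- e i, 1:]) = card J" "coeff (\<Prod>i\<in>J. [:- (e i :: 'k), 1:]) (card J) = 1"
proof -
  have "degree (\<Prod>i\<in>J. [:- e i, 1:]) = card J \<and> lead_coeff (\<Prod>i\<in>J. [:- e i, 1:]) = 1"
    using assms
  proof (induction J rule: finite_induct)
    case (insert y J)
    let ?R = "\<Prod>y\<in>J. [:- e y, 1:]"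
    have R: "?R \<noteq> 0" "degree ?R = card J" "lead_coeff ?R = 1" using insert by auto
    have "degree ([:- e y, 1:] * ?R) = Suc (card J)" using R by (subst degree_mult_eq) auto
    moreover have "lead_coeff ([:- e y, 1:] * ?R) = lead_coeff [:- e y, 1:] * lead_coeff ?R"
      by (rule lead_coeff_mult)
    moreover have "lead_coeff [:- e y, 1:] = 1" by simp
    ultimately show ?case unfolding prod.insert[OF insert.hyps] card_insert_disjoint[OF insert.hyps] R(3) by simp
  qed simp
  then show "degree (\<Prod>i\<in>J. [:- e i, 1:]) = card J" "coeff (\<Prod>i\<in>J. [:- (e i :: 'k), 1:]) (card J) = 1" by auto
qed

text \<open>The numerator is normalised to the value 1 at 0, so interpolation leaves the value of
  the \<open>r\<close>-th power at 0. For \<open>q = 1\<close> each component sums to its Lagrange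
  coefficient times \<open>Q s ^ r\<close>, and a second interpolation at the \<open>Q s\<close>
  concludes.\<close>

theorem weight_sum:
  assumes r: "r < l"
  shows "(\<Sum>s<l. \<Sum>k=1..Suc (rows \<Lambda> s). weight \<Lambda> s k * res (outer \<Lambda> s k) ^ r) = (if r = 0 then 1 else 0)"
proof (cases "q = 1")
  case False
  define E where "E = (SIGMA t:{..<l}. {1..rows \<Lambda> t})"
  define e where "e y = res (inner \<Lambda> (fst y) (snd y))" for y
  have e0: "e y \<noteq> 0" if "y \<in> E" for y
    using that res_nz[of "inner \<Lambda> (fst y) (snd y)"] by (auto simp: E_def e_def inner_def)
  define P where "P = (\<Prod>y\<in>E. Polynomial.smult (1 / (- e y)) [:- e y, 1:]) * monom 1 r"
  have val: "poly P x = (\<Prod>y\<in>E. (x - e y) / (- e y)) * x ^ r" for x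
    unfolding P_def poly_mult poly_prod poly_unit_root poly_monom by simp
  have "degree P \<le> degree (\<Prod>y\<in>E. Polynomial.smult (1 / (- e y)) [:- e y, 1:]) + degree (monom (1 :: 'k) r)"
    unfolding P_def by (rule degree_mult_le)
  also have "degree (\<Prod>y\<in>E. Polynomial.smult (1 / (- e y)) [:- e y, 1:]) \<le> sum (degree \<circ> (\<lambda>y. Polynomial.smult (1 / (- e y)) [:- e y, 1:])) E"
    by (rule degree_prod_sum_le) (simp add: E_def)
  also have "\<dots> \<le> (\<Sum>y\<in>E. 1)" by (intro sum_mono) (simp add: degree_smult_le)
  finally have deg: "degree P < card E + l" using r by (simp add: degree_monom_eq)
  have "(\<Sum>s<l. \<Sum>k=1..Suc (rows \<Lambda> s). weight \<Lambda> s k * res (outer \<Lambda> s k) ^ r) = poly P 0"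
    by (rule weight_sum_q[OF False, folded E_def, OF _ deg]) (simp add: val e_def case_prod_beta')
  also have "poly P 0 = (if r = 0 then 1 else 0)"
    using e0 by (simp add: val)
  finally show ?thesis .
next
  case True
  have inner: "(\<Sum>k=1..Suc (rows \<Lambda> s). weight \<Lambda> s k * res (outer \<Lambda> s k) ^ r) = (\<Prod>t\<in>{..<l} - {s}. - Q t / (Q s - Q t)) * Q s ^ r"
    if s: "s < l" for s
  proof -
    define e where "e i = (of_int (content (inner \<Lambda> s i)) :: 'k)" for i
    define P where "P = Polynomial.smult (Q s ^ r) (\<Prod>i=1..rows \<Lambda> s. [:- e i, 1:])"
    have "res (outer \<Lambda> s k) = Q s" for k using True by (simp add: residue_def outer_def)
    then have "(\<Prod>i=1..rows \<Lambda> s. of_int (content (outer \<Lambda> s k)) - of_int (content (inner \<Lambda> s i))) * res (outer \<Lambda> s k) ^ r =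
        poly P (of_int (content (outer \<Lambda> s k)))" for k
      by (simp add: P_def poly_prod e_def algebra_simps)
    moreover have "degree P \<le> rows \<Lambda> s"
      using degree_smult_le[of "Q s ^ r" "\<Prod>i=1..rows \<Lambda> s. [:- e i, 1:]"] monic_prod_linear(1)[of "{1..rows \<Lambda> s}" e] by (simp add: P_def)
    ultimately have "(\<Sum>k=1..Suc (rows \<Lambda> s). weight \<Lambda> s k * res (outer \<Lambda> s k) ^ r) =
       (\<Prod>t\<in>{..<l} - {s}. - Q t / (Q s - Q t)) * coeff P (rows \<Lambda> s)"
      by (intro component_sum_q1[OF True s]) auto
    also have "coeff P (rows \<Lambda> s) = Q s ^ r" using monic_prod_linear(2)[of "{1..rows \<Lambda> s}" e] by (simp add: P_def)
    finally show ?thesis .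
  qed
  have inj: "inj_on Q {..<l}"
  proof (rule inj_onI, rule ccontr)
    fix s t assume "s \<in> {..<l}" "t \<in> {..<l}" "Q s = Q t" "s \<noteq> t"
    then show False using Q_sep[of s t 0] m by simp
  qed
  have "(\<Sum>s<l. \<Sum>k=1..Suc (rows \<Lambda> s). weight \<Lambda> s k * res (outer \<Lambda> s k) ^ r) =
     (\<Sum>s\<in>{..<l}. poly (monom 1 r) (Q s) * (\<Prod>t\<in>{..<l} - {s}. - Q t / (Q s - Q t)))"
  proof (rule sum.cong[OF refl])
    fix s assume "s \<in> {..<l}"
    then have "s < l" by simp
    from inner[OF this] show "(\<Sum>k=1..Suc (rows \<Lambda> s). weight \<Lambda> s k * res (outer \<Lambda> s k) ^ r) =
        poly (monom 1 r) (Q s) * (\<Prod>t\<in>{..<l} - {s}. - Q t / (Q s - Q t))"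
      by (simp only: poly_monom mult_1 mult.commute)
  qed
  also have "\<dots> = poly (monom 1 r) 0" using r by (intro lagrange_at_0 inj) (auto simp: degree_monom_eq)
  finally show ?thesis by (simp add: poly_monom)
qed

text \<open>The coefficient has a pole at the residue of the row end, which cancels a zero of the
  numerator, and it carries a factor \<open>x\<close>: the degree bound persists and the polynomial
  vanishes at 0. For \<open>q = 1\<close> the cancellation pushes the degree in component
  \<open>u\<close> below the coefficient that is read off. Since the row end is removable, the pole
  is not an interpolation node.\<close>

theorem weight_sum_coeff:
  assumes r: "r < l" and uv: "u < l" "1 \<le> v" "v \<le> rows \<Lambda> u" "(\<Lambda> ! u) (Suc v) < (\<Lambda> ! u) v"
  shows "(\<Sum>s<l. \<Sum>k=1..Suc (rows \<Lambda> s). weight \<Lambda> s k * (res (outer \<Lambda> s k) ^ r * a (inner \<Lambda> u v) (outer \<Lambda> s k))) = 0"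
proof (cases "q = 1")
  case False
  define E where "E = (SIGMA t:{..<l}. {1..rows \<Lambda> t})"
  define e where "e y = res (inner \<Lambda> (fst y) (snd y))" for y
  have finE: "finite E" by (simp add: E_def)
  have uvE: "(u, v) \<in> E" using uv by (simp add: E_def)
  define P where "P = (\<Prod>y\<in>E - {(u, v)}. Polynomial.smult (1 / (- e y)) [:- e y, 1:]) * monom ((q - 1) / (- e (u, v))) (Suc r)"
  have val: "poly P x = (\<Prod>y\<in>E - {(u, v)}. (x - e y) / (- e y)) * ((q - 1) / (- e (u, v)) * x ^ Suc r)" for x
    unfolding P_def poly_mult poly_prod poly_unit_root poly_monom ..
  have "degree P \<le> degree (\<Prod>y\<in>E - {(u, v)}. Polynomial.smult (1 / (- e y)) [:- e y, 1:]) + degree (monom ((q - 1) / (- e (u, v))) (Suc r))"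
    unfolding P_def by (rule degree_mult_le)
  also have "degree (\<Prod>y\<in>E - {(u, v)}. Polynomial.smult (1 / (- e y)) [:- e y, 1:]) \<le> sum (degree \<circ> (\<lambda>y. Polynomial.smult (1 / (- e y)) [:- e y, 1:])) (E - {(u, v)})"
    by (rule degree_prod_sum_le) (simp add: finE)
  also have "\<dots> \<le> (\<Sum>y\<in>E - {(u, v)}. 1)" by (intro sum_mono) (simp add: degree_smult_le)
  also have "\<dots> + degree (monom ((q - 1) / (- e (u, v))) (Suc r)) \<le> card (E - {(u, v)}) + Suc r"
    by (simp add: degree_monom_le)
  also have "card (E - {(u, v)}) + Suc r = card E + r"
    using uvE finE by (metis add_Suc_right add_Suc card_Suc_Diff1)
  finally have deg: "degree P < card E + l" using r by simp
  have "(\<Sum>s<l. \<Sum>k=1..Suc (rows \<Lambda> s). weight \<Lambda> s k * (res (outer \<Lambda> s k) ^ r * a (inner \<Lambda> u v) (outer \<Lambda> s k))) = poly P 0"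
  proof (rule weight_sum_q[OF False, folded E_def, OF _ deg])
    fix s k assume sk: "s < l" "1 \<le> k" "k \<le> Suc (rows \<Lambda> s)"
    let ?x = "res (outer \<Lambda> s k)"
    have g: "good (inner \<Lambda> u v) (outer \<Lambda> s k)" by (rule good_inner_outer[OF sk uv])
    have ax: "a (inner \<Lambda> u v) (outer \<Lambda> s k) = (q - 1) * ?x / (?x - e (u, v))"
      using a_eq_res[OF False g] by (simp add: e_def)
    have ne: "?x - e (u, v) \<noteq> 0" using g False by (auto simp: good_def e_def)
    have "(\<Prod>y\<in>E. (?x - e y) / (- e y)) = (?x - e (u, v)) / (- e (u, v)) * (\<Prod>y\<in>E - {(u, v)}. (?x - e y) / (- e y))"
      using finE uvE by (rule prod.remove)
    then have "(\<Prod>y\<in>E. (?x - e y) / (- e y)) * (?x ^ r * a (inner \<Lambda> u v) (outer \<Lambda> s k)) =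
       (\<Prod>y\<in>E - {(u, v)}. (?x - e y) / (- e y)) * (((?x - e (u, v)) / (?x - e (u, v))) * ((q - 1) / (- e (u, v)) * ?x ^ Suc r))"
      unfolding ax by simp
    also have "\<dots> = poly P ?x" using ne by (simp add: val)
    finally show "(\<Prod>(t, i)\<in>E. (?x - res (inner \<Lambda> t i)) / (- res (inner \<Lambda> t i))) *
         (?x ^ r * a (inner \<Lambda> u v) (outer \<Lambda> s k)) = poly P ?x" by (simp add: e_def case_prod_beta')
  qed
  also have "poly P 0 = 0" by (simp add: val)
  finally show ?thesis .
next
  case True
  have inner: "(\<Sum>k=1..Suc (rows \<Lambda> s). weight \<Lambda> s k * (res (outer \<Lambda> s k) ^ r * a (inner \<Lambda> u v) (outer \<Lambda> s k))) = 0"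
    if s: "s < l" for s
  proof (cases "s = u")
    case False
    then have "a (inner \<Lambda> u v) (outer \<Lambda> s k) = 0" for k
      unfolding a_q1[OF True] by (simp add: inner_def outer_def)
    then show ?thesis by (simp del: sum.cl_ivl_Suc)
  next
    case su: True
    define e where "e i = (of_int (content (inner \<Lambda> u i)) :: 'k)" for i
    define P where "P = Polynomial.smult (Q u ^ r) (\<Prod>i\<in>{1..rows \<Lambda> u} - {v}. [:- e i, 1:])"
    have degP: "degree P \<le> rows \<Lambda> u - 1"
      using degree_smult_le[of "Q u ^ r" "\<Prod>i\<in>{1..rows \<Lambda> u} - {v}. [:- e i, 1:]"]
        monic_prod_linear(1)[of "{1..rows \<Lambda> u} - {v}" e] uv by (simp add: P_def)
    have "(\<Sum>k=1..Suc (rows \<Lambda> u). weight \<Lambda> u k * (res (outer \<Lambda> u k) ^ r * a (inner \<Lambda> u v) (outer \<Lambda> u k))) =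
       (\<Prod>t\<in>{..<l} - {u}. - Q t / (Q u - Q t)) * coeff P (rows \<Lambda> u)"
    proof (rule component_sum_q1[OF True uv(1)])
      fix k assume k: "1 \<le> k" "k \<le> Suc (rows \<Lambda> u)"
      let ?d = "of_int (content (outer \<Lambda> u k)) :: 'k"
      have g: "good (inner \<Lambda> u v) (outer \<Lambda> u k)" by (rule good_inner_outer[OF uv(1) k uv])
      have ax: "a (inner \<Lambda> u v) (outer \<Lambda> u k) = 1 / (?d - e v)"
        unfolding a_q1[OF True] by (simp add: inner_def outer_def e_def)
      have ne: "?d - e v \<noteq> 0" using g True unfolding good_def by (simp add: e_def inner_def outer_def)
      have rQ: "res (outer \<Lambda> u k) = Q u" using True by (simp add: residue_def outer_def)
      have R: "(\<Prod>i=1..rows \<Lambda> u. ?d - e i) = (?d - e v) * (\<Prod>i\<in>{1..rows \<Lambda> u} - {v}. ?d - e i)"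
        using uv by (intro prod.remove) auto
      have "poly P ?d = Q u ^ r * (\<Prod>i\<in>{1..rows \<Lambda> u} - {v}. ?d - e i)" by (simp add: P_def poly_prod)
      then show "(\<Prod>i=1..rows \<Lambda> u. ?d - of_int (content (inner \<Lambda> u i))) *
          (res (outer \<Lambda> u k) ^ r * a (inner \<Lambda> u v) (outer \<Lambda> u k)) = poly P ?d"
        unfolding e_def[symmetric] ax rQ R using ne by simp
    qed (use degP in simp)
    also have "coeff P (rows \<Lambda> u) = 0" using degP uv by (intro coeff_eq_0) simp
    finally show ?thesis using su by simp
  qed
  show ?thesis by (rule sum.neutral) (use inner in auto)
qed

end

end

section \<open>The weighted trace\<close>

definition shape :: "nat \<Rightarrow> node set \<Rightarrow> multipartition" where
  "shape l D = map (\<lambda>s i. card {j. (s, i, j) \<in> D}) [0..<l]"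

lemma length_shape [simp]: "length (shape l D) = l" by (simp add: shape_def)

lemma shape_nth: "s < l \<Longrightarrow> (shape l D ! s) i = card {j. (s, i, j) \<in> D}" by (simp add: shape_def)

lemma finite_down_closed_interval:
  assumes "finite (A :: nat set)" "\<And>j. j \<in> A \<Longrightarrow> 1 \<le> j" "\<And>j. j \<in> A \<Longrightarrow> 1 < j \<Longrightarrow> j - 1 \<in> A"
  shows "A = {1..card A}"
proof (cases "A = {}")
  case False
  define M where "M = Max A"
  have M: "M \<in> A" "\<And>j. j \<in> A \<Longrightarrow> j \<le> M" using assms(1) False by (auto simp: M_def)
  have down: "M - k \<in> A" if "k < M" for k using that
  proof (induction k)
    case (Suc k)
    then have "M - k - 1 \<in> A" by (intro assms(3)) auto
    then show ?case by simp
  qed (use M in simp)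
  have "A = {1..M}"
  proof
    show "A \<subseteq> {1..M}" using M assms(2) by auto
    show "{1..M} \<subseteq> A"
    proof
      fix j assume "j \<in> {1..M}"
      then show "j \<in> A" using down[of "M - j"] by auto
    qed
  qed
  then show ?thesis by (metis card_atLeastAtMost diff_Suc_1)
qed simp

lemma shape_row:
  assumes D: "closed_diagram l D" "finite D" and s: "s < l"
  shows "{j. (s, i, j) \<in> D} = {1..(shape l D ! s) i}"
proof -
  have "finite {j. (s, i, j) \<in> D}"
    using D(2) by (rule finite_surj[of D _ "\<lambda>x. snd (snd x)"]) force
  then show ?thesis using D(1) unfolding shape_nth[OF s] closed_diagram_def
    by (intro finite_down_closed_interval) auto
qed

lemma in_shape_iff:
  assumes D: "closed_diagram l D" "finite D"
  shows "(s, i, j) \<in> D \<longleftrightarrow> s < l \<and> 1 \<le> i \<and> 1 \<le> j \<and> j \<le> (shape l D ! s) i"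
proof -
  have "(s, i, j) \<in> D \<Longrightarrow> s < l \<and> 1 \<le> i" using D(1) by (auto simp: closed_diagram_def)
  moreover have "(s, i, j) \<in> D \<longleftrightarrow> 1 \<le> j \<and> j \<le> (shape l D ! s) i" if "s < l" using shape_row[OF D that, of i] by auto
  ultimately show ?thesis by blast
qed

lemma shape_partition:
  assumes D: "closed_diagram l D" "finite D" and s: "s < l"
  shows "is_partition (shape l D ! s)"
  unfolding is_partition_def
proof (intro conjI allI impI)
  let ?p = "shape l D ! s"
  have "{j. (s, 0, j) \<in> D} = {}" using D(1) unfolding closed_diagram_def by fastforce
  then show "?p 0 = 0" by (simp add: shape_nth[OF s])
  show "?p (Suc i) \<le> ?p i" if "1 \<le> i" for i
  proof (cases "?p (Suc i) = 0")
    case False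
    then have "(s, Suc i, ?p (Suc i)) \<in> D" using in_shape_iff[OF D] s by simp
    then have "(s, i, ?p (Suc i)) \<in> D" using D(1) that unfolding closed_diagram_def by fastforce
    then show ?thesis using in_shape_iff[OF D] by simp
  qed simp
  have "{i. ?p i \<noteq> 0} \<subseteq> (\<lambda>x. fst (snd x)) ` D"
  proof
    fix i assume "i \<in> {i. ?p i \<noteq> 0}"
    then have "{j. (s, i, j) \<in> D} \<noteq> {}" using shape_row[OF D s, of i] by auto
    then obtain j where "(s, i, j) \<in> D" by auto
    then show "i \<in> (\<lambda>x. fst (snd x)) ` D" by force
  qed
  then show "finite {i. ?p i \<noteq> 0}" by (rule finite_subset) (simp add: D(2))
qed

lemma mp_nodes_shape:
  assumes D: "closed_diagram l D" "finite D"
  shows "mp_nodes (shape l D) = D"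
proof -
  have "(s, i, j) \<in> mp_nodes (shape l D) \<longleftrightarrow> (s, i, j) \<in> D" for s i j
    unfolding in_shape_iff[OF D] by (auto simp: mp_nodes_def young_def)
  then show ?thesis by auto
qed

lemma card_mp_nodes:
  assumes "\<forall>p\<in>set \<Lambda>. is_partition p"
  shows "finite (mp_nodes \<Lambda>)" "card (mp_nodes \<Lambda>) = mp_size \<Lambda>"
proof -
  have e: "mp_nodes \<Lambda> = (SIGMA s:{..<length \<Lambda>}. young (\<Lambda> ! s))" by (auto simp: mp_nodes_def)
  have fin: "finite (young (\<Lambda> ! s))" if "s < length \<Lambda>" for s using assms that young_finite by simp
  show "finite (mp_nodes \<Lambda>)" unfolding e using fin by (intro finite_SigmaI) auto
  have "card (mp_nodes \<Lambda>) = (\<Sum>s<length \<Lambda>. card (young (\<Lambda> ! s)))" unfolding e using fin by (subst card_SigmaI) auto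
  also have "\<dots> = (\<Sum>s<length \<Lambda>. psize (\<Lambda> ! s))" using assms card_young by (intro sum.cong) auto
  also have "\<dots> = mp_size \<Lambda>" by (simp add: mp_size_def sum_list_sum_nth atLeast0LessThan)
  finally show "card (mp_nodes \<Lambda>) = mp_size \<Lambda>" .
qed

lemma shape_multipartition:
  assumes D: "closed_diagram l D" "finite D"
  shows "shape l D \<in> multipartitions l (card D)"
proof -
  have "\<forall>p\<in>set (shape l D). is_partition p"
    using shape_partition[OF D] by (metis in_set_conv_nth length_shape)
  then show ?thesis using card_mp_nodes(2)[of "shape l D"] mp_nodes_shape[OF D]
    by (simp add: multipartitions_def)
qed

lemma shape_mp_nodes:
  assumes "\<Lambda> \<in> multipartitions l m"
  shows "closed_diagram l (mp_nodes \<Lambda>)" "finite (mp_nodes \<Lambda>)" "card (mp_nodes \<Lambda>) = m" "shape l (mp_nodes \<Lambda>) = \<Lambda>"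
proof -
  have L: "length \<Lambda> = l" "\<forall>p\<in>set \<Lambda>. is_partition p" "mp_size \<Lambda> = m" using assms by (auto simp: multipartitions_def)
  have p: "is_partition (\<Lambda> ! s)" if "s < l" for s using L that by auto
  show "finite (mp_nodes \<Lambda>)" "card (mp_nodes \<Lambda>) = m" using card_mp_nodes L by auto
  have "(\<Lambda> ! s) i \<le> (\<Lambda> ! s) (i - 1)" if "s < l" "1 < i" for s i
    using partition_antimono[OF p[OF that(1)], of "i - 1" i] that by simp
  then show "closed_diagram l (mp_nodes \<Lambda>)"
    unfolding closed_diagram_def mp_nodes_def young_def using L by (auto intro: le_trans)
  show "shape l (mp_nodes \<Lambda>) = \<Lambda>"
  proof (rule nth_equalityI)
    fix s assume "s < length (shape l (mp_nodes \<Lambda>))"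
    then have s: "s < l" by simp
    have "(shape l (mp_nodes \<Lambda>) ! s) i = (\<Lambda> ! s) i" for i
    proof (cases "i = 0")
      case True
      then show ?thesis using p[OF s] by (simp add: shape_nth[OF s] mp_nodes_def young_def is_partition_def)
    next
      case False
      then have "{j. (s, i, j) \<in> mp_nodes \<Lambda>} = {1..(\<Lambda> ! s) i}" using s L by (auto simp: mp_nodes_def young_def)
      then show ?thesis by (simp add: shape_nth[OF s])
    qed
    then show "shape l (mp_nodes \<Lambda>) ! s = \<Lambda> ! s" by blast
  qed (use L in simp)
qed

lemma addable_shape_iff:
  assumes D: "closed_diagram l D" "finite D"
  shows "addable l D (s, i, j) \<longleftrightarrow> s < l \<and> 1 \<le> i \<and> j = Suc ((shape l D ! s) i) \<and>
    (i = 1 \<or> (shape l D ! s) i < (shape l D ! s) (i - 1))"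
  unfolding addable_def by (simp add: in_shape_iff[OF D]) (auto simp: not_le less_Suc_eq_le)

lemma shape_insert:
  assumes D: "closed_diagram l D" "finite D" and x: "addable l D (s, i, j)"
  shows "shape l (insert (s, i, j) D) = (shape l D)[s := add_box (shape l D ! s) i]"
proof (rule nth_equalityI)
  have s: "s < l" and n: "(s, i, j) \<notin> D" using x by (auto simp: addable_def)
  have fin: "finite {j. (t, k, j) \<in> D}" for t k
    using D(2) by (rule finite_surj[of D _ "\<lambda>x. snd (snd x)"]) force
  fix t assume "t < length (shape l (insert (s, i, j) D))"
  then have t: "t < l" by simp
  have "(shape l (insert (s, i, j) D) ! t) k = ((shape l D)[s := add_box (shape l D ! s) i] ! t) k" for k
  proof (cases "t = s \<and> k = i")
    case True
    then have "{j'. (t, k, j') \<in> insert (s, i, j) D} = insert j {j. (t, k, j) \<in> D}" by auto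
    then show ?thesis using True t n fin by (simp add: shape_nth add_box_def)
  next
    case False
    then have "{j'. (t, k, j') \<in> insert (s, i, j) D} = {j. (t, k, j) \<in> D}" by auto
    then show ?thesis using False t s by (cases "t = s") (auto simp: shape_nth add_box_def)
  qed
  then show "shape l (insert (s, i, j) D) ! t = (shape l D)[s := add_box (shape l D ! s) i] ! t" by blast
qed simp

lemma separated_mono:
  assumes "separated l n q Q" "m \<le> n"
  shows "separated l m q Q"
  using assms unfolding separated_def by auto

context separated
begin

section \<open>Sums of reciprocals over addable nodes\<close>

definition S :: "node set \<Rightarrow> 'k" where "S D = schur_formula l (card D) q Q (shape l D)"

lemma S_empty: "S {} = 1"
proof -
  have sh: "p = (\<lambda>i. 0)" if "p \<in> set (shape l {})" for p using that by (auto simp: shape_def)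
  have z: "shape l {} ! s = (\<lambda>i. 0)" if "s < l" for s using that sh[of "shape l {} ! s"] by simp
  have "is_partition (\<lambda>i. 0)" by (simp add: is_partition_def)
  then have "n_stat (mp_bar (shape l {})) = (\<Sum>j=1..0. \<Sum>k<(\<Sum>p\<leftarrow>shape l {}. conj_part p j). k)"
    using sh by (intro n_stat_bar) auto
  moreover have "young (\<lambda>i. 0) = {}" by (auto simp: young_def)
  ultimately show ?thesis unfolding S_def schur_formula_def by (simp add: z)
qed

text \<open>\<open>schur_formula_add_box\<close> solved for the reciprocal; the sign
  \<open>(-1) ^ (l - 1)\<close> is its own inverse.\<close>

lemma S_insert:
  assumes D: "closed_diagram l D" "finite D" "card D < n" "S D \<noteq> 0"
    and x: "addable l D (s, k, j)"
  shows "1 / S (insert (s, k, j) D) = weight (shape l D) s k / S D" "S (insert (s, k, j) D) \<noteq> 0"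
proof -
  let ?\<Lambda> = "shape l D" and ?D = "insert (s, k, j) D"
  have D': "closed_diagram l ?D" "finite ?D" using closed_diagram_insert[OF D(1) x] D(2) by auto
  have sk: "s < l" "1 \<le> k" "k = 1 \<or> (?\<Lambda> ! s) k < (?\<Lambda> ! s) (k - 1)" using x addable_shape_iff[OF D(1,2)] by auto
  have \<Lambda>: "?\<Lambda> \<in> multipartitions l (card D)" by (rule shape_multipartition[OF D(1,2)])
  have card: "card ?D = Suc (card D)" using x D(2) by (simp add: addable_def)
  have sh: "shape l ?D = ?\<Lambda>[s := add_box (?\<Lambda> ! s) k]" by (rule shape_insert[OF D(1,2) x])
  have \<Lambda>': "?\<Lambda>[s := add_box (?\<Lambda> ! s) k] \<in> multipartitions l (Suc (card D))"
    using shape_multipartition[OF D'] unfolding sh card .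
  have part: "is_partition (?\<Lambda> ! s)" by (rule shape_partition[OF D(1,2) sk(1)])
  have part': "is_partition (add_box (?\<Lambda> ! s) k)"
    using shape_partition[OF D' sk(1)] sk(1) unfolding sh by simp
  have kr: "k \<le> Suc (rows ?\<Lambda> s)"
  proof (cases "k = 1")
    case False
    then have "(?\<Lambda> ! s) (k - 1) \<noteq> 0" using sk by auto
    moreover have "1 \<le> k - 1" using False sk(2) by simp
    ultimately show ?thesis using part_zero_iff[OF part, of "k - 1"] by (simp add: rows_def)
  qed simp
  have d: "denom ?\<Lambda> s k \<noteq> 0" by (rule denom_nz[OF \<Lambda> D(3) sk(1,2) kr])
  have nn: "numer ?\<Lambda> s (content (outer ?\<Lambda> s k)) \<noteq> 0" by (rule numer_nz[OF \<Lambda> D(3) sk(1,2) kr sk(3)])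
  have eq: "S ?D * numer ?\<Lambda> s (content (outer ?\<Lambda> s k)) = (-1) ^ (l - 1) * S D * denom ?\<Lambda> s k"
    unfolding S_def sh card by (rule schur_formula_add_box[OF \<Lambda> D(3) sk(1,2) part' refl \<Lambda>'])
  then show nz: "S ?D \<noteq> 0" using D(4) d by (metis mult_eq_0_iff power_eq_0_iff neg_equal_0_iff_equal zero_neq_one)
  have "numer ?\<Lambda> s (content (outer ?\<Lambda> s k)) = (-1) ^ (l - 1) * S D * denom ?\<Lambda> s k / S ?D"
    using eq nz by (simp add: field_simps)
  moreover have "(-1 :: 'k) ^ (l - 1) * (-1) ^ (l - 1) = 1" by (simp add: power_mult_distrib[symmetric])
  ultimately have "weight ?\<Lambda> s k = S D / S ?D"
    unfolding weight_def using d by (simp add: field_simps)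
  then show "1 / S ?D = weight ?\<Lambda> s k / S D" using D(4) by simp
qed

lemma S_nz:
  assumes "path l p" "length p \<le> n"
  shows "S (set p) \<noteq> 0"
  using assms
proof (induction p rule: rev_induct)
  case Nil
  then show ?case using S_empty by simp
next
  case (snoc x p)
  then have p: "path l p" "addable l (set p) x" by (auto simp: path_from_append)
  have "card (set p) < n" using snoc.prems card_length[of p] by simp
  then show ?case using S_insert(2)[OF path_closed[OF p(1)] _ _ _ , of "fst x" "fst (snd x)" "snd (snd x)"] p snoc by simp
qed

text \<open>Rows without an addable node have weight 0, so the sum may be extended to all
  rows.\<close>

lemma sum_addable:
  assumes D: "closed_diagram l D" "finite D" "card D < n" "S D \<noteq> 0"
  shows "(\<Sum>x | addable l D x. g x / S (insert x D)) =
    (\<Sum>s<l. \<Sum>k=1..Suc (rows (shape l D) s). weight (shape l D) s k * g (outer (shape l D) s k)) / S D"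
proof -
  let ?\<Lambda> = "shape l D"
  have \<Lambda>: "?\<Lambda> \<in> multipartitions l (card D)" by (rule shape_multipartition[OF D(1,2)])
  let ?I = "SIGMA s:{..<l}. {1..Suc (rows ?\<Lambda> s)}"
  let ?ok = "\<lambda>s k. k = 1 \<or> (?\<Lambda> ! s) k < (?\<Lambda> ! s) (k - 1)"
  let ?J = "{x\<in>?I. ?ok (fst x) (snd x)}"
  have "(\<Sum>s<l. \<Sum>k=1..Suc (rows ?\<Lambda> s). weight ?\<Lambda> s k * g (outer ?\<Lambda> s k)) / S D =
     (\<Sum>x\<in>?I. weight ?\<Lambda> (fst x) (snd x) / S D * g (outer ?\<Lambda> (fst x) (snd x)))"
    by (subst sum.Sigma) (auto simp: case_prod_beta' sum_divide_distrib)
  also have "\<dots> = (\<Sum>x\<in>?J. weight ?\<Lambda> (fst x) (snd x) / S D * g (outer ?\<Lambda> (fst x) (snd x)))"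
  proof (rule sum.mono_neutral_right)
    show "\<forall>i\<in>?I - ?J. weight ?\<Lambda> (fst i) (snd i) / S D * g (outer ?\<Lambda> (fst i) (snd i)) = 0"
    proof
      fix i assume "i \<in> ?I - ?J"
      then obtain s k where i: "i = (s, k)" "s < l" "1 \<le> k" "k \<le> Suc (rows ?\<Lambda> s)" "\<not> ?ok s k" by auto
      have "(?\<Lambda> ! s) k \<le> (?\<Lambda> ! s) (k - 1)"
        using partition_antimono[OF shape_partition[OF D(1,2) i(2)], of "k - 1" k] i by auto
      then have "weight ?\<Lambda> s k = 0" using weight_zero[OF \<Lambda> D(3) i(2), of k] i by auto
      then show "weight ?\<Lambda> (fst i) (snd i) / S D * g (outer ?\<Lambda> (fst i) (snd i)) = 0" using i by simp
    qed
  qed auto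
  also have "\<dots> = (\<Sum>x | addable l D x. g x / S (insert x D))"
  proof (rule sum.reindex_bij_witness[of _ "\<lambda>x. (fst x, fst (snd x))" "\<lambda>x. outer ?\<Lambda> (fst x) (snd x)"])
    fix x assume x: "x \<in> ?J"
    then have add: "addable l D (outer ?\<Lambda> (fst x) (snd x))"
      unfolding outer_def addable_shape_iff[OF D(1,2)] by auto
    then show "outer ?\<Lambda> (fst x) (snd x) \<in> {x. addable l D x}" by simp
    show "(fst (outer ?\<Lambda> (fst x) (snd x)), fst (snd (outer ?\<Lambda> (fst x) (snd x)))) = x" by (simp add: outer_def)
    show "g (outer ?\<Lambda> (fst x) (snd x)) / S (insert (outer ?\<Lambda> (fst x) (snd x)) D) =
       weight ?\<Lambda> (fst x) (snd x) / S D * g (outer ?\<Lambda> (fst x) (snd x))"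
      using S_insert(1)[OF D add[unfolded outer_def]] unfolding outer_def
      by (metis (no_types, lifting) divide_inverse inverse_eq_divide mult.commute)
  next
    fix x assume "x \<in> {x. addable l D x}"
    then obtain s i j where x: "x = (s, i, j)" "addable l D (s, i, j)" by (cases x) auto
    then have c: "s < l" "1 \<le> i" "j = Suc ((?\<Lambda> ! s) i)" "?ok s i" using addable_shape_iff[OF D(1,2)] by auto
    have "i \<le> Suc (rows ?\<Lambda> s)"
    proof (cases "i = 1")
      case False
      then have "(?\<Lambda> ! s) (i - 1) \<noteq> 0" using c by auto
      moreover have "1 \<le> i - 1" using False c(2) by simp
      ultimately show ?thesis using part_zero_iff[OF shape_partition[OF D(1,2) c(1)], of "i - 1"] by (simp add: rows_def)
    qed simp
    then show "(fst x, fst (snd x)) \<in> ?J" using x c by auto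
    show "outer ?\<Lambda> (fst (fst x, fst (snd x))) (snd (fst x, fst (snd x))) = x" using x c by (simp add: outer_def)
  qed
  finally show ?thesis ..
qed

lemma sum_res_addable:
  assumes D: "closed_diagram l D" "finite D" "card D < n" "S D \<noteq> 0" and r: "r < l"
  shows "(\<Sum>x | addable l D x. res x ^ r / S (insert x D)) = (if r = 0 then 1 / S D else 0)"
  unfolding sum_addable[OF D, of "\<lambda>x. res x ^ r"] weight_sum[OF shape_multipartition[OF D(1,2)] D(3) r] by simp

text \<open>A node just added is the end of its row and the row below is shorter, so
  \<open>weight_sum_coeff\<close> applies to it.\<close>

lemma sum_res_a_addable:
  assumes D: "closed_diagram l D" "finite D" "addable l D y"
    and c: "card (insert y D) < n" "S (insert y D) \<noteq> 0" and r: "r < l"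
  shows "(\<Sum>x | addable l (insert y D) x. res x ^ r * a y x / S (insert x (insert y D))) = 0"
proof -
  obtain u v w where y: "y = (u, v, w)" by (cases y) auto
  let ?D = "insert y D"
  let ?\<Lambda> = "shape l ?D"
  have D': "closed_diagram l ?D" "finite ?D" using closed_diagram_insert[OF D(1,3)] D(2) by auto
  have uv: "u < l" "1 \<le> v" "w = Suc ((shape l D ! u) v)" using D(3) addable_shape_iff[OF D(1,2)] y by auto
  have sh: "?\<Lambda> ! u = add_box (shape l D ! u) v" using shape_insert[OF D(1,2), of u v w] D(3) y uv(1) by simp
  have "(?\<Lambda> ! u) v = w" unfolding sh by (simp add: add_box_def uv(3))
  then have inn: "inner ?\<Lambda> u v = y" by (simp add: inner_def) (simp add: y)
  have "(shape l D ! u) (Suc v) \<le> (shape l D ! u) v"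
    using partition_antimono[OF shape_partition[OF D(1,2) uv(1)], of v "Suc v"] uv by simp
  then have lt: "(?\<Lambda> ! u) (Suc v) < (?\<Lambda> ! u) v" by (simp add: sh add_box_def)
  have v: "v \<le> rows ?\<Lambda> u"
    using part_zero_iff[OF shape_partition[OF D' uv(1)] uv(2)] lt by (simp add: rows_def)
  show ?thesis
    unfolding sum_addable[OF D' c, of "\<lambda>x. res x ^ r * a y x"]
      weight_sum_coeff[OF shape_multipartition[OF D'] c(1) r uv(1,2) v lt, unfolded inn] by simp
qed

end

section \<open>Words and monomials in the free algebra\<close>

definition delta :: "'x \<Rightarrow> 'x \<Rightarrow> 'k::field" where "delta p r = (if r = p then 1 else 0)"

definition fword :: "nat list \<Rightarrow> 'k::field free_alg" where "fword u = Poly_Mapping.single (FM u) 1"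

lemma fword_append: "fword (u @ v) = fword u * fword v"
  by (simp add: fword_def mult_single plus_free_monoid_def)

lemma fword_Nil: "fword [] = 1"
  by (simp add: fword_def zero_free_monoid_def[symmetric])

lemma fword_Cons: "fword (i # u) = free_gen i * fword u"
  using fword_append[of "[i]" u] by (simp add: fword_def free_gen_def)

lemma rep_fword: "rep G (fword u) v = foldr G u v"
  by (simp add: fword_def rep_single fun_eq_iff)

lemma fword_carrier: "set u \<subseteq> {..<n} \<Longrightarrow> fword u \<in> carrier (free_algebra n)"
  by (simp add: free_algebra_carrier_iff fword_def)

lemma free_algebra_mono: "m \<le> n \<Longrightarrow> x \<in> carrier (free_algebra m) \<Longrightarrow> x \<in> carrier (free_algebra n)"
  unfolding free_algebra_carrier_iff by (meson lessThan_subset_iff subset_trans)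

lemma free_algebra_power: "x \<in> carrier (free_algebra n) \<Longrightarrow> x ^ k \<in> carrier (free_algebra n)"
  for x :: "'k::field free_alg"
  by (induction k) (auto intro: free_algebra_closed)

lemma free_algebra_prod_list:
  fixes f :: "'b \<Rightarrow> 'k::field free_alg"
  shows "(\<And>k. k \<in> set ks \<Longrightarrow> f k \<in> carrier (free_algebra n)) \<Longrightarrow> (\<Prod>k\<leftarrow>ks. f k) \<in> carrier (free_algebra n)"
  by (induction ks) (auto intro: free_algebra_closed)

text \<open>Representatives of the \<open>L k\<close> in the free algebra, where they act on paths
  before any quotient is formed.\<close>

definition fL :: "'k::field \<Rightarrow> nat \<Rightarrow> 'k free_alg" where
  "fL q k = free_const (q powi (1 - int k)) * fword (rev [1..<k] @ [0] @ [1..<k])"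

definition fLmon :: "'k::field \<Rightarrow> nat \<Rightarrow> (nat \<Rightarrow> nat) \<Rightarrow> 'k free_alg" where
  "fLmon q m c = (\<Prod>k\<leftarrow>[1..<m + 1]. fL q k ^ c k)"

lemma fL_carrier: "1 \<le> k \<Longrightarrow> k \<le> n \<Longrightarrow> fL q k \<in> carrier (free_algebra n)"
  unfolding fL_def by (intro free_algebra_closed fword_carrier) auto

lemma fLmon_carrier: "m \<le> n \<Longrightarrow> fLmon q m c \<in> carrier (free_algebra n)"
  unfolding fLmon_def by (intro free_algebra_prod_list free_algebra_power fL_carrier) auto

lemma fLmon_Suc: "fLmon q (Suc m) c = fLmon q m c * fL q (Suc m) ^ c (Suc m)"
  by (simp add: fLmon_def)

section \<open>The trace form and its value on monomials\<close>

context separated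
begin

lemma rep_F_zero_block:
  assumes x: "x \<in> carrier (free_algebra m)" and p: "p \<in> paths l m"
    and v: "\<And>r. r \<in> paths l m \<Longrightarrow> set r = set p \<Longrightarrow> v r = v' r"
  shows "rep F x v p = rep F x v' p"
proof (rule rep_local[of "{..<m}" "{r\<in>paths l m. set r = set p}"])
  show "\<And>w. w \<in> Poly_Mapping.keys x \<Longrightarrow> set (letters w) \<subseteq> {..<m}"
    using x by (simp add: free_algebra_carrier_iff)
  show "F k v r = F k v' r" if "k \<in> {..<m}" "r \<in> {r\<in>paths l m. set r = set p}"
    "\<And>r. r \<in> {r\<in>paths l m. set r = set p} \<Longrightarrow> v r = v' r" for k v v' r
    using that by (intro path_op_local[of k m r l]) auto
qed (use p v in auto)

lemma rep_F_const_zero: "rep F x (\<lambda>_. 0) p = 0"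
  by (simp add: rep_def foldr_linear_zero[OF linear_path_op])

lemma rep_F_delta_zero:
  assumes x: "x \<in> carrier (free_algebra m)" and p: "p \<in> paths l m" and r: "set r \<noteq> set p"
  shows "rep F x (delta r) p = 0"
proof -
  have "rep F x (delta r) p = rep F x (\<lambda>_. 0) p"
    using r by (intro rep_F_zero_block[OF x p]) (auto simp: delta_def)
  then show ?thesis by (simp add: rep_F_const_zero)
qed

lemma rep_F_expand:
  assumes x: "x \<in> carrier (free_algebra m)" and p: "p \<in> paths l m"
  shows "rep F x v p = (\<Sum>r\<in>paths l m. v r * rep F x (delta r) p)"
proof -
  have "rep F x v p = rep F x (\<lambda>u. \<Sum>r\<in>paths l m. v r * delta r u) p"
  proof (rule rep_F_zero_block[OF x p])
    fix r assume r: "r \<in> paths l m"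
    have "(\<Sum>r'\<in>paths l m. v r' * delta r' r) = (\<Sum>r'\<in>paths l m. if r' = r then v r else 0)"
      by (intro sum.cong) (auto simp: delta_def)
    also have "\<dots> = v r" using r finite_paths by simp
    finally show "v r = (\<Sum>r'\<in>paths l m. v r' * delta r' r)" ..
  qed
  then show ?thesis using rep_linear_sum[OF linear_path_op finite_paths, of l q Q x v delta l m p] by simp
qed

text \<open>A family indexed by the level, because monomials are evaluated by descending from one
  level to the previous one.\<close>

definition trc :: "nat \<Rightarrow> 'k free_alg \<Rightarrow> 'k" where
  "trc m x = (\<Sum>p\<in>paths l m. 1 / S (set p) * rep F x (delta p) p)"

lemma trc_add: "trc m (x + y) = trc m x + trc m y"
  by (simp add: trc_def rep_add distrib_left sum.distrib)

lemma trc_scale: "trc m (free_const c * x) = c * trc m x"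
  by (simp add: trc_def rep_mult[OF linear_path_op] rep_const sum_distrib_left mult.left_commute)

text \<open>The weight of a path depends only on its set of nodes, and matrix entries between
  different sets vanish; so the symmetry of the ordinary trace survives the weights.\<close>

lemma trc_commute:
  assumes x: "x \<in> carrier (free_algebra m)" and y: "y \<in> carrier (free_algebra m)"
  shows "trc m (x * y) = trc m (y * x)"
proof -
  have *: "trc m (x * y) = (\<Sum>p\<in>paths l m. \<Sum>r\<in>paths l m. 1 / S (set p) * (rep F y (delta p) r * rep F x (delta r) p))"
    if x: "x \<in> carrier (free_algebra m)" for x y
    unfolding trc_def rep_mult[OF linear_path_op]
    by (rule sum.cong[OF refl], subst rep_F_expand[OF x]) (auto simp: sum_distrib_left)
  have "trc m (x * y) = (\<Sum>r\<in>paths l m. \<Sum>p\<in>paths l m. 1 / S (set p) * (rep F y (delta p) r * rep F x (delta r) p))"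
    unfolding *[OF x] by (rule sum.swap)
  also have "\<dots> = (\<Sum>r\<in>paths l m. \<Sum>p\<in>paths l m. 1 / S (set r) * (rep F x (delta r) p * rep F y (delta p) r))"
  proof (intro sum.cong refl)
    fix r p assume r: "r \<in> paths l m" "p \<in> paths l m"
    show "1 / S (set p) * (rep F y (delta p) r * rep F x (delta r) p) = 1 / S (set r) * (rep F x (delta r) p * rep F y (delta p) r)"
    proof (cases "set p = set r")
      case True
      then show ?thesis by (simp only: mult_ac)
    next
      case False
      then show ?thesis using rep_F_delta_zero[OF y r(1) False] by simp
    qed
  qed
  also have "\<dots> = trc m (y * x)" unfolding *[OF y] ..
  finally show ?thesis .
qed

text \<open>Generators of index below \<open>m\<close> exchange nodes among the first
  \<open>m\<close> only, and whether the result is a path does not depend on the node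
  appended.\<close>

lemma rep_F_snoc:
  assumes h: "h \<in> carrier (free_algebra m)" and p: "p \<in> paths l m" "addable l (set p) x"
  shows "rep F h v (p @ [x]) = rep F h (\<lambda>r. v (r @ [x])) p"
proof (rule rep_transport[of "{..<m}" "{r\<in>paths l m. set r = set p}"])
  show "\<And>w. w \<in> Poly_Mapping.keys h \<Longrightarrow> set (letters w) \<subseteq> {..<m}"
    using h by (simp add: free_algebra_carrier_iff)
  show "F k v r = F k v' r" if "k \<in> {..<m}" "r \<in> {r\<in>paths l m. set r = set p}"
    "\<And>r. r \<in> {r\<in>paths l m. set r = set p} \<Longrightarrow> v r = v' r" for k v v' r
    using that by (intro path_op_local[of k m r l]) auto
  fix k v r assume k: "k \<in> {..<m}" and r: "r \<in> {r\<in>paths l m. set r = set p}"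
  have len: "length r = m" using r by (simp add: paths_def)
  show "F k v (r @ [x]) = F k (\<lambda>r. v (r @ [x])) r"
  proof (cases "k = 0")
    case True
    then show ?thesis using k len by (cases r) (auto simp: path_op_0)
  next
    case False
    then have "1 \<le> k" "k < length r" using k len by auto
    then obtain u y z w where s: "r = u @ y # z # w" "k = Suc (length u)" by (rule split_at)
    have "set (u @ z # y # w) = set p" using r s by auto
    then have "path l (u @ z # y # w @ [x]) \<longleftrightarrow> path l (u @ z # y # w)"
      using p(2) path_from_append[of l "{}" "u @ z # y # w" "[x]"] by simp
    then show ?thesis
      unfolding s(1) path_op_swap[OF s(2)] using path_op_swap[OF s(2), of l q Q v y z "w @ [x]"] by simp
  qed
qed (use p in auto)

lemma rep_fL:
  assumes "m \<le> n" "p \<in> paths l m" "1 \<le> k" "k \<le> m"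
  shows "rep F (fL q k) v p = res (p ! (k - 1)) * v p"
proof -
  interpret m: separated l m q Q by (rule separated_mono[OF separated_axioms assms(1)])
  have "q powi (1 - int k) = inverse (q ^ (k - 1))"
    using assms by (simp add: power_int_def nat_diff_distrib power_inverse)
  then show ?thesis using q0 m.F_L_word[OF assms(2-4), of v]
    unfolding fL_def rep_mult[OF linear_path_op] rep_fword rep_const by simp
qed

lemma rep_fL_pow:
  assumes "m \<le> n" "p \<in> paths l m" "1 \<le> k" "k \<le> m"
  shows "rep F (fL q k ^ c) v p = res (p ! (k - 1)) ^ c * v p"
  by (induction c) (simp_all add: rep_one rep_mult[OF linear_path_op] rep_fL[OF assms] mult.assoc)

lemma paths_Suc_sum:
  "(\<Sum>p\<in>paths l (Suc m). f p) = (\<Sum>p\<in>paths l m. \<Sum>x | addable l (set p) x. f (p @ [x]))"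
proof -
  have "(\<Sum>p\<in>paths l m. \<Sum>x | addable l (set p) x. f (p @ [x])) =
     (\<Sum>y\<in>(SIGMA p:paths l m. {x. addable l (set p) x}). f (fst y @ [snd y]))"
    by (subst sum.Sigma) (auto simp: finite_paths finite_addable case_prod_beta')
  also have "\<dots> = (\<Sum>p\<in>paths l (Suc m). f p)"
    by (rule sum.reindex_bij_witness[of _ "\<lambda>p. (butlast p, last p)" "\<lambda>y. fst y @ [snd y]"])
       (auto simp: paths_Suc)
  finally show ?thesis ..
qed

text \<open>The Markov property. \<open>L_{m+1}\<close> multiplies by a power of the residue of the
  last node while the other factors ignore that node, so the sum over it is the one in
  \<open>sum_res_addable\<close>.\<close>

lemma trc_L_power:
  assumes m: "m < n" and A: "A \<in> carrier (free_algebra m)" and B: "B \<in> carrier (free_algebra m)" and c: "c < l"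
  shows "trc (Suc m) (A * fL q (Suc m) ^ c * B) = (if c = 0 then trc m (A * B) else 0)"
proof -
  have val: "rep F (A * fL q (Suc m) ^ c * B) (delta (p @ [x])) (p @ [x]) = res x ^ c * rep F (A * B) (delta p) p"
    if p: "p \<in> paths l m" and x: "addable l (set p) x" for p x
  proof -
    have len: "length p = m" using p by (simp add: paths_def)
    have "rep F (A * fL q (Suc m) ^ c * B) (delta (p @ [x])) (p @ [x]) =
       rep F A (\<lambda>r. rep F (fL q (Suc m) ^ c) (rep F B (delta (p @ [x]))) (r @ [x])) p"
      unfolding mult.assoc rep_mult[OF linear_path_op] by (rule rep_F_snoc[OF A p x])
    \<comment> \<open>The scalar is written as a sum over one element so that
      \<open>rep_linear_sum\<close> can take it out.\<close>
    also have "\<dots> = rep F A (\<lambda>r. \<Sum>i\<in>{()}. res x ^ c * rep F B (delta p) r) p"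
    proof (rule rep_F_zero_block[OF A p])
      fix r assume r: "r \<in> paths l m" "set r = set p"
      have rx: "r @ [x] \<in> paths l (Suc m)" using r x by (simp add: paths_def path_from_append)
      have "rep F (fL q (Suc m) ^ c) (rep F B (delta (p @ [x]))) (r @ [x]) =
         res x ^ c * rep F B (delta (p @ [x])) (r @ [x])"
        using rep_fL_pow[OF _ rx, of "Suc m" c] m r by (simp add: paths_def nth_append)
      also have "rep F B (delta (p @ [x])) (r @ [x]) = rep F B (\<lambda>r. delta (p @ [x]) (r @ [x])) r"
        using r x by (intro rep_F_snoc[OF B]) auto
      also have "(\<lambda>r. delta (p @ [x]) (r @ [x])) = delta p" by (auto simp: delta_def fun_eq_iff)
      finally show "rep F (fL q (Suc m) ^ c) (rep F B (delta (p @ [x]))) (r @ [x]) = (\<Sum>i\<in>{()}. res x ^ c * rep F B (delta p) r)"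
        by simp
    qed
    also have "\<dots> = res x ^ c * rep F (A * B) (delta p) p"
      unfolding rep_mult[OF linear_path_op] by (subst rep_linear_sum[OF linear_path_op]) auto
    finally show ?thesis .
  qed
  have "trc (Suc m) (A * fL q (Suc m) ^ c * B) =
     (\<Sum>p\<in>paths l m. \<Sum>x | addable l (set p) x. res x ^ c / S (insert x (set p)) * rep F (A * B) (delta p) p)"
    unfolding trc_def paths_Suc_sum by (intro sum.cong refl) (simp add: val)
  also have "\<dots> = (\<Sum>p\<in>paths l m. (if c = 0 then 1 / S (set p) else 0) * rep F (A * B) (delta p) p)"
  proof (rule sum.cong[OF refl])
    fix p assume p: "p \<in> paths l m"
    then have pp: "path l p" "length p = m" by (auto simp: paths_def)
    have "(\<Sum>x | addable l (set p) x. res x ^ c / S (insert x (set p))) = (if c = 0 then 1 / S (set p) else 0)"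
      using pp m S_nz[OF pp(1)] card_length[of p] 
      by (intro sum_res_addable[OF path_closed[OF pp(1)] _ _ _ c]) auto
    then show "(\<Sum>x | addable l (set p) x. res x ^ c / S (insert x (set p)) * rep F (A * B) (delta p) p) =
       (if c = 0 then 1 / S (set p) else 0) * rep F (A * B) (delta p) p"
      by (simp only: sum_distrib_right[symmetric])
  qed
  also have "\<dots> = (if c = 0 then trc m (A * B) else 0)" by (simp add: trc_def)
  finally show ?thesis .
qed

text \<open>On the diagonal \<open>T_m\<close> acts by the coefficient of the last two nodes, since
  the exchanged path ends in a different node. The sum over the last node then vanishes by
  \<open>sum_res_a_addable\<close>.\<close>

lemma trc_L_power_T:
  assumes m: "1 \<le> m" "m < n" and A: "A \<in> carrier (free_algebra m)" and B: "B \<in> carrier (free_algebra m)" and c: "c < l"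
  shows "trc (Suc m) (A * fL q (Suc m) ^ c * B * free_gen m) = 0"
proof -
  have val: "rep F (A * fL q (Suc m) ^ c * B * free_gen m) (delta (p @ [x])) (p @ [x]) =
      res x ^ c * a (last p) x * rep F (A * B) (delta p) p"
    if p: "p \<in> paths l m" and x: "addable l (set p) x" for p x
  proof -
    have len: "length p = m" using p by (simp add: paths_def)
    have Fm: "F m (delta (p @ [x])) (r @ [x]) = a (last p) x * delta p r"
      if r: "r \<in> paths l m" "set r = set p" for r
    proof -
      have "length r = m" using r by (simp add: paths_def)
      then obtain u y where u: "r = u @ [y]" "m = Suc (length u)" using m(1) by (cases r rule: rev_cases) auto
      have "x \<notin> set p" using x by (auto simp: addable_def split: prod.splits)
      then have "y \<noteq> x" using u r(2) by auto
      then have "delta (p @ [x]) (u @ [x, y]) = (0 :: 'k)" by (auto simp: delta_def dest: arg_cong[where f = last])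
      moreover have "delta (p @ [x]) (u @ [y, x]) = (delta p r :: 'k)" using u by (simp add: delta_def)
      moreover have "a y x * delta p r = a (last p) x * delta p r" using u by (auto simp: delta_def)
      ultimately show ?thesis using path_op_swap[OF u(2), of l q Q "delta (p @ [x])" y x "[]"] u(1) by simp
    qed
    have "rep F (A * fL q (Suc m) ^ c * B * free_gen m) (delta (p @ [x])) (p @ [x]) =
       rep F A (\<lambda>r. rep F (fL q (Suc m) ^ c) (rep F B (F m (delta (p @ [x])))) (r @ [x])) p"
      unfolding mult.assoc rep_mult[OF linear_path_op] rep_gen by (rule rep_F_snoc[OF A p x])
    also have "\<dots> = rep F A (\<lambda>r. \<Sum>i\<in>{()}. (res x ^ c * a (last p) x) * rep F B (delta p) r) p"
    proof (rule rep_F_zero_block[OF A p])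
      fix r assume r: "r \<in> paths l m" "set r = set p"
      have rx: "r @ [x] \<in> paths l (Suc m)" using r x by (simp add: paths_def path_from_append)
      have "rep F (fL q (Suc m) ^ c) (rep F B (F m (delta (p @ [x])))) (r @ [x]) =
         res x ^ c * rep F B (F m (delta (p @ [x]))) (r @ [x])"
        using rep_fL_pow[OF _ rx, of "Suc m" c] m r by (simp add: paths_def nth_append)
      also have "rep F B (F m (delta (p @ [x]))) (r @ [x]) = rep F B (\<lambda>r. F m (delta (p @ [x])) (r @ [x])) r"
        using r x by (intro rep_F_snoc[OF B]) auto
      also have "\<dots> = rep F B (\<lambda>r. \<Sum>i\<in>{()}. a (last p) x * delta p r) r"
        using Fm r by (intro rep_F_zero_block[OF B r(1)]) auto
      also have "\<dots> = a (last p) x * rep F B (delta p) r"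
        by (subst rep_linear_sum[OF linear_path_op]) auto
      finally show "rep F (fL q (Suc m) ^ c) (rep F B (F m (delta (p @ [x])))) (r @ [x]) =
          (\<Sum>i\<in>{()}. (res x ^ c * a (last p) x) * rep F B (delta p) r)"
        by simp
    qed
    also have "\<dots> = res x ^ c * a (last p) x * rep F (A * B) (delta p) p"
      unfolding rep_mult[OF linear_path_op] by (subst rep_linear_sum[OF linear_path_op]) auto
    finally show ?thesis .
  qed
  have "trc (Suc m) (A * fL q (Suc m) ^ c * B * free_gen m) =
     (\<Sum>p\<in>paths l m. \<Sum>x | addable l (set p) x. res x ^ c * a (last p) x / S (insert x (set p)) * rep F (A * B) (delta p) p)"
    unfolding trc_def paths_Suc_sum by (intro sum.cong refl) (simp add: val)
  also have "\<dots> = 0"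
  proof (rule sum.neutral, rule ballI)
    fix p assume p: "p \<in> paths l m"
    then have pp: "path l p" "length p = m" by (auto simp: paths_def)
    then obtain u y where u: "p = u @ [y]" using m(1) by (cases p rule: rev_cases) auto
    have uy: "path l u" "addable l (set u) y" using pp u by (auto simp: path_from_append)
    have set: "set p = insert y (set u)" using u by auto
    have "(\<Sum>x | addable l (insert y (set u)) x. res x ^ c * a y x / S (insert x (insert y (set u)))) = 0"
      using m pp S_nz[OF pp(1)] card_length[of p]
      by (intro sum_res_a_addable[OF path_closed[OF uy(1)] _ uy(2) _ _ c]) (auto simp: set[symmetric])
    then show "(\<Sum>x | addable l (set p) x. res x ^ c * a (last p) x / S (insert x (set p)) * rep F (A * B) (delta p) p) = 0"
      unfolding sum_distrib_right[symmetric] set using u by simp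
  qed
  finally show ?thesis .
qed

text \<open>If the last run of the canonical word is empty, the Markov property lowers the level.
  Otherwise the run begins with \<open>T_m\<close>; what follows is rotated to the front by the
  trace property, and the value is 0.\<close>

theorem trc_basis:
  assumes "m \<le> n" "is_code m j" "\<forall>k\<in>{1..m}. c k < l"
  shows "trc m (fLmon q m c * fword (cword j m)) = (if (\<forall>k\<in>{1..m}. c k = 0) \<and> cword j m = [] then 1 else 0)"
  using assms
proof (induction m)
  case 0
  have "paths l 0 = {[]}" by (auto simp: paths_def)
  then show ?case by (simp add: trc_def fLmon_def fword_Nil rep_one S_empty delta_def)
next
  case (Suc m)
  let ?J = "j (Suc m)"
  have code: "is_code m j" "1 \<le> ?J" "?J \<le> Suc m" using Suc.prems by (auto simp: is_code_Suc)
  have cm: "c (Suc m) < l" "\<forall>k\<in>{1..m}. c k < l" using Suc.prems by auto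
  define A where "A = fLmon q m c"
  define B where "B = (fword (cword j m) :: 'k free_alg)"
  define X where "X = fL q (Suc m) ^ c (Suc m)"
  have A: "A \<in> carrier (free_algebra m)" unfolding A_def by (rule fLmon_carrier) simp
  have B: "B \<in> carrier (free_algebra m)"
    unfolding B_def using set_cword[OF code(1)] by (intro fword_carrier) auto
  have X: "X \<in> carrier (free_algebra (Suc m))" unfolding X_def by (intro free_algebra_power fL_carrier) auto
  have elt: "fLmon q (Suc m) c * fword (cword j (Suc m)) = A * X * B * fword (rev [?J..<Suc m])"
    by (simp add: fLmon_Suc A_def B_def X_def fword_append mult.assoc del: upt_Suc)
  show ?case
  proof (cases "?J = Suc m")
    case True
    then have "trc (Suc m) (fLmon q (Suc m) c * fword (cword j (Suc m))) = trc (Suc m) (A * X * B)"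
      unfolding elt by (simp add: fword_Nil)
    also have "\<dots> = (if c (Suc m) = 0 then trc m (A * B) else 0)"
      unfolding X_def using Suc.prems by (intro trc_L_power A B cm) auto
    also have "trc m (A * B) = (if (\<forall>k\<in>{1..m}. c k = 0) \<and> cword j m = [] then 1 else 0)"
      unfolding A_def B_def using Suc.prems by (intro Suc.IH code cm) auto
    finally have *: "trc (Suc m) (fLmon q (Suc m) c * fword (cword j (Suc m))) =
      (if c (Suc m) = 0 then if (\<forall>k\<in>{1..m}. c k = 0) \<and> cword j m = [] then 1 else 0 else 0)" .
    have "{1..Suc m} = insert (Suc m) {1..m}" by auto
    then show ?thesis unfolding * using True by simp
  next
    case False
    define R where "R = (fword (rev [?J..<m]) :: 'k free_alg)"
    have m1: "1 \<le> m" using code False by simp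
    have R: "R \<in> carrier (free_algebra m)" unfolding R_def by (intro fword_carrier) auto
    have "rev [?J..<Suc m] = m # rev [?J..<m]" using code False by simp
    then have "fLmon q (Suc m) c * fword (cword j (Suc m)) = (A * X * B * free_gen m) * R"
      unfolding elt R_def by (simp add: fword_Cons mult.assoc)
    then have "trc (Suc m) (fLmon q (Suc m) c * fword (cword j (Suc m))) = trc (Suc m) (R * (A * X * B * free_gen m))"
      using A B X R by (simp only:) (intro trc_commute free_algebra_closed; auto intro: free_algebra_mono[of m])
    also have "R * (A * X * B * free_gen m) = (R * A) * X * B * free_gen m" by (simp only: mult.assoc)
    also have "trc (Suc m) \<dots> = 0"
      unfolding X_def using Suc.prems by (intro trc_L_power_T m1 B cm free_algebra_closed A R) auto
    finally have "trc (Suc m) (fLmon q (Suc m) c * fword (cword j (Suc m))) = 0" .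
    moreover have "cword j (Suc m) \<noteq> []" using code False by simp
    ultimately show ?thesis by simp
  qed
qed

end

section \<open>Standard tableaux as paths\<close>

lemma path_iff_addable: "path l p \<longleftrightarrow> (\<forall>m<length p. addable l (set (take m p)) (p ! m))"
proof (induction p rule: rev_induct)
  case (snoc x p)
  have "(\<forall>m<length (p @ [x]). addable l (set (take m (p @ [x]))) ((p @ [x]) ! m)) \<longleftrightarrow>
     (\<forall>m<length p. addable l (set (take m p)) (p ! m)) \<and> addable l (set p) x"
    by (auto simp: less_Suc_eq nth_append)
  then show ?case using snoc by (simp add: path_from_append)
qed simp

definition tab :: "node list \<Rightarrow> tableau" where
  "tab p x = (if x \<in> set p then Suc (THE i. i < length p \<and> p ! i = x) else 0)"

lemma tab_nth:
  assumes "distinct p" "i < length p"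
  shows "tab p (p ! i) = Suc i"
proof -
  have "(THE i'. i' < length p \<and> p ! i' = p ! i) = i"
    using assms by (intro the_equality) (auto simp: nth_eq_iff_index_eq)
  then show ?thesis using assms by (simp add: tab_def)
qed

lemma tab_notin: "x \<notin> set p \<Longrightarrow> tab p x = 0" by (simp add: tab_def)

lemma tab_before:
  assumes "distinct p" "b < length p" "x \<in> set (take b p)"
  shows "tab p x < tab p (p ! b)"
proof -
  obtain i where i: "i < b" "x = p ! i" using assms by (auto simp: in_set_conv_nth)
  then show ?thesis using tab_nth[OF assms(1), of i] tab_nth[OF assms(1), of b] assms(2) by simp
qed

definition paths_of :: "multipartition \<Rightarrow> nat \<Rightarrow> nat \<Rightarrow> node list set" where
  "paths_of \<Lambda> l n = {p \<in> paths l n. set p = mp_nodes \<Lambda>}"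

lemma tab_std:
  assumes p: "p \<in> paths_of \<Lambda> l n" and size: "mp_size \<Lambda> = n"
  shows "tab p \<in> std_tableaux \<Lambda>"
proof -
  have pp: "path l p" "length p = n" "set p = mp_nodes \<Lambda>" using p by (auto simp: paths_of_def paths_def)
  have d: "distinct p" using path_from_distinct[OF pp(1)] by simp
  have bij: "bij_betw (tab p) (mp_nodes \<Lambda>) {1..mp_size \<Lambda>}"
  proof (rule bij_betw_imageI)
    show "inj_on (tab p) (mp_nodes \<Lambda>)"
    proof (rule inj_onI)
      fix x y assume "x \<in> mp_nodes \<Lambda>" "y \<in> mp_nodes \<Lambda>" "tab p x = tab p y"
      moreover obtain i j where "i < length p" "x = p ! i" "j < length p" "y = p ! j"
        using calculation(1,2) unfolding pp(3)[symmetric] in_set_conv_nth by blast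
      ultimately show "x = y" using tab_nth[OF d] by simp
    qed
    show "tab p ` mp_nodes \<Lambda> = {1..mp_size \<Lambda>}"
    proof
      show "tab p ` mp_nodes \<Lambda> \<subseteq> {1..mp_size \<Lambda>}"
      proof
        fix k assume "k \<in> tab p ` mp_nodes \<Lambda>"
        then obtain i where "i < length p" "k = tab p (p ! i)" using pp(3) by (metis imageE in_set_conv_nth)
        then show "k \<in> {1..mp_size \<Lambda>}" using tab_nth[OF d] pp size by simp
      qed
      show "{1..mp_size \<Lambda>} \<subseteq> tab p ` mp_nodes \<Lambda>"
      proof
        fix k assume "k \<in> {1..mp_size \<Lambda>}"
        then have "k - 1 < length p" "Suc (k - 1) = k" using pp size by auto
        then show "k \<in> tab p ` mp_nodes \<Lambda>" using tab_nth[OF d, of "k - 1"] pp(3) by (metis imageI nth_mem)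
      qed
    qed
  qed
  \<comment> \<open>An added node needs its upper or left neighbour, and closedness of the initial
    segment supplies the earlier nodes of that column or row.\<close>
  have before: "x \<in> set (take b p)" if "b < length p" "(s, i, j) = p ! b" "x = (s, i', j')" "1 \<le> i'" "1 \<le> j'"
      "(i' < i \<and> j' = j) \<or> (i' = i \<and> j' < j)" for b s i j i' j' x
  proof -
    have add: "addable l (set (take b p)) (s, i, j)" using pp(1) that(1,2) unfolding path_iff_addable by metis
    have c: "closed_diagram l (set (take b p))"
      using pp(1) path_from_append[of l "{}" "take b p" "drop b p"] by (intro path_closed) simp
    show ?thesis
    proof (cases "i' < i")
      case True
      then have "(s, i - 1, j) \<in> set (take b p)" using add that(4) by (simp add: addable_def)
      then show ?thesis using closed_diagram_down[OF c, of s "i - 1" j i' j'] that True by auto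
    next
      case False
      then have "1 < j" using that(5,6) by auto
      then have "(s, i, j - 1) \<in> set (take b p)" using add by (simp add: addable_def)
      then show ?thesis using closed_diagram_down[OF c, of s i "j - 1" i' j'] that False by auto
    qed
  qed
  have pos: "1 \<le> i \<and> 1 \<le> j" if "(s, i, j) \<in> mp_nodes \<Lambda>" for s i j using that by (auto simp: mp_nodes_def young_def)
  have less: "tab p (s, i', j') < tab p (s, i, j)"
    if "(s, i, j) \<in> mp_nodes \<Lambda>" "(s, i', j') \<in> mp_nodes \<Lambda>" "(i' < i \<and> j' = j) \<or> (i' = i \<and> j' < j)" for s i j i' j'
  proof -
    have "(s, i, j) \<in> set p" using that(1) pp(3) by simp
    then obtain b where b: "b < length p" "p ! b = (s, i, j)" by (metis in_set_conv_nth)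
    have "(s, i', j') \<in> set (take b p)"
      by (rule before[OF b(1) b(2)[symmetric] refl _ _ that(3)]) (use pos[OF that(2)] in simp_all)
    then show ?thesis using tab_before[OF d b(1)] b(2) by simp
  qed
  show ?thesis unfolding std_tableaux_def
  proof (intro CollectI conjI allI impI)
    show "bij_betw (tab p) (mp_nodes \<Lambda>) {1..mp_size \<Lambda>}" by (rule bij)
    show "tab p x = 0" if "x \<notin> mp_nodes \<Lambda>" for x using that pp(3) tab_notin by simp
  qed (rule less; auto)+
qed

lemma tab_inj:
  assumes "p \<in> paths_of \<Lambda> l n" "r \<in> paths_of \<Lambda> l n" "tab p = tab r"
  shows "p = r"
proof (rule nth_equalityI)
  have d: "distinct p" "distinct r" "length p = n" "length r = n" "set p = set r"
    using assms path_from_distinct by (auto simp: paths_of_def paths_def)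
  show "length p = length r" using d by simp
  fix i assume i: "i < length p"
  then obtain j where j: "j < length r" "p ! i = r ! j" using d by (metis in_set_conv_nth nth_mem)
  then have "Suc i = Suc j" using tab_nth[OF d(1) i] tab_nth[OF d(2) j(1)] assms(3) by simp
  then show "p ! i = r ! i" using j by simp
qed

text \<open>The nodes are listed in the order of their entries. Left and upper neighbours have
  smaller entries, so each node is addable when its turn comes.\<close>

lemma tab_surj:
  assumes \<Lambda>: "\<Lambda> \<in> multipartitions l n" and T: "T \<in> std_tableaux \<Lambda>"
  shows "\<exists>p\<in>paths_of \<Lambda> l n. tab p = T"
proof -
  have L: "length \<Lambda> = l" "\<forall>p\<in>set \<Lambda>. is_partition p" "mp_size \<Lambda> = n" using \<Lambda> by (auto simp: multipartitions_def)
  have bij: "bij_betw T (mp_nodes \<Lambda>) {1..n}" and out: "\<And>x. x \<notin> mp_nodes \<Lambda> \<Longrightarrow> T x = 0"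
    and row: "\<And>s i j j'. (s, i, j) \<in> mp_nodes \<Lambda> \<Longrightarrow> (s, i, j') \<in> mp_nodes \<Lambda> \<Longrightarrow> j < j' \<Longrightarrow> T (s, i, j) < T (s, i, j')"
    and col: "\<And>s i i' j. (s, i, j) \<in> mp_nodes \<Lambda> \<Longrightarrow> (s, i', j) \<in> mp_nodes \<Lambda> \<Longrightarrow> i < i' \<Longrightarrow> T (s, i, j) < T (s, i', j)"
    using T L unfolding std_tableaux_def by auto
  define p where "p = map (\<lambda>k. inv_into (mp_nodes \<Lambda>) T (Suc k)) [0..<n]"
  have len: "length p = n" by (simp add: p_def)
  have nth: "p ! k \<in> mp_nodes \<Lambda>" "T (p ! k) = Suc k" if "k < n" for k
  proof -
    have "Suc k \<in> T ` mp_nodes \<Lambda>" using bij that by (auto simp: bij_betw_def)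
    then show "p ! k \<in> mp_nodes \<Lambda>" "T (p ! k) = Suc k"
      using that by (auto simp: p_def inv_into_into f_inv_into_f)
  qed
  have before: "x \<in> set (take k p)" if "x \<in> mp_nodes \<Lambda>" "T x < Suc k" "k < n" for x k
  proof -
    have "T x \<in> {1..n}" using bij that(1) by (auto simp: bij_betw_def)
    then have i: "T x - 1 < k" "Suc (T x - 1) = T x" using that by auto
    then have "p ! (T x - 1) = x" using nth[of "T x - 1"] that bij by (metis bij_betw_def inj_onD less_trans)
    moreover have "p ! (T x - 1) \<in> set (take k p)" using i that len by (auto simp: in_set_conv_nth)
    ultimately show ?thesis by simp
  qed
  have "addable l (set (take k p)) (p ! k)" if k: "k < length p" for k
  proof -
    obtain s i j where x: "p ! k = (s, i, j)" by (cases "p ! k") auto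
    have kn: "k < n" using k len by simp
    have mem: "(s, i, j) \<in> mp_nodes \<Lambda>" "T (s, i, j) = Suc k" using nth[OF kn] x by auto
    have "p ! k \<notin> set (take k p)"
    proof
      assume "p ! k \<in> set (take k p)"
      then obtain i where "i < k" "p ! i = p ! k" by (auto simp: in_set_conv_nth)
      then show False using nth[of i] nth[of k] kn by simp
    qed
    moreover have "closed_diagram l (mp_nodes \<Lambda>)" using shape_mp_nodes[OF \<Lambda>] by simp
    then have preds: "s < l" "1 \<le> i" "1 \<le> j" "1 < i \<Longrightarrow> (s, i - 1, j) \<in> mp_nodes \<Lambda>" "1 < j \<Longrightarrow> (s, i, j - 1) \<in> mp_nodes \<Lambda>"
      using mem(1) unfolding closed_diagram_def by blast+
    moreover have "(s, i - 1, j) \<in> set (take k p)" if "1 < i"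
      using before[OF preds(4)[OF that] _ kn] col[OF preds(4)[OF that] mem(1)] that mem(2) by simp
    moreover have "(s, i, j - 1) \<in> set (take k p)" if "1 < j"
      using before[OF preds(5)[OF that] _ kn] row[OF preds(5)[OF that] mem(1)] that mem(2) by simp
    ultimately show ?thesis unfolding x addable_def by simp
  qed
  then have path: "path l p" unfolding path_iff_addable by blast
  have set: "set p = mp_nodes \<Lambda>"
  proof
    show "set p \<subseteq> mp_nodes \<Lambda>"
    proof
      fix x assume "x \<in> set p"
      then obtain k where "k < n" "x = p ! k" using len by (metis in_set_conv_nth)
      then show "x \<in> mp_nodes \<Lambda>" using nth(1) by simp
    qed
    show "mp_nodes \<Lambda> \<subseteq> set p"
    proof
      fix x assume x: "x \<in> mp_nodes \<Lambda>"
      then have "T x \<in> {1..n}" using bij by (auto simp: bij_betw_def)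
      then have i: "T x - 1 < n" "Suc (T x - 1) = T x" by auto
      then have "p ! (T x - 1) = x" using nth[of "T x - 1"] x bij by (metis bij_betw_def inj_onD)
      then show "x \<in> set p" using i len by (metis nth_mem)
    qed
  qed
  have d: "distinct p" using path_from_distinct[OF path] by simp
  have "tab p x = T x" for x
  proof (cases "x \<in> set p")
    case True
    then obtain k where "k < n" "x = p ! k" using len by (metis in_set_conv_nth)
    then show ?thesis using tab_nth[OF d, of k] nth[of k] len by simp
  next
    case False
    then show ?thesis using out set by (simp add: tab_notin)
  qed
  then have "tab p = T" by blast
  moreover have "p \<in> paths_of \<Lambda> l n" using path len set by (simp add: paths_of_def paths_def)
  ultimately show ?thesis by blast
qed

lemma std_tableaux_eq:
  assumes "\<Lambda> \<in> multipartitions l n"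
  shows "std_tableaux \<Lambda> = tab ` paths_of \<Lambda> l n" "inj_on tab (paths_of \<Lambda> l n)" "finite (paths_of \<Lambda> l n)"
proof -
  have "mp_size \<Lambda> = n" using assms by (simp add: multipartitions_def)
  then show "std_tableaux \<Lambda> = tab ` paths_of \<Lambda> l n" using tab_std tab_surj[OF assms] by blast
  show "inj_on tab (paths_of \<Lambda> l n)" using tab_inj by (blast intro: inj_onI)
  show "finite (paths_of \<Lambda> l n)" using finite_paths by (simp add: paths_of_def)
qed

lemma node_of_tab:
  assumes "p \<in> paths_of \<Lambda> l n" "1 \<le> k" "k \<le> n"
  shows "node_of \<Lambda> (tab p) k = p ! (k - 1)"
proof -
  have d: "distinct p" "length p = n" "set p = mp_nodes \<Lambda>"
    using assms path_from_distinct by (auto simp: paths_of_def paths_def)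
  have "tab p (p ! (k - 1)) = k" using tab_nth[OF d(1), of "k - 1"] d assms by simp
  moreover have "p ! (k - 1) \<in> mp_nodes \<Lambda>" using nth_mem[of "k - 1" p] d assms by simp
  moreover have "inj_on (tab p) (mp_nodes \<Lambda>)"
  proof (rule inj_onI)
    fix x y assume "x \<in> mp_nodes \<Lambda>" "y \<in> mp_nodes \<Lambda>" "tab p x = tab p y"
    moreover obtain i j where "i < length p" "x = p ! i" "j < length p" "y = p ! j"
      using calculation(1,2) unfolding d(3)[symmetric] in_set_conv_nth by blast
    ultimately show "x = y" using tab_nth[OF d(1)] by simp
  qed
  ultimately show ?thesis unfolding node_of_def by (metis inv_into_f_f)
qed

lemma tab_swap:
  assumes d: "distinct (u @ x # y # w)" and k: "k = Suc (length u)"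
  shows "Transposition.transpose k (k + 1) \<circ> tab (u @ x # y # w) = tab (u @ y # x # w)"
proof
  fix z
  let ?p = "u @ x # y # w" and ?r = "u @ y # x # w"
  have d': "distinct ?r" using d by auto
  show "(Transposition.transpose k (k + 1) \<circ> tab ?p) z = tab ?r z"
  proof (cases "z \<in> set ?p")
    case False
    then have "tab ?p z = 0" "tab ?r z = 0" by (auto simp: tab_notin)
    then show ?thesis using k by (simp add: transpose_def)
  next
    case True
    then obtain i where i: "i < length ?p" "z = ?p ! i" by (metis in_set_conv_nth)
    have t: "tab ?p z = Suc i" using tab_nth[OF d i(1)] i(2) by simp
    consider "i = length u" | "i = Suc (length u)" | "i \<noteq> length u" "i \<noteq> Suc (length u)" by blast
    then show ?thesis
    proof cases
      case 1
      then have "z = ?r ! Suc (length u)" using i by (simp add: nth_append)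
      then have "tab ?r z = Suc (Suc (length u))" using tab_nth[OF d', of "Suc (length u)"] by simp
      then show ?thesis using t 1 k by (simp add: transpose_def)
    next
      case 2
      then have "z = ?r ! length u" using i by (simp add: nth_append)
      then have "tab ?r z = Suc (length u)" using tab_nth[OF d', of "length u"] by simp
      then show ?thesis using t 2 k by (simp add: transpose_def)
    next
      case 3
      then have "z = ?r ! i" using i by (auto simp: nth_append nth_Cons split: nat.splits)
      then have "tab ?r z = Suc i" using tab_nth[OF d', of i] i by simp
      then show ?thesis using t 3 k by (simp add: transpose_def)
    qed
  qed
qed

text \<open>A node maximising \<open>i + j\<close> has no node to its right or below it, so it can
  be the last one added. This gives every multipartition a standard tableau.\<close>

lemma closed_diagram_path:
  assumes "closed_diagram l D" "finite D"
  shows "\<exists>p. path l p \<and> set p = D \<and> length p = card D"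
  using assms
proof (induction "card D" arbitrary: D)
  case 0
  then show ?case by simp
next
  case (Suc m)
  define h :: "node \<Rightarrow> nat" where "h = (\<lambda>(s, i, j). i + j)"
  have ne: "D \<noteq> {}" using Suc by auto
  then have "Max (h ` D) \<in> h ` D" using Suc by (intro Max_in) auto
  then obtain z where z: "z \<in> D" "h z = Max (h ` D)" by auto
  have max: "h x \<le> h z" if "x \<in> D" for x using that z Suc by simp
  obtain s i j where zz: "z = (s, i, j)" by (cases z) auto
  have "closed_diagram l (D - {z})" unfolding closed_diagram_def
  proof (intro allI impI)
    fix t i' j' assume a: "(t, i', j') \<in> D - {z}"
    then have c: "t < l \<and> 1 \<le> i' \<and> 1 \<le> j' \<and> (1 < i' \<longrightarrow> (t, i' - 1, j') \<in> D) \<and> (1 < j' \<longrightarrow> (t, i', j' - 1) \<in> D)"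
      using Suc.prems(1) unfolding closed_diagram_def by blast
    have "i' + j' \<le> i + j" using max[of "(t, i', j')"] a by (simp add: h_def zz)
    then show "t < l \<and> 1 \<le> i' \<and> 1 \<le> j' \<and> (1 < i' \<longrightarrow> (t, i' - 1, j') \<in> D - {z}) \<and> (1 < j' \<longrightarrow> (t, i', j' - 1) \<in> D - {z})"
      using c by (auto simp: zz)
  qed
  moreover have "m = card (D - {z})" using Suc z by simp
  ultimately obtain p where p: "path l p" "set p = D - {z}" "length p = card (D - {z})"
    using Suc.hyps(1)[of "D - {z}"] Suc.prems by auto
  have "addable l (D - {z}) z" using Suc.prems(1) z(1) unfolding zz addable_def closed_diagram_def by auto
  then have "path l (p @ [z])" using p by (simp add: path_from_append)
  then show ?case using p z Suc by (intro exI[of _ "p @ [z]"]) auto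
qed

section \<open>Paths grouped by shape\<close>

lemma paths_shape:
  assumes "p \<in> paths l n"
  shows "shape l (set p) \<in> multipartitions l n" "mp_nodes (shape l (set p)) = set p" "card (set p) = n"
proof -
  have D: "closed_diagram l (set p)" using assms path_closed by (simp add: paths_def)
  show card: "card (set p) = n" using assms path_from_distinct[of l "{}" p] by (simp add: paths_def distinct_card)
  show "shape l (set p) \<in> multipartitions l n" using shape_multipartition[OF D] card by simp
  show "mp_nodes (shape l (set p)) = set p" using mp_nodes_shape[OF D] by simp
qed

lemma paths_of_eq:
  assumes "\<Lambda> \<in> multipartitions l n"
  shows "paths_of \<Lambda> l n = {p \<in> paths l n. shape l (set p) = \<Lambda>}"
  using paths_shape[of _ l n] shape_mp_nodes(4)[OF assms] by (auto simp: paths_of_def)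

lemma paths_of_nonempty:
  assumes "\<Lambda> \<in> multipartitions l n"
  shows "\<exists>p. p \<in> paths_of \<Lambda> l n"
  using closed_diagram_path[of l "mp_nodes \<Lambda>"] shape_mp_nodes[OF assms] by (auto simp: paths_of_def paths_def)

lemma finite_multipartitions: "finite (multipartitions l n)"
proof -
  have "multipartitions l n \<subseteq> (\<lambda>p. shape l (set p)) ` paths l n"
  proof
    fix \<Lambda> assume "\<Lambda> \<in> multipartitions l n"
    then obtain p where "p \<in> paths l n" "shape l (set p) = \<Lambda>" using paths_of_nonempty paths_of_eq by blast
    then show "\<Lambda> \<in> (\<lambda>p. shape l (set p)) ` paths l n" by blast
  qed
  then show ?thesis using finite_paths finite_subset by blast
qed

lemma addable_same_row:
  assumes D: "closed_diagram l D" and "addable l D (s, i, j)" "addable l D (s, i, j')"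
  shows "j = j'"
proof -
  have *: False if "addable l D (s, i, j)" "addable l D (s, i, j')" "j < j'" for j j'
  proof -
    have "(s, i, j' - 1) \<in> D" "1 \<le> i" "1 \<le> j" "j \<le> j' - 1" "(s, i, j) \<notin> D" using that by (auto simp: addable_def)
    then show False using closed_diagram_down[OF D] by blast
  qed
  show ?thesis using *[of j j'] *[of j' j] assms by (meson linorder_neqE_nat)
qed

lemma addable_same_col:
  assumes D: "closed_diagram l D" and "addable l D (s, i, j)" "addable l D (s, i', j)"
  shows "i = i'"
proof -
  have *: False if "addable l D (s, i, j)" "addable l D (s, i', j)" "i < i'" for i i'
  proof -
    have "(s, i' - 1, j) \<in> D" "1 \<le> i" "1 \<le> j" "i \<le> i' - 1" "(s, i, j) \<notin> D" using that by (auto simp: addable_def)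
    then show False using closed_diagram_down[OF D] by blast
  qed
  show ?thesis using *[of i i'] *[of i' i] assms by (meson linorder_neqE_nat)
qed

section \<open>Agreement of the actions on tableaux and on paths\<close>

context separated
begin

text \<open>The three cases of \<open>gen_basis\<close> merge. For adjacent nodes the coefficient is
  already \<open>q\<close> or \<open>-1\<close>; consecutive nodes that are not adjacent are both
  addable to one diagram and cannot lie in a common row or column.\<close>

lemma gen_basis_path:
  assumes r: "u @ x # y # w \<in> paths_of \<Lambda> l n" and k: "k = Suc (length u)"
  shows "gen_basis q Q \<Lambda> k (tab (u @ x # y # w)) U = a x y * basis_vec (tab (u @ x # y # w)) U +
    (if adjacent x y then 0 else (1 + a x y) * basis_vec (tab (u @ y # x # w)) U)"
proof -
  let ?r = "u @ x # y # w"
  have rp: "path l ?r" "length ?r = n" using r by (auto simp: paths_of_def paths_def)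
  have D: "closed_diagram l (set u)" "addable l (set u) x" "addable l (insert x (set u)) y"
    using rp(1) path_closed[of l u] by (auto simp: path_from_append)
  obtain s i j where x: "x = (s, i, j)" by (cases x) auto
  obtain t i' j' where y: "y = (t, i', j')" by (cases y) auto
  have nodes: "node_of \<Lambda> (tab ?r) k = (s, i, j)" "node_of \<Lambda> (tab ?r) (k + 1) = (t, i', j')"
    using node_of_tab[OF r, of k] node_of_tab[OF r, of "k + 1"] rp(2) k x y by (auto simp: nth_append)
  have inv: "inverse q - 1 = - (inverse q * (q - 1))" using q0 by (simp add: right_diff_distrib)
  have sw: "Transposition.transpose k (k + 1) \<circ> tab ?r = tab (u @ y # x # w)"
    using path_distinct[OF rp(1)] k by (rule tab_swap)
  have e: "gen_basis q Q \<Lambda> k (tab ?r) U =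
     (if s = t \<and> i = i' then q * basis_vec (tab ?r) U
      else if s = t \<and> j = j' then - basis_vec (tab ?r) U
      else a x y * basis_vec (tab ?r) U + (1 + a x y) * basis_vec (tab (u @ y # x # w)) U)"
    unfolding gen_basis_def nodes sw using k by (simp add: Let_def x y)
  show ?thesis
  proof (cases "adjacent x y")
    case True
    then consider "y = (s, i, Suc j)" | "y = (s, Suc i, j)" by (auto simp: adjacent_def x)
    then show ?thesis
    proof cases
      case 1
      then have "a x y = q" by (simp add: seminormal_coeff_def x)
      then show ?thesis unfolding e using 1 True y by simp
    next
      case 2
      then have "a x y = - 1" using q0 by (simp add: seminormal_coeff_def Let_def x power_int_minus inv)
      moreover have "i \<noteq> i'" using 2 y by simp
      ultimately show ?thesis unfolding e using 2 True y by simp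
    qed
  next
    case False
    then have ay: "addable l (set u) y" "addable l (insert y (set u)) x" using addable_swap[OF D(2,3)] by auto
    have "\<not> (s = t \<and> i = i')"
      using addable_same_row[OF D(1), of s i j j'] D(2,3) ay x y by (auto simp: addable_def)
    moreover have "\<not> (s = t \<and> j = j')"
      using addable_same_col[OF D(1), of s i j i'] D(2,3) ay x y by (auto simp: addable_def)
    ultimately show ?thesis unfolding e using False by auto
  qed
qed

text \<open>\<open>gen_basis\<close> describes a column of the matrix and \<open>path_op\<close> a
  row. The off-diagonal expressions agree because \<open>1 + a x y = q - a y x\<close>.\<close>

lemma gen_basis_tab:
  assumes r: "r \<in> paths_of \<Lambda> l n" and p: "p \<in> paths_of \<Lambda> l n" and k: "k < n"
  shows "gen_basis q Q \<Lambda> k (tab r) (tab p) = F k (delta r) p"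
proof -
  have bv: "basis_vec (tab r) (tab p) = (delta r p :: 'k)" if "r \<in> paths_of \<Lambda> l n" for r
    using tab_inj[OF that p] by (auto simp: basis_vec_def delta_def)
  have pr: "p \<in> paths l n" "r \<in> paths l n" "length p = n" "length r = n" "path l p" "path l r"
    using p r by (auto simp: paths_of_def paths_def)
  show ?thesis
  proof (cases "k = 0")
    case True
    have "node_of \<Lambda> (tab r) 1 = r ! 0" using node_of_tab[OF r, of 1] k by simp
    moreover have "r ! 0 = hd r" using pr k by (cases r) auto
    ultimately show ?thesis using True by (simp add: gen_basis_def path_op_0 bv[OF r] delta_def)
  next
    case False
    then have k1: "1 \<le> k" "k < length r" "k < length p" using pr k by auto
    obtain u x y w where 1: "r = u @ x # y # w" "k = Suc (length u)" using split_at[OF k1(1,2)] by metis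
    obtain u' x' y' w' where 2: "p = u' @ x' # y' # w'" "k = Suc (length u')" using split_at[OF k1(1,3)] by metis
    have len: "length u = length u'" using 1 2 by simp
    have xy: "x \<noteq> y" using path_distinct[OF pr(6)] 1 by auto
    have bv': "basis_vec (tab (u @ y # x # w)) (tab p) = (delta (u @ y # x # w) p :: 'k)" if "\<not> adjacent x y"
    proof (rule bv)
      have "path l (u @ y # x # w)" using path_swap[of u x y w] pr(6) 1 that by simp
      then show "u @ y # x # w \<in> paths_of \<Lambda> l n" using r 1 by (auto simp: paths_of_def paths_def)
    qed
    have L: "gen_basis q Q \<Lambda> k (tab r) (tab p) = a x y * delta r p +
       (if adjacent x y then 0 else (1 + a x y) * delta (u @ y # x # w) p)"
      using gen_basis_path[of u x y w \<Lambda> k "tab p"] r 1 bv[OF r] bv' by simp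
    have R: "F k (delta r) p = a x' y' * delta r p +
       (if path l (u' @ y' # x' # w') then (q - a x' y') * delta r (u' @ y' # x' # w') else 0)"
      using path_op_swap[OF 2(2), of l q Q "delta r" x' y' w'] 2(1) by simp
    have asum: "1 + a x y = q - a y x"
      using a_sum[OF path_good2[of u x y w]] pr 1 by (simp add: algebra_simps)
    consider "p = r" | "p \<noteq> r" "p = u @ y # x # w" | "p \<noteq> r" "p \<noteq> u @ y # x # w" by blast
    then show ?thesis
    proof cases
      case eq: 1
      then have "u' @ x' # y' # w' = u @ x # y # w" using 1(1) 2(1) by metis
      then have e: "u' = u" "x' = x" "y' = y" "w' = w" using len by simp_all
      have "u @ y # x # w \<noteq> u @ x # y # w" using xy by simp
      then show ?thesis unfolding L R unfolding e eq unfolding 1(1) using xy by (simp add: delta_def)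
    next
      case sw: 2
      then have "u' @ x' # y' # w' = u @ y # x # w" using 2(1) by metis
      then have e: "u' = u" "x' = y" "y' = x" "w' = w" using len by simp_all
      have "\<not> adjacent x y" using path_swap[of u x y w] pr(5,6) unfolding 1(1) sw(2) by simp
      moreover have "path l (u @ x # y # w)" using pr(6) unfolding 1(1) .
      moreover have "delta r p = (0::'k)" using sw(1) by (simp add: delta_def)
      ultimately show ?thesis unfolding L R unfolding e unfolding sw(2) 1(1) asum by (simp add: delta_def)
    next
      case 3
      have "u' @ y' # x' # w' \<noteq> r"
      proof
        assume "u' @ y' # x' # w' = r"
        then have "u' @ y' # x' # w' = u @ x # y # w" using 1(1) by metis
        then have "u' = u" "y' = x" "x' = y" "w' = w" using len by simp_all
        then show False using 3(2) 2(1) by metis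
      qed
      moreover have "delta r p = (0::'k)" "delta (u @ y # x # w) p = (0::'k)" using 3 by (simp_all add: delta_def)
      ultimately show ?thesis unfolding L R by (simp add: delta_def)
    qed
  qed
qed

context
  fixes \<Lambda> assumes \<Lambda>: "\<Lambda> \<in> multipartitions l n"
begin

lemma gen_op_sum: "gen_op q Q \<Lambda> k v U = (\<Sum>r\<in>paths_of \<Lambda> l n. v (tab r) * gen_basis q Q \<Lambda> k (tab r) U)"
  unfolding gen_op_def std_tableaux_eq(1)[OF \<Lambda>] using std_tableaux_eq(2)[OF \<Lambda>] by (simp add: sum.reindex)

lemma gen_op_tab:
  assumes p: "p \<in> paths_of \<Lambda> l n" and k: "k < n"
  shows "gen_op q Q \<Lambda> k v (tab p) = F k (\<lambda>r. v (tab r)) p"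
proof -
  have pp: "p \<in> paths l n" "set p = mp_nodes \<Lambda>" using p by (auto simp: paths_of_def)
  have fg: "free_gen k \<in> carrier (free_algebra n)" using k by (intro free_algebra_closed)
  have "F k (\<lambda>r. v (tab r)) p = (\<Sum>r\<in>paths l n. v (tab r) * F k (delta r) p)"
    using rep_F_expand[OF fg pp(1), of "\<lambda>r. v (tab r)"] by (simp add: rep_gen)
  also have "\<dots> = (\<Sum>r\<in>paths_of \<Lambda> l n. v (tab r) * F k (delta r) p)"
  proof (rule sum.mono_neutral_right[OF finite_paths])
    show "paths_of \<Lambda> l n \<subseteq> paths l n" by (auto simp: paths_of_def)
    have "F k (delta r) p = 0" if "r \<in> paths l n - paths_of \<Lambda> l n" for r
      using rep_F_delta_zero[OF fg pp(1), of r] that pp(2) by (auto simp: paths_of_def rep_gen)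
    then show "\<forall>r\<in>paths l n - paths_of \<Lambda> l n. v (tab r) * F k (delta r) p = 0" by simp
  qed
  also have "\<dots> = gen_op q Q \<Lambda> k v (tab p)"
    unfolding gen_op_sum using gen_basis_tab[OF _ p k] by simp
  finally show ?thesis by simp
qed

text \<open>\<open>ak_op\<close> compares images as functions on all tableaux, so their values off
  the standard ones have to be known too.\<close>

lemma gen_op_outside:
  assumes U: "U \<notin> std_tableaux \<Lambda>" and k: "k < n"
  shows "gen_op q Q \<Lambda> k v U = 0"
proof -
  have std: "tab r \<in> std_tableaux \<Lambda>" if "r \<in> paths_of \<Lambda> l n" for r using std_tableaux_eq(1)[OF \<Lambda>] that by simp
  have bv: "basis_vec (tab r) U = (0 :: 'k)" if "r \<in> paths_of \<Lambda> l n" for r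
    using std[OF that] U by (auto simp: basis_vec_def)
  have "gen_basis q Q \<Lambda> k (tab r) U = 0" if r: "r \<in> paths_of \<Lambda> l n" for r
  proof (cases "k = 0")
    case True
    then show ?thesis using bv[OF r] by (simp add: gen_basis_def)
  next
    case False
    have "length r = n" "path l r" using r by (auto simp: paths_of_def paths_def)
    moreover have "1 \<le> k" using False by simp
    ultimately obtain u x y w where 1: "r = u @ x # y # w" "k = Suc (length u)" using k split_at[of k r] by metis
    have "u @ y # x # w \<in> paths_of \<Lambda> l n" if "\<not> adjacent x y"
      using path_swap[of u x y w] r 1 that by (auto simp: paths_of_def paths_def)
    then show ?thesis using gen_basis_path[of u x y w \<Lambda> k U] bv r 1 by simp
  qed
  then show ?thesis unfolding gen_op_sum by simp
qed

lemma free_op_tab: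
  assumes x: "x \<in> carrier (free_algebra n)" and p: "p \<in> paths_of \<Lambda> l n"
  shows "free_op q Q \<Lambda> x v (tab p) = rep F x (\<lambda>r. v (tab r)) p"
proof -
  have "rep (gen_op q Q \<Lambda>) x v (tab p) = rep F x (\<lambda>r. v (tab r)) p"
  proof (rule rep_transport[of "{..<n}" "paths_of \<Lambda> l n"])
    show "\<And>w. w \<in> Poly_Mapping.keys x \<Longrightarrow> set (letters w) \<subseteq> {..<n}"
      using x by (simp add: free_algebra_carrier_iff)
    show "gen_op q Q \<Lambda> k v (tab p) = F k (\<lambda>r. v (tab r)) p" if "k \<in> {..<n}" "p \<in> paths_of \<Lambda> l n" for k v p
      using gen_op_tab that by simp
    show "F k v p = F k v' p" if "k \<in> {..<n}" "p \<in> paths_of \<Lambda> l n" "\<And>r. r \<in> paths_of \<Lambda> l n \<Longrightarrow> v r = v' r" for k v v' p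
      using that by (intro path_op_local[of k n p l]) (auto simp: paths_of_def)
  qed (rule p)
  then show ?thesis by (simp add: free_op_def rep_def)
qed

lemma free_op_outside:
  assumes x: "x \<in> carrier (free_algebra n)" and U: "U \<notin> std_tableaux \<Lambda>" "v U = 0"
  shows "free_op q Q \<Lambda> x v U = 0"
proof -
  have "foldr (gen_op q Q \<Lambda>) (letters w) v U = 0" if "w \<in> Poly_Mapping.keys x" for w
  proof (cases "letters w")
    case (Cons k ks)
    then have "k < n" using x that by (auto simp: free_algebra_carrier_iff)
    then show ?thesis using gen_op_outside[OF U(1)] Cons by simp
  qed (use U in simp)
  then show ?thesis unfolding free_op_def by simp
qed

text \<open>The ideal acts as 0 on paths, so all representatives have the same image of a basis
  vector and \<open>the_elem\<close> returns it.\<close>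

lemma ak_op_coset:
  assumes n: "1 \<le> n" and x: "x \<in> carrier (free_algebra n)" and p: "p \<in> paths_of \<Lambda> l n"
  shows "ak_op q Q \<Lambda> (ak_ideal l n q Q +>\<^bsub>free_algebra n\<^esub> x) (basis_vec (tab p)) = free_op q Q \<Lambda> x (basis_vec (tab p))"
proof -
  let ?I = "ak_ideal l n q Q" and ?R = "free_algebra n :: 'k free_alg ring"
  interpret I: ideal ?I ?R by (rule ideal_ak_ideal[OF n])
  have eq: "free_op q Q \<Lambda> (h + x) (basis_vec (tab p)) = free_op q Q \<Lambda> x (basis_vec (tab p))" if h: "h \<in> ?I" for h
  proof
    fix U
    have hx: "h + x \<in> carrier ?R" "h \<in> carrier ?R" using I.a_subset h x by (auto intro: free_algebra_closed)
    show "free_op q Q \<Lambda> (h + x) (basis_vec (tab p)) U = free_op q Q \<Lambda> x (basis_vec (tab p)) U"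
    proof (cases "U \<in> std_tableaux \<Lambda>")
      case True
      then obtain r where r: "r \<in> paths_of \<Lambda> l n" "U = tab r" using std_tableaux_eq(1)[OF \<Lambda>] by auto
      then have "r \<in> paths l n" by (simp add: paths_of_def)
      then show ?thesis unfolding r(2) free_op_tab[OF hx(1) r(1)] free_op_tab[OF x r(1)] rep_add
        using rep_F_ideal[OF h _ n] by simp
    next
      case False
      have "tab p \<in> std_tableaux \<Lambda>" using std_tableaux_eq(1)[OF \<Lambda>] p by simp
      then have "basis_vec (tab p) U = (0::'k)" using False by (auto simp: basis_vec_def)
      then show ?thesis using free_op_outside[OF hx(1) False] free_op_outside[OF x False] by simp
    qed
  qed
  have c: "?I +>\<^bsub>?R\<^esub> x = (\<lambda>h. h + x) ` ?I" by (auto simp: a_r_coset_def' free_algebra_simps)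
  have "0 \<in> ?I" using I.zero_closed I.a_subset additive_subgroup.zero_closed[OF I.is_additive_subgroup]
    by (simp add: free_algebra_simps)
  then have "(\<lambda>x. free_op q Q \<Lambda> x (basis_vec (tab p))) ` (?I +>\<^bsub>?R\<^esub> x) = {free_op q Q \<Lambda> x (basis_vec (tab p))}"
    unfolding c using eq by (auto simp: image_image)
  then show ?thesis unfolding ak_op_def by simp
qed

lemma ak_character_coset:
  assumes n: "1 \<le> n" and x: "x \<in> carrier (free_algebra n)"
  shows "ak_character q Q \<Lambda> (ak_ideal l n q Q +>\<^bsub>free_algebra n\<^esub> x) = (\<Sum>p\<in>paths_of \<Lambda> l n. rep F x (delta p) p)"
proof -
  have "ak_op q Q \<Lambda> (ak_ideal l n q Q +>\<^bsub>free_algebra n\<^esub> x) (basis_vec (tab p)) (tab p) = rep F x (delta p) p"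
    if p: "p \<in> paths_of \<Lambda> l n" for p
  proof -
    have pp: "p \<in> paths l n" "set p = mp_nodes \<Lambda>" using p by (auto simp: paths_of_def)
    have "ak_op q Q \<Lambda> (ak_ideal l n q Q +>\<^bsub>free_algebra n\<^esub> x) (basis_vec (tab p)) (tab p) =
       rep F x (\<lambda>r. basis_vec (tab p) (tab r)) p"
      unfolding ak_op_coset[OF n x p] by (rule free_op_tab[OF x p])
    also have "\<dots> = rep F x (delta p) p"
    proof (rule rep_F_zero_block[OF x pp(1)])
      fix r assume "r \<in> paths l n" "set r = set p"
      then have "r \<in> paths_of \<Lambda> l n" using pp by (simp add: paths_of_def)
      then show "basis_vec (tab p) (tab r) = (delta p r :: 'k)"
        using tab_inj[OF _ p] by (auto simp: basis_vec_def delta_def)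
    qed
    finally show ?thesis .
  qed
  then show ?thesis
    unfolding ak_character_def std_tableaux_eq(1)[OF \<Lambda>] using std_tableaux_eq(2)[OF \<Lambda>] by (simp add: sum.reindex)
qed

lemma schur_formula_nz: "schur_formula l n q Q \<Lambda> \<noteq> 0"
proof -
  obtain p where "p \<in> paths l n" "shape l (set p) = \<Lambda>"
    using paths_of_nonempty[OF \<Lambda>] paths_of_eq[OF \<Lambda>] by auto
  then show ?thesis using S_nz[of p] paths_shape(3)[of p l n] by (simp add: S_def paths_def)
qed

end

lemma trc_characters:
  assumes n: "1 \<le> n" and x: "x \<in> carrier (free_algebra n)"
  shows "trc n x = (\<Sum>\<Lambda>\<in>multipartitions l n. 1 / schur_formula l n q Q \<Lambda> *
    ak_character q Q \<Lambda> (ak_ideal l n q Q +>\<^bsub>free_algebra n\<^esub> x))"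
proof -
  have "trc n x = (\<Sum>\<Lambda>\<in>multipartitions l n. \<Sum>p\<in>{p\<in>paths l n. shape l (set p) = \<Lambda>}. 1 / S (set p) * rep F x (delta p) p)"
    unfolding trc_def using paths_shape(1)
    by (intro sum.group[symmetric] finite_paths finite_multipartitions) auto
  also have "\<dots> = (\<Sum>\<Lambda>\<in>multipartitions l n. 1 / schur_formula l n q Q \<Lambda> *
    ak_character q Q \<Lambda> (ak_ideal l n q Q +>\<^bsub>free_algebra n\<^esub> x))"
  proof (rule sum.cong[OF refl])
    fix \<Lambda> assume L: "\<Lambda> \<in> multipartitions l n"
    have "S (set p) = schur_formula l n q Q \<Lambda>" if "p \<in> paths l n" "shape l (set p) = \<Lambda>" for p
      using paths_shape(3)[OF that(1)] that(2) by (simp add: S_def)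
    then show "(\<Sum>p\<in>{p\<in>paths l n. shape l (set p) = \<Lambda>}. 1 / S (set p) * rep F x (delta p) p) =
      1 / schur_formula l n q Q \<Lambda> * ak_character q Q \<Lambda> (ak_ideal l n q Q +>\<^bsub>free_algebra n\<^esub> x)"
      unfolding ak_character_coset[OF L n x] paths_of_eq[OF L] sum_distrib_left by (intro sum.cong) auto
  qed
  finally show ?thesis .
qed

end

section \<open>Linear forms on the algebra\<close>

lemma free_const_central: "free_const c * x = x * free_const c" for x :: "'k::field free_alg"
proof (induction x rule: free_alg_induct)
  case (step x w d)
  have "Poly_Mapping.single 0 c * Poly_Mapping.single w d = Poly_Mapping.single w d * Poly_Mapping.single (0 :: nat free_monoid) c"
    by (simp add: mult_single mult.commute)
  then show ?case using step by (simp add: distrib_left distrib_right free_const_def)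
qed simp

lemma free_const_simps:
  "free_const (a + b) = free_const a + free_const b" "free_const (a - b) = free_const a - free_const b"
  "free_const (a * b) = free_const a * free_const b" "free_const 1 = 1" "free_const 0 = 0"
  by (simp_all add: free_const_def single_add single_diff mult_single)

lemma fLmon_zero: "fLmon q m (\<lambda>k. 0) = 1"
proof (induction m)
  case (Suc m)
  then show ?case by (simp add: fLmon_Suc)
qed (simp add: fLmon_def)

text \<open>Deletes all words with a letter outside \<open>{..<n}\<close>. This is multiplicative,
  and it pulls \<open>ak_ideal\<close>, an ideal of the carrier only, back to a two-sided ideal of
  the whole type, as required for a component of \<open>all_quotients\<close>.\<close>

definition free_proj :: "nat \<Rightarrow> 'k::field free_alg \<Rightarrow> 'k free_alg" where
  "free_proj n x = Poly_Mapping.mapp (\<lambda>w c. if set (letters w) \<subseteq> {..<n} then c else 0) x"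

lemma lookup_free_proj:
  "Poly_Mapping.lookup (free_proj n x) w = (if set (letters w) \<subseteq> {..<n} then Poly_Mapping.lookup x w else 0)"
  by (auto simp: free_proj_def lookup_mapp when_def in_keys_iff)

lemma free_proj_add: "free_proj n (x + y) = free_proj n x + free_proj n y"
  by (rule poly_mapping_eqI) (simp add: lookup_free_proj lookup_add)

lemma free_proj_diff: "free_proj n (x - y) = free_proj n x - free_proj n y"
  by (rule poly_mapping_eqI) (simp add: lookup_free_proj lookup_minus)

lemma free_proj_0: "free_proj n 0 = 0"
  by (rule poly_mapping_eqI) (simp add: lookup_free_proj)

lemma free_proj_single:
  "free_proj n (Poly_Mapping.single w c) = (if set (letters w) \<subseteq> {..<n} then Poly_Mapping.single w c else 0)"
  by (rule poly_mapping_eqI) (auto simp: lookup_free_proj lookup_single when_def)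

lemma free_proj_mult: "free_proj n (x * y) = free_proj n x * free_proj n y"
proof (induction x rule: free_alg_induct)
  case (step x w c)
  have "free_proj n (Poly_Mapping.single w c * y) = free_proj n (Poly_Mapping.single w c) * free_proj n y"
  proof (induction y rule: free_alg_induct)
    case (step y w' c')
    have "free_proj n (Poly_Mapping.single w c * Poly_Mapping.single w' c') =
      free_proj n (Poly_Mapping.single w c) * free_proj n (Poly_Mapping.single w' c')"
      by (auto simp: mult_single free_proj_single plus_free_monoid_def)
    then show ?case using step by (simp add: distrib_left free_proj_add)
  qed (simp add: free_proj_0)
  then show ?case using step by (simp add: distrib_right free_proj_add)
qed (simp add: free_proj_0)

lemma free_proj_carrier: "free_proj n x \<in> carrier (free_algebra n)"
  by (auto simp: free_algebra_carrier_iff in_keys_iff lookup_free_proj split: if_splits)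

lemma free_proj_id:
  assumes "x \<in> carrier (free_algebra n)"
  shows "free_proj n x = x"
proof (rule poly_mapping_eqI)
  fix w
  show "Poly_Mapping.lookup (free_proj n x) w = Poly_Mapping.lookup x w"
    using assms by (auto simp: lookup_free_proj free_algebra_carrier_iff in_keys_iff)
qed

definition full_ideal :: "nat \<Rightarrow> nat \<Rightarrow> 'k::field \<Rightarrow> (nat \<Rightarrow> 'k) \<Rightarrow> 'k free_alg set" where
  "full_ideal l n q Q = {x. free_proj n x \<in> ak_ideal l n q Q}"

text \<open>The generators act by scalars in the quotients where the relations fail, so that the relations hold in
  every component.\<close>

definition quot_gen :: "nat \<Rightarrow> nat \<Rightarrow> 'k::field \<Rightarrow> (nat \<Rightarrow> 'k) \<Rightarrow> nat \<Rightarrow> 'k free_alg all_quotients" where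
  "quot_gen l n q Q i =
     abs_all_quotients (\<lambda>J. if ak_relations l n q Q \<subseteq> J then free_gen i else free_const (if i = 0 then Q 0 else q))"

definition quot_const :: "'k::field \<Rightarrow> 'k free_alg all_quotients" where
  "quot_const c = abs_all_quotients (\<lambda>J. free_const c)"

lemma ak_ideal_closed:
  assumes "1 \<le> n"
  shows "0 \<in> ak_ideal l n q Q"
    "x \<in> ak_ideal l n q Q \<Longrightarrow> y \<in> ak_ideal l n q Q \<Longrightarrow> x + y \<in> ak_ideal l n q Q"
    "x \<in> ak_ideal l n q Q \<Longrightarrow> y \<in> ak_ideal l n q Q \<Longrightarrow> x - y \<in> ak_ideal l n q Q"
    "x \<in> ak_ideal l n q Q \<Longrightarrow> r \<in> carrier (free_algebra n) \<Longrightarrow> r * x \<in> ak_ideal l n q Q"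
    "x \<in> ak_ideal l n q Q \<Longrightarrow> r \<in> carrier (free_algebra n) \<Longrightarrow> x * r \<in> ak_ideal l n q Q"
    "ak_ideal l n q Q \<subseteq> carrier (free_algebra n)" "ak_relations l n q Q \<subseteq> ak_ideal l n q Q"
proof -
  interpret I: ideal "ak_ideal l n q Q" "free_algebra n" by (rule ideal_ak_ideal[OF assms])
  show z: "0 \<in> ak_ideal l n q Q" using additive_subgroup.zero_closed[OF I.is_additive_subgroup]
    by (simp add: free_algebra_simps)
  show add: "x + y \<in> ak_ideal l n q Q" if "x \<in> ak_ideal l n q Q" "y \<in> ak_ideal l n q Q" for x y
    using additive_subgroup.a_closed[OF I.is_additive_subgroup that] by (simp add: free_algebra_simps)
  show mul: "r * x \<in> ak_ideal l n q Q" if "x \<in> ak_ideal l n q Q" "r \<in> carrier (free_algebra n)" for x r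
    using I.I_l_closed[OF that] by (simp add: free_algebra_simps)
  show "x * r \<in> ak_ideal l n q Q" if "x \<in> ak_ideal l n q Q" "r \<in> carrier (free_algebra n)"
    using I.I_r_closed[OF that] by (simp add: free_algebra_simps)
  show "x - y \<in> ak_ideal l n q Q" if "x \<in> ak_ideal l n q Q" "y \<in> ak_ideal l n q Q"
    using add[OF that(1) mul[OF that(2), of "- 1"]] by (simp add: free_algebra_closed)
  show "ak_ideal l n q Q \<subseteq> carrier (free_algebra n)" by (rule I.a_subset)
  show "ak_relations l n q Q \<subseteq> ak_ideal l n q Q" unfolding ak_ideal_def
    by (intro ring.genideal_self ring_free_algebra ak_relations_carrier assms)
qed

lemma two_sided_full_ideal:
  assumes "1 \<le> n"
  shows "two_sided_ideal (full_ideal l n q Q)"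
  unfolding two_sided_ideal_def full_ideal_def mem_Collect_eq free_proj_0 free_proj_diff free_proj_mult
  by (intro conjI ballI allI ak_ideal_closed[OF assms]) (simp_all add: free_proj_carrier)

lemma full_ideal_carrier: "x \<in> carrier (free_algebra n) \<Longrightarrow> x \<in> full_ideal l n q Q \<longleftrightarrow> x \<in> ak_ideal l n q Q"
  by (simp add: full_ideal_def free_proj_id)

lemma relations_full_ideal:
  assumes "1 \<le> n"
  shows "ak_relations l n q Q \<subseteq> full_ideal l n q Q"
  using full_ideal_carrier ak_ideal_closed(7)[OF assms] ak_relations_carrier[OF assms] by blast

lemma abs_all_quotients_eqI:
  assumes "\<And>J. two_sided_ideal J \<Longrightarrow> f J - g J \<in> J"
  shows "abs_all_quotients f = abs_all_quotients g"
  using assms by (simp add: all_quotients.abs_eq_iff)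

lemmas abs_quot = plus_all_quotients.abs_eq minus_all_quotients.abs_eq times_all_quotients.abs_eq
  one_all_quotients.abs_eq zero_all_quotients.abs_eq

lemma abs_quot_prod_list:
  fixes f :: "'s \<Rightarrow> 'r::ring_1 set \<Rightarrow> 'r"
  shows "(\<Prod>s\<leftarrow>ss. abs_all_quotients (f s)) = abs_all_quotients (\<lambda>J. \<Prod>s\<leftarrow>ss. f s J)"
  by (induction ss) (simp_all add: one_all_quotients_def times_all_quotients.abs_eq)

lemma ak_ring_quot:
  fixes q :: "'k::field"
  assumes l: "1 \<le> l" and q0: "q \<noteq> 0"
  shows "ak_ring l n q Q quot_const (quot_gen l n q Q)"
proof
  let ?R = "ak_relations l n q Q" and ?c = "\<lambda>i. free_const (if i = 0 then Q 0 else q) :: 'k free_alg"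
  have cases: "abs_all_quotients f = abs_all_quotients g"
    if "\<And>J. ?R \<subseteq> J \<Longrightarrow> f J - g J \<in> ?R" "\<And>J. \<not> ?R \<subseteq> J \<Longrightarrow> f J = g J" for f g :: "'k free_alg set \<Rightarrow> 'k free_alg"
  proof (rule abs_all_quotients_eqI)
    fix J :: "'k free_alg set" assume J: "two_sided_ideal J"
    show "f J - g J \<in> J" using that[of J] two_sided_idealD(1)[OF J] by (cases "?R \<subseteq> J") auto
  qed
  show "1 \<le> l" "q \<noteq> 0" by fact+
  show "quot_const (a + b) = quot_const a + quot_const b" "quot_const (a * b) = quot_const a * quot_const b" for a b :: 'k
    by (simp_all add: quot_const_def abs_quot free_const_simps)
  show "quot_const (1::'k) = 1" by (simp add: quot_const_def one_all_quotients_def free_const_simps)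
  show "quot_const a * x = x * quot_const a" for a :: 'k and x
  proof (induction x rule: all_quotients.abs_induct)
    case (1 f)
    then show ?case by (simp add: quot_const_def abs_quot free_const_central)
  qed
  have rel: "(free_gen i - free_const q) * (free_gen i + 1) \<in> ?R" if "1 \<le> i" "i < n" for i
    unfolding ak_relations_def using that by blast
  show "(\<Prod>s\<leftarrow>[0..<l]. quot_gen l n q Q 0 - quot_const (Q s)) = 0"
    unfolding quot_gen_def quot_const_def minus_all_quotients.abs_eq abs_quot_prod_list zero_all_quotients_def
  proof (rule cases)
    fix J :: "'k free_alg set"
    show "(\<Prod>s\<leftarrow>[0..<l]. (if ?R \<subseteq> J then free_gen 0 else ?c 0) - free_const (Q s)) - 0 \<in> ?R" if "?R \<subseteq> J"
      using that by (simp add: ak_relations_def)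
    \<comment> \<open>The factor for index 0 is \<open>Q 0 - Q 0\<close>.\<close>
    show "(\<Prod>s\<leftarrow>[0..<l]. (if ?R \<subseteq> J then free_gen 0 else ?c 0) - free_const (Q s)) = 0" if "\<not> ?R \<subseteq> J"
      using that upt_conv_Cons[of 0 l] l by simp
  qed
  show "quot_gen l n q Q i * quot_gen l n q Q i = quot_const (q - 1) * quot_gen l n q Q i + quot_const q"
    if "1 \<le> i" "i < n" for i
    unfolding quot_gen_def quot_const_def abs_quot
  proof (rule cases)
    fix J :: "'k free_alg set"
    have e: "free_gen i * free_gen i - (free_const (q - 1) * free_gen i + free_const q) =
       (free_gen i - free_const q) * (free_gen i + 1)"
      by (simp add: free_const_simps algebra_simps)
    show "(if ?R \<subseteq> J then free_gen i else ?c i) * (if ?R \<subseteq> J then free_gen i else ?c i) -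
      (free_const (q - 1) * (if ?R \<subseteq> J then free_gen i else ?c i) + free_const q) \<in> ?R" if "?R \<subseteq> J"
      using that rel \<open>1 \<le> i\<close> \<open>i < n\<close> e by simp
    show "(if ?R \<subseteq> J then free_gen i else ?c i) * (if ?R \<subseteq> J then free_gen i else ?c i) =
      free_const (q - 1) * (if ?R \<subseteq> J then free_gen i else ?c i) + free_const q" if "\<not> ?R \<subseteq> J"
      using that \<open>1 \<le> i\<close> by (simp add: free_const_simps algebra_simps)
  qed
  show "quot_gen l n q Q 0 * quot_gen l n q Q 1 * quot_gen l n q Q 0 * quot_gen l n q Q 1 =
      quot_gen l n q Q 1 * quot_gen l n q Q 0 * quot_gen l n q Q 1 * quot_gen l n q Q 0" if n: "2 \<le> n"
    unfolding quot_gen_def abs_quot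
  proof (rule cases, goal_cases)
    case (1 J)
    then show ?case using n by (simp add: ak_relations_def)
  next
    case (2 J)
    then show ?case by (simp add: free_const_simps(3)[symmetric] mult_ac)
  qed
  show "quot_gen l n q Q i * quot_gen l n q Q (i + 1) * quot_gen l n q Q i =
      quot_gen l n q Q (i + 1) * quot_gen l n q Q i * quot_gen l n q Q (i + 1)" if i: "1 \<le> i" "i + 1 < n" for i
    unfolding quot_gen_def abs_quot
  proof (rule cases, goal_cases)
    case (1 J)
    have "free_gen i * free_gen (i + 1) * free_gen i - free_gen (i + 1) * free_gen i * free_gen (i + 1) \<in> ?R"
      unfolding ak_relations_def using i by blast
    then show ?case using 1 by simp
  next
    case (2 J)
    then show ?case using i by (simp add: free_const_simps(3)[symmetric] mult_ac)
  qed
  show "quot_gen l n q Q i * quot_gen l n q Q j = quot_gen l n q Q j * quot_gen l n q Q i" if i: "i + 1 < j" "j < n" for i j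
    unfolding quot_gen_def abs_quot
  proof (rule cases, goal_cases)
    case (1 J)
    have "free_gen i * free_gen j - free_gen j * free_gen i \<in> ?R" unfolding ak_relations_def using i by blast
    then show ?case using 1 by simp
  next
    case (2 J)
    then show ?case by (simp add: free_const_simps(3)[symmetric] mult_ac)
  qed
qed

text \<open>The component of \<open>X\<close> at \<open>full_ideal\<close> is represented by
  \<open>x\<close>. In this way identities in the product of quotients become congruences modulo
  \<open>ak_ideal\<close>.\<close>

definition models :: "nat \<Rightarrow> nat \<Rightarrow> 'k::field \<Rightarrow> (nat \<Rightarrow> 'k) \<Rightarrow> 'k free_alg all_quotients \<Rightarrow> 'k free_alg \<Rightarrow> bool" where
  "models l n q Q X x \<longleftrightarrow> x \<in> carrier (free_algebra n) \<and>
     (\<exists>f. X = abs_all_quotients f \<and> f (full_ideal l n q Q) - x \<in> full_ideal l n q Q)"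

section \<open>Transfer from the product of quotients to the algebra\<close>

locale ak_params =
  fixes l n :: nat and q :: "'k::field" and Q :: "nat \<Rightarrow> 'k"
  assumes l1: "1 \<le> l" and n1: "1 \<le> n" and q_nz: "q \<noteq> 0"
begin

sublocale H: ak_ring l n q Q quot_const "quot_gen l n q Q" using l1 q_nz by (rule ak_ring_quot)

abbreviation "I \<equiv> ak_ideal l n q Q"
abbreviation "C \<equiv> carrier (free_algebra n) :: 'k free_alg set"
abbreviation "mod_eq \<equiv> models l n q Q"

lemmas full = two_sided_full_ideal[OF n1, of l q Q]
lemmas I_closed = ak_ideal_closed[OF n1, where l=l and q=q and Q=Q]

lemma models_unique:
  assumes "mod_eq X x" "mod_eq X y"
  shows "x - y \<in> I"
proof -
  let ?J = "full_ideal l n q Q"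
  obtain f g where fg: "X = abs_all_quotients f" "f ?J - x \<in> ?J" "X = abs_all_quotients g" "g ?J - y \<in> ?J"
    using assms unfolding models_def by blast
  have "f ?J - g ?J \<in> ?J" using abs_all_quotients_eqD[of f g] fg full by simp
  then have "(f ?J - g ?J) - (f ?J - x) + (g ?J - y) \<in> ?J"
    using two_sided_idealD(2,4)[OF full] fg by blast
  then have "x - y \<in> ?J" by simp
  moreover have "x - y \<in> C" using assms by (intro free_algebra_closed) (auto simp: models_def)
  ultimately show ?thesis using full_ideal_carrier by blast
qed

lemma models_add: "mod_eq X x \<Longrightarrow> mod_eq Y y \<Longrightarrow> mod_eq (X + Y) (x + y)"
proof -
  let ?J = "full_ideal l n q Q"
  assume a: "mod_eq X x" "mod_eq Y y"
  then obtain f g where fg: "X = abs_all_quotients f" "f ?J - x \<in> ?J" "Y = abs_all_quotients g" "g ?J - y \<in> ?J"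
    unfolding models_def by blast
  have "(f ?J - x) + (g ?J - y) \<in> ?J" by (intro two_sided_idealD(4)[OF full] fg)
  then have "f ?J + g ?J - (x + y) \<in> ?J" by (simp add: algebra_simps)
  then show ?thesis using a fg unfolding models_def by (auto intro: free_algebra_closed simp: abs_quot)
qed

lemma models_mult: "mod_eq X x \<Longrightarrow> mod_eq Y y \<Longrightarrow> mod_eq (X * Y) (x * y)"
proof -
  let ?J = "full_ideal l n q Q"
  assume a: "mod_eq X x" "mod_eq Y y"
  then obtain f g where fg: "X = abs_all_quotients f" "f ?J - x \<in> ?J" "Y = abs_all_quotients g" "g ?J - y \<in> ?J"
    unfolding models_def by blast
  have "(f ?J - x) * g ?J + x * (g ?J - y) \<in> ?J"
    by (intro two_sided_idealD(4)[OF full] two_sided_idealD(5,6)[OF full] fg)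
  then have "f ?J * g ?J - (x * y) \<in> ?J" by (simp add: algebra_simps)
  then show ?thesis using a fg unfolding models_def by (auto intro: free_algebra_closed simp: abs_quot)
qed

lemma models_const: "mod_eq (quot_const c) (free_const c)"
  using two_sided_idealD(1)[OF full] unfolding models_def quot_const_def
  by (intro conjI free_algebra_closed exI[of _ "\<lambda>J. free_const c"]) auto

lemma models_one: "mod_eq 1 1" using models_const[of 1] by (simp add: free_const_simps H.eta_one)
lemma models_zero: "mod_eq 0 0" using models_const[of 0] by (simp add: free_const_simps H.eta_zero)

lemma models_gen: "i < n \<Longrightarrow> mod_eq (quot_gen l n q Q i) (free_gen i)"
  using two_sided_idealD(1)[OF full] relations_full_ideal[OF n1, of l q Q] unfolding models_def quot_gen_def
  by (intro conjI free_algebra_closed exI[of _ "\<lambda>J. if ak_relations l n q Q \<subseteq> J then free_gen i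
     else free_const (if i = 0 then Q 0 else q)"]) auto

lemma models_word: "set u \<subseteq> {..<n} \<Longrightarrow> mod_eq (H.wordT u) (fword u)"
  by (induction u) (auto simp: fword_Nil fword_Cons intro: models_one models_mult models_gen)

lemma models_L: "1 \<le> k \<Longrightarrow> k \<le> n \<Longrightarrow> mod_eq (H.L k) (fL q k)"
  unfolding H.L_def fL_def by (intro models_mult models_const models_word) auto

lemma models_power: "mod_eq X x \<Longrightarrow> mod_eq (X ^ c) (x ^ c)"
  by (induction c) (auto intro: models_one models_mult)

lemma models_prod_list: "(\<And>k. k \<in> set ks \<Longrightarrow> mod_eq (X k) (x k)) \<Longrightarrow> mod_eq (\<Prod>k\<leftarrow>ks. X k) (\<Prod>k\<leftarrow>ks. x k)"
  by (induction ks) (auto intro: models_one models_mult)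

lemma models_basis:
  assumes "is_code n j"
  shows "mod_eq (H.Lmon c * H.wordT (cword j n)) (fLmon q n c * fword (cword j n))"
proof -
  have "set (cword j n) \<subseteq> {..<n}" using set_cword[of n j] assms by fastforce
  then show ?thesis unfolding H.Lmon_def fLmon_def
    by (intro models_mult models_prod_list models_power models_L models_word) auto
qed

text \<open>Linear forms on the algebra, pulled back to the free algebra.\<close>

definition linear_mod :: "('k free_alg \<Rightarrow> 'k) \<Rightarrow> bool" where
  "linear_mod f \<longleftrightarrow> (\<forall>x\<in>C. \<forall>y\<in>C. f (x + y) = f x + f y) \<and> (\<forall>c. \<forall>x\<in>C. f (free_const c * x) = c * f x) \<and> (\<forall>x\<in>I. f x = 0)"

lemma linear_modD:
  assumes "linear_mod f"
  shows "x \<in> C \<Longrightarrow> y \<in> C \<Longrightarrow> f (x + y) = f x + f y" "x \<in> C \<Longrightarrow> f (free_const c * x) = c * f x" "x \<in> I \<Longrightarrow> f x = 0" "f 0 = 0"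
    "x \<in> C \<Longrightarrow> y \<in> C \<Longrightarrow> x - y \<in> I \<Longrightarrow> f x = f y"
proof -
  show 1: "x \<in> C \<Longrightarrow> y \<in> C \<Longrightarrow> f (x + y) = f x + f y" for x y using assms by (simp add: linear_mod_def)
  show "x \<in> C \<Longrightarrow> f (free_const c * x) = c * f x" "x \<in> I \<Longrightarrow> f x = 0" "f 0 = 0"
    using assms I_closed(1) by (auto simp: linear_mod_def)
  show "f x = f y" if "x \<in> C" "y \<in> C" "x - y \<in> I"
    using 1[OF that(2), of "x - y"] that assms I_closed(6) by (auto simp: linear_mod_def)
qed

lemma aspan_models:
  assumes f: "linear_mod f" and M: "0 \<in> M" "\<And>x y. x \<in> M \<Longrightarrow> y \<in> M \<Longrightarrow> x + y \<in> M" "\<And>a x. a \<in> A \<Longrightarrow> x \<in> M \<Longrightarrow> a * x \<in> M"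
    and B: "\<And>b. b \<in> B \<Longrightarrow> \<exists>z. mod_eq b z \<and> f z \<in> M" and X: "X \<in> H.aspan A B"
  shows "\<exists>z. mod_eq X z \<and> f z \<in> M"
  using X
proof (induction rule: H.aspan.induct)
  case zero
  then show ?case using models_zero linear_modD(4)[OF f] M(1) by metis
next
  case (step a b x)
  obtain y z where y: "mod_eq b y" "f y \<in> M" and z: "mod_eq x z" "f z \<in> M" using B step by blast
  have C: "y \<in> C" "z \<in> C" using y z by (auto simp: models_def)
  have "mod_eq (quot_const a * b + x) (free_const a * y + z)" by (intro models_add models_mult models_const y z)
  moreover have "f (free_const a * y + z) = a * f y + f z"
    using linear_modD(1,2)[OF f] C by (simp add: free_algebra_closed)
  ultimately show ?case using M step.hyps y z by metis
qed

text \<open>Used twice: with \<open>M = {0}\<close> and all scalars it shows that a form is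
  determined by its values on monomials, and with the power series for both \<open>A\<close> and
  \<open>M\<close> it shows that the generic trace is integral on words.\<close>

lemma span_values:
  assumes f: "linear_mod f" and M: "0 \<in> M" "\<And>x y. x \<in> M \<Longrightarrow> y \<in> M \<Longrightarrow> x + y \<in> M" "\<And>a x. a \<in> A \<Longrightarrow> x \<in> M \<Longrightarrow> a * x \<in> M"
    and A: "0 \<in> A" "1 \<in> A" "q \<in> A" "\<And>a b. a \<in> A \<Longrightarrow> b \<in> A \<Longrightarrow> a - b \<in> A"
      "\<And>a b. a \<in> A \<Longrightarrow> b \<in> A \<Longrightarrow> a * b \<in> A" "\<And>s. s < l \<Longrightarrow> Q s \<in> A"
    and B: "\<And>c j. (\<forall>k\<in>{1..n}. c k < l) \<Longrightarrow> is_code n j \<Longrightarrow> f (fLmon q n c * fword (cword j n)) \<in> M"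
    and u: "set u \<subseteq> {..<n}"
  shows "f (fword u) \<in> M"
proof -
  have "H.wordT u \<in> H.aspan A H.basis_elts" by (rule H.words_in_aspan[OF n1 A u])
  then have "\<exists>z. mod_eq (H.wordT u) z \<and> f z \<in> M"
  proof (rule aspan_models[OF f M, rotated -1])
    fix b assume "b \<in> H.basis_elts"
    then show "\<exists>z. mod_eq b z \<and> f z \<in> M" unfolding H.basis_elts_def using models_basis B by blast
  qed
  then obtain z where z: "mod_eq (H.wordT u) z" "f z \<in> M" by blast
  have "fword u - z \<in> I" by (rule models_unique[OF models_word[OF u] z(1)])
  moreover have "z \<in> C" using z by (simp add: models_def)
  ultimately show ?thesis using linear_modD(5)[OF f fword_carrier[OF u]] z by simp
qed

lemma linear_mod_unique:
  assumes f: "linear_mod f" and g: "linear_mod g"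
    and B: "\<And>c j. (\<forall>k\<in>{1..n}. c k < l) \<Longrightarrow> is_code n j \<Longrightarrow>
      f (fLmon q n c * fword (cword j n)) = g (fLmon q n c * fword (cword j n))"
    and x: "x \<in> C"
  shows "f x = g x"
proof -
  have h: "linear_mod (\<lambda>x. f x - g x)"
    using f g unfolding linear_mod_def by (auto simp: algebra_simps)
  have "f (fword u) - g (fword u) \<in> {0}" if "set u \<subseteq> {..<n}" for u
    by (rule span_values[OF h, of "{0}" UNIV]) (use B that in auto)
  then have words: "f (fword u) = g (fword u)" if "set u \<subseteq> {..<n}" for u using that by simp
  show ?thesis using x
  proof (induction x rule: free_alg_induct)
    case zero
    then show ?case using linear_modD(4)[OF f] linear_modD(4)[OF g] by simp
  next
    case (step x w c)
    note keys = free_algebra_single_add(1)[OF step.prems step.hyps]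
      and xC = free_algebra_single_add(2)[OF step.prems step.hyps]
    have s: "Poly_Mapping.single w c = free_const c * fword (letters w)"
      by (simp add: fword_def free_const_def mult_single plus_free_monoid_def zero_free_monoid_def)
    have wC: "fword (letters w) \<in> C" by (rule fword_carrier[OF keys])
    then have "free_const c * fword (letters w) \<in> C" by (intro free_algebra_closed)
    note lin = linear_modD(1)[OF _ this xC] linear_modD(2)[OF _ wC]
    show ?case unfolding s lin[OF f] lin[OF g] words[OF keys] step.IH[OF xC] ..
  qed
qed

lemma reduced_word:
  assumes "reduced_expr n w u"
  shows "\<exists>j. is_code n j \<and> word_perm (cword j n) = w \<and> fword u - fword (cword j n) \<in> I"
proof -
  obtain j where j: "is_code n j" "word_perm (cword j n) = w" "braid_eq u (cword j n)"
    using reduced_expr_braid_eq_cword[OF assms] by blast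
  have u: "set u \<subseteq> {1..<n}" using assms by (simp add: reduced_expr_def)
  then have u': "set u \<subseteq> {..<n}" "set (cword j n) \<subseteq> {..<n}" using braid_eq_length_set[OF j(3)] by auto
  have "H.wordT u = H.wordT (cword j n)" by (rule H.wordT_braid_eq[OF j(3) u])
  then show ?thesis using models_unique[of "H.wordT u"] models_word[OF u'(1)] models_word[OF u'(2)] j by auto
qed

text \<open>Collects, for a representative in the free algebra, what is known of
  \<open>one_dim s\<close>: its value under the form, its eigenvalues and its square.\<close>

lemma one_dim_representative:
  assumes f: "linear_mod f" and s: "s < l"
    and B: "\<And>c j. (\<forall>k\<in>{1..n}. c k < l) \<Longrightarrow> is_code n j \<Longrightarrow> f (fLmon q n c * fword (cword j n)) =
      (if (\<forall>k\<in>{1..n}. c k = 0) \<and> cword j n = [] then 1 else 0)"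
  shows "\<exists>y\<in>C. f y = (\<Prod>t\<leftarrow>H.others s. - Q t) ^ n \<and>
    (\<forall>u. set u \<subseteq> {..<n} \<longrightarrow> y * fword u - free_const (H.lin_char s u) * y \<in> I) \<and>
    y * y - free_const ((\<Prod>k\<leftarrow>[1..<n + 1]. \<Prod>t\<leftarrow>H.others s. q ^ (k - 1) * Q s - Q t) * (\<Prod>k=1..n. q_int q k)) * y \<in> I"
proof -
  let ?\<kappa> = "(\<Prod>t\<leftarrow>H.others s. - Q t) ^ n"
  obtain r where r: "r \<in> H.aspan UNIV H.nontrivial_elts" "H.one_dim s = quot_const ?\<kappa> + r"
    using H.one_dim_expand[OF s] by blast
  have "\<exists>z. mod_eq r z \<and> f z \<in> {0}"
  proof (rule aspan_models[OF f _ _ _ _ r(1)])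
    fix b assume "b \<in> H.nontrivial_elts"
    then show "\<exists>z. mod_eq b z \<and> f z \<in> {0}" unfolding H.nontrivial_elts_def using models_basis B by (smt (verit, ccfv_SIG) mem_Collect_eq singletonI)
  qed auto
  then obtain z where z: "mod_eq r z" "f z = 0" by blast
  define y where "y = free_const ?\<kappa> + z"
  have y: "mod_eq (H.one_dim s) y" unfolding r(2) y_def by (intro models_add models_const z)
  have yC: "y \<in> C" "z \<in> C" using y z by (auto simp: models_def)
  have self: "cword (\<lambda>m. m) n = []" "is_code n (\<lambda>m. m)" using cword_self[of n] by auto
  have "f 1 = 1"
    using B[of "\<lambda>k. 0" "\<lambda>m. m"] self l1 by (simp add: fLmon_zero fword_Nil)
  then have "f (free_const ?\<kappa> * 1) = ?\<kappa>" using linear_modD(2)[OF f, of 1 ?\<kappa>] by (simp add: free_algebra_closed)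
  then have "f y = ?\<kappa>" unfolding y_def using linear_modD(1)[OF f, of "free_const ?\<kappa>" z] z yC by (simp add: free_algebra_closed)
  moreover have "y * fword u - free_const (H.lin_char s u) * y \<in> I" if u: "set u \<subseteq> {..<n}" for u
    using models_unique[of "H.one_dim s * H.wordT u"] models_mult[OF y models_word[OF u]]
      models_mult[OF models_const y] H.one_dim_word[OF n1 s u] by simp
  moreover have "y * y - free_const ((\<Prod>k\<leftarrow>[1..<n + 1]. \<Prod>t\<leftarrow>H.others s. q ^ (k - 1) * Q s - Q t) * (\<Prod>k=1..n. q_int q k)) * y \<in> I"
    using models_unique[OF models_mult[OF y y]] models_mult[OF models_const y] unfolding H.one_dim_square[OF n1 s] by blast
  ultimately show ?thesis using yC by blast
qed

end

section \<open>Specialisation of generic parameters\<close>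

text \<open>The linear extension of a function on words. The operator of a letter appends it to the
  argument, and evaluation at the empty word returns the value at the whole word; additivity and
  scaling are inherited from \<open>rep\<close>.\<close>

definition lin_ext :: "(nat list \<Rightarrow> 'k) \<Rightarrow> 'k::field free_alg \<Rightarrow> 'k" where
  "lin_ext \<phi> x = rep (\<lambda>k v u. v (u @ [k])) x \<phi> []"

lemma foldr_append_letters: "foldr (\<lambda>k v u. v (u @ [k])) ks \<phi> u = \<phi> (u @ ks)"
  by (induction ks arbitrary: u) auto

lemma lin_ext_add: "lin_ext \<phi> (x + y) = lin_ext \<phi> x + lin_ext \<phi> y"
  by (simp add: lin_ext_def rep_add)

lemma lin_ext_zero: "lin_ext \<phi> 0 = 0"
  by (simp add: lin_ext_def rep_zero)

lemma lin_ext_single: "lin_ext \<phi> (Poly_Mapping.single w c) = c * \<phi> (letters w)"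
  by (simp add: lin_ext_def rep_single foldr_append_letters)

lemma lin_ext_scale: "lin_ext \<phi> (free_const c * x) = c * lin_ext \<phi> x"
proof -
  have "linear_ops (\<lambda>k v u. v (u @ [k]) :: 'a)" by (simp add: linear_ops_def)
  then show ?thesis unfolding lin_ext_def by (simp add: rep_mult rep_const)
qed

text \<open>The power series among the Laurent series. On them the coefficient at 0 is a ring
  homomorphism, which is the specialisation.\<close>

definition integral_elts :: "'a::field fls set" where "integral_elts = range fps_to_fls"

lemma integral_closed:
  fixes x y :: "'a::field fls"
  shows "(0::'a fls) \<in> integral_elts" "(1::'a fls) \<in> integral_elts" "x \<in> integral_elts \<Longrightarrow> y \<in> integral_elts \<Longrightarrow> x + y \<in> integral_elts"
  "x \<in> integral_elts \<Longrightarrow> y \<in> integral_elts \<Longrightarrow> x - y \<in> integral_elts"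
  "x \<in> integral_elts \<Longrightarrow> - x \<in> integral_elts"
  "x \<in> integral_elts \<Longrightarrow> y \<in> integral_elts \<Longrightarrow> x * y \<in> integral_elts" "fls_const (c::'a) \<in> integral_elts"
proof -
  have I: "fps_to_fls f \<in> integral_elts" for f :: "'a fps" by (simp add: integral_elts_def)
  show "(0::'a fls) \<in> integral_elts" "(1::'a fls) \<in> integral_elts" "fls_const c \<in> integral_elts"
    using I[of 0] I[of 1] I[of "fps_const c"] by simp_all
  show "- x \<in> integral_elts" if "x \<in> integral_elts"
  proof -
    obtain f where "x = fps_to_fls f" using \<open>x \<in> integral_elts\<close> by (auto simp: integral_elts_def)
    then show ?thesis using I[of "- f"] by simp
  qed
  assume "x \<in> integral_elts" "y \<in> integral_elts"
  then obtain f g where "x = fps_to_fls f" "y = fps_to_fls g" by (auto simp: integral_elts_def)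
  then show "x + y \<in> integral_elts" "x - y \<in> integral_elts" "x * y \<in> integral_elts"
    using I[of "f + g"] I[of "f - g"] I[of "f * g"] by (simp_all add: fls_times_fps_to_fls)
qed

lemma integral_mult_nth_0:
  assumes "x \<in> integral_elts" "y \<in> integral_elts"
  shows "fls_nth (x * y) 0 = fls_nth x 0 * fls_nth y 0"
proof -
  obtain f g where "x = fps_to_fls f" "y = fps_to_fls g" using assms by (auto simp: integral_elts_def)
  then show ?thesis by (simp add: fls_times_fps_to_fls[symmetric])
qed

lemma integral_inverse:
  assumes "x \<in> integral_elts" "fls_nth x 0 \<noteq> 0"
  shows "inverse x \<in> integral_elts" "fls_nth (inverse x) 0 = inverse (fls_nth x 0)"
proof -
  obtain f where f: "x = fps_to_fls f" using assms by (auto simp: integral_elts_def)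
  then have f0: "fps_nth f 0 \<noteq> 0" using assms by simp
  then have "inverse x = fps_to_fls (inverse f)" using f by (simp add: fls_inverse_fps_to_fls)
  then show "inverse x \<in> integral_elts" "fls_nth (inverse x) 0 = inverse (fls_nth x 0)"
    using f by (simp_all add: integral_elts_def)
qed

lemma integral_power:
  assumes "x \<in> integral_elts"
  shows "x ^ m \<in> integral_elts \<and> fls_nth (x ^ m) 0 = fls_nth x 0 ^ m"
  by (induction m) (auto simp: integral_closed integral_mult_nth_0 assms)

lemma integral_powi:
  assumes "x \<in> integral_elts" "fls_nth x 0 \<noteq> 0"
  shows "x powi d \<in> integral_elts" "fls_nth (x powi d) 0 = fls_nth x 0 powi d"
  using integral_power[OF assms(1)] integral_power[OF integral_inverse(1)[OF assms]] integral_inverse(2)[OF assms]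
  by (auto simp: power_int_def)

text \<open>\<open>X\<close> has power series coefficients and specialises to \<open>x\<close>.
  Building the relation term by term makes it compatible with sums and products even where terms
  cancel.\<close>

inductive lifts :: "nat \<Rightarrow> 'a::field free_alg \<Rightarrow> 'a fls free_alg \<Rightarrow> bool" for n where
  lifts_zero: "lifts n 0 0"
| lifts_step: "a \<in> integral_elts \<Longrightarrow> set (letters w) \<subseteq> {..<n} \<Longrightarrow> lifts n x X \<Longrightarrow>
    lifts n (Poly_Mapping.single w (fls_nth a 0) + x) (Poly_Mapping.single w a + X)"

lemma lifts_add: "lifts n x X \<Longrightarrow> lifts n y Y \<Longrightarrow> lifts n (x + y) (X + Y)"
  by (induction rule: lifts.induct) (auto simp: add.assoc intro: lifts.intros)

lemma lifts_single: "a \<in> integral_elts \<Longrightarrow> set (letters w) \<subseteq> {..<n} \<Longrightarrow>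
    lifts n (Poly_Mapping.single w (fls_nth a 0)) (Poly_Mapping.single w a)"
  using lifts_step[OF _ _ lifts_zero] by fastforce

lemma lifts_mult:
  assumes x: "lifts n x X" and y: "lifts n y Y"
  shows "lifts n (x * y) (X * Y)"
  using x
proof (induction rule: lifts.induct)
  case lifts_zero
  then show ?case by (simp add: lifts.lifts_zero)
next
  case (lifts_step a w x X)
  have "lifts n (Poly_Mapping.single w (fls_nth a 0) * y) (Poly_Mapping.single w a * Y)"
    using y
  proof (induction rule: lifts.induct)
    case lifts_zero
    then show ?case by (simp add: lifts.lifts_zero)
  next
    case (lifts_step b u y Y)
    have "lifts n (Poly_Mapping.single (w + u) (fls_nth (a * b) 0)) (Poly_Mapping.single (w + u) (a * b))"
      using lifts_step \<open>a \<in> integral_elts\<close> \<open>set (letters w) \<subseteq> {..<n}\<close>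
      by (intro lifts_single integral_closed) (auto simp: plus_free_monoid_def)
    then show ?case using lifts_step \<open>a \<in> integral_elts\<close>
      by (simp add: distrib_left mult_single integral_mult_nth_0 lifts_add)
  qed
  then show ?case using lifts_step by (simp add: distrib_right lifts_add)
qed

lemma lifts_const: "a \<in> integral_elts \<Longrightarrow> lifts n (free_const (fls_nth a 0)) (free_const a)"
  unfolding free_const_def by (rule lifts_single) (simp_all add: zero_free_monoid_def)

lemma lifts_one: "lifts n 1 1"
  using lifts_const[of 1 n] by (simp add: free_const_simps integral_closed)

lemma lifts_uminus: "lifts n x X \<Longrightarrow> lifts n (- x) (- X)"
  using lifts_mult[OF lifts_const[of "- 1" n]] by (fastforce simp: free_const_def integral_closed single_uminus)

lemma lifts_diff: "lifts n x X \<Longrightarrow> lifts n y Y \<Longrightarrow> lifts n (x - y) (X - Y)"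
  using lifts_add[OF _ lifts_uminus] by fastforce

lemma lifts_word: "set u \<subseteq> {..<n} \<Longrightarrow> lifts n (fword u) (fword u)"
  unfolding fword_def using lifts_single[of 1 "FM u" n] by (simp add: integral_closed)

lemma lifts_gen: "i < n \<Longrightarrow> lifts n (free_gen i) (free_gen i)"
  using lifts_word[of "[i]" n] by (simp add: fword_Cons fword_Nil)

lemma lifts_power: "lifts n x X \<Longrightarrow> lifts n (x ^ c) (X ^ c)"
  by (induction c) (auto intro: lifts_one lifts_mult)

lemma lifts_prod_list: "(\<And>k. k \<in> set ks \<Longrightarrow> lifts n (x k) (X k)) \<Longrightarrow> lifts n (\<Prod>k\<leftarrow>ks. x k) (\<Prod>k\<leftarrow>ks. X k)"
  by (induction ks) (auto intro: lifts_one lifts_mult)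

lemma lifts_carrier: "lifts n x X \<Longrightarrow> x \<in> carrier (free_algebra n) \<and> X \<in> carrier (free_algebra n)"
proof (induction rule: lifts.induct)
  case (lifts_step a w x X)
  then have "Poly_Mapping.single w (fls_nth a 0) \<in> carrier (free_algebra n)" "Poly_Mapping.single w a \<in> carrier (free_algebra n)"
    by (auto simp: free_algebra_carrier_iff)
  then show ?case using lifts_step by (simp add: free_algebra_closed(1))
qed (simp add: free_algebra_closed(5))

lemma lifts_exists: "x \<in> carrier (free_algebra n) \<Longrightarrow> \<exists>X. lifts n x X"
proof (induction x rule: free_alg_induct)
  case zero
  then show ?case using lifts_zero by blast
next
  case (step x w c)
  note w = free_algebra_single_add[OF step.prems step.hyps]
  obtain X where "lifts n x X" using step.IH w by blast
  then show ?case using lifts_step[of "fls_const c" w n x X] w by (auto simp: integral_closed)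
qed

lemma ak_relations_lift:
  assumes r: "r \<in> ak_relations l n q Q" and n: "1 \<le> n"
    and q': "q' \<in> integral_elts" "fls_nth q' 0 = q" and Q': "\<And>s. s < l \<Longrightarrow> Q' s \<in> integral_elts \<and> fls_nth (Q' s) 0 = Q s"
  shows "\<exists>R\<in>ak_relations l n q' Q'. lifts n r R"
proof -
  have lq: "lifts n (free_const q) (free_const q')" using lifts_const q' by metis
  have lQ: "lifts n (free_const (Q s)) (free_const (Q' s))" if "s < l" for s using lifts_const Q'[OF that] by metis
  note intros = lifts_mult lifts_diff lifts_add lifts_gen lifts_one lq
  consider "r = (\<Prod>s\<leftarrow>[0..<l]. free_gen 0 - free_const (Q s))"
    | i where "1 \<le> i" "i < n" "r = (free_gen i - free_const q) * (free_gen i + 1)"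
    | "2 \<le> n" "r = free_gen 0 * free_gen 1 * free_gen 0 * free_gen 1 - free_gen 1 * free_gen 0 * free_gen 1 * free_gen 0"
    | i where "1 \<le> i" "i + 1 < n" "r = free_gen i * free_gen (i + 1) * free_gen i - free_gen (i + 1) * free_gen i * free_gen (i + 1)"
    | i j where "i + 1 < j" "j < n" "r = free_gen i * free_gen j - free_gen j * free_gen i"
    using r unfolding ak_relations_def by (auto split: if_splits)
  then show ?thesis
  proof cases
    case 1
    have "lifts n r (\<Prod>s\<leftarrow>[0..<l]. free_gen 0 - free_const (Q' s))"
      unfolding 1 using n by (intro lifts_prod_list lifts_diff lifts_gen lQ) auto
    then show ?thesis unfolding ak_relations_def by blast
  next
    case 2
    have "lifts n r ((free_gen i - free_const q') * (free_gen i + 1))" unfolding 2(3) using 2 by (intro intros)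
    then show ?thesis unfolding ak_relations_def using 2 by blast
  next
    case 3
    have "lifts n r (free_gen 0 * free_gen 1 * free_gen 0 * free_gen 1 - free_gen 1 * free_gen 0 * free_gen 1 * free_gen 0)"
      unfolding 3(2) using 3(1) by (intro intros) auto
    then show ?thesis unfolding ak_relations_def using 3(1) by auto
  next
    case 4
    have "lifts n r (free_gen i * free_gen (i + 1) * free_gen i - free_gen (i + 1) * free_gen i * free_gen (i + 1))"
      unfolding 4(3) using 4 by (intro intros) auto
    then show ?thesis unfolding ak_relations_def using 4(1,2) by blast
  next
    case 5
    have "lifts n r (free_gen i * free_gen j - free_gen j * free_gen i)"
      unfolding 5(3) using 5 by (intro intros) auto
    then show ?thesis unfolding ak_relations_def using 5(1,2) by blast
  qed
qed

text \<open>The elements with a lift in the generic ideal form an ideal, and each relation lifts to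
  the corresponding generic relation.\<close>

lemma ak_ideal_lift:
  assumes n: "1 \<le> n" and q': "q' \<in> integral_elts" "fls_nth q' 0 = q"
    and Q': "\<And>s. s < l \<Longrightarrow> Q' s \<in> integral_elts \<and> fls_nth (Q' s) 0 = Q s"
    and x: "x \<in> ak_ideal l n (q :: 'a::field) Q"
  shows "\<exists>X\<in>ak_ideal l n q' Q'. lifts n x X"
proof -
  let ?N = "{x. \<exists>X\<in>ak_ideal l n q' Q'. lifts n x X}"
  note closed = ak_ideal_closed[OF n, where l=l and q=q' and Q=Q']
  have "ideal ?N (free_algebra n)"
  proof (rule ideal_free_algebraI)
    show "?N \<subseteq> carrier (free_algebra n)" using lifts_carrier by blast
    show "0 \<in> ?N" using closed(1) lifts_zero by blast
    show "x + y \<in> ?N" if "x \<in> ?N" "y \<in> ?N" for x y using that closed(2) lifts_add by blast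
    fix x r :: "'a free_alg" assume x: "x \<in> ?N" and r: "r \<in> carrier (free_algebra n)"
    obtain X Y where X: "X \<in> ak_ideal l n q' Q'" "lifts n x X" "lifts n r Y" using x lifts_exists[OF r] by blast
    then show "r * x \<in> ?N" "x * r \<in> ?N" using closed(4,5)[OF X(1), of Y] lifts_carrier lifts_mult by blast+
  qed
  moreover have "ak_relations l n q Q \<subseteq> ?N" using ak_relations_lift[where q=q and Q=Q and l=l, OF _ n q' Q'] closed(7) by blast
  ultimately have "ak_ideal l n q Q \<subseteq> ?N" unfolding ak_ideal_def
    by (intro ring.genideal_minimal[OF ring_free_algebra])
  then show ?thesis using x by blast
qed

definition generic :: "'a::field poly \<Rightarrow> 'a fls" where "generic p = fps_to_fls (fps_of_poly p)"

lemma generic_hom: "generic (p + r) = generic p + generic r" "generic (p * r) = generic p * generic r"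
  "generic 1 = 1" "generic 0 = 0" "generic (p ^ m) = generic p ^ m" "generic p = generic r \<longleftrightarrow> p = r"
  "generic p \<in> integral_elts" "fls_nth (generic p) 0 = coeff p 0"
proof -
  show 1: "generic (p * r) = generic p * generic r" for p r :: "'a poly"
    by (simp add: generic_def fps_of_poly_mult fls_times_fps_to_fls)
  show 2: "generic 1 = 1" by (simp add: generic_def)
  show "generic (p ^ m) = generic p ^ m" by (induction m) (simp_all add: 1 2)
qed (simp_all add: generic_def fps_of_poly_add integral_elts_def)

lemma generic_sum: "generic (\<Sum>k\<in>S. f k) = (\<Sum>k\<in>S. generic (f k))"
  by (induction S rule: infinite_finite_induct) (simp_all add: generic_hom)

text \<open>Everything is read off from degrees in X. The q-integer of \<open>m\<close> is monic of
  degree \<open>m - 1\<close>. The product of the \<open>k\<close>-th power of the generic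
  \<open>q\<close> and the \<open>s\<close>-th generic parameter has degree
  \<open>k + n * Suc s\<close>; for \<open>k < n\<close>, division by \<open>n\<close> recovers
  \<open>s\<close>. All these exponents are positive, so the parameters still specialise to
  \<open>Q s\<close>.\<close>

lemma generic_separated:
  fixes q :: "'a::field"
  assumes l: "1 \<le> l" and n: "1 \<le> n"
  shows "separated l n (generic [:q, 1:]) (\<lambda>s. generic ([:Q s:] + monom 1 (n * Suc s)))"
proof
  let ?q = "[:q, 1:]" and ?Q = "\<lambda>s. [:Q s:] + monom 1 (n * Suc s)"
  have Qdeg: "degree (?Q s) = n * Suc s" "?Q s \<noteq> 0" for s
  proof -
    show d: "degree (?Q s) = n * Suc s"
      using n by (subst degree_add_eq_right) (auto simp: degree_monom_eq)
    show "?Q s \<noteq> 0" using d n by (metis degree_0 mult_eq_0_iff nat.distinct(1) not_one_le_zero)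
  qed
  have qdeg: "degree (?q ^ k) = k" for k by (simp add: degree_power_eq)
  show "1 \<le> l" by fact
  show "generic ?q \<noteq> 0" using generic_hom(6)[of ?q 0] unfolding generic_hom(4) by simp
  show "generic (?Q s) \<noteq> 0" for s using generic_hom(6)[of "?Q s" 0] Qdeg(2) unfolding generic_hom(4) by simp
  show "q_int (generic ?q) m \<noteq> 0" if "1 \<le> m" "m \<le> n" for m
  proof -
    have "coeff (\<Sum>k<m. ?q ^ k) (m - 1) = (\<Sum>k<m. if k = m - 1 then 1 else 0)"
      unfolding coeff_sum
    proof (rule sum.cong[OF refl])
      fix k assume "k \<in> {..<m}"
      moreover have "coeff (?q ^ k) k = 1" using lead_coeff_power[of ?q k] qdeg[of k] by simp
      moreover have "coeff (?q ^ k) (m - 1) = 0" if "k < m - 1" using qdeg[of k] that by (intro coeff_eq_0) simp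
      ultimately show "coeff (?q ^ k) (m - 1) = (if k = m - 1 then 1 else 0)"
        by (cases "k = m - 1") auto
    qed
    also have "\<dots> = 1" using that by simp
    finally have "(\<Sum>k<m. ?q ^ k) \<noteq> 0" by auto
    then show ?thesis unfolding q_int_def generic_hom(5)[symmetric] generic_sum[symmetric]
      using generic_hom(6)[of "\<Sum>k<m. ?q ^ k" 0] unfolding generic_hom(4) by simp
  qed
  have sep: "generic ?q ^ k * generic (?Q s) \<noteq> generic (?Q t)" if "s \<noteq> t" "k < n" for s t k
  proof
    assume "generic ?q ^ k * generic (?Q s) = generic (?Q t)"
    then have "?q ^ k * ?Q s = ?Q t" unfolding generic_hom(5)[symmetric] generic_hom(2)[symmetric] generic_hom(6) .
    then have "k + n * Suc s = n * Suc t" using Qdeg qdeg[of k] degree_mult_eq[of "?q ^ k" "?Q s"] by simp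
    then have "(k + n * Suc s) div n = (n * Suc t) div n" by (rule arg_cong)
    moreover have "(k + n * Suc s) div n = k div n + Suc s" "(n * Suc t) div n = Suc t"
      using n div_mult_self2[of n k "Suc s"] nonzero_mult_div_cancel_left[of n "Suc t"] by linarith+
    ultimately show False using that by simp
  qed
  show "generic ?q powi d * generic (?Q s) \<noteq> generic (?Q t)" if "s < l" "t < l" "s \<noteq> t" "\<bar>d\<bar> < int n" for s t d
  proof (cases "0 \<le> d")
    case True
    then show ?thesis using sep[of s t "nat d"] that by (simp add: power_int_def)
  next
    case False
    have q0: "generic ?q \<noteq> 0" by fact
    have "generic ?q ^ nat (- d) * generic (?Q t) \<noteq> generic (?Q s)" using sep[of t s "nat (- d)"] that False by simp
    then show ?thesis using False q0 by (auto simp: power_int_def power_inverse field_simps)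
  qed
qed

context ak_params
begin

text \<open>The constant coefficient of the generic trace. It exists on words by integrality, it
  vanishes on the ideal because elements of the ideal lift to the generic one, and it takes the
  prescribed values because the generic trace does.\<close>

theorem exists_trace:
  "\<exists>f. linear_mod f \<and> (\<forall>c j. (\<forall>k\<in>{1..n}. c k < l) \<longrightarrow> is_code n j \<longrightarrow> f (fLmon q n c * fword (cword j n)) =
      (if (\<forall>k\<in>{1..n}. c k = 0) \<and> cword j n = [] then 1 else 0))"
proof -
  define q' where "q' = generic [:q, 1:]"
  define Q' where "Q' = (\<lambda>s. generic ([:Q s:] + monom 1 (n * Suc s)))"
  interpret K: separated l n q' Q' unfolding q'_def Q'_def using l1 n1 by (rule generic_separated)
  interpret KP: ak_params l n q' Q' using l1 n1 K.q0 by unfold_locales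
  have q': "q' \<in> integral_elts" "fls_nth q' 0 = q" by (simp_all add: q'_def generic_hom)
  have Q': "Q' s \<in> integral_elts \<and> fls_nth (Q' s) 0 = Q s" for s using n1 unfolding Q'_def by (simp add: generic_hom(7,8))
  have lin: "KP.linear_mod (K.trc n)" unfolding KP.linear_mod_def
  proof (intro conjI ballI allI)
    fix x assume "x \<in> ak_ideal l n q' Q'"
    then show "K.trc n x = 0" unfolding K.trc_def using K.rep_F_ideal n1 by simp
  qed (simp_all add: K.trc_add K.trc_scale)
  have basis: "K.trc n (fLmon q' n c * fword (cword j n)) = (if (\<forall>k\<in>{1..n}. c k = 0) \<and> cword j n = [] then 1 else 0)"
    if "\<forall>k\<in>{1..n}. c k < l" "is_code n j" for c j using that by (intro K.trc_basis) auto
  have int: "K.trc n (fword u) \<in> integral_elts" if "set u \<subseteq> {..<n}" for u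
    by (rule KP.span_values[OF lin, of integral_elts integral_elts])
       (use that q' Q' basis in \<open>auto simp: integral_closed\<close>)
  define f where "f = lin_ext (\<lambda>u. fls_nth (K.trc n (fword u)) 0)"
  have trc0: "K.trc n 0 = 0" using KP.linear_modD(4)[OF lin] .
  \<comment> \<open>The specialised trace is the same for all lifts of \<open>x\<close>, so
    \<open>f\<close> may be computed from any of them.\<close>
  have lifted: "K.trc n X \<in> integral_elts \<and> fls_nth (K.trc n X) 0 = f x" if "lifts n x X" for x X
    using that
  proof (induction rule: lifts.induct)
    case (lifts_step a w x X)
    have s: "Poly_Mapping.single w a = free_const a * fword (letters w)"
      by (simp add: fword_def free_const_def mult_single plus_free_monoid_def zero_free_monoid_def)
    show ?case unfolding s K.trc_add K.trc_scale
      using lifts_step int by (simp add: integral_closed integral_mult_nth_0 f_def lin_ext_add lin_ext_single)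
  qed (simp add: trc0 integral_closed f_def lin_ext_zero)
  have "linear_mod f" unfolding linear_mod_def
  proof (intro conjI ballI allI)
    fix x assume "x \<in> I"
    then obtain X where "X \<in> ak_ideal l n q' Q'" "lifts n x X" using ak_ideal_lift[where q=q and Q=Q and l=l, OF n1 q' Q'] by blast
    then show "f x = 0" using lifted KP.linear_modD(3)[OF lin] by fastforce
  qed (simp_all add: f_def lin_ext_add lin_ext_scale)
  moreover have "f (fLmon q n c * fword (cword j n)) = (if (\<forall>k\<in>{1..n}. c k = 0) \<and> cword j n = [] then 1 else 0)"
    if "\<forall>k\<in>{1..n}. c k < l" "is_code n j" for c j
  proof -
    have L: "lifts n (fL q k) (fL q' k)" if "k \<in> set [1..<n + 1]" for k
    proof -
      have "lifts n (free_const (fls_nth (q' powi (1 - int k)) 0)) (free_const (q' powi (1 - int k)))"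
        using integral_powi(1)[of q' "1 - int k"] q' q_nz by (intro lifts_const) simp
      then have "lifts n (free_const (q powi (1 - int k))) (free_const (q' powi (1 - int k)))"
        using integral_powi(2)[of q' "1 - int k"] q' q_nz by simp
      then show ?thesis unfolding fL_def using that by (intro lifts_mult lifts_word) auto
    qed
    have "set (cword j n) \<subseteq> {..<n}" using set_cword[OF that(2)] by auto
    then have "lifts n (fLmon q n c * fword (cword j n)) (fLmon q' n c * fword (cword j n))"
      unfolding fLmon_def by (intro lifts_mult lifts_prod_list lifts_power lifts_word L)
    from lifted[OF this] show ?thesis unfolding basis[OF that] by (auto split: if_splits)
  qed
  ultimately show ?thesis by blast
qed

end

section \<open>Semisimplicity and the symmetrizing form\<close>

context ak_params
begin

abbreviation "H_alg \<equiv> ak_algebra l n q Q"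

definition coset :: "'k free_alg \<Rightarrow> 'k free_alg set" where
  "coset x = I +>\<^bsub>free_algebra n\<^esub> x"

lemma coset_ops:
  shows coset_carrier: "carrier H_alg = coset ` C"
    and coset_mult: "x \<in> C \<Longrightarrow> y \<in> C \<Longrightarrow> coset x \<otimes>\<^bsub>H_alg\<^esub> coset y = coset (x * y)"
    and coset_add: "x \<in> C \<Longrightarrow> y \<in> C \<Longrightarrow> coset x \<oplus>\<^bsub>H_alg\<^esub> coset y = coset (x + y)"
    and coset_one: "\<one>\<^bsub>H_alg\<^esub> = coset 1" and coset_zero: "\<zero>\<^bsub>H_alg\<^esub> = coset 0"
    and coset_eq: "x \<in> C \<Longrightarrow> y \<in> C \<Longrightarrow> coset x = coset y \<longleftrightarrow> x - y \<in> I"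
proof -
  interpret J: ideal I "free_algebra n" by (rule ideal_ak_ideal[OF n1])
  have hom: "coset \<in> ring_hom (free_algebra n) H_alg"
    using J.rcos_ring_hom unfolding ak_algebra_def coset_def[abs_def] .
  show "carrier H_alg = coset ` C"
    unfolding ak_algebra_def FactRing_def A_RCOSETS_def' coset_def[abs_def] by auto
  show "x \<in> C \<Longrightarrow> y \<in> C \<Longrightarrow> coset x \<otimes>\<^bsub>H_alg\<^esub> coset y = coset (x * y)"
    using ring_hom_mult[OF hom] by (simp add: free_algebra_simps)
  show "x \<in> C \<Longrightarrow> y \<in> C \<Longrightarrow> coset x \<oplus>\<^bsub>H_alg\<^esub> coset y = coset (x + y)"
    using ring_hom_add[OF hom] by (simp add: free_algebra_simps)
  show "\<one>\<^bsub>H_alg\<^esub> = coset 1" using ring_hom_one[OF hom] by (simp add: free_algebra_simps)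
  have "coset 0 = I" using J.a_rcos_const[OF I_closed(1)] by (simp add: coset_def)
  then show "\<zero>\<^bsub>H_alg\<^esub> = coset 0" by (simp add: ak_algebra_def FactRing_def)
  show "coset x = coset y \<longleftrightarrow> x - y \<in> I" if "x \<in> C" "y \<in> C"
  proof -
    have "\<ominus>\<^bsub>free_algebra n\<^esub> y = - y"
      using that by (intro J.minus_equality) (auto simp: free_algebra_simps free_algebra_closed)
    then have "x \<ominus>\<^bsub>free_algebra n\<^esub> y = x - y" by (simp add: a_minus_def free_algebra_simps)
    then show ?thesis using J.quotient_eq_iff_same_a_r_cos[OF J.ideal_axioms that] by (simp add: coset_def)
  qed
qed

text \<open>The left ideal generated by \<open>y\<close> has a complement, which gives
  \<open>1 = x y + z\<close> and hence \<open>y = y x y + y z\<close>. Being an eigenvector,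
  \<open>y\<close> satisfies \<open>y x y = c y y\<close>, which would be 0; then
  \<open>y = y z\<close> would lie in the complement as well as in the left ideal and be 0.\<close>

lemma semisimple_square:
  assumes ss: "semisimple_module H_alg (regular_module H_alg)"
    and y: "y \<in> C" "y \<notin> I" and eig: "\<And>x. x \<in> C \<Longrightarrow> \<exists>c. y * x - free_const c * y \<in> I"
  shows "y * y \<notin> I"
proof
  assume yy: "y * y \<in> I"
  let ?M = "regular_module H_alg"
  note closed = free_algebra_closed
  interpret A: ring H_alg by (rule ring_ak_algebra[OF n1])
  interpret M: left_module H_alg ?M by (rule A.left_module_regular)
  have ops: "carrier ?M = coset ` C" "add ?M = add H_alg" "zero ?M = coset 0" "Module.smult ?M = mult H_alg"
    using coset_carrier coset_zero by (simp_all add: regular_module_def)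
  let ?N = "{coset (x * y) | x. x \<in> C}"
  have "submodule ?N H_alg ?M"
  proof (intro submodule.intro submodule_axioms.intro)
    show "subgroup ?N (add_monoid ?M)"
    proof (rule M.M.add.subgroupI)
      show "?N \<subseteq> carrier ?M" unfolding ops using y by (auto intro: closed)
      show "?N \<noteq> {}" using closed(5) by blast
      fix a assume "a \<in> ?N"
      then obtain x where x: "x \<in> C" "a = coset (x * y)" by blast
      have c: "x * y \<in> C" "- x * y \<in> C" using x y by (intro closed; simp)+
      have "coset (- x * y) \<oplus>\<^bsub>?M\<^esub> coset (x * y) = \<zero>\<^bsub>?M\<^esub>"
        unfolding ops coset_add[OF c(2,1)] by (simp add: distrib_right[symmetric])
      then have "\<ominus>\<^bsub>?M\<^esub> a = coset (- x * y)"
        using c unfolding x(2) by (intro M.M.minus_equality) (auto simp: ops)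
      moreover have "coset (- x * y) \<in> ?N" using x closed(4) by blast
      ultimately show "\<ominus>\<^bsub>?M\<^esub> a \<in> ?N" by simp
      fix b assume "b \<in> ?N"
      then obtain z where z: "z \<in> C" "b = coset (z * y)" by blast
      have "a \<oplus>\<^bsub>?M\<^esub> b = coset ((x + z) * y)"
        using x z y by (simp add: ops coset_add closed distrib_right)
      then show "a \<oplus>\<^bsub>?M\<^esub> b \<in> ?N" using x z closed(1) by blast
    qed
    fix a b assume "a \<in> carrier H_alg" "b \<in> ?N"
    then obtain x z where xz: "x \<in> C" "a = coset x" "z \<in> C" "b = coset (z * y)" using coset_carrier by auto
    have "a \<odot>\<^bsub>?M\<^esub> b = coset ((x * z) * y)" using xz y by (simp add: ops coset_mult closed mult.assoc)
    then show "a \<odot>\<^bsub>?M\<^esub> b \<in> ?N" using xz closed(3) by blast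
  qed
  then obtain N' where N': "submodule N' H_alg ?M" "?N \<inter> N' = {\<zero>\<^bsub>?M\<^esub>}" "?N <+>\<^bsub>?M\<^esub> N' = carrier ?M"
    using ss unfolding semisimple_module_def by blast
  have "coset 1 \<in> ?N <+>\<^bsub>?M\<^esub> N'" unfolding N'(3) ops using closed(6) by blast
  then obtain x e where x: "x \<in> C" and e: "e \<in> N'" and one: "coset 1 = coset (x * y) \<oplus>\<^bsub>?M\<^esub> e"
    unfolding set_add_def' by auto
  have sub: "N' \<subseteq> carrier ?M"
    using subgroup.subset[OF submodule.axioms(1)[OF N'(1)]] by simp
  then obtain z where z: "z \<in> C" "e = coset z" using e ops(1) by auto
  have "1 - (x * y + z) \<in> I"
    using one coset_eq[OF closed(6), of "x * y + z"] x y z by (simp add: ops coset_add closed)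
  \<comment> \<open>In the algebra this reads \<open>y = y x y + y z\<close>.\<close>
  then have 1: "y * (1 - (x * y + z)) \<in> I" using I_closed(4) y by blast
  obtain c where c: "y * x - free_const c * y \<in> I" using eig[OF x] by blast
  have "(y * x - free_const c * y) * y + free_const c * (y * y) \<in> I"
    using I_closed(2) I_closed(5)[OF c y(1)] I_closed(4)[OF yy closed(7)] by blast
  then have "y * x * y \<in> I" by (simp add: algebra_simps)
  with 1 have "y * (1 - (x * y + z)) + y * x * y \<in> I" by (rule I_closed(2))
  then have "y - y * z \<in> I" by (simp add: algebra_simps)
  then have "coset y = coset (y * z)" using y z by (subst coset_eq) (auto intro: closed)
  also have "\<dots> = coset y \<odot>\<^bsub>?M\<^esub> e" using y z by (simp add: ops coset_mult)
  also have "\<dots> \<in> N'" using submodule.smult_closed[OF N'(1) _ e] y coset_carrier by blast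
  finally have "coset y \<in> N'" .
  moreover have "coset y = coset (1 * y)" by simp
  then have "coset y \<in> ?N" using closed(6) by blast
  ultimately have "coset y = coset 0" using N'(2) ops(3) by blast
  then have "y \<in> I" using coset_eq[OF y(1) closed(5)] by simp
  then show False using y(2) by contradiction
qed

lemma separated_of_semisimple:
  assumes ss: "semisimple_module H_alg (regular_module H_alg)" and Q0: "\<And>s. s < l \<Longrightarrow> Q s \<noteq> 0"
  shows "separated l n q Q"
proof -
  obtain f where f: "linear_mod f" "\<And>c j. (\<forall>k\<in>{1..n}. c k < l) \<Longrightarrow> is_code n j \<Longrightarrow> f (fLmon q n c * fword (cword j n)) =
      (if (\<forall>k\<in>{1..n}. c k = 0) \<and> cword j n = [] then 1 else 0)"
    using exists_trace by blast
  have nz: "(\<Prod>k\<leftarrow>[1..<n + 1]. \<Prod>t\<leftarrow>H.others s. q ^ (k - 1) * Q s - Q t) * (\<Prod>k=1..n. q_int q k) \<noteq> 0" (is "?c \<noteq> 0")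
    if s: "s < l" for s
  proof
    assume c0: "?c = 0"
    obtain y where y: "y \<in> C" "f y = (\<Prod>t\<leftarrow>H.others s. - Q t) ^ n"
      "\<And>u. set u \<subseteq> {..<n} \<Longrightarrow> y * fword u - free_const (H.lin_char s u) * y \<in> I" "y * y - free_const ?c * y \<in> I"
      using one_dim_representative[OF f(1) s f(2)] by blast
    have "prod_list (map (\<lambda>t. - Q t) ts) \<noteq> 0" if "set ts \<subseteq> {..<l}" for ts
      using that Q0 by (induction ts) auto
    moreover have "set (H.others s) \<subseteq> {..<l}" using s by (auto simp: H.others_def)
    ultimately have "f y \<noteq> 0" unfolding y(2) by simp
    then have "y \<notin> I" using linear_modD(3)[OF f(1)] by blast
    \<comment> \<open>The eigenvector property extends from words to all elements by
      linearity.\<close>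
    moreover have "\<exists>c. y * x - free_const c * y \<in> I" if "x \<in> C" for x
      using that
    proof (induction x rule: free_alg_induct)
      case zero
      then show ?case using I_closed(1) by (intro exI[of _ 0]) (simp add: free_const_simps)
    next
      case (step x w c)
      note w = free_algebra_single_add[OF step.prems step.hyps]
      obtain d where d: "y * x - free_const d * y \<in> I" using step.IH w by blast
      have s: "Poly_Mapping.single w c = fword (letters w) * free_const c"
        by (simp add: fword_def free_const_def mult_single plus_free_monoid_def zero_free_monoid_def)
      have "(y * fword (letters w) - free_const (H.lin_char s (letters w)) * y) * free_const c \<in> I"
        using y(3)[OF w(1)] by (intro I_closed(5)) (auto intro: free_algebra_closed)
      from I_closed(2)[OF this d]
      have "y * (Poly_Mapping.single w c + x) - free_const (H.lin_char s (letters w) * c + d) * y \<in> I"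
        unfolding s free_const_simps using free_const_central[of c y] by (simp add: algebra_simps)
      then show ?case by blast
    qed
    ultimately have "y * y \<notin> I" using semisimple_square[OF ss y(1)] by blast
    then show False using y(4) unfolding c0 by (simp add: free_const_simps)
  qed
  show ?thesis
  proof
    show "1 \<le> l" "q \<noteq> 0" by (rule l1, rule q_nz)
    show "Q s \<noteq> 0" if "s < l" for s using Q0 that .
    have "(\<Prod>k=1..n. q_int q k) \<noteq> 0" using nz[of 0] l1 by simp
    then show "q_int q m \<noteq> 0" if "1 \<le> m" "m \<le> n" for m using that by simp
    have sep: "q ^ m * Q s \<noteq> Q t" if "s < l" "t < l" "s \<noteq> t" "m < n" for s t m
    proof -
      have zero: "prod_list xs = 0 \<longleftrightarrow> 0 \<in> set xs" for xs :: "'k list" by (induction xs) auto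
      have "(\<Prod>k\<leftarrow>[1..<n + 1]. \<Prod>t\<leftarrow>H.others s. q ^ (k - 1) * Q s - Q t) \<noteq> 0" using nz[OF that(1)] by simp
      then have "0 \<notin> set (map (\<lambda>k. \<Prod>t\<leftarrow>H.others s. q ^ (k - 1) * Q s - Q t) [1..<n + 1])" unfolding zero .
      moreover have "Suc m \<in> set [1..<n + 1]" using that by auto
      ultimately have "(\<Prod>t\<leftarrow>H.others s. q ^ m * Q s - Q t) \<noteq> 0" by force
      then have "0 \<notin> set (map (\<lambda>t. q ^ m * Q s - Q t) (H.others s))" unfolding zero .
      moreover have "t \<in> set (H.others s)" using that by (auto simp: H.others_def)
      ultimately show ?thesis by force
    qed
    show "q powi d * Q s \<noteq> Q t" if "s < l" "t < l" "s \<noteq> t" "\<bar>d\<bar> < int n" for s t d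
    proof (cases "0 \<le> d")
      case True
      then show ?thesis using sep[of s t "nat d"] that by (simp add: power_int_def)
    next
      case False
      \<comment> \<open>Negative exponents reduce to positive ones by exchanging the two
        parameters.\<close>
      have "q ^ nat (- d) * Q t \<noteq> Q s" using sep[of t s "nat (- d)"] that False by simp
      then show ?thesis using False q_nz by (auto simp: power_int_def power_inverse field_simps)
    qed
  qed
qed

section \<open>The basis elements as cosets and the symmetrizing form\<close>

lemma coset_word:
  assumes "set u \<subseteq> {..<n}"
  shows "ak_word l n q Q u = coset (fword u)"
  using assms
proof (induction u)
  case Nil
  then show ?case by (simp add: ak_word_def fword_Nil coset_one)
next
  case (Cons i u)
  have "ak_word l n q Q (i # u) = coset (free_gen i) \<otimes>\<^bsub>H_alg\<^esub> coset (fword u)"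
    using Cons by (simp add: ak_word_def ak_gen_def coset_def)
  also have "\<dots> = coset (free_gen i * fword u)"
    using Cons.prems by (intro coset_mult free_algebra_closed fword_carrier) auto
  finally show ?case by (simp add: fword_Cons)
qed

lemma coset_pow: "x \<in> C \<Longrightarrow> coset x [^]\<^bsub>H_alg\<^esub> (c::nat) = coset (x ^ c)"
proof (induction c)
  case (Suc c)
  then show ?case using coset_mult[of "x ^ c" x] by (simp add: free_algebra_power power_Suc2 del: power_Suc)
qed (simp add: coset_one nat_pow_def)

text \<open>The reduced expression chosen in \<open>ak_T\<close> is braid equivalent to a canonical
  word, so the choice does not affect the coset.\<close>

lemma coset_basis:
  assumes "w permutes {1..n}"
  shows "\<exists>j. is_code n j \<and> word_perm (cword j n) = w \<and> (\<forall>c. ak_basis l n q Q c w = coset (fLmon q n c * fword (cword j n)))"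
proof -
  define u where "u = (SOME u. reduced_expr n w u)"
  have red: "reduced_expr n w u" unfolding u_def by (rule someI_ex[OF reduced_expr_exists[OF assms]])
  then obtain j where j: "is_code n j" "word_perm (cword j n) = w" "fword u - fword (cword j n) \<in> I"
    using reduced_word by blast
  have u: "set u \<subseteq> {..<n}" using red by (auto simp: reduced_expr_def)
  have T: "ak_T l n q Q w = coset (fword u)" using coset_word[OF u] by (simp add: ak_T_def u_def)
  have L: "ak_L l n q Q k = coset (fL q k)" if "1 \<le> k" "k \<le> n" for k
  proof -
    have w: "set (rev [1..<k] @ [0] @ [1..<k]) \<subseteq> {..<n}" using that by auto
    have "ak_L l n q Q k = coset (free_const (q powi (1 - int k))) \<otimes>\<^bsub>H_alg\<^esub> coset (fword (rev [1..<k] @ [0] @ [1..<k]))"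
      unfolding ak_L_def coset_word[OF w] by (simp add: ak_scalar_def coset_def)
    then show ?thesis unfolding fL_def using coset_mult[OF free_algebra_closed(7) fword_carrier[OF w]] by simp
  qed
  have fold: "foldr (\<lambda>k X. ak_L l n q Q k [^]\<^bsub>H_alg\<^esub> c k \<otimes>\<^bsub>H_alg\<^esub> X) ks (coset z) = coset ((\<Prod>k\<leftarrow>ks. fL q k ^ c k) * z)"
    if "set ks \<subseteq> {1..n}" "z \<in> C" for ks z and c :: "nat \<Rightarrow> nat"
    using that(1)
  proof (induction ks)
    case (Cons k ks)
    have k: "fL q k ^ c k \<in> C" using Cons.prems by (intro free_algebra_power fL_carrier) auto
    have ks: "(\<Prod>k\<leftarrow>ks. fL q k ^ c k) * z \<in> C"
      using Cons.prems that(2) by (intro free_algebra_closed free_algebra_prod_list free_algebra_power fL_carrier) auto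
    have "ak_L l n q Q k [^]\<^bsub>H_alg\<^esub> c k = coset (fL q k ^ c k)"
      using Cons.prems L[of k] coset_pow[OF fL_carrier[of k n q]] by simp
    then show ?case using Cons coset_mult[OF k ks] by (simp add: mult.assoc)
  qed simp
  have "ak_basis l n q Q c w = coset (fLmon q n c * fword (cword j n))" for c
  proof -
    have cj: "fword (cword j n) \<in> C" using set_cword[OF j(1)] by (intro fword_carrier) auto
    have "ak_basis l n q Q c w = coset (fLmon q n c * fword u)"
      unfolding ak_basis_def T fLmon_def using fword_carrier[OF u] by (intro fold) auto
    moreover have "fLmon q n c * (fword u - fword (cword j n)) \<in> I" using j(3) fLmon_carrier[OF order_refl] by (rule I_closed(4))
    then have "coset (fLmon q n c * fword u) = coset (fLmon q n c * fword (cword j n))"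
      using fLmon_carrier[OF order_refl] fword_carrier[OF u] cj
      by (subst coset_eq) (auto simp: right_diff_distrib intro: free_algebra_closed)
    ultimately show ?thesis by simp
  qed
  then show ?thesis using j by blast
qed

text \<open>The form induced by \<open>g\<close> fits the description, and any other candidate
  agrees with it on the spanning monomials and hence on the carrier; extensionality fixes the values
  elsewhere.\<close>

lemma ak_tau_coset:
  assumes g: "linear_mod g" and basis: "\<And>c j. (\<forall>k\<in>{1..n}. c k < l) \<Longrightarrow> is_code n j \<Longrightarrow> g (fLmon q n c * fword (cword j n)) =
      (if (\<forall>k\<in>{1..n}. c k = 0) \<and> cword j n = [] then 1 else 0)"
    and x: "x \<in> C"
  shows "ak_tau l n q Q (coset x) = g x"
proof -
  let ?P = "\<lambda>f. f \<in> extensional (carrier H_alg) \<and> ak_linear_form l n q Q f \<and>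
     (\<forall>c \<in> {1..n} \<rightarrow> {..<l}. \<forall>w. w permutes {1..n} \<longrightarrow>
        f (ak_basis l n q Q c w) = (if (\<forall>k\<in>{1..n}. c k = 0) \<and> w = id then 1 else 0))"
  \<comment> \<open>\<open>h\<close> evaluates \<open>g\<close> at an arbitrary representative;
    congruent representatives give the same value.\<close>
  define h where "h = restrict (\<lambda>X. g (SOME x. x \<in> C \<and> coset x = X)) (carrier H_alg)"
  have scalar: "ak_scalar l n q Q c = coset (free_const c)" for c by (simp add: ak_scalar_def coset_def)
  \<comment> \<open>Canonical words are determined by their permutation, so the identity is
    represented by the empty word only.\<close>
  have id: "word_perm (cword j n) = id \<longleftrightarrow> cword j n = []" if "is_code n j" for j
    using cword_inj[OF that cword_self(2)] by (auto simp: cword_self word_perm_def)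
  have h: "h (coset x) = g x" if x: "x \<in> C" for x
  proof -
    let ?z = "SOME z. z \<in> C \<and> coset z = coset x"
    have z: "?z \<in> C \<and> coset ?z = coset x" using x by (intro someI_ex[of "\<lambda>z. z \<in> C \<and> coset z = coset x"]) blast
    then have "?z - x \<in> I" using coset_eq x by blast
    then have "g ?z = g x" using linear_modD(5)[OF g] z x by blast
    then show ?thesis using x coset_carrier by (simp add: h_def)
  qed
  have "?P h"
  proof (intro conjI ballI allI impI)
    show "h \<in> extensional (carrier H_alg)" by (simp add: h_def)
    show "ak_linear_form l n q Q h" unfolding ak_linear_form_def coset_carrier scalar
    proof (intro conjI ballI allI)
      fix X Y assume "X \<in> coset ` C" "Y \<in> coset ` C"
      then show "h (X \<oplus>\<^bsub>H_alg\<^esub> Y) = h X + h Y"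
        using linear_modD(1)[OF g] by (auto simp: coset_add h free_algebra_closed)
    next
      fix c X assume "X \<in> coset ` C"
      then show "h (coset (free_const c) \<otimes>\<^bsub>H_alg\<^esub> X) = c * h X"
        using linear_modD(2)[OF g] by (auto simp: coset_mult h free_algebra_closed)
    qed
    fix c :: "nat \<Rightarrow> nat" and w assume c: "c \<in> {1..n} \<rightarrow> {..<l}" and w: "w permutes {1..n}"
    obtain j where j: "is_code n j" "word_perm (cword j n) = w"
      "\<And>c. ak_basis l n q Q c w = coset (fLmon q n c * fword (cword j n))"
      using coset_basis[OF w] by blast
    have "fLmon q n c * fword (cword j n) \<in> C"
      using set_cword[OF j(1)] by (intro free_algebra_closed fLmon_carrier fword_carrier) auto
    then have "h (ak_basis l n q Q c w) = g (fLmon q n c * fword (cword j n))" unfolding j(3) by (rule h)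
    also have "\<dots> = (if (\<forall>k\<in>{1..n}. c k = 0) \<and> cword j n = [] then 1 else 0)"
      using c by (intro basis j) auto
    finally show "h (ak_basis l n q Q c w) = (if (\<forall>k\<in>{1..n}. c k = 0) \<and> w = id then 1 else 0)"
      using id[OF j(1)] j(2) by simp
  qed
  moreover have "f = h" if f: "?P f" for f
  proof (rule extensionalityI)
    show "f \<in> extensional (carrier H_alg)" "h \<in> extensional (carrier H_alg)" using f by (auto simp: h_def)
    have lin: "linear_mod (\<lambda>x. f (coset x))" unfolding linear_mod_def
    proof (intro conjI ballI allI)
      have F: "ak_linear_form l n q Q f" using f by blast
      show "f (coset (x + y)) = f (coset x) + f (coset y)" if "x \<in> C" "y \<in> C" for x y
        using F that unfolding ak_linear_form_def coset_carrier by (simp add: coset_add[symmetric])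
      show sc: "f (coset (free_const c * x)) = c * f (coset x)" if "x \<in> C" for c x
        using F that unfolding ak_linear_form_def coset_carrier scalar by (simp add: coset_mult[symmetric] free_algebra_closed)
      fix x assume "x \<in> I"
      then have "coset x = coset (free_const 0 * 0)"
        using coset_eq[OF _ free_algebra_closed(5), of x] I_closed(6) by auto
      then show "f (coset x) = 0" using sc[of 0 0] by (simp add: free_algebra_closed)
    qed
    fix X assume "X \<in> carrier H_alg"
    then obtain x where x: "x \<in> C" "X = coset x" using coset_carrier by blast
    have "f (coset x) = g x"
    proof (rule linear_mod_unique[OF lin g _ x(1)])
      fix c :: "nat \<Rightarrow> nat" and j assume c: "\<forall>k\<in>{1..n}. c k < l" and j: "is_code n j"
      have w: "word_perm (cword j n) permutes {1..n}" using word_perm_permutes[OF set_cword[OF j]] .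
      obtain j' where j': "is_code n j'" "word_perm (cword j' n) = word_perm (cword j n)"
        "\<And>c. ak_basis l n q Q c (word_perm (cword j n)) = coset (fLmon q n c * fword (cword j' n))"
        using coset_basis[OF w] by blast
      have eq: "cword j' n = cword j n" using cword_inj[OF j'(1) j j'(2)] .
      have "f (ak_basis l n q Q c (word_perm (cword j n))) =
         (if (\<forall>k\<in>{1..n}. c k = 0) \<and> word_perm (cword j n) = id then 1 else 0)"
        using f c w by auto
      then show "f (coset (fLmon q n c * fword (cword j n))) = g (fLmon q n c * fword (cword j n))"
        unfolding j'(3) eq basis[OF c j] id[OF j] .
    qed
    then show "f X = h X" using h x by simp
  qed
  ultimately have "ak_tau l n q Q = h" unfolding ak_tau_def by (intro the_equality) blast+
  then show ?thesis using h[OF x] by simp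
qed

end

section \<open>Independence of the characters\<close>

text \<open>In distinct components a first row and a first column are disjoint, which gains one over
  \<open>content_diff_less\<close>. The gain is needed for the diagram of up to \<open>n + 1\<close>
  nodes in \<open>diagonal_separates\<close>.\<close>

lemma content_diff_components:
  assumes D: "closed_diagram l D" "finite D" and x: "x \<in> D" and y: "y \<in> D" and ne: "fst x \<noteq> fst y"
  shows "content x - content y \<le> int (card D) - 2"
proof -
  obtain s i j where xx: "x = (s, i, j)" by (cases x) auto
  obtain t i' j' where yy: "y = (t, i', j')" by (cases y) auto
  have pos: "1 \<le> i" "1 \<le> j" "1 \<le> i'" "1 \<le> j'" using D(1) x y unfolding xx yy closed_diagram_def by blast+
  let ?A = "(\<lambda>k. (s, 1, k)) ` {1..j}" and ?B = "(\<lambda>k. (t, k, 1)) ` {1..i'}"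
  have "?A \<subseteq> D" using closed_diagram_down[OF D(1), of s i j 1] x pos by (auto simp: xx)
  moreover have "?B \<subseteq> D" using closed_diagram_down[OF D(1), of t i' j' _ 1] y pos by (auto simp: yy)
  ultimately have "card (?A \<union> ?B) \<le> card D" using D(2) by (intro card_mono) auto
  moreover have "card (?A \<union> ?B) = j + i'"
    using ne by (subst card_Un_disjoint) (auto simp: card_image inj_on_def xx yy)
  ultimately show ?thesis using pos by (simp add: content_def xx yy)
qed

context separated
begin

text \<open>These functions form an algebra, so once they separate paths, interpolation produces the
  indicator of a single path.\<close>

definition diagonal :: "(node list \<Rightarrow> 'k) \<Rightarrow> bool" where
  "diagonal d \<longleftrightarrow> (\<exists>x\<in>carrier (free_algebra n). \<forall>r\<in>paths l n. \<forall>v. rep F x v r = d r * v r)"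

lemma diagonal_const: "diagonal (\<lambda>r. c)"
  unfolding diagonal_def using free_algebra_closed(7) by (intro bexI[of _ "free_const c"]) (auto simp: rep_const)

lemma diagonal_add:
  assumes "diagonal d" "diagonal e"
  shows "diagonal (\<lambda>r. d r + e r)"
proof -
  obtain x y where "x \<in> carrier (free_algebra n)" "\<forall>r\<in>paths l n. \<forall>v. rep F x v r = d r * v r"
    "y \<in> carrier (free_algebra n)" "\<forall>r\<in>paths l n. \<forall>v. rep F y v r = e r * v r"
    using assms unfolding diagonal_def by blast
  then show ?thesis unfolding diagonal_def
    by (intro bexI[of _ "x + y"]) (auto simp: rep_add distrib_right intro: free_algebra_closed)
qed

lemma diagonal_mult:
  assumes "diagonal d" "diagonal e"
  shows "diagonal (\<lambda>r. d r * e r)"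
proof -
  obtain x y where "x \<in> carrier (free_algebra n)" "\<forall>r\<in>paths l n. \<forall>v. rep F x v r = d r * v r"
    "y \<in> carrier (free_algebra n)" "\<forall>r\<in>paths l n. \<forall>v. rep F y v r = e r * v r"
    using assms unfolding diagonal_def by blast
  then show ?thesis unfolding diagonal_def
    by (intro bexI[of _ "x * y"]) (auto simp: rep_mult[OF linear_path_op] mult.assoc intro: free_algebra_closed)
qed

lemma diagonal_sum: "(\<And>i. i \<in> X \<Longrightarrow> diagonal (d i)) \<Longrightarrow> diagonal (\<lambda>r. \<Sum>i\<in>X. d i r)"
  by (induction X rule: infinite_finite_induct) (auto intro: diagonal_const diagonal_add)

lemma diagonal_prod: "(\<And>i. i \<in> X \<Longrightarrow> diagonal (d i)) \<Longrightarrow> diagonal (\<lambda>r. \<Prod>i\<in>X. d i r)"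
  by (induction X rule: infinite_finite_induct) (auto intro: diagonal_const diagonal_mult)

lemma diagonal_cong: "diagonal d \<Longrightarrow> (\<And>r. r \<in> paths l n \<Longrightarrow> d r = e r) \<Longrightarrow> diagonal e"
  unfolding diagonal_def by simp

lemma diagonal_affine:
  assumes "diagonal d"
  shows "diagonal (\<lambda>r. (d r - c) / b)"
proof -
  have "diagonal (\<lambda>r. (d r + (- c)) * (1 / b))" by (intro diagonal_mult diagonal_add diagonal_const assms)
  then show ?thesis by simp
qed

lemma diagonal_residue:
  assumes "1 \<le> k" "k \<le> n"
  shows "diagonal (\<lambda>r. res (r ! (k - 1)))"
  unfolding diagonal_def using rep_fL[OF order_refl _ assms] fL_carrier[OF assms] by blast

text \<open>Lagrange interpolation over the finitely many values of \<open>d\<close> on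
  paths.\<close>

lemma diagonal_indicator:
  assumes "diagonal d"
  shows "diagonal (\<lambda>r. if d r = c then 1 else 0)"
proof (rule diagonal_cong)
  let ?S = "d ` paths l n - {c}"
  show "diagonal (\<lambda>r. \<Prod>c'\<in>?S. (d r - c') / (c - c'))" by (intro diagonal_prod diagonal_affine assms)
  fix r assume r: "r \<in> paths l n"
  have fin: "finite ?S" using finite_paths by simp
  show "(\<Prod>c'\<in>?S. (d r - c') / (c - c')) = (if d r = c then 1 else 0)"
  proof (cases "d r = c")
    case True
    then show ?thesis by (simp, intro prod.neutral ballI) auto
  next
    case False
    then have "d r \<in> ?S" using r by simp
    then show ?thesis using False fin by (auto intro!: prod_zero)
  qed
qed

text \<open>For q = 1 the contents are not functions of the residues; they are diagonal by the relation
  \<open>T\<^sub>k J\<^sub>k\<^sub>+\<^sub>1 = J\<^sub>k T\<^sub>k + E\<^sub>k\<close> of the degenerate algebra, where \<open>E\<^sub>k\<close> tests whether the k-th and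
  (k+1)-st nodes lie in the same component.\<close>

lemma diagonal_content:
  assumes q1: "q = 1" and k: "k < n"
  shows "diagonal (\<lambda>r. of_int (content (r ! k)))"
  using k
proof (induction k)
  case 0
  have "content (r ! 0) = 0" if "r \<in> paths l n" for r
  proof -
    have "addable l {} (r ! 0)" using that 0 path_iff_addable[of l r] by (auto simp: paths_def)
    then show ?thesis by (cases "r ! 0") (auto simp: addable_def content_def)
  qed
  then show ?case using diagonal_cong[OF diagonal_const[of 0]] by simp
next
  case (Suc k)
  have Qeq: "Q s = Q t \<longleftrightarrow> s = t" if "s < l" "t < l" for s t
    using Q_sep[OF that, of 0] Suc.prems by auto
  have comp: "fst (r ! m) < l" if "r \<in> paths l n" "m < n" for r m
  proof -
    have "addable l (set (take m r)) (r ! m)" using that path_iff_addable[of l r] by (simp add: paths_def)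
    then show ?thesis by (cases "r ! m") (simp add: addable_def)
  qed
  have res1: "res x = Q (fst x)" for x by (simp add: residue_def q1)
  let ?d = "\<lambda>m r. res (r ! m)" and ?E = "\<lambda>r. if fst (r ! k) = fst (r ! Suc k) then 1 else 0 :: 'k"
  have dm: "diagonal (?d m)" if "m < n" for m using diagonal_residue[of "Suc m"] that by simp
  \<comment> \<open>For \<open>q = 1\<close> the residue of a node is the parameter of its
    component, and distinct components have distinct parameters; so equality of components can be
    tested through residues.\<close>
  have "diagonal ?E"
  proof (rule diagonal_cong)
    show "diagonal (\<lambda>r. \<Sum>s<l. (if ?d k r = Q s then 1 else 0) * (if ?d (Suc k) r = Q s then 1 else 0))"
      using dm Suc.prems by (intro diagonal_sum diagonal_mult diagonal_indicator) auto
    fix r assume r: "r \<in> paths l n"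
    let ?s = "fst (r ! k)" and ?t = "fst (r ! Suc k)"
    have st: "?s < l" "?t < l" using comp[OF r] Suc.prems by auto
    have "(\<Sum>s<l. (if ?d k r = Q s then 1 else 0) * (if ?d (Suc k) r = Q s then 1 else 0)) =
      (\<Sum>s<l. if s = ?s then (if ?t = ?s then 1 else 0) else (0::'k))"
      using Qeq st by (intro sum.cong) (auto simp: res1)
    also have "\<dots> = ?E r" using st by auto
    finally show "(\<Sum>s<l. (if ?d k r = Q s then 1 else 0) * (if ?d (Suc k) r = Q s then 1 else 0)) = ?E r" .
  qed
  then obtain E where E: "E \<in> carrier (free_algebra n)" "\<And>r v. r \<in> paths l n \<Longrightarrow> rep F E v r = ?E r * v r"
    unfolding diagonal_def by blast
  obtain J where J: "J \<in> carrier (free_algebra n)" "\<And>r v. r \<in> paths l n \<Longrightarrow> rep F J v r = of_int (content (r ! k)) * v r"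
    using Suc unfolding diagonal_def by auto
  let ?T = "free_gen (Suc k) :: 'k free_alg"
  have T: "?T \<in> carrier (free_algebra n)" using Suc.prems by (intro free_algebra_closed)
  \<comment> \<open>The relation is multiplied on the left by the generator, whose square is 1 for
    \<open>q = 1\<close>; this solves it for the next content operator.\<close>
  have "rep F (?T * J * ?T + ?T * E) v r = of_int (content (r ! Suc k)) * v r" if r: "r \<in> paths l n" for r v
  proof -
    have "F (Suc k) (rep F J (F (Suc k) v)) r + F (Suc k) (rep F E v) r =
      F (Suc k) (F (Suc k) (\<lambda>r. of_int (content (r ! Suc k)) * v r)) r"
    proof -
      have eq: "rep F J (F (Suc k) v) p + rep F E v p = F (Suc k) (\<lambda>r. of_int (content (r ! Suc k)) * v r) p"
        if p: "p \<in> paths l n" for p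
      proof -
        have len: "1 \<le> Suc k" "Suc k < length p" using p Suc.prems by (auto simp: paths_def)
        obtain u x y w where p': "p = u @ x # y # w" "Suc k = Suc (length u)" using split_at[OF len] by metis
        have path: "path l (u @ x # y # w)" "length (u @ x # y # w) \<le> n" using p p' by (auto simp: paths_def)
        have nth: "p ! k = x" "p ! Suc k = y" "(u @ y # x # w) ! Suc k = x" using p' by (auto simp: nth_append)
        have ne: "of_int (content y - content x) \<noteq> (0::'k)" if "fst x = fst y"
          using path_good2[OF path] that q1 unfolding good_def by auto
        have a: "a x y * (of_int (content y) - of_int (content x)) = (if fst x = fst y then 1 else 0)"
          unfolding a_q1[OF q1] using ne by auto
        have "rep F J (F (Suc k) v) p + rep F E v p =
           of_int (content x) * F (Suc k) v (u @ x # y # w) + a x y * (of_int (content y) - of_int (content x)) * v (u @ x # y # w)"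
          unfolding J(2)[OF p] E(2)[OF p] nth a by (simp add: p'(1))
        also have "\<dots> = F (Suc k) (\<lambda>r. of_int (content (r ! Suc k)) * v r) (u @ x # y # w)"
          unfolding path_op_swap[OF p'(2)] using nth(2,3) p'(1) by (auto simp: algebra_simps)
        finally show ?thesis unfolding p'(1) .
      qed
      have "F (Suc k) (rep F J (F (Suc k) v)) r + F (Suc k) (rep F E v) r =
         F (Suc k) (\<lambda>p. 1 * rep F J (F (Suc k) v) p + rep F E v p) r"
        using fun_cong[OF foldr_linear[OF linear_path_op[of l q Q], where ks="[Suc k]" and c=1
            and v="rep F J (F (Suc k) v)" and v'="rep F E v"], of r] by simp
      also have "\<dots> = F (Suc k) (F (Suc k) (\<lambda>r. of_int (content (r ! Suc k)) * v r)) r"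
        using Suc.prems r eq by (intro path_op_local[of _ n r l]) auto
      finally show ?thesis .
    qed
    also have "\<dots> = of_int (content (r ! Suc k)) * v r"
      using F_quadratic[OF r, of "Suc k"] Suc.prems q1 by simp
    finally show ?thesis by (simp add: rep_add rep_mult[OF linear_path_op] rep_gen)
  qed
  moreover have "?T * J * ?T + ?T * E \<in> carrier (free_algebra n)" by (intro free_algebra_closed T J E)
  ultimately show ?case unfolding diagonal_def by blast
qed

text \<open>At the first index where they differ, both paths add a node to the same diagram, so the
  two nodes lie in distinct components or on distinct diagonals. Residues tell them apart, or
  contents if \<open>q = 1\<close> and the components agree.\<close>

lemma diagonal_separates:
  assumes p: "p \<in> paths l n" and r: "r \<in> paths l n" and ne: "p \<noteq> r"
  shows "\<exists>d. diagonal d \<and> d p \<noteq> d r"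
proof -
  have len: "length p = n" "length r = n" "path l p" "path l r" using p r by (auto simp: paths_def)
  define k where "k = (LEAST k. k < n \<and> p ! k \<noteq> r ! k)"
  have "\<exists>k. k < n \<and> p ! k \<noteq> r ! k" using ne len by (metis nth_equalityI)
  then have k: "k < n" "p ! k \<noteq> r ! k" unfolding k_def by (metis (mono_tags, lifting) LeastI)+
  have below: "p ! i = r ! i" if "i < k" for i
    using not_less_Least[of i "\<lambda>k. k < n \<and> p ! k \<noteq> r ! k"] that k(1) unfolding k_def by auto
  then have take: "take k p = take k r" using k len by (intro nth_take_lemma) auto
  let ?D = "set (take k p)" and ?x = "p ! k" and ?y = "r ! k"
  have x: "addable l ?D ?x" using len k path_iff_addable by metis
  have y: "addable l ?D ?y" using len k take path_iff_addable by metis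
  have D: "closed_diagram l ?D" using len(3) path_from_append[of l "{}" "take k p" "drop k p"] by (intro path_closed) simp
  \<comment> \<open>An auxiliary diagram containing both nodes; it has at most \<open>n + 1\<close>
    nodes and bounds the difference of their contents.\<close>
  let ?D' = "insert ?y (insert ?x ?D)"
  have y': "addable l (insert ?x ?D) ?y" using y k(2) by (auto simp: addable_def split: prod.splits)
  have D': "closed_diagram l ?D'" by (intro closed_diagram_insert D x y')
  have "card ?D \<le> k" using card_length[of "take k p"] k len by simp
  then have card: "card ?D' \<le> n + 1" using k card_insert_le_m1 by (simp add: card_insert_if)
  have comp: "fst ?x < l" "fst ?y < l" using x y by (auto simp: addable_def split: prod.splits)
  have res: "diagonal (\<lambda>r. res (r ! k))" using diagonal_residue[of "Suc k"] k by simp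
  have q0p: "q powi content ?y \<noteq> 0" using q0 by simp
  have shift: "q powi content ?x = q powi (content ?x - content ?y) * q powi content ?y"
    using q0 by (simp add: power_int_diff)
  show ?thesis
  proof (cases "fst ?x = fst ?y")
    case False
    have "content ?x - content ?y \<le> int (card ?D') - 2" "content ?y - content ?x \<le> int (card ?D') - 2"
      using content_diff_components[OF D', of ?x ?y] content_diff_components[OF D', of ?y ?x] False by auto
    then have "\<bar>content ?x - content ?y\<bar> < int n" using card by simp
    then have "q powi (content ?x - content ?y) * Q (fst ?x) \<noteq> Q (fst ?y)" using Q_sep comp False by blast
    then have "res ?x \<noteq> res ?y" unfolding residue_def shift using q0p by simp
    then show ?thesis using res by blast
  next
    case True
    have c: "content ?x \<noteq> content ?y" using addable_distinct_content[OF D x y True k(2)] .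
    have b: "\<bar>content ?x - content ?y\<bar> \<le> int n" using content_diff_less[OF D', of ?x ?y] card by simp
    show ?thesis
    proof (cases "q = 1")
      case q1: True
      have "of_int (content ?x - content ?y) \<noteq> (0::'k)" using of_int_nz[OF q1 _ b] c by simp
      then show ?thesis using diagonal_content[OF q1 k(1)] by (intro exI[of _ "\<lambda>r. of_int (content (r ! k))"]) simp
    next
      case False
      have "q powi (content ?x - content ?y) \<noteq> 1" using powi_ne_1[OF False _ b] c by simp
      then have "res ?x \<noteq> res ?y" unfolding residue_def shift using q0p Q0[OF comp(2)] True by simp
      then show ?thesis using res by blast
    qed
  qed
qed

lemma diagonal_delta:
  assumes p: "p \<in> paths l n"
  shows "diagonal (\<lambda>r. if r = p then 1 else 0)"
proof -
  have "\<forall>r. \<exists>d. r \<in> paths l n \<and> p \<noteq> r \<longrightarrow> diagonal d \<and> d p \<noteq> d r" using diagonal_separates[OF p] by metis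
  then obtain d where d: "\<And>r. r \<in> paths l n \<Longrightarrow> p \<noteq> r \<Longrightarrow> diagonal (d r) \<and> d r p \<noteq> d r r" by metis
  let ?S = "paths l n - {p}"
  have "diagonal (\<lambda>r. \<Prod>c\<in>?S. (d c r - d c c) / (d c p - d c c))"
    using d by (intro diagonal_prod diagonal_affine) auto
  moreover have "(\<Prod>c\<in>?S. (d c r - d c c) / (d c p - d c c)) = (if r = p then 1 else 0)" if r: "r \<in> paths l n" for r
  proof (cases "r = p")
    case True
    then show ?thesis using d by (simp, intro prod.neutral ballI) auto
  next
    case False
    then show ?thesis using r finite_paths by (auto intro!: prod_zero bexI[of _ r])
  qed
  ultimately show ?thesis by (rule diagonal_cong)
qed

text \<open>Existence is \<open>trc_characters\<close>. For uniqueness, an element acting as the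
  indicator of one path of shape \<Lambda> has character 1 at \<Lambda> and 0 at every other
  multipartition, so the form evaluated there is the coefficient of \<Lambda>.\<close>

theorem schur_element_eq:
  assumes n: "1 \<le> n" and \<Lambda>: "\<Lambda> \<in> multipartitions l n"
  shows "schur_element l n q Q \<Lambda> = schur_formula l n q Q \<Lambda>"
proof -
  interpret P: ak_params l n q Q using l n q0 by unfold_locales
  let ?M = "multipartitions l n" and ?A = "ak_algebra l n q Q"
  have lin: "P.linear_mod (trc n)" unfolding P.linear_mod_def
  proof (intro conjI ballI allI)
    fix x assume "x \<in> ak_ideal l n q Q"
    then show "trc n x = 0" unfolding trc_def using rep_F_ideal n by simp
  qed (simp_all add: trc_add trc_scale)
  have tau: "ak_tau l n q Q (P.coset x) = trc n x" if "x \<in> carrier (free_algebra n)" for x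
    by (rule P.ak_tau_coset[OF lin _ that]) (intro trc_basis; auto)
  define s where "s = restrict (schur_formula l n q Q) ?M"
  let ?P = "\<lambda>s. s \<in> ?M \<rightarrow>\<^sub>E (UNIV - {0}) \<and> (\<forall>X\<in>carrier ?A. ak_tau l n q Q X = (\<Sum>\<Lambda>\<in>?M. 1 / s \<Lambda> * ak_character q Q \<Lambda> X))"
  have val: "?P s"
  proof
    show "s \<in> ?M \<rightarrow>\<^sub>E (UNIV - {0})" using schur_formula_nz by (auto simp: s_def)
    show "\<forall>X\<in>carrier ?A. ak_tau l n q Q X = (\<Sum>\<Lambda>\<in>?M. 1 / s \<Lambda> * ak_character q Q \<Lambda> X)"
      unfolding P.coset_carrier using tau trc_characters[OF n] by (auto simp: P.coset_def s_def)
  qed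
  moreover have "s' = s" if s': "?P s'" for s'
  proof (rule extensionalityI)
    show "s' \<in> extensional ?M" "s \<in> extensional ?M" using s' val by (auto simp: PiE_def)
    fix \<Lambda> assume L: "\<Lambda> \<in> ?M"
    obtain p where p: "p \<in> paths_of \<Lambda> l n" using paths_of_nonempty[OF L] by blast
    then have pp: "p \<in> paths l n" "shape l (set p) = \<Lambda>" using paths_of_eq[OF L] by auto
    obtain x where x: "x \<in> carrier (free_algebra n)" "\<And>r v. r \<in> paths l n \<Longrightarrow> rep F x v r = (if r = p then 1 else 0) * v r"
      using diagonal_delta[OF pp(1)] unfolding diagonal_def by blast
    have char: "ak_character q Q \<Gamma> (P.coset x) = (if \<Gamma> = \<Lambda> then 1 else 0)" if G: "\<Gamma> \<in> ?M" for \<Gamma>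
    proof -
      have "ak_character q Q \<Gamma> (P.coset x) = (\<Sum>r\<in>paths_of \<Gamma> l n. if r = p then 1 else 0)"
        unfolding P.coset_def ak_character_coset[OF G n x(1)]
        using x(2) by (intro sum.cong) (auto simp: paths_of_def delta_def)
      also have "\<dots> = (if p \<in> paths_of \<Gamma> l n then 1 else 0)" using std_tableaux_eq(3)[OF G] by simp
      also have "p \<in> paths_of \<Gamma> l n \<longleftrightarrow> \<Gamma> = \<Lambda>" using pp paths_of_eq[OF G] by auto
      finally show ?thesis .
    qed
    have eqv: "1 / t \<Lambda> = ak_tau l n q Q (P.coset x)" if t: "?P t" for t
    proof -
      have "P.coset x \<in> carrier ?A" using x(1) P.coset_carrier by blast
      then have "ak_tau l n q Q (P.coset x) = (\<Sum>\<Gamma>\<in>?M. 1 / t \<Gamma> * ak_character q Q \<Gamma> (P.coset x))" using t by blast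
      also have "\<dots> = (\<Sum>\<Gamma>\<in>?M. if \<Gamma> = \<Lambda> then 1 / t \<Lambda> else 0)" using char by (intro sum.cong) auto
      also have "\<dots> = 1 / t \<Lambda>" using L finite_multipartitions by simp
      finally show ?thesis ..
    qed
    have "1 / s' \<Lambda> = 1 / s \<Lambda>" unfolding eqv[OF s'] eqv[OF val] ..
    then show "s' \<Lambda> = s \<Lambda>" by simp
  qed
  ultimately have "schur_element l n q Q = s" unfolding schur_element_def by (rule the_equality)
  then show ?thesis using \<Lambda> by (simp add: s_def)
qed

lemma schur_formula_eq_hooks:
  assumes q1: "q \<noteq> 1" and \<Lambda>: "\<Lambda> \<in> multipartitions l n"
  shows "schur_formula l n q Q \<Lambda> =
        (-1) ^ (n * (l - 1)) * q powi (- int (n_stat (mp_bar \<Lambda>))) * (q - 1) powi (- int n) *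
        (\<Prod>s<l. \<Prod>(i, j)\<in>young (\<Lambda> ! s). \<Prod>t<l.
           (q powi hook (\<Lambda> ! s) (\<Lambda> ! t) i j * Q s * inverse (Q t) - 1))"
proof -
  have L: "length \<Lambda> = l" "\<forall>p\<in>set \<Lambda>. is_partition p" "mp_size \<Lambda> = n" using \<Lambda> by (auto simp: multipartitions_def)
  let ?f = "\<lambda>s i j t. q powi hook (\<Lambda> ! s) (\<Lambda> ! t) i j * Q s * inverse (Q t) - 1"
  have factor: "q_int q (nat (hook (\<Lambda> ! s) (\<Lambda> ! s) i j)) * (\<Prod>t\<in>{..<l} - {s}. ?f s i j t) = inverse (q - 1) * (\<Prod>t<l. ?f s i j t)"
    if "s < l" "(i, j) \<in> young (\<Lambda> ! s)" for s i j
  proof -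
    have "1 \<le> hook (\<Lambda> ! s) (\<Lambda> ! s) i j" using hook_pos that L by simp
    \<comment> \<open>The factor for \<open>t = s\<close> is \<open>q - 1\<close> times the
      q-integer of the hook length; one factor \<open>q - 1\<close> for each of the \<open>n\<close>
      nodes accounts for the difference between the two forms.\<close>
    then have "?f s i j s = (q - 1) * q_int q (nat (hook (\<Lambda> ! s) (\<Lambda> ! s) i j))"
      using Q0[OF that(1)] by (simp add: q_int_eq power_int_def)
    then show ?thesis using that q1 by (subst prod.remove[of "{..<l}" s]) simp_all
  qed
  have "(\<Prod>s<l. \<Prod>(i, j)\<in>young (\<Lambda> ! s). q_int q (nat (hook (\<Lambda> ! s) (\<Lambda> ! s) i j)) * (\<Prod>t\<in>{..<l} - {s}. ?f s i j t)) =
    (\<Prod>s<l. \<Prod>x\<in>young (\<Lambda> ! s). inverse (q - 1) * (case x of (i, j) \<Rightarrow> \<Prod>t<l. ?f s i j t))"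
    using factor by (intro prod.cong refl) auto
  also have "\<dots> = (\<Prod>s<l. inverse (q - 1) ^ card (young (\<Lambda> ! s))) * (\<Prod>s<l. \<Prod>(i, j)\<in>young (\<Lambda> ! s). \<Prod>t<l. ?f s i j t)"
    by (simp add: prod.distrib)
  also have "(\<Prod>s<l. inverse (q - 1) ^ card (young (\<Lambda> ! s))) = inverse (q - 1) ^ (\<Sum>s<l. card (young (\<Lambda> ! s)))"
    by (simp add: power_sum)
  also have "(\<Sum>s<l. card (young (\<Lambda> ! s))) = n"
    using L card_young unfolding mp_size_def sum_list_sum_nth by (auto simp: atLeast0LessThan intro!: sum.cong)
  finally show ?thesis unfolding schur_formula_def by (simp add: power_int_minus power_inverse mult.assoc)
qed

end

theorem theorem3p2:
  fixes l n :: nat and q :: "'a::field" and Q :: "nat \<Rightarrow> 'a" and \<Lambda> :: multipartition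
  assumes "1 \<le> l" and "1 \<le> n"
    and "q \<noteq> 0" and "\<And>s. s < l \<Longrightarrow> Q s \<noteq> 0"
    and "split_semisimple (ak_algebra l n q Q) (ak_scalar l n q Q)"
    and "\<Lambda> \<in> multipartitions l n"
  shows "(q \<noteq> 1 \<longrightarrow>
      schur_element l n q Q \<Lambda> =
        (-1) ^ (n * (l - 1)) * q powi (- int (n_stat (mp_bar \<Lambda>))) * (q - 1) powi (- int n) *
        (\<Prod>s<l. \<Prod>(i, j)\<in>young (\<Lambda> ! s). \<Prod>t<l.
           (q powi hook (\<Lambda> ! s) (\<Lambda> ! t) i j * Q s * inverse (Q t) - 1))) \<and>
    schur_element l n q Q \<Lambda> =
        (-1) ^ (n * (l - 1)) * q powi (- int (n_stat (mp_bar \<Lambda>))) *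
        (\<Prod>s<l. \<Prod>(i, j)\<in>young (\<Lambda> ! s).
           q_int q (nat (hook (\<Lambda> ! s) (\<Lambda> ! s) i j)) *
           (\<Prod>t\<in>{..<l} - {s}.
              (q powi hook (\<Lambda> ! s) (\<Lambda> ! t) i j * Q s * inverse (Q t) - 1)))"
proof -
  interpret P: ak_params l n q Q using assms(1-3) by unfold_locales
  interpret separated l n q Q
    using assms(4,5) by (intro P.separated_of_semisimple) (auto simp: split_semisimple_def)
  show ?thesis
    using schur_element_eq[OF assms(2,6)] schur_formula_eq_hooks[OF _ assms(6)] unfolding schur_formula_def by simp
qed

end
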